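(* (i) For any $\kappa,d>0$ there is a bifurcation of symmetric solutions from the normal state: there is a sequence of symmetric solutions $(\phi_n,a_n,h_n)$ with $\phi_n>0$ on $[-d,d]$, $h_n\to h(0)$, and $(\phi_n,a_n)\to(0,h(0)x)$ in $C^1[-d,d]$. (ii) There are constants $0<k<K$ such that whenever $\kappa d<k$ or $\kappa d>K$, a unique curve of symmetric solutions bifurcates from the normal state; in other words, there are $\delta>0$ and $\alpha_0>0$ such that for every $\alpha\in(0,\alpha_0)$ the rescaled problem $$\psi''=\kappa^2(\alpha^2\psi^2+a^2-1)\psi,\quad a''=\alpha^2\psi^2a,\quad \psi(-d)=1,\ \psi'(\pm d)=0,\ a'(\pm d)=h$$ has exactly one solution $(\psi,a,h)$ with $\psi>0$ on $[-d,d]$, $h>0$ and $|h-h(0)|<\delta$, and this solution is symmetric ($\psi$ even, $a$ odd). (iii) Suppose that $(\kappa_1,d_1)$ and $(\kappa_2,d_2)$ in $(0,\infty)^2$ are such that $I'(0)<0$ if $(\kappa,d)=(\kappa_1,d_1)$ and $I'(0)>0$ if $(\kappa,d)=(\kappa_2,d_2)$, and let $t\mapsto(\kappa(t),d(t))\in(0,\infty)^2$, $t\in[0,1]$, be a real analytic curve with $(\kappa(0),d(0))=(\kappa_1,d_1)$ and $(\kappa(1),d(1))=(\kappa_2,d_2)$. Then there exists $t_0\in(0,1)$ such that, with $\tilde h_0$ denoting the value $h(0)$ for $(\kappa,d)=(\kappa(t_0),d(t_0))$, the following holds: for every $\varepsilon>0$ there are $\kappa,d,h>0$ with $|\kappa-\kappa(t_0)|<\varepsilon$,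 $|d-d(t_0)|<\varepsilon$, $|h-\tilde h_0|<\varepsilon$ and an asymmetric solution $(\phi,a,h)$ for these $(\kappa,d)$ with $\phi>0$ on $[-d,d]$ and $$\sup_{x\in[-d,d]}\bigl(|\phi(x)|+|\phi'(x)|+|a(x)-\tilde h_0x|+|a'(x)-\tilde h_0|\bigr)<\varepsilon$$ (so these asymmetric solutions are nearly symmetric).
   Context: For $\kappa,d>0$ a solution means a triple $(\phi,a,h)$ with $h>0$ satisfying on $[-d,d]$ $$\phi''=\kappa^2\phi(\phi^2+a^2-1),\qquad a''=\phi^2a,\qquad \phi'(\pm d)=0,\quad a'(\pm d)=h.$$ Only solutions with $\phi>0$ on $[-d,d]$ are considered, apart from the trivial normal states $\phi=0$, $a=h(x+c)$. A solution is symmetric if $\phi$ is even and $a$ is odd in $x$, and asymmetric otherwise. The rescaled problem arises by writing $\phi=\alpha\psi$ with $\alpha=\phi(-d)$. For each $c\in\mathbb R$ there is a unique $h=h(c)>0$ (depending also on $\kappa,d$) such that the linear problem $$\psi_0''=\kappa^2\bigl(h^2(x+c)^2-1\bigr)\psi_0\ \text{ on }[-d,d],\qquad \psi_0(-d)=1,\quad \psi_0'(\pm d)=0$$ has a positive solution $\psi_0$, and this positive solution is unique (standard linear theory). Define $$I(c)=\int_{-d}^{d}(x+c)\,\psi_0(x)^2\,dx,$$ with $h=h(c)$ and $\psi_0=\psi_0(\cdot\,;c)$, and let $I'(0)$ be the derivative of $I$ with respect to $c$ at $c=0$, for fixed $\kappa,d$. *)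

theory Defs
  imports "HOL-Analysis.Analysis"
begin

text \<open>
  Functions on the interval from \<open>-d\<close> to \<open>d\<close> are represented by functions on all of \<open>real\<close>
  whose values outside the interval are irrelevant; derivatives are therefore taken relative to the
  interval and are one-sided at the end points.
\<close>

definition ideriv :: "real \<Rightarrow> (real \<Rightarrow> real) \<Rightarrow> real \<Rightarrow> real" where
  "ideriv d f x = vector_derivative f (at x within {-d..d})"

text \<open>The equations \<open>f'' = g\<close> on the interval and \<open>f'(-d) = f'(d) = b\<close>.\<close>

definition second_order_bvp :: "real \<Rightarrow> (real \<Rightarrow> real) \<Rightarrow> (real \<Rightarrow> real) \<Rightarrow> real \<Rightarrow> bool" where
  "second_order_bvp d f g b \<longleftrightarrow>
     (\<forall>x\<in>{-d..d}. (f has_real_derivative ideriv d f x) (at x within {-d..d}) \<and>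
                   (ideriv d f has_real_derivative g x) (at x within {-d..d})) \<and>
     ideriv d f (-d) = b \<and> ideriv d f d = b"

definition solution ::
  "real \<Rightarrow> real \<Rightarrow> (real \<Rightarrow> real) \<Rightarrow> (real \<Rightarrow> real) \<Rightarrow> real \<Rightarrow> bool" where
  "solution \<kappa> d \<phi> a h \<longleftrightarrow> h > 0 \<and>
     second_order_bvp d \<phi> (\<lambda>x. \<kappa>\<^sup>2 * \<phi> x * ((\<phi> x)\<^sup>2 + (a x)\<^sup>2 - 1)) 0 \<and>
     second_order_bvp d a (\<lambda>x. (\<phi> x)\<^sup>2 * a x) h"

definition rescaled_solution ::
  "real \<Rightarrow> real \<Rightarrow> real \<Rightarrow> (real \<Rightarrow> real) \<Rightarrow> (real \<Rightarrow> real) \<Rightarrow> real \<Rightarrow> bool" where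
  "rescaled_solution \<kappa> d \<alpha> \<psi> a h \<longleftrightarrow> h > 0 \<and> \<psi> (-d) = 1 \<and>
     second_order_bvp d \<psi> (\<lambda>x. \<kappa>\<^sup>2 * (\<alpha>\<^sup>2 * (\<psi> x)\<^sup>2 + (a x)\<^sup>2 - 1) * \<psi> x) 0 \<and>
     second_order_bvp d a (\<lambda>x. \<alpha>\<^sup>2 * (\<psi> x)\<^sup>2 * a x) h"

definition positive_on :: "real \<Rightarrow> (real \<Rightarrow> real) \<Rightarrow> bool" where
  "positive_on d f \<longleftrightarrow> (\<forall>x\<in>{-d..d}. f x > 0)"

definition symmetric :: "real \<Rightarrow> (real \<Rightarrow> real) \<Rightarrow> (real \<Rightarrow> real) \<Rightarrow> bool" where
  "symmetric d \<phi> a \<longleftrightarrow> (\<forall>x\<in>{-d..d}. \<phi> (-x) = \<phi> x \<and> a (-x) = - a x)"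

definition C1_limit :: "real \<Rightarrow> (nat \<Rightarrow> real \<Rightarrow> real) \<Rightarrow> (real \<Rightarrow> real) \<Rightarrow> bool" where
  "C1_limit d f g \<longleftrightarrow>
     uniform_limit {-d..d} f g sequentially \<and>
     uniform_limit {-d..d} (\<lambda>n. ideriv d (f n)) (ideriv d g) sequentially"

definition linear_solution :: "real \<Rightarrow> real \<Rightarrow> real \<Rightarrow> real \<Rightarrow> (real \<Rightarrow> real) \<Rightarrow> bool" where
  "linear_solution \<kappa> d c h \<psi> \<longleftrightarrow> \<psi> (-d) = 1 \<and>
     second_order_bvp d \<psi> (\<lambda>x. \<kappa>\<^sup>2 * (h\<^sup>2 * (x + c)\<^sup>2 - 1) * \<psi> x) 0"

definition h_crit :: "real \<Rightarrow> real \<Rightarrow> real \<Rightarrow> real" where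
  "h_crit \<kappa> d c = (THE h. h > 0 \<and> (\<exists>\<psi>. linear_solution \<kappa> d c h \<psi> \<and> positive_on d \<psi>))"

text \<open>
  The positive solution of the linear problem is unique only as a function on the interval, hence
  \<open>SOME\<close> instead of \<open>THE\<close>; the integral below does not depend on the choice.
\<close>

definition psi0 :: "real \<Rightarrow> real \<Rightarrow> real \<Rightarrow> real \<Rightarrow> real" where
  "psi0 \<kappa> d c = (SOME \<psi>. linear_solution \<kappa> d c (h_crit \<kappa> d c) \<psi> \<and> positive_on d \<psi>)"

definition I_fun :: "real \<Rightarrow> real \<Rightarrow> real \<Rightarrow> real" where
  "I_fun \<kappa> d c = integral {-d..d} (\<lambda>x. (x + c) * (psi0 \<kappa> d c x)\<^sup>2)"

text \<open>
  Local expansion in power series relative to \<open>S\<close>. At an end point of an interval \<open>S\<close>, convergence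
  on one side forces convergence on both, so this amounts to having an analytic extension to a
  neighbourhood of the interval.
\<close>

definition real_analytic_on :: "(real \<Rightarrow> 'a::real_normed_vector) \<Rightarrow> real set \<Rightarrow> bool" where
  "real_analytic_on f S \<longleftrightarrow>
     (\<forall>t\<in>S. \<exists>r>0. \<exists>c :: nat \<Rightarrow> 'a. \<forall>s\<in>S. \<bar>s - t\<bar> < r \<longrightarrow> (\<lambda>n. (s - t) ^ n *\<^sub>R c n) sums f s)"

end

theory Submission
  imports Defs
begin

text \<open>
  With \<open>\<epsilon> = \<alpha>\<^sup>2\<close>, \<open>\<nu> = \<kappa>\<^sup>2\<close> and \<open>a' = h + \<epsilon> j\<close> the rescaled problem becomes a shooting problem that stays regular
  at \<open>\<epsilon> = 0\<close>: from the left end with \<open>\<psi> = 1\<close>, \<open>\<psi>' = j = 0\<close>, choose \<open>a(-d)\<close> and \<open>h\<close> such that \<open>\<psi>' = j = 0\<close> at the right end.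
  At \<open>\<epsilon> = 0\<close> one has \<open>a = h (x + c)\<close> and \<open>\<psi>\<close> is a combination of the even and the odd solution of
  \<open>u'' = (\<mu> y\<^sup>2 - \<nu>) u\<close>, \<open>\<mu> = \<nu> h\<^sup>2\<close>.

  (i) On half of the interval the conditions are \<open>a = \<psi>' = 0\<close> in the middle; they are solved by the Poincare--Miranda theorem,
  and reflection gives a symmetric solution.

  (ii) A solution at \<open>\<epsilon> = 0\<close> is a pair \<open>L + R = 2d\<close> with \<open>wRho L + wRho R = 0\<close> and \<open>wPhi L = wPhi R\<close>. The derivative
  of \<open>wPhi\<close> has the sign of \<open>wN\<close>, which is positive for small and negative for large \<open>\<kappa> d\<close>, so that \<open>L = R = d\<close>. If uniqueness
  failed for a sequence \<open>\<epsilon> \<rightarrow> 0\<close>, the a priori bounds would make both solutions converge to the symmetric normal state,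
  and their normalized difference to a nonzero solution of the linearized problem, which is impossible for \<open>wN \<noteq> 0\<close> at \<open>d\<close>.

  (iii) \<open>I'(0)\<close> has the sign of \<open>wN\<close> at \<open>d\<close>, hence \<open>wN\<close> vanishes somewhere on the curve. Near such a point \<open>wN\<close> takes both
  signs, and for small \<open>c > 0\<close> so does \<open>I(c)\<close>. On a segment between points of opposite sign the shooting problem with
  \<open>a(-d) = - h (d - c)\<close> is then solvable for small \<open>\<epsilon> > 0\<close>, and \<open>a(0) \<approx> h c \<noteq> 0\<close>.
\<close>


text \<open>The shooting map is only known to be Lipschitz in its data; no derivative of it with
  respect to a parameter is formed. This shapes the proof: critical values h(c) are located by sign
  changes and monotonicity in h, nonlinear solutions by signs on the faces of a rectangle, and the
  linearized problem appears only as a limit of difference quotients. The estimates on Weber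
  functions come from Wronskians. With \<mu> = m^2, the functions exp (+-m y^2 / 2) and y exp (+-m
  y^2 / 2) solve neighbouring equations exactly, and the condition \<nu> <= m, that is \<kappa> <=
  h, makes them comparison functions. The critical h at c = 0 satisfies \<kappa> < h, and nearby
  critical values inherit it. The constants in (ii) are values with which these explicit bounds
  close: for \<kappa> d <= 1/100 the Neumann condition pins m d between \<kappa> and 2 \<kappa>; for
  \<kappa> d >= 4 a stretch of length 1/\<kappa> remains between 3/\<kappa>, from where on
  \<open>wPhi\<close> decays at rate \<kappa>, and d.\<close>

section \<open>Antiderivatives, global existence, Gronwall estimates and zeros of maps on
  boxes\<close>

lemma antiderivative_real_line:
  fixes g :: "real \<Rightarrow> 'a::euclidean_space"
  assumes "continuous_on UNIV g"
  shows "\<exists>G. G 0 = 0 \<and> (\<forall>t. (G has_vector_derivative g t) (at t))"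
proof -
  have "\<exists>F. \<forall>x :: real. -\<infinity> < ereal x \<longrightarrow> ereal x < \<infinity> \<longrightarrow> (F has_vector_derivative g x) (at x)"
    by (rule einterval_antiderivative)
      (use assms in \<open>auto simp: continuous_on_eq_continuous_at\<close>)
  then obtain F where F: "\<And>x. (F has_vector_derivative g x) (at x)"
    by auto
  have "((\<lambda>t. F t - F 0) has_vector_derivative g t) (at t)" for t
    using has_vector_derivative_diff[OF F[of t] has_vector_derivative_const[of "F 0"]] by simp
  then show ?thesis
    by (intro exI[of _ "\<lambda>t. F t - F 0"]) auto
qed

lemma nondecreasing_within:
  fixes f :: "real \<Rightarrow> real"
  assumes "a \<le> b"
    and der: "\<And>x. x \<in> {a..b} \<Longrightarrow> (f has_real_derivative f' x) (at x within {a..b})"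
    and nonneg: "\<And>x. x \<in> {a<..<b} \<Longrightarrow> f' x \<ge> 0"
  shows "f a \<le> f b"
proof (cases "a = b")
  case False
  have "\<exists>x\<in>{a<..<b}. f b - f a = f' x * (b - a)"
    using der \<open>a \<le> b\<close> False by (intro mvt_simple) (auto simp: has_field_derivative_def)
  then show ?thesis using nonneg \<open>a \<le> b\<close> by (metis diff_ge_0_iff_ge mult_nonneg_nonneg)
qed simp

lemma increasing_within:
  fixes f :: "real \<Rightarrow> real"
  assumes "a < b"
    and der: "\<And>x. x \<in> {a..b} \<Longrightarrow> (f has_real_derivative f' x) (at x within {a..b})"
    and "\<And>x. x \<in> {a<..<b} \<Longrightarrow> f' x > 0"
  shows "f a < f b"
proof -
  have "\<exists>x\<in>{a<..<b}. f b - f a = f' x * (b - a)"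
    using der by (intro mvt_simple[OF \<open>a < b\<close>]) (auto simp: has_field_derivative_def)
  then show ?thesis using assms by (metis diff_gt_0_iff_gt mult_pos_pos)
qed

text \<open>The weighted estimate behind \<open>picard_global\<close>: the factor \<open>k\<close>
  is absorbed by integration because \<open>k * exp \<Lambda>\<close> is the derivative of
  \<open>exp \<Lambda>\<close>. Negative times are reduced to positive ones by t -> -t, under which
  -\<Lambda>(-t) again has a nonnegative derivative.\<close>

lemma antiderivative_exp_bound:
  fixes G :: "real \<Rightarrow> 'a::euclidean_space" and \<Lambda> k :: "real \<Rightarrow> real"
  assumes G: "G 0 = 0" "\<And>t. (G has_vector_derivative g t) (at t)"
    and \<Lambda>: "\<Lambda> 0 = 0" "\<And>t. (\<Lambda> has_real_derivative k t) (at t)" and k: "\<And>t. k t \<ge> 0"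
    and g: "\<And>t. norm (g t) \<le> C * k t * exp \<bar>\<Lambda> t\<bar>" and C: "C \<ge> 0"
  shows "norm (G t) \<le> C * exp \<bar>\<Lambda> t\<bar>"
proof -
  have pos: "norm (G t) \<le> C * exp \<bar>\<Lambda> t\<bar>"
    if G: "G 0 = 0" "\<And>t. (G has_vector_derivative g t) (at t)"
    and \<Lambda>: "\<Lambda> 0 = 0" "\<And>t. (\<Lambda> has_real_derivative k t) (at t)" and k: "\<And>t. k t \<ge> 0"
    and g: "\<And>t. norm (g t) \<le> C * k t * exp \<bar>\<Lambda> t\<bar>" and t: "t > 0"
    for G :: "real \<Rightarrow> 'a" and g \<Lambda> k t
  proof -
    have \<Lambda>0: "0 \<le> \<Lambda> s" if "0 \<le> s" for s
      using nondecreasing_within[of 0 s \<Lambda> k] \<Lambda> k that by (auto intro: has_field_derivative_at_within)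
    have "norm (G t - G 0) \<le> C * exp (\<Lambda> t) - C * exp (\<Lambda> 0)"
    proof (rule differentiable_bound_general[OF t])
      show "continuous_on {0..t} G"
        by (meson G(2) continuous_at_imp_continuous_on has_vector_derivative_continuous)
      show "continuous_on {0..t} (\<lambda>s. C * exp (\<Lambda> s))"
        by (intro continuous_intros DERIV_continuous_on[OF has_field_derivative_at_within[OF \<Lambda>(2)]])
      show "(G has_vector_derivative g s) (at s)" for s by (rule G)
      show "((\<lambda>s. C * exp (\<Lambda> s)) has_vector_derivative C * k s * exp (\<Lambda> s)) (at s)" for s
        unfolding has_real_derivative_iff_has_vector_derivative[symmetric]
        by (auto intro!: derivative_eq_intros \<Lambda>(2))
      show "norm (g s) \<le> C * k s * exp (\<Lambda> s)" if "0 < s" for s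
        using g[of s] that \<Lambda>0[of s] by simp
    qed
    then show ?thesis using G(1) \<Lambda>(1) \<Lambda>0[of t] t C by simp
  qed
  consider "t > 0" | "t = 0" | "t < 0" by linarith
  then show ?thesis
  proof cases
    case 1 then show ?thesis using pos[OF G \<Lambda> k g] by simp
  next
    case 2 then show ?thesis using G assms by simp
  next
    case 3
    have G': "((\<lambda>s. G (- s)) has_vector_derivative - g (- s)) (at s)" for s
    proof -
      have "((\<lambda>s. G (- s)) has_vector_derivative (-1) *\<^sub>R g (- s)) (at s)"
        using vector_diff_chain_at[of "\<lambda>s. - s" "-1" s G "g (- s)"] G(2)[of "- s"]
        by (simp add: o_def has_vector_derivative_minus[OF has_vector_derivative_id, simplified])
      then show ?thesis by simp
    qed
    have \<Lambda>': "((\<lambda>s. - \<Lambda> (- s)) has_real_derivative k (- s)) (at s)" for s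
    proof -
      have "((\<lambda>s. - \<Lambda> (- s)) has_real_derivative - (k (- s) * - 1)) (at s)"
        by (intro DERIV_minus DERIV_chain2[OF \<Lambda>(2)]) (auto intro!: derivative_eq_intros)
      then show ?thesis by simp
    qed
    show ?thesis
      using pos[OF _ G' _ \<Lambda>', of "- t"] g[of "- _"] G \<Lambda> k 3 by simp
  qed
qed

text \<open>Contraction in a weighted supremum norm (Bielecki): the solution is written as
  \<open>v * w\<close> with \<open>v = exp \<bar>\<Lambda>\<bar>\<close> and w bounded and
  continuous. A single fixed point then gives a solution on the whole line although
  \<open>L t\<close> may grow with t, as it does for the Weber equation.\<close>

theorem picard_global:
  fixes F :: "real \<Rightarrow> 'a::euclidean_space \<Rightarrow> 'a"
  assumes cont: "continuous_on UNIV (\<lambda>p. F (fst p) (snd p))"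
    and contL: "continuous_on UNIV L"
    and lip: "\<And>t x y. norm (F t x - F t y) \<le> L t * norm (x - y)"
    and bd: "\<And>t. norm (F t 0) \<le> B"
  shows "\<exists>y. y 0 = x0 \<and> (\<forall>t. (y has_vector_derivative F t (y t)) (at t))"
proof -
  have L0: "L t \<ge> 0" for t
    using lip[of t "SOME b. b \<in> Basis" 0]
    by (metis SOME_Basis norm_ge_zero norm_Basis diff_zero mult.right_neutral order_trans)
  have B0: "B \<ge> 0" using bd[of 0] norm_ge_zero order_trans by blast
  \<comment> \<open>The factor 2 produces the contraction constant 1/2. The summand 1 gives
    \<open>k * v >= 1\<close>, so that the constant \<open>B\<close> is dominated by a multiple of
    \<open>k * v\<close> as well.\<close>
  define k where "k t = 2 * L t + 1" for t
  have k: "k t \<ge> 1" for t using L0[of t] by (simp add: k_def)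
  have "continuous_on UNIV k" unfolding k_def by (intro continuous_intros contL)
  then obtain \<Lambda> where \<Lambda>: "\<Lambda> 0 = 0" "\<And>t. (\<Lambda> has_real_derivative k t) (at t)"
    using antiderivative_real_line[of k] by (auto simp: has_real_derivative_iff_has_vector_derivative)
  define v where "v t = exp \<bar>\<Lambda> t\<bar>" for t
  have v: "v t \<ge> 1" "v t > 0" for t by (auto simp: v_def)
  have vc: "continuous_on UNIV v" unfolding v_def
    by (intro continuous_intros DERIV_continuous_on[OF has_field_derivative_at_within[OF \<Lambda>(2)]])
  define anti :: "(real \<Rightarrow> 'a) \<Rightarrow> real \<Rightarrow> 'a" where
    "anti g = (SOME G. G 0 = 0 \<and> (\<forall>t. (G has_vector_derivative g t) (at t)))" for g
  have anti: "anti g 0 = 0 \<and> (\<forall>t. (anti g has_vector_derivative g t) (at t))"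
    if "continuous_on UNIV g" for g :: "real \<Rightarrow> 'a"
    unfolding anti_def using someI_ex[OF antiderivative_real_line[OF that]] by blast
  define G where "G w s = F s (v s *\<^sub>R apply_bcontfun w s)" for w :: "real \<Rightarrow>\<^sub>C 'a" and s
  have Gc: "continuous_on UNIV (G w)" for w
  proof -
    have "continuous_on UNIV (\<lambda>s. (s, v s *\<^sub>R apply_bcontfun w s))"
      by (intro continuous_intros vc) auto
    from continuous_on_compose2[OF cont this] show ?thesis by (simp add: G_def)
  qed
  \<comment> \<open>The Picard operator in the variable w = y / v.\<close>
  define S where "S w t = (x0 + anti (G w) t) /\<^sub>R v t" for w t
  have Sc: "S w \<in> bcontfun" for w
  proof (rule bcontfun_normI)
    have "continuous_on UNIV (anti (G w))"
      by (metis anti[OF Gc] continuous_at_imp_continuous_on has_vector_derivative_continuous)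
    then show "continuous_on UNIV (S w)"
      unfolding S_def using v by (intro continuous_intros vc) (auto simp: less_imp_neq[symmetric])
    fix t
    have *: "norm (G w s) \<le> (B + norm w) * k s * exp \<bar>\<Lambda> s\<bar>" for s
    proof -
      have "norm (G w s) \<le> norm (F s 0) + norm (F s (v s *\<^sub>R apply_bcontfun w s) - F s 0)"
        unfolding G_def by (metis add.commute diff_add_cancel norm_triangle_ineq)
      also have "\<dots> \<le> B + L s * norm (v s *\<^sub>R apply_bcontfun w s)"
        using bd[of s] lip[of s "v s *\<^sub>R apply_bcontfun w s" 0] by auto
      also have "\<dots> \<le> B * (k s * v s) + k s * (norm w * v s)"
      proof (rule add_mono)
        have "1 * 1 \<le> k s * v s" using k[of s] v(1)[of s] by (intro mult_mono) auto
        then show "B \<le> B * (k s * v s)" using B0 by (simp add: mult_le_cancel_left1)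
        have "norm (apply_bcontfun w s) \<le> norm w" by (rule norm_bounded)
        then have "norm (v s *\<^sub>R apply_bcontfun w s) \<le> norm w * v s"
          using v(2)[of s] by (simp add: mult.commute mult_right_mono)
        then show "L s * norm (v s *\<^sub>R apply_bcontfun w s) \<le> k s * (norm w * v s)"
          using L0[of s] by (intro mult_mono) (auto simp: k_def)
      qed
      finally show ?thesis by (simp add: v_def algebra_simps)
    qed
    have "norm (anti (G w) t) \<le> (B + norm w) * v t"
      unfolding v_def
      by (rule antiderivative_exp_bound[OF _ _ \<Lambda> _ *]) (use anti[OF Gc] k B0 in \<open>auto intro: order_trans[OF zero_le_one]\<close>)
    moreover have "norm x0 \<le> norm x0 * v t" using v(1)[of t] by (simp add: mult_le_cancel_left1)
    ultimately have "norm (x0 + anti (G w) t) \<le> (norm x0 + (B + norm w)) * v t"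
      using norm_triangle_ineq[of x0 "anti (G w) t"] by (simp add: algebra_simps)
    then show "norm (S w t) \<le> norm x0 + (B + norm w)"
      using v(2)[of t] by (simp add: S_def pos_divide_le_eq divide_inverse_commute[symmetric])
  qed
  define T where "T w = Bcontfun (S w)" for w
  have Tap: "apply_bcontfun (T w) = S w" for w
    using Sc by (simp add: T_def Bcontfun_inverse)
  have "dist (T w1) (T w2) \<le> 1/2 * dist w1 w2" for w1 w2
  proof (rule dist_bound)
    fix t
    have *: "norm (G w1 s - G w2 s) \<le> (1/2 * dist w1 w2) * k s * exp \<bar>\<Lambda> s\<bar>" for s
    proof -
      have "norm (G w1 s - G w2 s) \<le> L s * norm (v s *\<^sub>R apply_bcontfun w1 s - v s *\<^sub>R apply_bcontfun w2 s)"
        unfolding G_def by (rule lip)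
      also have "\<dots> = L s * (v s * dist (apply_bcontfun w1 s) (apply_bcontfun w2 s))"
        using v(2)[of s] by (simp add: scaleR_diff_right[symmetric] dist_norm)
      also have "\<dots> \<le> (k s / 2) * (v s * dist w1 w2)"
        using v(2)[of s] L0[of s] by (intro mult_mono dist_bounded) (auto simp: k_def)
      finally show ?thesis by (simp add: v_def mult_ac)
    qed
    have "norm (anti (G w1) t - anti (G w2) t) \<le> (1/2 * dist w1 w2) * v t"
      unfolding v_def
    proof (rule antiderivative_exp_bound[OF _ _ \<Lambda> _ *])
      show "((\<lambda>t. anti (G w1) t - anti (G w2) t) has_vector_derivative G w1 s - G w2 s) (at s)" for s
        using anti[OF Gc] by (intro has_vector_derivative_diff) auto
    qed (use anti[OF Gc] k in \<open>auto intro: order_trans[OF zero_le_one]\<close>)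
    moreover have "dist (S w1 t) (S w2 t) = norm (anti (G w1) t - anti (G w2) t) / v t"
      using v(2)[of t]
      by (simp add: S_def dist_norm scaleR_diff_right[symmetric] divide_inverse mult.commute)
    ultimately have "dist (S w1 t) (S w2 t) \<le> 1/2 * dist w1 w2"
      using v(2)[of t] by (simp add: pos_divide_le_eq)
    then show "dist (apply_bcontfun (T w1) t) (apply_bcontfun (T w2) t) \<le> 1/2 * dist w1 w2"
      by (simp add: Tap)
  qed
  then have "\<exists>!w. T w = w" by (intro banach_fix_type[of "1/2"]) auto
  then obtain w where w: "T w = w" by blast
  define y where "y t = v t *\<^sub>R apply_bcontfun w t" for t
  have y: "y t = x0 + anti (G w) t" for t
    using v(2)[of t] w Tap[of w] by (simp add: y_def S_def)
  have "G w t = F t (y t)" for t by (simp add: G_def y_def)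
  moreover have "(y has_vector_derivative G w t) (at t)" for t
  proof -
    have "((\<lambda>t. x0 + anti (G w) t) has_vector_derivative 0 + G w t) (at t)"
      using anti[OF Gc] by (intro has_vector_derivative_add has_vector_derivative_const) auto
    then show ?thesis by (simp add: y[abs_def])
  qed
  moreover have "y 0 = x0" using y[of 0] anti[OF Gc] by simp
  ultimately show ?thesis by auto
qed

text \<open>The squared norm is differentiable also where y vanishes. In the rate 2 L + 1 the part 2
  L comes from the linear term and the 1 from 2 |y| B <= |y|^2 + B^2, which leaves B^2 as
  inhomogeneity.\<close>

theorem gronwall_norm:
  fixes y :: "real \<Rightarrow> 'a::real_inner"
  assumes der: "\<And>t. t \<in> {0..T} \<Longrightarrow> (y has_vector_derivative y' t) (at t within {0..T})"
    and le: "\<And>t. t \<in> {0..T} \<Longrightarrow> norm (y' t) \<le> L * norm (y t) + B"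
    and "L \<ge> 0" "B \<ge> 0" and t: "t \<in> {0..T}"
  shows "(norm (y t))\<^sup>2 \<le> exp ((2 * L + 1) * t) * ((norm (y 0))\<^sup>2 + B\<^sup>2 * t)"
proof -
  define K where "K = 2 * L + 1"
  define g where "g s = exp (- K * s) * (y s \<bullet> y s) - B\<^sup>2 * s" for s
  define g' where "g' s = exp (- K * s) * (2 * (y s \<bullet> y' s)) - K * exp (- K * s) * (y s \<bullet> y s) - B\<^sup>2" for s
  have "(g has_real_derivative g' s) (at s within {0..T})" if "s \<in> {0..T}" for s
    unfolding g_def g'_def has_real_derivative_iff_has_vector_derivative has_vector_derivative_def
    by (rule der[OF that, unfolded has_vector_derivative_def] derivative_eq_intros refl)+
      (auto simp: algebra_simps inner_commute)
  moreover have "g' s \<le> 0" if s: "s \<in> {0..T}" for s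
  proof -
    have "y s \<bullet> y' s \<le> norm (y s) * norm (y' s)" by (rule norm_cauchy_schwarz)
    also have "\<dots> \<le> norm (y s) * (L * norm (y s) + B)"
      using le[OF s] by (intro mult_left_mono) auto
    finally have "2 * (y s \<bullet> y' s) \<le> 2 * L * (norm (y s))\<^sup>2 + 2 * norm (y s) * B"
      by (simp add: power2_eq_square algebra_simps)
    also have "2 * norm (y s) * B \<le> (norm (y s))\<^sup>2 + B\<^sup>2" by (rule sum_squares_bound)
    finally have "2 * (y s \<bullet> y' s) \<le> K * (y s \<bullet> y s) + B\<^sup>2"
      by (simp add: K_def dot_square_norm algebra_simps)
    then have "exp (- K * s) * (2 * (y s \<bullet> y' s)) \<le> exp (- K * s) * (K * (y s \<bullet> y s) + B\<^sup>2)"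
      by (intro mult_left_mono) auto
    moreover have "K * s \<ge> 0" using s \<open>L \<ge> 0\<close> by (simp add: K_def)
    then have "exp (- K * s) * B\<^sup>2 \<le> 1 * B\<^sup>2"
      by (intro mult_right_mono) auto
    ultimately show ?thesis by (simp add: g'_def algebra_simps)
  qed
  ultimately have "- g 0 \<le> - g t"
    using t by (intro nondecreasing_within[where f = "\<lambda>s. - g s" and f' = "\<lambda>s. - g' s"])
      (auto intro!: DERIV_minus intro: DERIV_subset[where s = "{0..T}"])
  then have "exp (- K * t) * (norm (y t))\<^sup>2 \<le> (norm (y 0))\<^sup>2 + B\<^sup>2 * t"
    by (simp add: g_def dot_square_norm)
  then have "exp (K * t) * (exp (- K * t) * (norm (y t))\<^sup>2) \<le> exp (K * t) * ((norm (y 0))\<^sup>2 + B\<^sup>2 * t)"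
    by (intro mult_left_mono) auto
  moreover have "exp (K * t) * (exp (- K * t) * x) = x" for x
    by (simp add: mult.assoc[symmetric] exp_add[symmetric])
  ultimately have "(norm (y t))\<^sup>2 \<le> exp (K * t) * ((norm (y 0))\<^sup>2 + B\<^sup>2 * t)" by metis
  then show ?thesis by (simp only: K_def)
qed

corollary gronwall_norm_linear:
  fixes y :: "real \<Rightarrow> 'a::real_inner"
  assumes der: "\<And>t. t \<in> {0..T} \<Longrightarrow> (y has_vector_derivative y' t) (at t within {0..T})"
    and le: "\<And>t. t \<in> {0..T} \<Longrightarrow> norm (y' t) \<le> L * norm (y t) + B"
    and LB: "L \<ge> 0" "B \<ge> 0" and t: "t \<in> {0..T}"
  shows "norm (y t) \<le> exp ((2 * L + 1) * T) * (1 + T) * (norm (y 0) + B)"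
proof -
  define C where "C = exp ((2 * L + 1) * T) * (1 + T)"
  have T: "T \<ge> 0" using t by simp
  have "exp ((2 * L + 1) * T) \<ge> 1" using T LB by simp
  then have C: "C \<ge> 1" using T mult_mono[of 1 "exp ((2 * L + 1) * T)" 1 "1 + T"] by (simp add: C_def)
  have "(norm (y t))\<^sup>2 \<le> exp ((2 * L + 1) * t) * ((norm (y 0))\<^sup>2 + B\<^sup>2 * t)"
    by (rule gronwall_norm[OF assms])
  also have "\<dots> \<le> exp ((2 * L + 1) * T) * ((norm (y 0) + B)\<^sup>2 * (1 + T))"
  proof (rule mult_mono)
    have "B\<^sup>2 * t \<le> B\<^sup>2 * T" using t by (simp add: mult_left_mono)
    moreover have "(norm (y 0) + B)\<^sup>2 \<ge> (norm (y 0))\<^sup>2 + B\<^sup>2" using LB by (simp add: power2_sum)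
    then have "(norm (y 0) + B)\<^sup>2 * (1 + T) \<ge> ((norm (y 0))\<^sup>2 + B\<^sup>2) * (1 + T)"
      using T by (intro mult_right_mono) auto
    ultimately show "(norm (y 0))\<^sup>2 + B\<^sup>2 * t \<le> (norm (y 0) + B)\<^sup>2 * (1 + T)"
      using T LB by (simp add: algebra_simps) (smt (verit) mult_nonneg_nonneg zero_le_power2)
  qed (use t LB in \<open>auto intro!: mult_left_mono\<close>)
  also have "\<dots> = C * (norm (y 0) + B)\<^sup>2" by (simp add: C_def)
  \<comment> \<open>As C >= 1, replacing C by its square turns the right-hand side into a square, so
    that roots can be taken.\<close>
  also have "\<dots> \<le> C\<^sup>2 * (norm (y 0) + B)\<^sup>2"
    using C by (intro mult_right_mono) (auto simp: power2_eq_square mult_le_cancel_left1)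
  also have "\<dots> = (C * (norm (y 0) + B))\<^sup>2" by (simp add: power_mult_distrib)
  finally have "norm (y t) \<le> C * (norm (y 0) + B)"
    by (rule power2_le_imp_le) (use C LB in simp)
  then show ?thesis by (simp add: C_def)
qed

corollary ode_dependence:
  fixes y z :: "real \<Rightarrow> 'a::real_inner"
  assumes y: "\<And>t. t \<in> {0..T} \<Longrightarrow> (y has_vector_derivative F t (y t)) (at t within {0..T})"
    and z: "\<And>t. t \<in> {0..T} \<Longrightarrow> (z has_vector_derivative z' t) (at t within {0..T})"
    and lip: "\<And>t. t \<in> {0..T} \<Longrightarrow> norm (F t (y t) - F t (z t)) \<le> L * norm (y t - z t)"
    and err: "\<And>t. t \<in> {0..T} \<Longrightarrow> norm (F t (z t) - z' t) \<le> B"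
    and "L \<ge> 0" "B \<ge> 0" "t \<in> {0..T}"
  shows "norm (y t - z t) \<le> exp ((2 * L + 1) * T) * (1 + T) * (norm (y 0 - z 0) + B)"
proof (rule gronwall_norm_linear[where y' = "\<lambda>t. F t (y t) - z' t"])
  fix t assume t: "t \<in> {0..T}"
  show "((\<lambda>t. y t - z t) has_vector_derivative F t (y t) - z' t) (at t within {0..T})"
    by (intro has_vector_derivative_diff y z t)
  have "norm (F t (y t) - z' t) \<le> norm (F t (y t) - F t (z t)) + norm (F t (z t) - z' t)"
    using norm_triangle_ineq[of "F t (y t) - F t (z t)" "F t (z t) - z' t"] by simp
  then show "norm (F t (y t) - z' t) \<le> L * norm (y t - z t) + B"
    using lip[OF t] err[OF t] by simp
qed (use assms in auto)

text \<open>Multiplied by exp (2 L r) the squared norm is nondecreasing, multiplied by exp (-2 L r)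
  it is nonincreasing. A zero at \<open>s\<close> therefore spreads to the left by the first weight
  and to the right by the second; \<open>orbit_reflect\<close> starts from a midpoint and needs
  both.\<close>

lemma zero_propagation:
  fixes y :: "real \<Rightarrow> 'a::real_inner"
  assumes der: "\<And>t. t \<in> {a..b} \<Longrightarrow> (y has_vector_derivative y' t) (at t within {a..b})"
    and le: "\<And>t. t \<in> {a..b} \<Longrightarrow> norm (y' t) \<le> L * norm (y t)"
    and s: "s \<in> {a..b}" "y s = 0" and t: "t \<in> {a..b}"
  shows "y t = 0"
proof -
  define g where "g c r = exp (c * r) * (y r \<bullet> y r)" for c r :: real
  define g' where "g' c r = exp (c * r) * (2 * (y r \<bullet> y' r) + c * (y r \<bullet> y r))" for c r :: real
  have der_g: "(g c has_real_derivative g' c r) (at r within {a..b})" if "r \<in> {a..b}" for c r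
    unfolding g_def g'_def has_real_derivative_iff_has_vector_derivative has_vector_derivative_def
    by (rule der[OF that, unfolded has_vector_derivative_def] derivative_eq_intros refl)+
      (auto simp: algebra_simps inner_commute)
  have bound: "\<bar>2 * (y r \<bullet> y' r)\<bar> \<le> 2 * L * (y r \<bullet> y r)" if "r \<in> {a..b}" for r
  proof -
    have "\<bar>y r \<bullet> y' r\<bar> \<le> norm (y r) * norm (y' r)" by (rule Cauchy_Schwarz_ineq2)
    also have "\<dots> \<le> norm (y r) * (L * norm (y r))" using le[OF that] by (intro mult_left_mono) auto
    also have "\<dots> = L * (y r \<bullet> y r)" by (simp add: dot_square_norm power2_eq_square)
    finally show ?thesis by simp
  qed
  have sgn: "0 \<le> g' (2 * L) r" "g' (- 2 * L) r \<le> 0" if "r \<in> {a..b}" for r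
    using bound[OF that] by (auto simp: g'_def abs_le_iff zero_le_mult_iff mult_le_0_iff)
  have "g (2 * L) r \<le> g (2 * L) s" if "r \<in> {a..b}" "r \<le> s" for r
  proof (rule nondecreasing_within[OF \<open>r \<le> s\<close>])
    fix x assume "x \<in> {r..s}"
    then show "(g (2 * L) has_real_derivative g' (2 * L) x) (at x within {r..s})"
      using that s by (intro DERIV_subset[OF der_g]) auto
  next
    fix x assume "x \<in> {r<..<s}"
    then show "0 \<le> g' (2 * L) x" using that s by (intro sgn) auto
  qed
  moreover have "- g (- 2 * L) s \<le> - g (- 2 * L) r" if "r \<in> {a..b}" "s \<le> r" for r
  proof (rule nondecreasing_within[OF \<open>s \<le> r\<close>, where f = "\<lambda>r. - g (- 2 * L) r"])
    fix x assume "x \<in> {s..r}"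
    then show "((\<lambda>r. - g (- 2 * L) r) has_real_derivative - g' (- 2 * L) x) (at x within {s..r})"
      using that s by (intro DERIV_minus DERIV_subset[OF der_g]) auto
  next
    fix x assume "x \<in> {s<..<r}"
    then show "0 \<le> - g' (- 2 * L) x" using that s sgn(2)[of x] by auto
  qed
  ultimately have "g (2 * L) t \<le> 0 \<or> g (- 2 * L) t \<le> 0"
    using t s(2) by (cases "t \<le> s") (auto simp: g_def)
  then have "y t \<bullet> y t \<le> 0" by (auto simp: g_def mult_le_0_iff)
  then show ?thesis using inner_gt_zero_iff[of "y t"] by linarith
qed

text \<open>A fixed point of \<open>x \<mapsto> clamp a b (x - f x)\<close> is a zero of \<open>f\<close>,
  since the sign conditions exclude that the clamping is active.\<close>

theorem poincare_miranda:
  fixes f :: "'a::euclidean_space \<Rightarrow> 'a"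
  assumes cont: "continuous_on (cbox a b) f"
    and ab: "\<And>i. i \<in> Basis \<Longrightarrow> a \<bullet> i < b \<bullet> i"
    and lo: "\<And>x i. i \<in> Basis \<Longrightarrow> x \<in> cbox a b \<Longrightarrow> x \<bullet> i = a \<bullet> i \<Longrightarrow> f x \<bullet> i \<le> 0"
    and hi: "\<And>x i. i \<in> Basis \<Longrightarrow> x \<in> cbox a b \<Longrightarrow> x \<bullet> i = b \<bullet> i \<Longrightarrow> f x \<bullet> i \<ge> 0"
  shows "\<exists>x\<in>cbox a b. f x = 0"
proof -
  have ab': "\<forall>i\<in>Basis. a \<bullet> i \<le> b \<bullet> i" using ab less_imp_le by blast
  then have ne: "cbox a b \<noteq> {}" by (simp add: box_ne_empty)
  obtain x where x: "x \<in> cbox a b" "clamp a b (x - f x) = x"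
  proof (rule brouwer[of "cbox a b" "\<lambda>x. clamp a b (x - f x)"])
    have "continuous_on UNIV (clamp a b)"
      using clamp_continuous_on[of a b "\<lambda>x. x"] ab' by auto
    then show "continuous_on (cbox a b) (\<lambda>x. clamp a b (x - f x))"
      by (rule continuous_on_compose2) (auto intro!: continuous_intros cont)
    show "(\<lambda>x. clamp a b (x - f x)) \<in> cbox a b \<rightarrow> cbox a b"
      using clamp_in_interval[OF ab'[rule_format]] by auto
  qed (use ne compact_cbox convex_box in auto)
  have "f x \<bullet> i = 0" if i: "i \<in> Basis" for i
  proof -
    have eq: "x \<bullet> i = (if (x - f x) \<bullet> i < a \<bullet> i then a \<bullet> i
        else if (x - f x) \<bullet> i \<le> b \<bullet> i then (x - f x) \<bullet> i else b \<bullet> i)"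
      using arg_cong[OF x(2)[unfolded clamp_def if_P[OF ab']], of "\<lambda>z. z \<bullet> i"] i
      by (simp only: inner_sum_left_Basis)
    \<comment> \<open>The scalar core: X is a coordinate of the fixed point and F that component of
      the map. Without clamping X = X - F; with clamping X is an end value, and the direction of the
      overshoot contradicts the sign of F there.\<close>
    have gen: "F = 0" if "X = (if X - F < A then A else if X - F \<le> B then X - F else B)"
      "X = A \<Longrightarrow> F \<le> 0" "X = B \<Longrightarrow> F \<ge> 0" "A < B" for X F A B :: real
      using that by (auto split: if_splits)
    show ?thesis
      by (rule gen[OF eq[unfolded inner_diff_left] lo[OF i x(1)] hi[OF i x(1)] ab[OF i]])
  qed
  then have "f x = 0" using euclidean_all_zero_iff[of "f x"] by blast
  with x(1) show ?thesis by blast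
qed

lemma poincare_miranda_2d:
  fixes f g :: "real \<Rightarrow> real \<Rightarrow> real"
  assumes "continuous_on ({a..b} \<times> {c..d}) (\<lambda>p. f (fst p) (snd p))"
    and "continuous_on ({a..b} \<times> {c..d}) (\<lambda>p. g (fst p) (snd p))"
    and "a < b" "c < d"
    and "\<And>y. y \<in> {c..d} \<Longrightarrow> f a y \<le> 0" "\<And>y. y \<in> {c..d} \<Longrightarrow> f b y \<ge> 0"
    and "\<And>x. x \<in> {a..b} \<Longrightarrow> g x c \<le> 0" "\<And>x. x \<in> {a..b} \<Longrightarrow> g x d \<ge> 0"
  obtains x y where "x \<in> {a..b}" "y \<in> {c..d}" "f x y = 0" "g x y = 0"
proof -
  have box: "cbox (a, c) (b, d) = {a..b} \<times> {c..d}" by (simp add: cbox_Pair_eq)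
  have Basis: "i = (1, 0) \<or> i = (0, 1)" if "i \<in> Basis" for i :: "real \<times> real"
    using that by (auto simp: Basis_prod_def)
  have "\<exists>p\<in>cbox (a, c) (b, d). (f (fst p) (snd p), g (fst p) (snd p)) = 0"
  proof (rule poincare_miranda[where f = "\<lambda>p. (f (fst p) (snd p), g (fst p) (snd p))"])
    show "continuous_on (cbox (a, c) (b, d)) (\<lambda>p. (f (fst p) (snd p), g (fst p) (snd p)))"
      unfolding box by (intro continuous_on_Pair assms)
  next
    fix i :: "real \<times> real" assume "i \<in> Basis"
    then show "(a, c) \<bullet> i < (b, d) \<bullet> i" using Basis[of i] assms(3,4) by auto
  next
    fix p i :: "real \<times> real"
    assume *: "i \<in> Basis" "p \<in> cbox (a, c) (b, d)" "p \<bullet> i = (a, c) \<bullet> i"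
    obtain x y where p: "p = (x, y)" by (cases p)
    show "(f (fst p) (snd p), g (fst p) (snd p)) \<bullet> i \<le> 0"
      using Basis[OF *(1)] * assms(5)[of y] assms(7)[of x] by (auto simp: p box)
  next
    fix p i :: "real \<times> real"
    assume *: "i \<in> Basis" "p \<in> cbox (a, c) (b, d)" "p \<bullet> i = (b, d) \<bullet> i"
    obtain x y where p: "p = (x, y)" by (cases p)
    show "(f (fst p) (snd p), g (fst p) (snd p)) \<bullet> i \<ge> 0"
      using Basis[OF *(1)] * assms(6)[of y] assms(8)[of x] by (auto simp: p box)
  qed
  then obtain p where "p \<in> {a..b} \<times> {c..d}" "f (fst p) (snd p) = 0" "g (fst p) (snd p) = 0"
    unfolding box by (auto simp: zero_prod_def)
  then show ?thesis using that[of "fst p" "snd p"] by auto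
qed



section \<open>Linear second-order equations with a continuous coefficient\<close>

lemma linear_ode_exists:
  fixes Q :: "real \<Rightarrow> real"
  assumes "continuous_on UNIV Q"
  shows "\<exists>u u'. u 0 = a \<and> u' 0 = b \<and> (\<forall>t. (u has_real_derivative u' t) (at t) \<and>
           (u' has_real_derivative Q t * u t) (at t))"
proof -
  have "\<exists>y. y 0 = (a, b) \<and> (\<forall>t. (y has_vector_derivative (snd (y t), Q t * fst (y t))) (at t))"
  proof (rule picard_global[where F = "\<lambda>t y. (snd y, Q t * fst y)" and L = "\<lambda>t. 1 + \<bar>Q t\<bar>" and B = 0])
    have c: "continuous_on UNIV (\<lambda>p :: real \<times> real \<times> real. Q (fst p))"
      by (rule continuous_on_compose2[OF assms continuous_on_fst[OF continuous_on_id]]) auto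
    show "continuous_on UNIV (\<lambda>p :: real \<times> real \<times> real. (snd (snd p), Q (fst p) * fst (snd p)))"
      by (intro continuous_intros c)
    show "continuous_on UNIV (\<lambda>t. 1 + \<bar>Q t\<bar>)" by (intro continuous_intros assms)
    fix t :: real and x y :: "real \<times> real"
    have "norm ((snd x, Q t * fst x) - (snd y, Q t * fst y)) = norm (snd (x - y), Q t * fst (x - y))"
      by (simp add: algebra_simps)
    also have "\<dots> \<le> \<bar>snd (x - y)\<bar> + \<bar>Q t\<bar> * \<bar>fst (x - y)\<bar>"
      using norm_Pair_le[of "snd (x - y)" "Q t * fst (x - y)"] by (simp add: abs_mult)
    also have "\<dots> \<le> norm (x - y) + \<bar>Q t\<bar> * norm (x - y)"
      using norm_fst_le[of "fst (x - y)" "snd (x - y)"] norm_snd_le[of "snd (x - y)" "fst (x - y)"]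
      by (intro add_mono mult_left_mono) (auto simp del: fst_diff snd_diff)
    finally show "norm ((snd x, Q t * fst x) - (snd y, Q t * fst y)) \<le> (1 + \<bar>Q t\<bar>) * norm (x - y)"
      by (simp add: algebra_simps)
  qed auto
  then obtain y where y: "y 0 = (a, b)"
    "\<And>t. (y has_vector_derivative (snd (y t), Q t * fst (y t))) (at t)" by auto
  have "((\<lambda>t. fst (y t)) has_vector_derivative snd (y t)) (at t)"
    "((\<lambda>t. snd (y t)) has_vector_derivative Q t * fst (y t)) (at t)" for t
    using bounded_linear.has_vector_derivative[OF bounded_linear_fst y(2)[of t]]
      bounded_linear.has_vector_derivative[OF bounded_linear_snd y(2)[of t]] by simp_all
  with y(1) show ?thesis
    by (intro exI[of _ "\<lambda>t. fst (y t)"] exI[of _ "\<lambda>t. snd (y t)"])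
      (auto simp: has_real_derivative_iff_has_vector_derivative)
qed

lemma has_vector_derivative_real_Pair:
  fixes f g :: "real \<Rightarrow> real"
  assumes "(f has_real_derivative f') (at t within S)" "(g has_real_derivative g') (at t within S)"
  shows "((\<lambda>t. (f t, g t)) has_vector_derivative (f', g')) (at t within S)"
  using assms unfolding has_real_derivative_iff_has_vector_derivative
  by (rule has_vector_derivative_Pair)

lemma linear_ode_unique:
  fixes u v :: "real \<Rightarrow> real"
  assumes u: "\<And>t. t \<in> {a..b} \<Longrightarrow> (u has_real_derivative u' t) (at t within {a..b})"
      "\<And>t. t \<in> {a..b} \<Longrightarrow> (u' has_real_derivative Q t * u t) (at t within {a..b})"
    and v: "\<And>t. t \<in> {a..b} \<Longrightarrow> (v has_real_derivative v' t) (at t within {a..b})"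
      "\<And>t. t \<in> {a..b} \<Longrightarrow> (v' has_real_derivative Q t * v t) (at t within {a..b})"
    and Q: "continuous_on {a..b} Q"
    and s: "s \<in> {a..b}" "u s = v s" "u' s = v' s" and t: "t \<in> {a..b}"
  shows "u t = v t \<and> u' t = v' t"
proof -
  have "bounded (Q ` {a..b})" by (intro compact_imp_bounded compact_continuous_image Q) simp
  then obtain C where "\<forall>t\<in>{a..b}. \<bar>Q t\<bar> \<le> C" by (auto simp: bounded_iff)
  then have C: "\<bar>Q t\<bar> \<le> C" if "t \<in> {a..b}" for t using that by blast
  have "(u t - v t, u' t - v' t) = 0"
  proof (rule zero_propagation[where L = "1 + C" and a = a and b = b and s = s and t = t
        and y = "\<lambda>t. (u t - v t, u' t - v' t)" and y' = "\<lambda>t. (u' t - v' t, Q t * u t - Q t * v t)"])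
    fix t assume t: "t \<in> {a..b}"
    show "((\<lambda>t. (u t - v t, u' t - v' t)) has_vector_derivative (u' t - v' t, Q t * u t - Q t * v t))
      (at t within {a..b})"
      by (intro has_vector_derivative_real_Pair DERIV_diff u v t)
    let ?n = "norm (u t - v t, u' t - v' t)"
    have "norm (u' t - v' t, Q t * u t - Q t * v t) \<le> \<bar>u' t - v' t\<bar> + \<bar>Q t\<bar> * \<bar>u t - v t\<bar>"
      using norm_Pair_le[of "u' t - v' t" "Q t * u t - Q t * v t"]
      by (simp add: abs_mult[symmetric] algebra_simps)
    also have "\<dots> \<le> ?n + C * ?n"
      using C[OF t] norm_fst_le[of "u t - v t" "u' t - v' t"] norm_snd_le[of "u' t - v' t" "u t - v t"]
      by (intro add_mono mult_mono) auto
    finally show "norm (u' t - v' t, Q t * u t - Q t * v t) \<le> (1 + C) * ?n"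
      by (simp add: algebra_simps)
  qed (use s t in \<open>auto simp: zero_prod_def\<close>)
  then show ?thesis by (simp add: zero_prod_def)
qed

subsection \<open>The even and the odd Weber function\<close>

text \<open>\<open>weber \<mu> \<nu> a b\<close> solves \<open>u'' = (\<mu> y\<^sup>2 - \<nu>) u\<close>, \<open>u(0) = a\<close>, \<open>u'(0) = b\<close>. For a normal state
  \<open>h (x + c)\<close> one has \<open>\<nu> = \<kappa>\<^sup>2\<close>, \<open>\<mu> = \<kappa>\<^sup>2 h\<^sup>2\<close> and \<open>y = x + c\<close>.\<close>

definition weber :: "real \<Rightarrow> real \<Rightarrow> real \<Rightarrow> real \<Rightarrow> (real \<Rightarrow> real) \<times> (real \<Rightarrow> real)" where
  "weber \<mu> \<nu> a b = (SOME w. fst w 0 = a \<and> snd w 0 = b \<and>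
     (\<forall>t. (fst w has_real_derivative snd w t) (at t) \<and>
          (snd w has_real_derivative (\<mu> * t\<^sup>2 - \<nu>) * fst w t) (at t)))"

definition wE where "wE \<mu> \<nu> = fst (weber \<mu> \<nu> 1 0)"
definition wE' where "wE' \<mu> \<nu> = snd (weber \<mu> \<nu> 1 0)"
definition wO where "wO \<mu> \<nu> = fst (weber \<mu> \<nu> 0 1)"
definition wO' where "wO' \<mu> \<nu> = snd (weber \<mu> \<nu> 0 1)"

lemma weber:
  "fst (weber \<mu> \<nu> a b) 0 = a \<and> snd (weber \<mu> \<nu> a b) 0 = b \<and>
     (\<forall>t. (fst (weber \<mu> \<nu> a b) has_real_derivative snd (weber \<mu> \<nu> a b) t) (at t) \<and>
          (snd (weber \<mu> \<nu> a b) has_real_derivative (\<mu> * t\<^sup>2 - \<nu>) * fst (weber \<mu> \<nu> a b) t) (at t))"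
proof -
  have "continuous_on UNIV (\<lambda>t. \<mu> * t\<^sup>2 - \<nu>)" by (intro continuous_intros)
  from linear_ode_exists[OF this, of a b] obtain u u' where
    "u 0 = a \<and> u' 0 = b \<and> (\<forall>t. (u has_real_derivative u' t) (at t) \<and>
          (u' has_real_derivative (\<mu> * t\<^sup>2 - \<nu>) * u t) (at t))" by blast
  then have "\<exists>w. fst w 0 = a \<and> snd w 0 = b \<and>
     (\<forall>t. (fst w has_real_derivative snd w t) (at t) \<and>
          (snd w has_real_derivative (\<mu> * t\<^sup>2 - \<nu>) * fst w t) (at t))"
    by (intro exI[of _ "(u, u')"]) simp
  from someI_ex[OF this] show ?thesis unfolding weber_def[symmetric] .
qed

lemma wEO_0 [simp]: "wE \<mu> \<nu> 0 = 1" "wE' \<mu> \<nu> 0 = 0" "wO \<mu> \<nu> 0 = 0" "wO' \<mu> \<nu> 0 = 1"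
  using weber by (auto simp: wE_def wE'_def wO_def wO'_def)

lemma wEO_derivs:
  "(wE \<mu> \<nu> has_real_derivative wE' \<mu> \<nu> t) (at t within S)"
  "(wE' \<mu> \<nu> has_real_derivative (\<mu> * t\<^sup>2 - \<nu>) * wE \<mu> \<nu> t) (at t within S)"
  "(wO \<mu> \<nu> has_real_derivative wO' \<mu> \<nu> t) (at t within S)"
  "(wO' \<mu> \<nu> has_real_derivative (\<mu> * t\<^sup>2 - \<nu>) * wO \<mu> \<nu> t) (at t within S)"
  using weber by (auto simp: wE_def wE'_def wO_def wO'_def intro: has_field_derivative_at_within)

lemmas wEO_derivs_chain [derivative_intros] =
  wEO_derivs[THEN DERIV_chain2]

lemma wEO_unique:
  assumes "\<And>t. t \<in> {a..b} \<Longrightarrow> (u has_real_derivative u' t) (at t within {a..b})"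
      "\<And>t. t \<in> {a..b} \<Longrightarrow> (u' has_real_derivative (\<mu> * t\<^sup>2 - \<nu>) * u t) (at t within {a..b})"
    and "0 \<in> {a..b}" and t: "t \<in> {a..b}"
  shows "u t = u 0 * wE \<mu> \<nu> t + u' 0 * wO \<mu> \<nu> t \<and> u' t = u 0 * wE' \<mu> \<nu> t + u' 0 * wO' \<mu> \<nu> t"
  by (rule linear_ode_unique[where a = a and b = b and s = 0 and Q = "\<lambda>t. \<mu> * t\<^sup>2 - \<nu>"])
    (use assms in \<open>auto intro!: continuous_intros derivative_eq_intros wEO_derivs simp: algebra_simps\<close>)

lemma wEO_parity:
  "wE \<mu> \<nu> (- t) = wE \<mu> \<nu> t" "wE' \<mu> \<nu> (- t) = - wE' \<mu> \<nu> t"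
  "wO \<mu> \<nu> (- t) = - wO \<mu> \<nu> t" "wO' \<mu> \<nu> (- t) = wO' \<mu> \<nu> t"
proof -
  have t: "t \<in> {-\<bar>t\<bar>..\<bar>t\<bar>}" "0 \<in> {-\<bar>t\<bar>..\<bar>t\<bar>}" by auto
  have "wE \<mu> \<nu> (- t) = wE \<mu> \<nu> (-0) * wE \<mu> \<nu> t + (- wE' \<mu> \<nu> (-0)) * wO \<mu> \<nu> t \<and>
     - wE' \<mu> \<nu> (- t) = wE \<mu> \<nu> (-0) * wE' \<mu> \<nu> t + (- wE' \<mu> \<nu> (-0)) * wO' \<mu> \<nu> t"
    by (rule wEO_unique[OF _ _ t(2) t(1), of "\<lambda>t. wE \<mu> \<nu> (- t)" "\<lambda>t. - wE' \<mu> \<nu> (- t)"])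
      (auto intro!: derivative_eq_intros)
  moreover have "wO \<mu> \<nu> (- t) = wO \<mu> \<nu> (-0) * wE \<mu> \<nu> t + (- wO' \<mu> \<nu> (-0)) * wO \<mu> \<nu> t \<and>
     - wO' \<mu> \<nu> (- t) = wO \<mu> \<nu> (-0) * wE' \<mu> \<nu> t + (- wO' \<mu> \<nu> (-0)) * wO' \<mu> \<nu> t"
    by (rule wEO_unique[OF _ _ t(2) t(1), of "\<lambda>t. wO \<mu> \<nu> (- t)" "\<lambda>t. - wO' \<mu> \<nu> (- t)"])
      (auto intro!: derivative_eq_intros)
  ultimately show "wE \<mu> \<nu> (- t) = wE \<mu> \<nu> t" "wE' \<mu> \<nu> (- t) = - wE' \<mu> \<nu> t"
  "wO \<mu> \<nu> (- t) = - wO \<mu> \<nu> t" "wO' \<mu> \<nu> (- t) = wO' \<mu> \<nu> t" by auto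
qed

lemma wEO_wronskian: "wE \<mu> \<nu> t * wO' \<mu> \<nu> t - wE' \<mu> \<nu> t * wO \<mu> \<nu> t = 1"
proof -
  have "\<forall>x. ((\<lambda>t. wE \<mu> \<nu> t * wO' \<mu> \<nu> t - wE' \<mu> \<nu> t * wO \<mu> \<nu> t) has_real_derivative 0) (at x)"
    by (auto intro!: derivative_eq_intros)
  from DERIV_isconst_all[OF this, of t 0] show ?thesis by simp
qed

text \<open>The parameters enter the equation linearly. Hence the solution for
  \<open>(\<mu>\<^sub>0, \<nu>\<^sub>0)\<close> has in the equation for (\<mu>, \<nu>) a defect of
  at most M (T^2 + 1) times the parameter change, and \<open>ode_dependence\<close> converts this
  into a Lipschitz bound that is uniform on the time interval.\<close>

lemma wEO_continuous_at_aux: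
  fixes a b :: real
  defines "u \<equiv> \<lambda>\<mu> \<nu>. fst (weber \<mu> \<nu> a b)" and "u' \<equiv> \<lambda>\<mu> \<nu>. snd (weber \<mu> \<nu> a b)"
  shows "\<exists>C. \<forall>\<mu> \<nu>. \<bar>\<mu> - \<mu>\<^sub>0\<bar> \<le> 1 \<longrightarrow> \<bar>\<nu> - \<nu>\<^sub>0\<bar> \<le> 1 \<longrightarrow> (\<forall>t\<in>{0..T}.
     norm ((u \<mu> \<nu> t, u' \<mu> \<nu> t) - (u \<mu>\<^sub>0 \<nu>\<^sub>0 t, u' \<mu>\<^sub>0 \<nu>\<^sub>0 t)) \<le> C * (\<bar>\<mu> - \<mu>\<^sub>0\<bar> + \<bar>\<nu> - \<nu>\<^sub>0\<bar>))"
proof -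
  have der: "(u \<mu> \<nu> has_real_derivative u' \<mu> \<nu> t) (at t within S)"
    "(u' \<mu> \<nu> has_real_derivative (\<mu> * t\<^sup>2 - \<nu>) * u \<mu> \<nu> t) (at t within S)" for \<mu> \<nu> t S
    using weber unfolding u_def u'_def by (auto intro: has_field_derivative_at_within)
  have init: "u \<mu> \<nu> 0 = a" "u' \<mu> \<nu> 0 = b" for \<mu> \<nu> using weber unfolding u_def u'_def by auto
  have "bounded (u \<mu>\<^sub>0 \<nu>\<^sub>0 ` {0..T})"
    by (intro compact_imp_bounded compact_continuous_image) (auto intro: DERIV_continuous_on der)
  then obtain M where "\<forall>t\<in>{0..T}. \<bar>u \<mu>\<^sub>0 \<nu>\<^sub>0 t\<bar> \<le> M" by (auto simp: bounded_iff)
  then have M: "\<bar>u \<mu>\<^sub>0 \<nu>\<^sub>0 t\<bar> \<le> M" if "t \<in> {0..T}" for t using that by blast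
  define L where "L = 1 + ((\<bar>\<mu>\<^sub>0\<bar> + 1) * T\<^sup>2 + (\<bar>\<nu>\<^sub>0\<bar> + 1))"
  have L: "L \<ge> 0" by (auto simp: L_def)
  define C where "C = exp ((2 * L + 1) * T) * (1 + T) * ((T\<^sup>2 + 1) * M)"
  show ?thesis
  proof (intro exI[of _ C] allI impI ballI)
    fix \<mu> \<nu> t assume *: "\<bar>\<mu> - \<mu>\<^sub>0\<bar> \<le> 1" "\<bar>\<nu> - \<nu>\<^sub>0\<bar> \<le> 1" and t: "t \<in> {0..T}"
    let ?\<Delta> = "\<bar>\<mu> - \<mu>\<^sub>0\<bar> + \<bar>\<nu> - \<nu>\<^sub>0\<bar>"
    have M0: "M \<ge> 0" using M[OF t] by linarith
    have "norm ((u \<mu> \<nu> t, u' \<mu> \<nu> t) - (u \<mu>\<^sub>0 \<nu>\<^sub>0 t, u' \<mu>\<^sub>0 \<nu>\<^sub>0 t)) \<le> exp ((2 * L + 1) * T) * (1 + T) *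
       (norm ((u \<mu> \<nu> 0, u' \<mu> \<nu> 0) - (u \<mu>\<^sub>0 \<nu>\<^sub>0 0, u' \<mu>\<^sub>0 \<nu>\<^sub>0 0)) + (T\<^sup>2 + 1) * ?\<Delta> * M)"
    proof (rule ode_dependence[where F = "\<lambda>t y. (snd y, (\<mu> * t\<^sup>2 - \<nu>) * fst y)"
          and z' = "\<lambda>t. (u' \<mu>\<^sub>0 \<nu>\<^sub>0 t, (\<mu>\<^sub>0 * t\<^sup>2 - \<nu>\<^sub>0) * u \<mu>\<^sub>0 \<nu>\<^sub>0 t)"])
      fix s assume s: "s \<in> {0..T}"
      have s2: "s\<^sup>2 \<le> T\<^sup>2" using s by (intro power_mono) auto
      show "((\<lambda>t. (u \<mu> \<nu> t, u' \<mu> \<nu> t)) has_vector_derivative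
         (snd (u \<mu> \<nu> s, u' \<mu> \<nu> s), (\<mu> * s\<^sup>2 - \<nu>) * fst (u \<mu> \<nu> s, u' \<mu> \<nu> s))) (at s within {0..T})"
        by (simp, intro has_vector_derivative_real_Pair der)
      show "((\<lambda>t. (u \<mu>\<^sub>0 \<nu>\<^sub>0 t, u' \<mu>\<^sub>0 \<nu>\<^sub>0 t)) has_vector_derivative
         (u' \<mu>\<^sub>0 \<nu>\<^sub>0 s, (\<mu>\<^sub>0 * s\<^sup>2 - \<nu>\<^sub>0) * u \<mu>\<^sub>0 \<nu>\<^sub>0 s)) (at s within {0..T})"
        by (intro has_vector_derivative_real_Pair der)
      define p where "p = u \<mu> \<nu> s - u \<mu>\<^sub>0 \<nu>\<^sub>0 s"
      define p' where "p' = u' \<mu> \<nu> s - u' \<mu>\<^sub>0 \<nu>\<^sub>0 s"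
      have q: "\<bar>\<mu> * s\<^sup>2 - \<nu>\<bar> \<le> (\<bar>\<mu>\<^sub>0\<bar> + 1) * T\<^sup>2 + (\<bar>\<nu>\<^sub>0\<bar> + 1)"
      proof -
        have "\<bar>\<mu> * s\<^sup>2\<bar> \<le> (\<bar>\<mu>\<^sub>0\<bar> + 1) * T\<^sup>2"
          unfolding abs_mult using * s2 by (intro mult_mono) auto
        then show ?thesis using * by linarith
      qed
      have "norm (p', (\<mu> * s\<^sup>2 - \<nu>) * p) \<le> \<bar>p'\<bar> + \<bar>\<mu> * s\<^sup>2 - \<nu>\<bar> * \<bar>p\<bar>"
        using norm_Pair_le[of p' "(\<mu> * s\<^sup>2 - \<nu>) * p"] by (simp add: abs_mult)
      also have "\<dots> \<le> norm (p, p') + ((\<bar>\<mu>\<^sub>0\<bar> + 1) * T\<^sup>2 + (\<bar>\<nu>\<^sub>0\<bar> + 1)) * norm (p, p')"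
        using q norm_fst_le[of p p'] norm_snd_le[of p' p] by (intro add_mono mult_mono) auto
      finally show "norm ((snd (u \<mu> \<nu> s, u' \<mu> \<nu> s), (\<mu> * s\<^sup>2 - \<nu>) * fst (u \<mu> \<nu> s, u' \<mu> \<nu> s)) -
         (snd (u \<mu>\<^sub>0 \<nu>\<^sub>0 s, u' \<mu>\<^sub>0 \<nu>\<^sub>0 s), (\<mu> * s\<^sup>2 - \<nu>) * fst (u \<mu>\<^sub>0 \<nu>\<^sub>0 s, u' \<mu>\<^sub>0 \<nu>\<^sub>0 s)))
         \<le> L * norm ((u \<mu> \<nu> s, u' \<mu> \<nu> s) - (u \<mu>\<^sub>0 \<nu>\<^sub>0 s, u' \<mu>\<^sub>0 \<nu>\<^sub>0 s))"
        by (simp add: p_def p'_def L_def algebra_simps)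
      have "\<bar>(\<mu> - \<mu>\<^sub>0) * s\<^sup>2 - (\<nu> - \<nu>\<^sub>0)\<bar> \<le> \<bar>\<mu> - \<mu>\<^sub>0\<bar> * T\<^sup>2 + \<bar>\<nu> - \<nu>\<^sub>0\<bar>"
      proof -
        have "\<bar>(\<mu> - \<mu>\<^sub>0) * s\<^sup>2\<bar> \<le> \<bar>\<mu> - \<mu>\<^sub>0\<bar> * T\<^sup>2"
          unfolding abs_mult using s2 by (intro mult_mono) auto
        then show ?thesis by linarith
      qed
      also have "\<dots> \<le> (T\<^sup>2 + 1) * ?\<Delta>" by (simp add: algebra_simps)
      finally have "\<bar>((\<mu> - \<mu>\<^sub>0) * s\<^sup>2 - (\<nu> - \<nu>\<^sub>0)) * u \<mu>\<^sub>0 \<nu>\<^sub>0 s\<bar> \<le> (T\<^sup>2 + 1) * ?\<Delta> * M"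
        unfolding abs_mult using M[OF s] by (intro mult_mono) auto
      then show "norm ((snd (u \<mu>\<^sub>0 \<nu>\<^sub>0 s, u' \<mu>\<^sub>0 \<nu>\<^sub>0 s), (\<mu> * s\<^sup>2 - \<nu>) * fst (u \<mu>\<^sub>0 \<nu>\<^sub>0 s, u' \<mu>\<^sub>0 \<nu>\<^sub>0 s)) -
          (u' \<mu>\<^sub>0 \<nu>\<^sub>0 s, (\<mu>\<^sub>0 * s\<^sup>2 - \<nu>\<^sub>0) * u \<mu>\<^sub>0 \<nu>\<^sub>0 s)) \<le> (T\<^sup>2 + 1) * ?\<Delta> * M"
        by (simp add: algebra_simps)
    qed (use t L M0 in auto)
    then show "norm ((u \<mu> \<nu> t, u' \<mu> \<nu> t) - (u \<mu>\<^sub>0 \<nu>\<^sub>0 t, u' \<mu>\<^sub>0 \<nu>\<^sub>0 t)) \<le> C * ?\<Delta>"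
      by (simp add: init C_def mult_ac)
  qed
qed

text \<open>The Gronwall estimates are for nonnegative times, hence the absolute value of t;
  \<open>wEO_continuous\<close> recovers the other half by parity.\<close>

lemma weber_continuous:
  fixes a b :: real
  shows "continuous_on UNIV (\<lambda>(\<mu>, \<nu>, t). fst (weber \<mu> \<nu> a b) \<bar>t\<bar>)"
    "continuous_on UNIV (\<lambda>(\<mu>, \<nu>, t). snd (weber \<mu> \<nu> a b) \<bar>t\<bar>)"
proof -
  let ?u = "\<lambda>\<mu> \<nu>. fst (weber \<mu> \<nu> a b)" and ?u' = "\<lambda>\<mu> \<nu>. snd (weber \<mu> \<nu> a b)"
  have "isCont (\<lambda>(\<mu>, \<nu>, t). (?u \<mu> \<nu> \<bar>t\<bar>, ?u' \<mu> \<nu> \<bar>t\<bar>)) (\<mu>\<^sub>0, \<nu>\<^sub>0, t\<^sub>0)" for \<mu>\<^sub>0 \<nu>\<^sub>0 t\<^sub>0 :: real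
  proof -
    obtain C where C: "\<And>\<mu> \<nu> t. \<bar>\<mu> - \<mu>\<^sub>0\<bar> \<le> 1 \<Longrightarrow> \<bar>\<nu> - \<nu>\<^sub>0\<bar> \<le> 1 \<Longrightarrow> t \<in> {0..\<bar>t\<^sub>0\<bar> + 1} \<Longrightarrow>
      norm ((?u \<mu> \<nu> t, ?u' \<mu> \<nu> t) - (?u \<mu>\<^sub>0 \<nu>\<^sub>0 t, ?u' \<mu>\<^sub>0 \<nu>\<^sub>0 t)) \<le> C * (\<bar>\<mu> - \<mu>\<^sub>0\<bar> + \<bar>\<nu> - \<nu>\<^sub>0\<bar>)"
      using wEO_continuous_at_aux[of \<mu>\<^sub>0 \<nu>\<^sub>0 "\<bar>t\<^sub>0\<bar> + 1" a b] by blast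
    let ?p = "(\<mu>\<^sub>0, \<nu>\<^sub>0, t\<^sub>0)"
    have lim: "(fst \<longlongrightarrow> \<mu>\<^sub>0) (at ?p)" "((\<lambda>p. fst (snd p)) \<longlongrightarrow> \<nu>\<^sub>0) (at ?p)"
      "((\<lambda>p. snd (snd p)) \<longlongrightarrow> t\<^sub>0) (at ?p)"
      by (auto intro!: tendsto_eq_intros)
    have cu: "isCont (?u \<mu>\<^sub>0 \<nu>\<^sub>0) t" "isCont (?u' \<mu>\<^sub>0 \<nu>\<^sub>0) t" for t
      using weber by (blast intro: DERIV_isCont)+
    \<comment> \<open>Joint continuity is split: this term moves the time at the base parameters,
      the next one changes the parameters at the moving time.\<close>
    have 1: "((\<lambda>p. (?u \<mu>\<^sub>0 \<nu>\<^sub>0 \<bar>snd (snd p)\<bar>, ?u' \<mu>\<^sub>0 \<nu>\<^sub>0 \<bar>snd (snd p)\<bar>)) \<longlongrightarrow>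
       (?u \<mu>\<^sub>0 \<nu>\<^sub>0 \<bar>t\<^sub>0\<bar>, ?u' \<mu>\<^sub>0 \<nu>\<^sub>0 \<bar>t\<^sub>0\<bar>)) (at ?p)"
      by (intro tendsto_Pair isCont_tendsto_compose[OF cu(1)] isCont_tendsto_compose[OF cu(2)]
          tendsto_rabs lim)
    have 2: "((\<lambda>p. (?u (fst p) (fst (snd p)) \<bar>snd (snd p)\<bar>, ?u' (fst p) (fst (snd p)) \<bar>snd (snd p)\<bar>) -
       (?u \<mu>\<^sub>0 \<nu>\<^sub>0 \<bar>snd (snd p)\<bar>, ?u' \<mu>\<^sub>0 \<nu>\<^sub>0 \<bar>snd (snd p)\<bar>)) \<longlongrightarrow> 0) (at ?p)"
    proof (rule Lim_null_comparison)
      show "((\<lambda>p. C * (\<bar>fst p - \<mu>\<^sub>0\<bar> + \<bar>fst (snd p) - \<nu>\<^sub>0\<bar>)) \<longlongrightarrow> 0) (at ?p)"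
        by (auto intro!: tendsto_eq_intros)
      have "\<forall>\<^sub>F p in at ?p. dist (fst p) \<mu>\<^sub>0 < 1" "\<forall>\<^sub>F p in at ?p. dist (fst (snd p)) \<nu>\<^sub>0 < 1"
        "\<forall>\<^sub>F p in at ?p. dist (snd (snd p)) t\<^sub>0 < 1"
        using lim by (auto intro: tendstoD)
      then show "\<forall>\<^sub>F p in at ?p. norm ((?u (fst p) (fst (snd p)) \<bar>snd (snd p)\<bar>, ?u' (fst p) (fst (snd p)) \<bar>snd (snd p)\<bar>) -
       (?u \<mu>\<^sub>0 \<nu>\<^sub>0 \<bar>snd (snd p)\<bar>, ?u' \<mu>\<^sub>0 \<nu>\<^sub>0 \<bar>snd (snd p)\<bar>)) \<le> C * (\<bar>fst p - \<mu>\<^sub>0\<bar> + \<bar>fst (snd p) - \<nu>\<^sub>0\<bar>)"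
      proof eventually_elim
        case (elim p)
        show ?case by (rule C) (use elim in \<open>auto simp: dist_real_def\<close>)
      qed
    qed
    from tendsto_add[OF 2 1] show ?thesis
      unfolding isCont_def by (simp add: case_prod_beta' del: diff_Pair add_Pair)
  qed
  then have "continuous_on UNIV (\<lambda>p. (\<lambda>(\<mu>, \<nu>, t). (?u \<mu> \<nu> \<bar>t\<bar>, ?u' \<mu> \<nu> \<bar>t\<bar>)) p)"
    by (auto simp: continuous_on_eq_continuous_at)
  from continuous_on_fst[OF this] continuous_on_snd[OF this]
  show "continuous_on UNIV (\<lambda>(\<mu>, \<nu>, t). fst (weber \<mu> \<nu> a b) \<bar>t\<bar>)"
    "continuous_on UNIV (\<lambda>(\<mu>, \<nu>, t). snd (weber \<mu> \<nu> a b) \<bar>t\<bar>)"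
    by (simp_all add: case_prod_beta)
qed

lemma wEO_continuous [continuous_intros]:
  fixes f g k :: "'a::topological_space \<Rightarrow> real"
  assumes "continuous_on S f" "continuous_on S g" "continuous_on S k"
  shows "continuous_on S (\<lambda>x. wE (f x) (g x) (k x))" "continuous_on S (\<lambda>x. wE' (f x) (g x) (k x))"
    "continuous_on S (\<lambda>x. wO (f x) (g x) (k x))" "continuous_on S (\<lambda>x. wO' (f x) (g x) (k x))"
proof -
  have even: "continuous_on S (\<lambda>x. fst (weber (f x) (g x) a b) \<bar>k x\<bar>)"
    "continuous_on S (\<lambda>x. snd (weber (f x) (g x) a b) \<bar>k x\<bar>)"
    if "continuous_on S k" for a b and k :: "'a \<Rightarrow> real"
  proof -
    have fgk: "continuous_on S (\<lambda>x. (f x, g x, k x))" by (intro continuous_intros assms that)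
    show "continuous_on S (\<lambda>x. fst (weber (f x) (g x) a b) \<bar>k x\<bar>)"
      "continuous_on S (\<lambda>x. snd (weber (f x) (g x) a b) \<bar>k x\<bar>)"
      using continuous_on_compose2[OF weber_continuous(1) fgk, of a b]
        continuous_on_compose2[OF weber_continuous(2) fgk, of a b] by auto
  qed
  have "wE (f x) (g x) \<bar>k x\<bar> = wE (f x) (g x) (k x)" for x
    using wEO_parity(1)[of "f x" "g x" "k x"] by (cases "k x \<ge> 0") auto
  with even(1)[OF assms(3), of 1 0] show "continuous_on S (\<lambda>x. wE (f x) (g x) (k x))"
    unfolding wE_def[symmetric] by (simp only:)
  have "wO' (f x) (g x) \<bar>k x\<bar> = wO' (f x) (g x) (k x)" for x
    using wEO_parity(4)[of "f x" "g x" "k x"] by (cases "k x \<ge> 0") auto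
  with even(2)[OF assms(3), of 0 1] show "continuous_on S (\<lambda>x. wO' (f x) (g x) (k x))"
    unfolding wO'_def[symmetric] by (simp only:)
  have odd: "continuous_on S (\<lambda>x. F (f x) (g x) (k x))"
    if F: "\<And>\<mu> \<nu> t. F \<mu> \<nu> (- t) = - F \<mu> \<nu> t"
      and c: "\<And>k. continuous_on S k \<Longrightarrow> continuous_on S (\<lambda>x. F (f x) (g x) \<bar>k x\<bar>)"
    for F :: "real \<Rightarrow> real \<Rightarrow> real \<Rightarrow> real"
  proof -
    have F0: "F \<mu> \<nu> 0 = 0" for \<mu> \<nu> using F[of \<mu> \<nu> 0] by simp
    \<comment> \<open>An odd F vanishes at 0, so F(k) = F(max k 0) - F(max (-k) 0), where both
      arguments are nonnegative.\<close>
    have "continuous_on S (\<lambda>x. F (f x) (g x) \<bar>max (k x) 0\<bar> - F (f x) (g x) \<bar>max (- k x) 0\<bar>)"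
      by (intro continuous_intros c assms)
    moreover have "F (f x) (g x) \<bar>max (k x) 0\<bar> - F (f x) (g x) \<bar>max (- k x) 0\<bar> = F (f x) (g x) (k x)" for x
      using F F0 by (auto simp: max_def abs_if)
    ultimately show ?thesis by simp
  qed
  show "continuous_on S (\<lambda>x. wE' (f x) (g x) (k x))"
    by (rule odd) (rule wEO_parity(2), simp only: wE'_def even(2))
  show "continuous_on S (\<lambda>x. wO (f x) (g x) (k x))"
    by (rule odd) (rule wEO_parity(3), simp only: wO_def even(1))
qed



subsection \<open>Sturm comparison\<close>

lemma nondecreasing_at:
  fixes f :: "real \<Rightarrow> real"
  assumes "a \<le> b" "\<And>x. x \<in> {a..b} \<Longrightarrow> (f has_real_derivative f' x) (at x)"
    and "\<And>x. x \<in> {a<..<b} \<Longrightarrow> f' x \<ge> 0"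
  shows "f a \<le> f b"
  using nondecreasing_within[OF assms(1), of f f'] assms(2,3)
  by (auto intro: has_field_derivative_at_within)

lemma increasing_at:
  fixes f :: "real \<Rightarrow> real"
  assumes "a < b" "\<And>x. x \<in> {a..b} \<Longrightarrow> (f has_real_derivative f' x) (at x)"
    and "\<And>x. x \<in> {a<..<b} \<Longrightarrow> f' x > 0"
  shows "f a < f b"
  using increasing_within[OF assms(1), of f f'] assms(2,3)
  by (auto intro: has_field_derivative_at_within)

text \<open>W = u' v - u v' has derivative (q1 - q2) u v, and u / v has derivative W / v^2. Before
  the first point where u <= 0 both derivatives are nonnegative, so u / v stays above its positive
  initial value and that point cannot exist.\<close>

lemma sturm_comparison:
  fixes u u' v v' q1 q2 :: "real \<Rightarrow> real"
  assumes u: "\<And>y. y \<in> {0..T} \<Longrightarrow> (u has_real_derivative u' y) (at y)"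
      "\<And>y. y \<in> {0..T} \<Longrightarrow> (u' has_real_derivative q1 y * u y) (at y)"
    and v: "\<And>y. y \<in> {0..T} \<Longrightarrow> (v has_real_derivative v' y) (at y)"
      "\<And>y. y \<in> {0..T} \<Longrightarrow> (v' has_real_derivative q2 y * v y) (at y)"
    and vpos: "\<And>y. y \<in> {0..T} \<Longrightarrow> v y > 0"
    and q: "\<And>y. y \<in> {0..T} \<Longrightarrow> q2 y \<le> q1 y"
    and init: "u 0 > 0" "u 0 * v' 0 \<le> u' 0 * v 0"
    and y: "y \<in> {0..T}"
  shows "u y > 0 \<and> u y * v' y \<le> u' y * v y"
proof -
  define W where "W r = u' r * v r - u r * v' r" for r
  have W: "(W has_real_derivative (q1 r - q2 r) * (u r * v r)) (at r)" if "r \<in> {0..T}" for r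
    unfolding W_def using that by (auto intro!: derivative_eq_intros u v simp: algebra_simps)
  have Wpos: "W r \<ge> 0" if r: "r \<in> {0..T}" and "\<And>s. 0 < s \<Longrightarrow> s < r \<Longrightarrow> u s > 0" for r
  proof -
    have "W 0 \<le> W r"
    proof (rule nondecreasing_at[where f = W and f' = "\<lambda>r. (q1 r - q2 r) * (u r * v r)"])
      fix x assume x: "x \<in> {0<..<r}"
      then show "0 \<le> (q1 x - q2 x) * (u x * v x)"
        using q[of x] vpos[of x] that(2)[of x] r by (intro mult_nonneg_nonneg) auto
    qed (use r in \<open>auto intro!: W\<close>)
    then show ?thesis using init by (simp add: W_def)
  qed
  have upos: "u r > 0" if "r \<in> {0..T}" for r
  proof (rule ccontr)
    assume "\<not> u r > 0"
    have contu: "continuous_on {0..T} u"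
      using u(1) by (meson DERIV_atLeastAtMost_imp_continuous_on atLeastAtMost_iff)
    define S where "S = {x \<in> {0..T}. u x \<le> 0}"
    have "closed S" unfolding S_def
      by (intro continuous_on_closed_Collect_le contu continuous_intros closed_atLeastAtMost)
    moreover have "S \<noteq> {}" using \<open>\<not> u r > 0\<close> that by (auto simp: S_def)
    moreover have bdd: "bdd_below S" by (auto simp: S_def)
    ultimately have s: "Inf S \<in> S" by (intro closed_contains_Inf)
    define s where "s = Inf S"
    have sT: "s \<in> {0..T}" "u s \<le> 0" using s by (auto simp: s_def S_def)
    have before: "u x > 0" if "0 \<le> x" "x < s" for x
    proof (rule ccontr)
      assume "\<not> u x > 0"
      then have "x \<in> S" using that sT by (auto simp: S_def)
      then have "s \<le> x" unfolding s_def by (rule cInf_lower[OF _ bdd])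
      with that show False by simp
    qed
    have "u 0 / v 0 \<le> u s / v s"
    proof (rule nondecreasing_at[where f = "\<lambda>r. u r / v r" and f' = "\<lambda>r. W r / (v r)\<^sup>2"])
      fix x assume "x \<in> {0..s}"
      then have x: "x \<in> {0..T}" using sT by auto
      show "((\<lambda>r. u r / v r) has_real_derivative W x / (v x)\<^sup>2) (at x)"
        using vpos[OF x] unfolding W_def
        by (auto intro!: derivative_eq_intros u(1)[OF x] v(1)[OF x] simp: power2_eq_square)
    next
      fix x assume "x \<in> {0<..<s}"
      then show "0 \<le> W x / (v x)\<^sup>2" using sT before by (intro divide_nonneg_nonneg Wpos) auto
    qed (use sT in auto)
    moreover have "u 0 / v 0 > 0" using init vpos[of 0] sT by auto
    ultimately have "u s / v s > 0" by linarith
    then show False using sT vpos[of s] by (simp add: zero_less_divide_iff)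
  qed
  with Wpos[OF y] y show ?thesis by (auto simp: W_def)
qed

text \<open>The explicit comparison functions. \<open>exp (m * y\<^sup>2 / 2)\<close> has the
  potential m^2 y^2 + m, and y times it the potential m^2 y^2 + 3 m. With -m for m the potentials
  are m^2 y^2 - m and m^2 y^2 - 3 m.\<close>

lemma gauss_derivs:
  fixes m y :: real
  shows "((\<lambda>y. exp (m * y\<^sup>2 / 2)) has_real_derivative m * y * exp (m * y\<^sup>2 / 2)) (at y)"
    "((\<lambda>y. m * y * exp (m * y\<^sup>2 / 2)) has_real_derivative (m\<^sup>2 * y\<^sup>2 + m) * exp (m * y\<^sup>2 / 2)) (at y)"
    "((\<lambda>y. y * exp (m * y\<^sup>2 / 2)) has_real_derivative (1 + m * y\<^sup>2) * exp (m * y\<^sup>2 / 2)) (at y)"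
    "((\<lambda>y. (1 + m * y\<^sup>2) * exp (m * y\<^sup>2 / 2)) has_real_derivative
        (m\<^sup>2 * y\<^sup>2 + 3 * m) * (y * exp (m * y\<^sup>2 / 2))) (at y)"
  by (auto intro!: derivative_eq_intros simp: power2_eq_square algebra_simps)

text \<open>From here on \<mu> = m^2. For \<nu> <= m the potential lies above that of the decaying
  Gaussian, which never vanishes, so Sturm comparison applies with both slopes zero at the
  origin.\<close>

lemma wE_pos:
  assumes m: "0 < \<nu>" "\<nu> \<le> m"
  shows "wE (m\<^sup>2) \<nu> y > 0"
proof -
  have "wE (m\<^sup>2) \<nu> \<bar>y\<bar> > 0 \<and> wE (m\<^sup>2) \<nu> \<bar>y\<bar> * (- m * \<bar>y\<bar> * exp (- m * \<bar>y\<bar>\<^sup>2 / 2))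
      \<le> wE' (m\<^sup>2) \<nu> \<bar>y\<bar> * exp (- m * \<bar>y\<bar>\<^sup>2 / 2)"
  proof (rule sturm_comparison[where u = "wE (m\<^sup>2) \<nu>" and u' = "wE' (m\<^sup>2) \<nu>" and v = "\<lambda>y. exp (- m * y\<^sup>2 / 2)"
        and v' = "\<lambda>y. - m * y * exp (- m * y\<^sup>2 / 2)" and T = "\<bar>y\<bar>"
        and ?q1.0 = "\<lambda>y. m\<^sup>2 * y\<^sup>2 - \<nu>" and ?q2.0 = "\<lambda>y. m\<^sup>2 * y\<^sup>2 - m"])
    show "((\<lambda>y. - m * y * exp (- m * y\<^sup>2 / 2)) has_real_derivative
        (m\<^sup>2 * x\<^sup>2 - m) * exp (- m * x\<^sup>2 / 2)) (at x)" for x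
      using gauss_derivs(2)[of "- m" x] by simp
  qed (use m gauss_derivs(1)[of "- m"] in \<open>auto intro!: wEO_derivs\<close>)
  then show ?thesis using wEO_parity(1)[of "m\<^sup>2" \<nu> y] by (cases "y \<ge> 0") auto
qed

text \<open>Reduction of order: by the Wronskian identity \<open>wO / wE\<close> has derivative
  \<open>1 / wE\<^sup>2\<close>.\<close>

lemma wO_pos:
  assumes m: "0 < \<nu>" "\<nu> \<le> m" and "y > 0"
  shows "wO (m\<^sup>2) \<nu> y > 0"
proof -
  have E: "wE (m\<^sup>2) \<nu> x > 0" for x by (rule wE_pos[OF m])
  have "wO (m\<^sup>2) \<nu> 0 / wE (m\<^sup>2) \<nu> 0 < wO (m\<^sup>2) \<nu> y / wE (m\<^sup>2) \<nu> y"
  proof (rule increasing_at[where f = "\<lambda>y. wO (m\<^sup>2) \<nu> y / wE (m\<^sup>2) \<nu> y" and f' = "\<lambda>y. 1 / (wE (m\<^sup>2) \<nu> y)\<^sup>2"])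
    fix x
    show "((\<lambda>y. wO (m\<^sup>2) \<nu> y / wE (m\<^sup>2) \<nu> y) has_real_derivative 1 / (wE (m\<^sup>2) \<nu> x)\<^sup>2) (at x)"
      using E[of x] wEO_wronskian[of "m\<^sup>2" \<nu> x]
      by (auto intro!: derivative_eq_intros simp: power2_eq_square algebra_simps)
    show "1 / (wE (m\<^sup>2) \<nu> x)\<^sup>2 > 0" using E[of x] by simp
  qed fact
  then show ?thesis using E[of y] by (simp add: zero_less_divide_iff)
qed

lemma wO_nonneg: "0 < \<nu> \<Longrightarrow> \<nu> \<le> m \<Longrightarrow> y \<ge> 0 \<Longrightarrow> wO (m\<^sup>2) \<nu> y \<ge> 0"
  using wO_pos[of \<nu> m y] by (cases "y = 0") auto

text \<open>Wronskian with z = y exp (-m y^2 / 2), whose logarithmic derivative is (1 - m y^2) / y.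
  The potential of z is lower by 3 m - \<nu> > 0, so the Wronskian increases from 0.\<close>

lemma wO_lower:
  assumes m: "0 < \<nu>" "\<nu> \<le> m" and "y > 0"
  shows "(1 - m * y\<^sup>2) * wO (m\<^sup>2) \<nu> y < y * wO' (m\<^sup>2) \<nu> y"
proof -
  define g where "g y = exp (- m * y\<^sup>2 / 2)" for y
  define z where "z y = y * g y" for y
  define z' where "z' y = (1 - m * y\<^sup>2) * g y" for y
  have g: "g x > 0" for x by (simp add: g_def)
  have z: "(z has_real_derivative z' x) (at x)" "(z' has_real_derivative (m\<^sup>2 * x\<^sup>2 - 3 * m) * z x) (at x)" for x
    using gauss_derivs(3,4)[of "- m" x] by (simp_all add: z_def[abs_def] z'_def[abs_def] g_def)
  have "wO' (m\<^sup>2) \<nu> 0 * z 0 - wO (m\<^sup>2) \<nu> 0 * z' 0 < wO' (m\<^sup>2) \<nu> y * z y - wO (m\<^sup>2) \<nu> y * z' y"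
  proof (rule increasing_at[where f = "\<lambda>y. wO' (m\<^sup>2) \<nu> y * z y - wO (m\<^sup>2) \<nu> y * z' y"
        and f' = "\<lambda>y. (3 * m - \<nu>) * (wO (m\<^sup>2) \<nu> y * z y)"])
    fix x
    show "((\<lambda>y. wO' (m\<^sup>2) \<nu> y * z y - wO (m\<^sup>2) \<nu> y * z' y) has_real_derivative
        (3 * m - \<nu>) * (wO (m\<^sup>2) \<nu> x * z x)) (at x)"
      by (auto intro!: derivative_eq_intros z simp: algebra_simps)
    assume "x \<in> {0<..<y}"
    then show "(3 * m - \<nu>) * (wO (m\<^sup>2) \<nu> x * z x) > 0"
      using m wO_pos[OF m, of x] g[of x] by (simp add: z_def)
  qed fact
  then have "((1 - m * y\<^sup>2) * wO (m\<^sup>2) \<nu> y) * g y < (y * wO' (m\<^sup>2) \<nu> y) * g y"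
    by (simp add: z_def z'_def algebra_simps)
  then show ?thesis using g[of y] by (simp only: mult_less_cancel_right_pos)
qed

text \<open>Counterpart of \<open>wO_lower\<close> with the growing function y exp (m y^2 / 2),
  whose logarithmic derivative is (1 + m y^2) / y and whose potential is higher by 3 m +
  \<nu>.\<close>

lemma wO_upper:
  assumes m: "0 < \<nu>" "\<nu> \<le> m" and "y \<ge> 0"
  shows "y * wO' (m\<^sup>2) \<nu> y \<le> (1 + m * y\<^sup>2) * wO (m\<^sup>2) \<nu> y"
proof -
  define g where "g y = exp (m * y\<^sup>2 / 2)" for y
  define z where "z y = y * g y" for y
  define z' where "z' y = (1 + m * y\<^sup>2) * g y" for y
  have g: "g x > 0" for x by (simp add: g_def)
  have z: "(z has_real_derivative z' x) (at x)" "(z' has_real_derivative (m\<^sup>2 * x\<^sup>2 + 3 * m) * z x) (at x)" for x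
    using gauss_derivs(3,4)[of m x] by (simp_all add: z_def[abs_def] z'_def[abs_def] g_def)
  have "wO (m\<^sup>2) \<nu> 0 * z' 0 - wO' (m\<^sup>2) \<nu> 0 * z 0 \<le> wO (m\<^sup>2) \<nu> y * z' y - wO' (m\<^sup>2) \<nu> y * z y"
  proof (rule nondecreasing_at[where f = "\<lambda>y. wO (m\<^sup>2) \<nu> y * z' y - wO' (m\<^sup>2) \<nu> y * z y"
        and f' = "\<lambda>y. (3 * m + \<nu>) * (wO (m\<^sup>2) \<nu> y * z y)"])
    fix x
    show "((\<lambda>y. wO (m\<^sup>2) \<nu> y * z' y - wO' (m\<^sup>2) \<nu> y * z y) has_real_derivative
        (3 * m + \<nu>) * (wO (m\<^sup>2) \<nu> x * z x)) (at x)"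
      by (auto intro!: derivative_eq_intros z simp: algebra_simps)
    assume "x \<in> {0<..<y}"
    then show "(3 * m + \<nu>) * (wO (m\<^sup>2) \<nu> x * z x) \<ge> 0"
      using m wO_pos[OF m, of x] g[of x] by (simp add: z_def)
  qed fact
  then have "(y * wO' (m\<^sup>2) \<nu> y) * g y \<le> ((1 + m * y\<^sup>2) * wO (m\<^sup>2) \<nu> y) * g y"
    by (simp add: z_def z'_def algebra_simps)
  then show ?thesis using g[of y] by (simp only: mult_le_cancel_right_pos)
qed

text \<open>Up to y = 1 / sqrt m the slope is positive by \<open>wO_lower\<close>. Beyond, the
  potential is at least m - \<nu> >= 0 and the slope does not decrease. The quotients by
  \<open>wO'\<close> below are therefore defined on the whole line.\<close>

lemma wO'_pos:
  assumes m: "0 < \<nu>" "\<nu> \<le> m"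
  shows "wO' (m\<^sup>2) \<nu> y > 0"
proof -
  have small: "wO' (m\<^sup>2) \<nu> x > 0" if x: "x > 0" "m * x\<^sup>2 \<le> 1" for x
  proof -
    have "0 \<le> (1 - m * x\<^sup>2) * wO (m\<^sup>2) \<nu> x" using wO_pos[OF m x(1)] x(2) by simp
    also have "\<dots> < x * wO' (m\<^sup>2) \<nu> x" by (rule wO_lower[OF m x(1)])
    finally show ?thesis using x(1) by (simp add: zero_less_mult_iff)
  qed
  have pos: "wO' (m\<^sup>2) \<nu> x > 0" if x: "x \<ge> 0" for x
  proof (cases "m * x\<^sup>2 \<le> 1")
    case True then show ?thesis using small[of x] x by (cases "x = 0") auto
  next
    case False
    define b where "b = 1 / sqrt m"
    have b: "b > 0" "m * b\<^sup>2 = 1" using m by (auto simp: b_def power_divide)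
    have "b\<^sup>2 < x\<^sup>2" using False b m by (metis leI mult_left_mono order_trans linorder_not_less mult_less_cancel_left_pos order_less_le_trans)
    then have "b \<le> x" using x b by (meson less_imp_le power2_less_imp_less)
    have "wO' (m\<^sup>2) \<nu> b \<le> wO' (m\<^sup>2) \<nu> x"
    proof (rule nondecreasing_at[OF \<open>b \<le> x\<close>, where f' = "\<lambda>y. (m\<^sup>2 * y\<^sup>2 - \<nu>) * wO (m\<^sup>2) \<nu> y"])
      fix y assume "y \<in> {b<..<x}"
      then have y: "y > 0" "b\<^sup>2 \<le> y\<^sup>2" using b by (auto intro!: power_mono)
      have "m * (m * b\<^sup>2) \<le> m * (m * y\<^sup>2)" using y m by (intro mult_left_mono) auto
      then have "m \<le> m * (m * y\<^sup>2)" using b by simp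
      then have "\<nu> \<le> m * (m * y\<^sup>2)" using m(2) by linarith
      then have "m\<^sup>2 * y\<^sup>2 \<ge> \<nu>" by (simp add: power2_eq_square mult.assoc)
      then show "0 \<le> (m\<^sup>2 * y\<^sup>2 - \<nu>) * wO (m\<^sup>2) \<nu> y" using wO_pos[OF m y(1)] by simp
    qed (rule wEO_derivs)
    with small[of b] b show ?thesis by simp
  qed
  show ?thesis using pos[of "\<bar>y\<bar>"] wEO_parity(4)[of "m\<^sup>2" \<nu> y] by (cases "y \<ge> 0") auto
qed

text \<open>A combination of \<open>wE\<close> and \<open>wO\<close> with zero slope at -L and at R
  exists exactly if \<open>wRho L + wRho R = 0\<close>, because \<open>wE'\<close> is odd and
  \<open>wO'\<close> is even.\<close>

definition wRho where "wRho \<mu> \<nu> y = wE' \<mu> \<nu> y / wO' \<mu> \<nu> y"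
text \<open>At once the derivative of \<open>wRho\<close> and the boundary term of the energy
  identity: for a Neumann solution u on [-L, R] the integral of y u^2 is a positive multiple of
  \<open>wPhi R - wPhi L\<close>, see \<open>I_fun_critical\<close>.\<close>

definition wPhi where "wPhi \<mu> \<nu> y = (\<mu> * y\<^sup>2 - \<nu>) / (wO' \<mu> \<nu> y)\<^sup>2"
text \<open>Numerator of the derivative of \<open>wPhi\<close>, up to the factor 2. Its sign at d
  decides whether the symmetric pair L = R = d is isolated to first order.\<close>

definition wN where "wN \<mu> \<nu> y = \<mu> * y * wO' \<mu> \<nu> y - (\<mu> * y\<^sup>2 - \<nu>)\<^sup>2 * wO \<mu> \<nu> y"

lemma wRho_deriv:
  assumes "wO' \<mu> \<nu> y \<noteq> 0"
  shows "(wRho \<mu> \<nu> has_real_derivative wPhi \<mu> \<nu> y) (at y)"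
proof -
  have "((\<mu> * y\<^sup>2 - \<nu>) * wE \<mu> \<nu> y) * wO' \<mu> \<nu> y - wE' \<mu> \<nu> y * ((\<mu> * y\<^sup>2 - \<nu>) * wO \<mu> \<nu> y)
      = (\<mu> * y\<^sup>2 - \<nu>) * (wE \<mu> \<nu> y * wO' \<mu> \<nu> y - wE' \<mu> \<nu> y * wO \<mu> \<nu> y)"
    by (simp add: algebra_simps)
  then show ?thesis
    using assms unfolding wRho_def[abs_def] wPhi_def
    by (auto intro!: derivative_eq_intros simp: wEO_wronskian power2_eq_square)
qed

lemma wPhi_deriv:
  assumes "wO' \<mu> \<nu> y \<noteq> 0"
  shows "(wPhi \<mu> \<nu> has_real_derivative 2 * wN \<mu> \<nu> y / (wO' \<mu> \<nu> y) ^ 3) (at y)"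
  using assms unfolding wPhi_def[abs_def] wN_def
  by (auto intro!: derivative_eq_intros simp: field_simps power2_eq_square power3_eq_cube)

subsection \<open>The even Neumann solution\<close>

text \<open>Starting from 0 the slope falls while the potential is negative and rises afterwards. On
  the rising part it is bounded by its value at d.\<close>

lemma wE_decreasing:
  assumes m: "0 < \<nu>" "\<nu> \<le> m" and d: "wE' (m\<^sup>2) \<nu> d \<le> 0" and y: "0 \<le> y" "y \<le> d"
  shows "wE' (m\<^sup>2) \<nu> y \<le> 0"
proof (cases "m\<^sup>2 * y\<^sup>2 \<le> \<nu>")
  case True
  have "- wE' (m\<^sup>2) \<nu> 0 \<le> - wE' (m\<^sup>2) \<nu> y"
  proof (rule nondecreasing_at[where f = "\<lambda>y. - wE' (m\<^sup>2) \<nu> y" and f' = "\<lambda>y. - ((m\<^sup>2 * y\<^sup>2 - \<nu>) * wE (m\<^sup>2) \<nu> y)"])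
    fix x assume "x \<in> {0<..<y}"
    then have "x\<^sup>2 \<le> y\<^sup>2" by (intro power_mono) auto
    then have "m\<^sup>2 * x\<^sup>2 \<le> m\<^sup>2 * y\<^sup>2" by (intro mult_left_mono) auto
    then have "m\<^sup>2 * x\<^sup>2 - \<nu> \<le> 0" using True by linarith
    then show "0 \<le> - ((m\<^sup>2 * x\<^sup>2 - \<nu>) * wE (m\<^sup>2) \<nu> x)"
      using wE_pos[OF m, of x] by (simp add: mult_le_0_iff)
  qed (use y in \<open>auto intro!: DERIV_minus wEO_derivs\<close>)
  then show ?thesis by simp
next
  case False
  have "wE' (m\<^sup>2) \<nu> y \<le> wE' (m\<^sup>2) \<nu> d"
  proof (rule nondecreasing_at[OF y(2), where f' = "\<lambda>y. (m\<^sup>2 * y\<^sup>2 - \<nu>) * wE (m\<^sup>2) \<nu> y"])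
    fix x assume "x \<in> {y<..<d}"
    then have "y\<^sup>2 \<le> x\<^sup>2" using y by (intro power_mono) auto
    then have "m\<^sup>2 * y\<^sup>2 \<le> m\<^sup>2 * x\<^sup>2" by (intro mult_left_mono) auto
    then have "m\<^sup>2 * x\<^sup>2 - \<nu> \<ge> 0" using False by linarith
    then show "0 \<le> (m\<^sup>2 * x\<^sup>2 - \<nu>) * wE (m\<^sup>2) \<nu> x" using wE_pos[OF m, of x] by simp
  qed (rule wEO_derivs)
  with d show ?thesis by simp
qed

lemma wE_antimono:
  assumes m: "0 < \<nu>" "\<nu> \<le> m" and d: "wE' (m\<^sup>2) \<nu> d \<le> 0" and y: "0 \<le> x" "x \<le> y" "y \<le> d"
  shows "wE (m\<^sup>2) \<nu> y \<le> wE (m\<^sup>2) \<nu> x"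
proof -
  have "- wE (m\<^sup>2) \<nu> x \<le> - wE (m\<^sup>2) \<nu> y"
    using wE_decreasing[OF m d] y
    by (intro nondecreasing_at[where f = "\<lambda>y. - wE (m\<^sup>2) \<nu> y" and f' = "\<lambda>y. - wE' (m\<^sup>2) \<nu> y"])
      (auto intro!: DERIV_minus wEO_derivs)
  then show ?thesis by simp
qed

lemma wE_le_one:
  assumes "0 < \<nu>" "\<nu> \<le> m" "wE' (m\<^sup>2) \<nu> d \<le> 0" "0 \<le> y" "y \<le> d"
  shows "wE (m\<^sup>2) \<nu> y \<le> 1"
  using wE_antimono[OF assms(1-3), of 0 y] assms by simp

text \<open>If the potential were nonpositive up to d, the slope would decrease strictly from 0 and
  be negative at d.\<close>

lemma wE_neumann_potential_pos:
  assumes m: "0 < \<nu>" "\<nu> \<le> m" and d: "wE' (m\<^sup>2) \<nu> d \<ge> 0" "d > 0"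
  shows "m\<^sup>2 * d\<^sup>2 > \<nu>"
proof (rule ccontr)
  assume *: "\<not> m\<^sup>2 * d\<^sup>2 > \<nu>"
  have "- wE' (m\<^sup>2) \<nu> 0 < - wE' (m\<^sup>2) \<nu> d"
  proof (rule increasing_at[where f = "\<lambda>y. - wE' (m\<^sup>2) \<nu> y" and f' = "\<lambda>y. - ((m\<^sup>2 * y\<^sup>2 - \<nu>) * wE (m\<^sup>2) \<nu> y)"])
    fix x assume "x \<in> {0<..<d}"
    then have "x\<^sup>2 < d\<^sup>2" by (intro power_strict_mono) auto
    then have "m\<^sup>2 * x\<^sup>2 < m\<^sup>2 * d\<^sup>2" using m by (intro mult_strict_left_mono) auto
    then have "m\<^sup>2 * x\<^sup>2 - \<nu> < 0" using * by linarith
    then show "0 < - ((m\<^sup>2 * x\<^sup>2 - \<nu>) * wE (m\<^sup>2) \<nu> x)"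
      using wE_pos[OF m, of x] by (simp add: mult_less_0_iff)
  qed (use d in \<open>auto intro!: DERIV_minus wEO_derivs\<close>)
  with d show False by simp
qed

text \<open>An explicit restriction on m: with wE between b and 1 on [0, d], integrating wE'' >= b
  m^2 y^2 - \<nu> twice controlled gives b m^2 d^2 <= 3 \<nu>. It shows that the slope is positive
  for large m, and it bounds m d from above when \<kappa> d is small.\<close>

lemma wE_neumann_bound:
  assumes m: "0 < \<nu>" "\<nu> \<le> m" and d: "wE' (m\<^sup>2) \<nu> d \<le> 0" "d > 0"
  shows "m\<^sup>2 * d\<^sup>2 * (1 - \<nu> * (sqrt \<nu> / m) * d) \<le> 3 * \<nu>"
proof -
  \<comment> \<open>The turning point, where the potential changes sign; the slope of wE attains its
    minimum there.\<close>
  define y1 where "y1 = sqrt \<nu> / m"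
  have y1: "y1 > 0" "m\<^sup>2 * y1\<^sup>2 = \<nu>" using m by (auto simp: y1_def power_divide)
  have le1: "wE (m\<^sup>2) \<nu> x \<le> 1" if "0 \<le> x" "x \<le> d" for x by (rule wE_le_one[OF m d(1) that])
  have low: "wE' (m\<^sup>2) \<nu> x \<ge> - \<nu> * x" if "0 \<le> x" "x \<le> d" for x
  proof -
    have "wE' (m\<^sup>2) \<nu> 0 + \<nu> * 0 \<le> wE' (m\<^sup>2) \<nu> x + \<nu> * x"
    proof (rule nondecreasing_at[where f = "\<lambda>x. wE' (m\<^sup>2) \<nu> x + \<nu> * x" and f' = "\<lambda>y. (m\<^sup>2 * y\<^sup>2 - \<nu>) * wE (m\<^sup>2) \<nu> y + \<nu>"])
      fix y assume y: "y \<in> {0<..<x}"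
      have "\<nu> * wE (m\<^sup>2) \<nu> y \<le> \<nu> * 1" using le1[of y] y that m by (intro mult_left_mono) auto
      moreover have "m\<^sup>2 * y\<^sup>2 * wE (m\<^sup>2) \<nu> y \<ge> 0" using wE_pos[OF m, of y] by simp
      ultimately show "0 \<le> (m\<^sup>2 * y\<^sup>2 - \<nu>) * wE (m\<^sup>2) \<nu> y + \<nu>" by (simp add: algebra_simps)
    qed (use that in \<open>auto intro!: derivative_eq_intros\<close>)
    then show ?thesis by simp
  qed
  have low1: "wE' (m\<^sup>2) \<nu> x \<ge> - \<nu> * y1" if x: "0 \<le> x" "x \<le> d" for x
  proof (cases "x \<le> y1")
    case True
    then have "\<nu> * x \<le> \<nu> * y1" using m by simp
    then show ?thesis using low[OF x] by simp
  next
    case False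
    have "wE' (m\<^sup>2) \<nu> y1 \<le> wE' (m\<^sup>2) \<nu> x"
    proof (rule nondecreasing_at[where f = "wE' (m\<^sup>2) \<nu>" and f' = "\<lambda>y. (m\<^sup>2 * y\<^sup>2 - \<nu>) * wE (m\<^sup>2) \<nu> y"])
      fix y assume "y \<in> {y1<..<x}"
      then have "y1\<^sup>2 \<le> y\<^sup>2" using y1 by (intro power_mono) auto
      then have "m\<^sup>2 * y1\<^sup>2 \<le> m\<^sup>2 * y\<^sup>2" by (intro mult_left_mono) auto
      then show "0 \<le> (m\<^sup>2 * y\<^sup>2 - \<nu>) * wE (m\<^sup>2) \<nu> y" using wE_pos[OF m, of y] y1 by simp
    qed (use False in \<open>auto intro!: wEO_derivs\<close>)
    then show ?thesis using low[of y1] y1 x False by simp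
  qed
  define b where "b = 1 - \<nu> * y1 * d"
  have lowE: "wE (m\<^sup>2) \<nu> x \<ge> b" if x: "0 \<le> x" "x \<le> d" for x
  proof -
    have "wE (m\<^sup>2) \<nu> 0 + \<nu> * y1 * 0 \<le> wE (m\<^sup>2) \<nu> x + \<nu> * y1 * x"
    proof (rule nondecreasing_at[where f = "\<lambda>x. wE (m\<^sup>2) \<nu> x + \<nu> * y1 * x" and f' = "\<lambda>y. wE' (m\<^sup>2) \<nu> y + \<nu> * y1"])
      fix y assume y: "y \<in> {0<..<x}"
      then show "0 \<le> wE' (m\<^sup>2) \<nu> y + \<nu> * y1" using low1[of y] x by simp
    qed (use that in \<open>auto intro!: derivative_eq_intros\<close>)
    moreover have "\<nu> * y1 * x \<le> \<nu> * y1 * d" using x m y1 by (intro mult_left_mono) auto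
    ultimately show ?thesis by (simp add: b_def)
  qed
  have "wE' (m\<^sup>2) \<nu> 0 + \<nu> * 0 - b * m\<^sup>2 * 0 ^ 3 / 3 \<le> wE' (m\<^sup>2) \<nu> d + \<nu> * d - b * m\<^sup>2 * d ^ 3 / 3"
  proof (rule nondecreasing_at[where f = "\<lambda>x. wE' (m\<^sup>2) \<nu> x + \<nu> * x - b * m\<^sup>2 * x ^ 3 / 3"
        and f' = "\<lambda>y. (m\<^sup>2 * y\<^sup>2 - \<nu>) * wE (m\<^sup>2) \<nu> y + \<nu> - b * m\<^sup>2 * y\<^sup>2"])
    fix y assume y: "y \<in> {0<..<d}"
    have "\<nu> * wE (m\<^sup>2) \<nu> y \<le> \<nu> * 1" using le1[of y] y m by (intro mult_left_mono) auto
    moreover have "m\<^sup>2 * y\<^sup>2 * b \<le> m\<^sup>2 * y\<^sup>2 * wE (m\<^sup>2) \<nu> y"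
      using lowE[of y] y by (intro mult_left_mono) auto
    ultimately show "0 \<le> (m\<^sup>2 * y\<^sup>2 - \<nu>) * wE (m\<^sup>2) \<nu> y + \<nu> - b * m\<^sup>2 * y\<^sup>2" by (simp add: algebra_simps)
  qed (use d in \<open>auto intro!: derivative_eq_intros simp: power2_eq_square\<close>)
  with d have "b * m\<^sup>2 * d ^ 3 \<le> 3 * \<nu> * d" by simp
  then have "(m\<^sup>2 * d\<^sup>2 * b) * d \<le> (3 * \<nu>) * d" by (simp add: power2_eq_square power3_eq_cube mult_ac)
  then show ?thesis using d by (simp add: b_def y1_def)
qed

text \<open>At m = \<nu> the even solution is the Gaussian itself. Its slope is negative for y > 0,
  which is the left end of the intermediate value argument in
  \<open>wE_neumann_exists\<close>.\<close>

lemma wE_gauss: "wE (\<nu>\<^sup>2) \<nu> y = exp (- \<nu> * y\<^sup>2 / 2)" "wE' (\<nu>\<^sup>2) \<nu> y = - \<nu> * y * exp (- \<nu> * y\<^sup>2 / 2)"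
proof -
  have "exp (- \<nu> * y\<^sup>2 / 2) = exp (- \<nu> * 0\<^sup>2 / 2) * wE (\<nu>\<^sup>2) \<nu> y + (- \<nu> * 0 * exp (- \<nu> * 0\<^sup>2 / 2)) * wO (\<nu>\<^sup>2) \<nu> y
    \<and> - \<nu> * y * exp (- \<nu> * y\<^sup>2 / 2) = exp (- \<nu> * 0\<^sup>2 / 2) * wE' (\<nu>\<^sup>2) \<nu> y + (- \<nu> * 0 * exp (- \<nu> * 0\<^sup>2 / 2)) * wO' (\<nu>\<^sup>2) \<nu> y"
  proof (rule wEO_unique[where a = "- \<bar>y\<bar>" and b = "\<bar>y\<bar>" and u = "\<lambda>y. exp (- \<nu> * y\<^sup>2 / 2)"
        and u' = "\<lambda>y. - \<nu> * y * exp (- \<nu> * y\<^sup>2 / 2)"])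
    fix t
    show "((\<lambda>y. exp (- \<nu> * y\<^sup>2 / 2)) has_real_derivative - \<nu> * t * exp (- \<nu> * t\<^sup>2 / 2)) (at t within {- \<bar>y\<bar>..\<bar>y\<bar>})"
      using gauss_derivs(1)[of "- \<nu>" t] by (auto intro: has_field_derivative_at_within)
    show "((\<lambda>y. - \<nu> * y * exp (- \<nu> * y\<^sup>2 / 2)) has_real_derivative (\<nu>\<^sup>2 * t\<^sup>2 - \<nu>) * exp (- \<nu> * t\<^sup>2 / 2)) (at t within {- \<bar>y\<bar>..\<bar>y\<bar>})"
      using gauss_derivs(2)[of "- \<nu>" t] by (auto intro: has_field_derivative_at_within)
  qed auto
  then show "wE (\<nu>\<^sup>2) \<nu> y = exp (- \<nu> * y\<^sup>2 / 2)" "wE' (\<nu>\<^sup>2) \<nu> y = - \<nu> * y * exp (- \<nu> * y\<^sup>2 / 2)" by auto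
qed

text \<open>The Wronskian for two values of m shows that the logarithmic derivative of wE at y > 0
  increases strictly with m. This fixes the sign of the end slope on both sides of the critical
  h.\<close>

lemma wE_strict_mono:
  assumes "0 < \<nu>" "\<nu> \<le> m1" "m1 < m2" "y > 0"
  shows "wE (m2\<^sup>2) \<nu> y * wE' (m1\<^sup>2) \<nu> y < wE' (m2\<^sup>2) \<nu> y * wE (m1\<^sup>2) \<nu> y"
proof -
  let ?f = "\<lambda>y. wE' (m2\<^sup>2) \<nu> y * wE (m1\<^sup>2) \<nu> y - wE (m2\<^sup>2) \<nu> y * wE' (m1\<^sup>2) \<nu> y"
  have "?f 0 < ?f y"
  proof (rule increasing_at[where f = ?f and f' = "\<lambda>y. (m2\<^sup>2 - m1\<^sup>2) * y\<^sup>2 * (wE (m1\<^sup>2) \<nu> y * wE (m2\<^sup>2) \<nu> y)"])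
    fix x
    show "(?f has_real_derivative (m2\<^sup>2 - m1\<^sup>2) * x\<^sup>2 * (wE (m1\<^sup>2) \<nu> x * wE (m2\<^sup>2) \<nu> x)) (at x)"
      by (auto intro!: derivative_eq_intros simp: algebra_simps)
    assume "x \<in> {0<..<y}"
    moreover have "m1\<^sup>2 < m2\<^sup>2" using assms by (intro power_strict_mono) auto
    ultimately show "(m2\<^sup>2 - m1\<^sup>2) * x\<^sup>2 * (wE (m1\<^sup>2) \<nu> x * wE (m2\<^sup>2) \<nu> x) > 0"
      using wE_pos[of \<nu> m1 x] wE_pos[of \<nu> m2 x] assms by simp
  qed (use assms in auto)
  then show ?thesis by simp
qed

lemma wE_neumann_exists:
  assumes "\<nu> > 0" "d > 0"
  shows "\<exists>m>\<nu>. wE' (m\<^sup>2) \<nu> d = 0"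
proof -
  \<comment> \<open>The second summand makes the correction term in \<open>wE_neumann_bound\<close>
    at most 1/2; the third makes \<open>M * d\<close> exceed sqrt (6 \<nu>), which that bound would
    forbid if the slope were nonpositive.\<close>
  define M where "M = \<nu> + 2 * \<nu> * sqrt \<nu> * d + (sqrt (6 * \<nu>) + 1) / d"
  have s6: "sqrt (6 * \<nu>) \<ge> 0" using assms by simp
  have M: "M > \<nu>" "M \<ge> 2 * \<nu> * sqrt \<nu> * d" "M \<ge> (sqrt (6 * \<nu>) + 1) / d"
    using assms s6 by (auto simp: M_def add_nonneg_pos add_pos_nonneg)
  have "wE' (M\<^sup>2) \<nu> d > 0"
  proof (rule ccontr)
    assume "\<not> wE' (M\<^sup>2) \<nu> d > 0"
    then have *: "M\<^sup>2 * d\<^sup>2 * (1 - \<nu> * (sqrt \<nu> / M) * d) \<le> 3 * \<nu>"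
      using assms M by (intro wE_neumann_bound) auto
    have "\<nu> * (sqrt \<nu> / M) * d \<le> 1 / 2" using M assms by (simp add: field_simps)
    then have "M\<^sup>2 * d\<^sup>2 * (1 / 2) \<le> M\<^sup>2 * d\<^sup>2 * (1 - \<nu> * (sqrt \<nu> / M) * d)" by (intro mult_left_mono) auto
    with * have "M\<^sup>2 * d\<^sup>2 * (1 / 2) \<le> 3 * \<nu>" by (rule order_trans[rotated])
    then have "(M * d)\<^sup>2 \<le> 6 * \<nu>" by (simp add: power_mult_distrib)
    then have "M * d \<le> sqrt (6 * \<nu>)" by (rule real_le_rsqrt)
    moreover have "sqrt (6 * \<nu>) + 1 \<le> M * d" using M(3) assms by (simp add: field_simps)
    ultimately show False by simp
  qed
  moreover have "wE' (\<nu>\<^sup>2) \<nu> d < 0" using assms by (simp add: wE_gauss)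
  moreover have "continuous_on {\<nu>..M} (\<lambda>m. wE' (m\<^sup>2) \<nu> d)" by (intro continuous_intros)
  ultimately obtain m where "\<nu> \<le> m" "m \<le> M" "wE' (m\<^sup>2) \<nu> d = 0"
    using IVT'[of "\<lambda>m. wE' (m\<^sup>2) \<nu> d" \<nu> 0 M] M by auto
  moreover have "m \<noteq> \<nu>" using \<open>wE' (\<nu>\<^sup>2) \<nu> d < 0\<close> calculation by auto
  ultimately show ?thesis by (intro exI[of _ m]) auto
qed



subsection \<open>Neumann pairs in the two regimes\<close>

text \<open>The negative term of wN dominates. With t = m y >= 3 \<kappa> the potential is at least
  8/9 t^2, and t y >= 9 turns \<open>wO_upper\<close> into wO' <= 10/9 t wO, so every term is
  comparable with t^3 wO'. The right-hand side is chosen so that after division by wO'^3 it says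
  wPhi' <= -\<kappa> wPhi.\<close>

lemma wN_large:
  assumes k: "\<kappa> > 0" "\<kappa>\<^sup>2 \<le> m" and y: "\<kappa> * y \<ge> 3"
  shows "2 * wN (m\<^sup>2) (\<kappa>\<^sup>2) y \<le> - \<kappa> * (m\<^sup>2 * y\<^sup>2 - \<kappa>\<^sup>2) * wO' (m\<^sup>2) (\<kappa>\<^sup>2) y"
    "m\<^sup>2 * y\<^sup>2 - \<kappa>\<^sup>2 > 0"
proof -
  define X where "X = wO (m\<^sup>2) (\<kappa>\<^sup>2) y"
  define X' where "X' = wO' (m\<^sup>2) (\<kappa>\<^sup>2) y"
  define t where "t = m * y"
  define q where "q = t\<^sup>2 - \<kappa>\<^sup>2"
  have nu: "0 < \<kappa>\<^sup>2" using k by simp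
  have "\<kappa> * y > 0" using y by simp
  then have y0: "y > 0" using k(1) by (rule zero_less_mult_pos)
  have O: "X > 0" "X' > 0" using wO_pos[OF nu k(2) y0] wO'_pos[OF nu k(2)] by (auto simp: X_def X'_def)
  have t3: "t \<ge> 3 * \<kappa>"
  proof -
    have "\<kappa>\<^sup>2 * y \<le> m * y" using k y0 by (intro mult_right_mono) auto
    moreover have "\<kappa> * 3 \<le> \<kappa> * (\<kappa> * y)" using k y by (intro mult_left_mono) auto
    ultimately show ?thesis by (simp add: t_def power2_eq_square algebra_simps)
  qed
  have t0: "t > 0" using t3 k by simp
  have kt: "9 * \<kappa>\<^sup>2 \<le> t\<^sup>2" using power_mono[OF t3, of 2] k by simp
  have q: "q \<ge> 8 / 9 * t\<^sup>2" "q \<le> t\<^sup>2" using kt k by (auto simp: q_def)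
  have "t\<^sup>2 > 0" using t0 by simp
  then have "q > 0" using q(1) by linarith
  then show "m\<^sup>2 * y\<^sup>2 - \<kappa>\<^sup>2 > 0" by (simp add: q_def t_def power_mult_distrib)
  have yt: "m * y\<^sup>2 = t * y" by (simp add: t_def power2_eq_square)
  have ty: "t * y \<ge> 9"
  proof -
    have "3 * \<kappa> * y \<le> t * y" using t3 y0 by (intro mult_right_mono) auto
    with y show ?thesis by simp
  qed
  have "y * X' \<le> (1 + t * y) * X"
    using wO_upper[OF nu k(2) less_imp_le[OF y0]] by (simp add: X_def X'_def yt)
  also have "\<dots> \<le> (10 / 9 * (t * y)) * X" using ty O by (intro mult_right_mono) auto
  finally have "y * X' \<le> y * (10 / 9 * t * X)" by (simp add: algebra_simps)
  then have OO: "9 * X' \<le> 10 * (t * X)" using y0 by simp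
  have "m\<^sup>2 * y \<le> t ^ 3 / 9"
  proof -
    have m0: "m \<ge> 0" using k zero_le_power2[of \<kappa>] by linarith
    have "m * 3 \<le> m * (\<kappa> * y)" using y m0 by (intro mult_left_mono) auto
    then have "3 * m \<le> t * \<kappa>" by (simp add: t_def mult_ac)
    also have "\<dots> \<le> t * (t / 3)" using t3 t0 by (intro mult_left_mono) auto
    finally have "m \<le> t\<^sup>2 / 9" by (simp add: power2_eq_square)
    then have "t * m \<le> t * (t\<^sup>2 / 9)" using t0 by (intro mult_left_mono) auto
    then show ?thesis by (simp add: t_def power2_eq_square power3_eq_cube algebra_simps)
  qed
  then have "2 * (m\<^sup>2 * y) \<le> 2 * (t ^ 3 / 9)" by linarith
  then have 1: "2 * (m\<^sup>2 * y) * X' \<le> 2 * (t ^ 3 / 9) * X'"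
    by (rule mult_right_mono) (use O in simp)
  have "\<kappa> * q \<le> (t / 3) * t\<^sup>2" using t3 q k t0 by (intro mult_mono) auto
  then have 2: "(\<kappa> * q) * X' \<le> (t ^ 3 / 3) * X'"
    using O by (intro mult_right_mono) (auto simp: power2_eq_square power3_eq_cube)
  have "(8 / 9 * t\<^sup>2)\<^sup>2 \<le> q\<^sup>2" using q by (intro power_mono) auto
  then have "(8 / 9 * t\<^sup>2)\<^sup>2 * X \<le> q\<^sup>2 * X" using O by (intro mult_right_mono) auto
  moreover have "t ^ 3 * (9 * X') \<le> t ^ 3 * (10 * (t * X))" using OO t0 by (intro mult_left_mono) auto
  \<comment> \<open>Twice this coefficient is 64/45, while the estimates 1 and 2 together cost 2/9 +
    1/3 = 5/9.\<close>
  ultimately have 3: "64 / 81 * (9 / 10) * (t ^ 3 * X') \<le> q\<^sup>2 * X"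
    by (simp add: power2_eq_square power3_eq_cube algebra_simps)
  have "t ^ 3 * X' > 0" using t0 O by simp
  with 1 2 3 have "2 * (m\<^sup>2 * y * X' - q\<^sup>2 * X) \<le> - \<kappa> * q * X'" by (simp add: algebra_simps)
  then show "2 * wN (m\<^sup>2) (\<kappa>\<^sup>2) y \<le> - \<kappa> * (m\<^sup>2 * y\<^sup>2 - \<kappa>\<^sup>2) * wO' (m\<^sup>2) (\<kappa>\<^sup>2) y"
    by (simp add: wN_def X_def X'_def q_def t_def power_mult_distrib)
qed

lemma wN_large_neg:
  assumes "\<kappa> > 0" "\<kappa>\<^sup>2 \<le> m" "\<kappa> * y \<ge> 3"
  shows "wN (m\<^sup>2) (\<kappa>\<^sup>2) y < 0"
proof -
  have "wO' (m\<^sup>2) (\<kappa>\<^sup>2) y > 0" using assms by (intro wO'_pos) auto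
  then have "\<kappa> * (m\<^sup>2 * y\<^sup>2 - \<kappa>\<^sup>2) * wO' (m\<^sup>2) (\<kappa>\<^sup>2) y > 0" using wN_large(2)[OF assms] assms(1) by simp
  with wN_large(1)[OF assms] show ?thesis by simp
qed

lemma wPhi_large_deriv:
  assumes "\<kappa> > 0" "\<kappa>\<^sup>2 \<le> m" "\<kappa> * y \<ge> 3"
  shows "wPhi (m\<^sup>2) (\<kappa>\<^sup>2) y > 0"
    "2 * wN (m\<^sup>2) (\<kappa>\<^sup>2) y / (wO' (m\<^sup>2) (\<kappa>\<^sup>2) y) ^ 3 \<le> - \<kappa> * wPhi (m\<^sup>2) (\<kappa>\<^sup>2) y"
proof -
  have O: "wO' (m\<^sup>2) (\<kappa>\<^sup>2) y > 0" using assms by (intro wO'_pos) auto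
  show "wPhi (m\<^sup>2) (\<kappa>\<^sup>2) y > 0" using wN_large(2)[OF assms] O by (simp add: wPhi_def)
  have "2 * wN (m\<^sup>2) (\<kappa>\<^sup>2) y / (wO' (m\<^sup>2) (\<kappa>\<^sup>2) y) ^ 3
      \<le> (- \<kappa> * (m\<^sup>2 * y\<^sup>2 - \<kappa>\<^sup>2) * wO' (m\<^sup>2) (\<kappa>\<^sup>2) y) / (wO' (m\<^sup>2) (\<kappa>\<^sup>2) y) ^ 3"
    using wN_large(1)[OF assms] O by (intro divide_right_mono) auto
  also have "\<dots> = - \<kappa> * wPhi (m\<^sup>2) (\<kappa>\<^sup>2) y"
    using O by (simp add: wPhi_def power2_eq_square power3_eq_cube)
  finally show "2 * wN (m\<^sup>2) (\<kappa>\<^sup>2) y / (wO' (m\<^sup>2) (\<kappa>\<^sup>2) y) ^ 3 \<le> - \<kappa> * wPhi (m\<^sup>2) (\<kappa>\<^sup>2) y" .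
qed

text \<open>If \<open>L < 3/\<kappa>\<close>, the gain of \<open>wRho\<close> from \<open>d\<close> to \<open>R\<close> is too small to compensate its value at \<open>L\<close>;
  otherwise \<open>wPhi\<close> is injective on the range considered.\<close>

lemma neumann_pair_large:
  assumes k: "\<kappa> > 0" "\<kappa>\<^sup>2 \<le> m" and d: "\<kappa> * d \<ge> 4" and E: "wE' (m\<^sup>2) (\<kappa>\<^sup>2) d = 0"
    and LR: "0 \<le> L" "L \<le> R" "L + R = 2 * d"
    and rho: "wRho (m\<^sup>2) (\<kappa>\<^sup>2) L + wRho (m\<^sup>2) (\<kappa>\<^sup>2) R = 0"
    and phi: "wPhi (m\<^sup>2) (\<kappa>\<^sup>2) L = wPhi (m\<^sup>2) (\<kappa>\<^sup>2) R"
  shows "L = R"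
proof (rule ccontr)
  assume "L \<noteq> R"
  then have Rd: "L < R" "d < R" "L < d" using LR by auto
  let ?\<Phi> = "wPhi (m\<^sup>2) (\<kappa>\<^sup>2)" and ?\<rho> = "wRho (m\<^sup>2) (\<kappa>\<^sup>2)"
  let ?D = "\<lambda>y. 2 * wN (m\<^sup>2) (\<kappa>\<^sup>2) y / (wO' (m\<^sup>2) (\<kappa>\<^sup>2) y) ^ 3"
  have O: "wO' (m\<^sup>2) (\<kappa>\<^sup>2) y \<noteq> 0" for y using wO'_pos[of "\<kappa>\<^sup>2" m y] k by auto
  note der = wPhi_deriv[OF O] wRho_deriv[OF O]
  note big = wPhi_large_deriv[OF k]
  have up: "\<kappa> * y \<ge> 3" if "3 / \<kappa> \<le> y" for y using that k by (simp add: field_simps)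
  have "4 / \<kappa> \<le> d" using d k by (simp add: pos_divide_le_eq mult.commute)
  moreover have "3 / \<kappa> \<le> 4 / \<kappa>" using k by (intro divide_right_mono) auto
  ultimately have d4: "4 / \<kappa> \<le> d" "3 / \<kappa> \<le> d" "3 / \<kappa> \<le> R" using Rd by auto
  have dec: "?\<Phi> z < ?\<Phi> y" if "3 / \<kappa> \<le> y" "y < z" for y z
  proof -
    have "- ?\<Phi> y < - ?\<Phi> z"
    proof (rule increasing_at[OF \<open>y < z\<close>, where f = "\<lambda>x. - ?\<Phi> x" and f' = "\<lambda>x. - ?D x"])
      fix x assume "x \<in> {y<..<z}"
      then have x: "\<kappa> * x \<ge> 3" using that by (intro up) auto
      have "\<kappa> * ?\<Phi> x > 0" using big(1)[OF x] k by simp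
      then show "0 < - ?D x" using big(2)[OF x] by simp
    qed (intro DERIV_minus der)
    then show ?thesis by simp
  qed
  have rd: "?\<rho> d = 0" using E by (simp add: wRho_def)
  show False
  proof (cases "3 / \<kappa> \<le> L")
    case True
    then show False using dec[of L R] Rd phi by simp
  next
    case False
    have posL: "?\<Phi> L > 0" using phi big(1)[OF up[OF d4(3)]] by simp
    have pos: "?\<Phi> x > 0" if "L \<le> x" for x
    proof -
      have "0 < m\<^sup>2 * L\<^sup>2 - \<kappa>\<^sup>2" using posL by (simp add: wPhi_def zero_less_divide_iff)
      also have "\<dots> \<le> m\<^sup>2 * x\<^sup>2 - \<kappa>\<^sup>2" using that LR by (intro diff_right_mono mult_left_mono power_mono) auto
      finally show ?thesis using O[of x] by (simp add: wPhi_def)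
    qed
    have "?\<rho> L \<le> ?\<rho> (3 / \<kappa>)"
      using False pos by (intro nondecreasing_at[where f = ?\<rho> and f' = ?\<Phi>] der) (auto intro: less_imp_le)
    \<comment> \<open>On [3/\<kappa>, d] the derivative \<open>wPhi\<close> of \<open>wRho\<close>
      is at least its value at d, so \<open>wRho\<close> rises by at least that value times the
      length, which is 1/\<kappa> or more.\<close>
    moreover have "?\<rho> (3 / \<kappa>) - ?\<Phi> d * (3 / \<kappa>) \<le> ?\<rho> d - ?\<Phi> d * d"
    proof (rule nondecreasing_at[OF d4(2), where f = "\<lambda>x. ?\<rho> x - ?\<Phi> d * x" and f' = "\<lambda>x. ?\<Phi> x - ?\<Phi> d"])
      fix x assume "x \<in> {3 / \<kappa><..<d}"
      then show "0 \<le> ?\<Phi> x - ?\<Phi> d" using dec[of x d] by auto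
    qed (auto intro!: derivative_eq_intros der)
    ultimately have "?\<rho> L \<le> - ?\<Phi> d * (d - 3 / \<kappa>)" using rd by (simp add: algebra_simps)
    also have "\<dots> \<le> - ?\<Phi> d * (1 / \<kappa>)"
    proof -
      have "?\<Phi> d * (1 / \<kappa>) \<le> ?\<Phi> d * (d - 3 / \<kappa>)"
        using d4(1) pos[of d] Rd by (intro mult_left_mono) (auto simp: diff_divide_distrib[symmetric] field_simps)
      then show ?thesis by simp
    qed
    finally have L: "?\<rho> L \<le> - ?\<Phi> d / \<kappa>" by simp
    \<comment> \<open>To the right of d the decay rate \<kappa> makes
      \<open>wRho + wPhi / \<kappa>\<close> nonincreasing, so \<open>wRho\<close> gains strictly
      less than \<open>wPhi d / \<kappa>\<close> there. The sum at L and R is then negative.\<close>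
    have "- (?\<rho> d + ?\<Phi> d / \<kappa>) \<le> - (?\<rho> R + ?\<Phi> R / \<kappa>)"
    proof (rule nondecreasing_at[where f = "\<lambda>x. - (?\<rho> x + ?\<Phi> x / \<kappa>)" and f' = "\<lambda>x. - (?\<Phi> x + ?D x / \<kappa>)"])
      fix x
      show "((\<lambda>x. - (?\<rho> x + ?\<Phi> x / \<kappa>)) has_real_derivative - (?\<Phi> x + ?D x / \<kappa>)) (at x)"
        by (intro DERIV_minus DERIV_add DERIV_cdivide der)
      assume "x \<in> {d<..<R}"
      then have x: "\<kappa> * x \<ge> 3" using d4 by (intro up) auto
      have "?D x / \<kappa> \<le> (- \<kappa> * ?\<Phi> x) / \<kappa>" using big(2)[OF x] k by (intro divide_right_mono) auto
      then show "0 \<le> - (?\<Phi> x + ?D x / \<kappa>)" using k by simp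
    qed (use Rd in auto)
    then have "?\<rho> R \<le> ?\<Phi> d / \<kappa> - ?\<Phi> R / \<kappa>" using rd by simp
    also have "\<dots> < ?\<Phi> d / \<kappa>" using pos[of R] Rd k by simp
    finally show False using L rho by simp
  qed
qed

text \<open>For small \<kappa> d the Neumann condition gives \<kappa> < m d <= 2 \<kappa>. On (0,
  2d], the range of both lengths L and R, the potential is at most 16 \<kappa>^2 in absolute value
  and wO < 2 y wO', whereas m > 100 \<kappa>^2 makes the term m^2 y wO' prevail.\<close>

lemma wN_small_pos:
  assumes k: "\<kappa> > 0" "\<kappa>\<^sup>2 \<le> m" and d: "d > 0" "\<kappa> * d \<le> 1 / 100" and E: "wE' (m\<^sup>2) (\<kappa>\<^sup>2) d = 0"
    and y: "0 < y" "y \<le> 2 * d"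
  shows "wN (m\<^sup>2) (\<kappa>\<^sup>2) y > 0"
proof -
  have nu: "0 < \<kappa>\<^sup>2" using k by simp
  have m0: "m > 0" using k nu by linarith
  define X where "X = wO (m\<^sup>2) (\<kappa>\<^sup>2) y"
  define X' where "X' = wO' (m\<^sup>2) (\<kappa>\<^sup>2) y"
  have O: "X > 0" "X' > 0" using wO_pos[OF nu k(2) y(1)] wO'_pos[OF nu k(2)] by (auto simp: X_def X'_def)
  have "\<kappa>\<^sup>2 < m\<^sup>2 * d\<^sup>2" using wE_neumann_potential_pos[OF nu k(2), of d] E d by simp
  then have "\<kappa>\<^sup>2 < (m * d)\<^sup>2" by (simp add: power_mult_distrib)
  then have md: "\<kappa> < m * d" by (rule power2_less_imp_less) (use m0 d in simp)
  have kd: "(\<kappa> * d)\<^sup>2 \<le> 1 / 10000" using power_mono[OF d(2), of 2] k d by (simp add: power_divide)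
  have "m\<^sup>2 * d\<^sup>2 * (1 - \<kappa>\<^sup>2 * (sqrt (\<kappa>\<^sup>2) / m) * d) \<le> 3 * \<kappa>\<^sup>2"
    using E by (intro wE_neumann_bound nu k d) simp
  moreover have "\<kappa>\<^sup>2 * (sqrt (\<kappa>\<^sup>2) / m) * d \<le> 1 / 10000"
  proof -
    have "\<kappa> / m \<le> d" using md m0 by (simp add: field_simps)
    then have "\<kappa>\<^sup>2 * (\<kappa> / m) * d \<le> \<kappa>\<^sup>2 * d * d" using d by (intro mult_right_mono mult_left_mono) auto
    also have "\<dots> = (\<kappa> * d)\<^sup>2" by (simp add: power2_eq_square mult_ac)
    finally have "\<kappa>\<^sup>2 * (\<kappa> / m) * d \<le> 1 / 10000" using kd by linarith
    then show ?thesis using k by (simp only: real_sqrt_abs abs_of_pos)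
  qed
  ultimately have "m\<^sup>2 * d\<^sup>2 * (1 - 1 / 10000) \<le> 3 * \<kappa>\<^sup>2"
    by (smt (verit) mult_left_mono zero_le_power2 mult_nonneg_nonneg)
  moreover have "x \<le> 4 * y" if "x * (1 - 1 / 10000) \<le> 3 * y" "0 < y" for x y :: real
    using that by simp
  ultimately have "m\<^sup>2 * d\<^sup>2 \<le> 4 * \<kappa>\<^sup>2" using nu by blast
  then have md2: "(m * d)\<^sup>2 \<le> 4 * \<kappa>\<^sup>2" by (simp add: power_mult_distrib)
  then have "(m * d)\<^sup>2 \<le> (2 * \<kappa>)\<^sup>2" by (simp add: power_mult_distrib)
  then have md': "m * d \<le> 2 * \<kappa>" by (rule power2_le_imp_le) (use k in simp)
  have "m * y \<le> m * (2 * d)" using y(2) m0 by (intro mult_left_mono) auto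
  also have "\<dots> = 2 * (m * d)" by simp
  also have "\<dots> \<le> 2 * (2 * \<kappa>)" using md' by (intro mult_left_mono) auto
  finally have my: "m * y \<le> 4 * \<kappa>" by simp
  have "m * y\<^sup>2 \<le> 4 * \<kappa> * (2 * d)" using mult_mono[OF my y(2)] k y by (simp add: power2_eq_square)
  then have "m * y\<^sup>2 \<le> 1 / 2" using d by simp
  then have "1 / 2 * X \<le> (1 - m * y\<^sup>2) * X" using O by (intro mult_right_mono) auto
  also have "\<dots> < y * X'" using wO_lower[OF nu k(2) y(1)] by (simp add: X_def X'_def)
  finally have OO: "X < 2 * (y * X')" by simp
  have "(m * y)\<^sup>2 \<le> (4 * \<kappa>)\<^sup>2" using my m0 y by (intro power_mono) auto
  then have "m\<^sup>2 * y\<^sup>2 \<le> 16 * \<kappa>\<^sup>2" by (simp add: power_mult_distrib)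
  moreover have "0 \<le> m\<^sup>2 * y\<^sup>2" by simp
  ultimately have "\<bar>m\<^sup>2 * y\<^sup>2 - \<kappa>\<^sup>2\<bar> \<le> 16 * \<kappa>\<^sup>2" using nu by linarith
  then have "\<bar>m\<^sup>2 * y\<^sup>2 - \<kappa>\<^sup>2\<bar> \<le> \<bar>16 * \<kappa>\<^sup>2\<bar>" by simp
  then have q: "(m\<^sup>2 * y\<^sup>2 - \<kappa>\<^sup>2)\<^sup>2 \<le> (16 * \<kappa>\<^sup>2)\<^sup>2" by (rule abs_le_square_iff[THEN iffD1])
  have "(m\<^sup>2 * y\<^sup>2 - \<kappa>\<^sup>2)\<^sup>2 * X \<le> (16 * \<kappa>\<^sup>2)\<^sup>2 * (2 * (y * X'))"
    using q OO O by (intro mult_mono) auto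
  also have "\<dots> = 512 * \<kappa>\<^sup>2 * (\<kappa>\<^sup>2 * (y * X'))" by (simp add: power2_eq_square algebra_simps)
  also have "\<dots> < m\<^sup>2 * (y * X')"
  proof -
    \<comment> \<open>512 is 2 * 16^2, collected from the two preceding estimates; it is well below
      100^2.\<close>
    have "512 * \<kappa>\<^sup>2 * \<kappa>\<^sup>2 < m\<^sup>2"
    proof -
      have "100 * \<kappa>\<^sup>2 * d \<le> \<kappa>" using mult_left_mono[OF d(2), of \<kappa>] k by (simp add: power2_eq_square algebra_simps)
      with md have "(100 * \<kappa>\<^sup>2) * d < m * d" by simp
      then have "100 * \<kappa>\<^sup>2 < m" using d by simp
      then have "(100 * \<kappa>\<^sup>2)\<^sup>2 < m\<^sup>2" using nu by (intro power_strict_mono) auto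
      moreover have "\<kappa>\<^sup>2 * \<kappa>\<^sup>2 > 0" using k by simp
      moreover have "(100 * \<kappa>\<^sup>2)\<^sup>2 = 10000 * (\<kappa>\<^sup>2 * \<kappa>\<^sup>2)" by (simp add: power2_eq_square)
      ultimately have "512 * (\<kappa>\<^sup>2 * \<kappa>\<^sup>2) < m\<^sup>2" by linarith
      then show ?thesis by (simp only: mult.assoc)
    qed
    then have "(512 * \<kappa>\<^sup>2 * \<kappa>\<^sup>2) * (y * X') < m\<^sup>2 * (y * X')" using y O by (intro mult_strict_right_mono) auto
    then show ?thesis by (simp add: mult_ac)
  qed
  finally show ?thesis by (simp add: wN_def X_def X'_def mult_ac)
qed

text \<open>In this regime \<open>wPhi\<close> increases strictly between any two lengths in
  [0, 2d], so equal values at L and R force L = R.\<close>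

lemma neumann_pair_small:
  assumes k: "\<kappa> > 0" "\<kappa>\<^sup>2 \<le> m" and d: "d > 0" "\<kappa> * d \<le> 1 / 100" and E: "wE' (m\<^sup>2) (\<kappa>\<^sup>2) d = 0"
    and LR: "0 \<le> L" "L \<le> R" "L + R = 2 * d"
    and phi: "wPhi (m\<^sup>2) (\<kappa>\<^sup>2) L = wPhi (m\<^sup>2) (\<kappa>\<^sup>2) R"
  shows "L = R"
proof (rule ccontr)
  assume "L \<noteq> R"
  then have "L < R" using LR by simp
  have O: "wO' (m\<^sup>2) (\<kappa>\<^sup>2) y > 0" for y using wO'_pos[of "\<kappa>\<^sup>2" m y] k by auto
  have "wPhi (m\<^sup>2) (\<kappa>\<^sup>2) L < wPhi (m\<^sup>2) (\<kappa>\<^sup>2) R"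
  proof (rule increasing_at[OF \<open>L < R\<close> wPhi_deriv])
    fix y assume "y \<in> {L<..<R}"
    then have "wN (m\<^sup>2) (\<kappa>\<^sup>2) y > 0" using LR by (intro wN_small_pos[OF k d E]) auto
    then show "0 < 2 * wN (m\<^sup>2) (\<kappa>\<^sup>2) y / wO' (m\<^sup>2) (\<kappa>\<^sup>2) y ^ 3" using O[of y] by simp
  qed (use O in \<open>auto simp: less_imp_neq[symmetric]\<close>)
  with phi show False by simp
qed

subsection \<open>The degenerate value is a transversal zero\<close>

text \<open>Only finite differences in \<open>\<nu>\<close> are used, so no differentiability in the parameter is needed.\<close>

lemma wE_neumann_difference:
  assumes m: "0 < \<nu>\<^sub>0" "\<nu>\<^sub>0 \<le> m" "0 < \<nu>\<^sub>1" "\<nu>\<^sub>1 \<le> m" and Z: "0 < Z\<^sub>0" "Z\<^sub>0 < Z\<^sub>1"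
    and E: "wE' (m\<^sup>2) \<nu>\<^sub>0 Z\<^sub>0 = 0" "wE' (m\<^sup>2) \<nu>\<^sub>1 Z\<^sub>1 = 0"
  shows "\<nu>\<^sub>0 < \<nu>\<^sub>1" "(\<nu>\<^sub>1 - \<nu>\<^sub>0) * Z\<^sub>0 \<le> (Z\<^sub>1 - Z\<^sub>0) * (m\<^sup>2 * Z\<^sub>1\<^sup>2 - \<nu>\<^sub>1)"
proof -
  let ?e0 = "wE (m\<^sup>2) \<nu>\<^sub>0" and ?e1 = "wE (m\<^sup>2) \<nu>\<^sub>1" and ?f0 = "wE' (m\<^sup>2) \<nu>\<^sub>0" and ?f1 = "wE' (m\<^sup>2) \<nu>\<^sub>1"
  have pos: "?e0 x > 0" "?e1 x > 0" for x using wE_pos m by auto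
  let ?W = "\<lambda>x. ?f1 x * ?e0 x - ?e1 x * ?f0 x"
  have W: "(?W has_real_derivative (\<nu>\<^sub>0 - \<nu>\<^sub>1) * (?e0 x * ?e1 x)) (at x)" for x
    by (auto intro!: derivative_eq_intros simp: algebra_simps)
  show less: "\<nu>\<^sub>0 < \<nu>\<^sub>1"
  proof (rule ccontr)
    \<comment> \<open>In this case the Wronskian gives a nonpositive slope of e0 at Z1, while the
      potential is positive beyond Z0 and the slope of e0 must have grown from 0.\<close>
    assume "\<not> \<nu>\<^sub>0 < \<nu>\<^sub>1"
    have "?W 0 \<le> ?W Z\<^sub>1"
    proof (rule nondecreasing_at[where f = ?W, OF _ W])
      fix x
      show "0 \<le> (\<nu>\<^sub>0 - \<nu>\<^sub>1) * (?e0 x * ?e1 x)"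
        using \<open>\<not> \<nu>\<^sub>0 < \<nu>\<^sub>1\<close> pos[of x] by (intro mult_nonneg_nonneg) auto
    qed (use Z in simp)
    then have "?e1 Z\<^sub>1 * ?f0 Z\<^sub>1 \<le> 0" using E by simp
    then have "?f0 Z\<^sub>1 \<le> 0" using pos(2)[of Z\<^sub>1] by (simp add: mult_le_0_iff)
    moreover have "?f0 Z\<^sub>0 < ?f0 Z\<^sub>1"
    proof (rule increasing_at[OF Z(2), where f = ?f0])
      fix x assume "x \<in> {Z\<^sub>0<..<Z\<^sub>1}"
      then have "m\<^sup>2 * Z\<^sub>0\<^sup>2 \<le> m\<^sup>2 * x\<^sup>2" using Z by (intro mult_left_mono power_mono) auto
      moreover have "\<nu>\<^sub>0 < m\<^sup>2 * Z\<^sub>0\<^sup>2" using wE_neumann_potential_pos[OF m(1,2), of Z\<^sub>0] E Z by simp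
      ultimately show "0 < (m\<^sup>2 * x\<^sup>2 - \<nu>\<^sub>0) * ?e0 x" using pos(1)[of x] by simp
    qed (rule wEO_derivs)
    ultimately show False using E by simp
  qed
  have anti1: "?e1 y \<le> ?e1 x" if "0 \<le> x" "x \<le> y" "y \<le> Z\<^sub>1" for x y
    using that E by (intro wE_antimono[OF m(3,4)]) auto
  have anti0: "?e0 y \<le> ?e0 x" if "0 \<le> x" "x \<le> y" "y \<le> Z\<^sub>0" for x y
    using that E by (intro wE_antimono[OF m(1,2)]) auto
  define c where "c = ?e0 Z\<^sub>0 * ?e1 Z\<^sub>0"
  \<comment> \<open>Integration of the Wronskian over [0, Z0]: both solutions decrease there, so
    their product is at least its end value c.\<close>
  have "- ?W 0 - (\<nu>\<^sub>1 - \<nu>\<^sub>0) * c * 0 \<le> - ?W Z\<^sub>0 - (\<nu>\<^sub>1 - \<nu>\<^sub>0) * c * Z\<^sub>0"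
  proof (rule nondecreasing_at[where f = "\<lambda>x. - ?W x - (\<nu>\<^sub>1 - \<nu>\<^sub>0) * c * x"
        and f' = "\<lambda>x. - ((\<nu>\<^sub>0 - \<nu>\<^sub>1) * (?e0 x * ?e1 x)) - (\<nu>\<^sub>1 - \<nu>\<^sub>0) * c"])
    fix x
    show "((\<lambda>x. - ?W x - (\<nu>\<^sub>1 - \<nu>\<^sub>0) * c * x) has_real_derivative
        - ((\<nu>\<^sub>0 - \<nu>\<^sub>1) * (?e0 x * ?e1 x)) - (\<nu>\<^sub>1 - \<nu>\<^sub>0) * c) (at x)"
      by (intro DERIV_diff DERIV_minus W) (auto intro!: derivative_eq_intros)
    assume x: "x \<in> {0<..<Z\<^sub>0}"
    have "c \<le> ?e0 x * ?e1 x" unfolding c_def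
      using x Z less_imp_le[OF pos(1)] less_imp_le[OF pos(2)] by (intro mult_mono anti0 anti1) auto
    then have "(\<nu>\<^sub>1 - \<nu>\<^sub>0) * c \<le> (\<nu>\<^sub>1 - \<nu>\<^sub>0) * (?e0 x * ?e1 x)" using less by (intro mult_left_mono) auto
    then show "0 \<le> - ((\<nu>\<^sub>0 - \<nu>\<^sub>1) * (?e0 x * ?e1 x)) - (\<nu>\<^sub>1 - \<nu>\<^sub>0) * c" by (simp add: algebra_simps)
  qed (use Z in auto)
  then have "?f1 Z\<^sub>0 * ?e0 Z\<^sub>0 \<le> (- ((\<nu>\<^sub>1 - \<nu>\<^sub>0) * Z\<^sub>0 * ?e1 Z\<^sub>0)) * ?e0 Z\<^sub>0"
    using E by (simp add: c_def algebra_simps)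
  then have 1: "?f1 Z\<^sub>0 \<le> - ((\<nu>\<^sub>1 - \<nu>\<^sub>0) * Z\<^sub>0 * ?e1 Z\<^sub>0)"
    using pos(1)[of Z\<^sub>0] by (simp only: mult_le_cancel_right_pos)
  define q where "q = m\<^sup>2 * Z\<^sub>1\<^sup>2 - \<nu>\<^sub>1"
  have q: "q > 0" using wE_neumann_potential_pos[OF m(3,4), of Z\<^sub>1] E Z by (simp add: q_def)
  \<comment> \<open>Over [Z0, Z1] the slope of e1 climbs to 0 at a rate of at most q e1(Z0).
    Together with 1 this bounds the change of \<nu>.\<close>
  have "q * ?e1 Z\<^sub>0 * Z\<^sub>0 - ?f1 Z\<^sub>0 \<le> q * ?e1 Z\<^sub>0 * Z\<^sub>1 - ?f1 Z\<^sub>1"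
  proof (rule nondecreasing_at[where f = "\<lambda>x. q * ?e1 Z\<^sub>0 * x - ?f1 x"
        and f' = "\<lambda>x. q * ?e1 Z\<^sub>0 - (m\<^sup>2 * x\<^sup>2 - \<nu>\<^sub>1) * ?e1 x"])
    fix x
    show "((\<lambda>x. q * ?e1 Z\<^sub>0 * x - ?f1 x) has_real_derivative q * ?e1 Z\<^sub>0 - (m\<^sup>2 * x\<^sup>2 - \<nu>\<^sub>1) * ?e1 x) (at x)"
      by (auto intro!: derivative_eq_intros)
    assume x: "x \<in> {Z\<^sub>0<..<Z\<^sub>1}"
    have "m\<^sup>2 * x\<^sup>2 \<le> m\<^sup>2 * Z\<^sub>1\<^sup>2" using x Z by (intro mult_left_mono power_mono) auto
    then have "(m\<^sup>2 * x\<^sup>2 - \<nu>\<^sub>1) * ?e1 x \<le> q * ?e1 x" using pos(2)[of x] by (simp add: q_def)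
    also have "\<dots> \<le> q * ?e1 Z\<^sub>0" using x Z q by (intro mult_left_mono anti1) auto
    finally show "0 \<le> q * ?e1 Z\<^sub>0 - (m\<^sup>2 * x\<^sup>2 - \<nu>\<^sub>1) * ?e1 x" by simp
  qed (use Z in auto)
  then have "- ?f1 Z\<^sub>0 \<le> q * ?e1 Z\<^sub>0 * (Z\<^sub>1 - Z\<^sub>0)" using E by (simp add: algebra_simps)
  with 1 have "((\<nu>\<^sub>1 - \<nu>\<^sub>0) * Z\<^sub>0) * ?e1 Z\<^sub>0 \<le> ((Z\<^sub>1 - Z\<^sub>0) * q) * ?e1 Z\<^sub>0" by (simp add: mult_ac)
  then show "(\<nu>\<^sub>1 - \<nu>\<^sub>0) * Z\<^sub>0 \<le> (Z\<^sub>1 - Z\<^sub>0) * (m\<^sup>2 * Z\<^sub>1\<^sup>2 - \<nu>\<^sub>1)"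
    using pos(2)[of Z\<^sub>0] by (simp only: mult_le_cancel_right_pos q_def)
qed

text \<open>The Wronskian of the two odd solutions starts at 0 and has a nonnegative
  derivative.\<close>

lemma wO_ratio_antimono:
  assumes "0 < \<nu>\<^sub>0" "\<nu>\<^sub>0 \<le> m" "0 < \<nu>\<^sub>1" "\<nu>\<^sub>1 \<le> m" "\<nu>\<^sub>0 \<le> \<nu>\<^sub>1" "y > 0"
  shows "wO' (m\<^sup>2) \<nu>\<^sub>1 y / wO (m\<^sup>2) \<nu>\<^sub>1 y \<le> wO' (m\<^sup>2) \<nu>\<^sub>0 y / wO (m\<^sup>2) \<nu>\<^sub>0 y"
proof -
  let ?W = "\<lambda>x. wO' (m\<^sup>2) \<nu>\<^sub>0 x * wO (m\<^sup>2) \<nu>\<^sub>1 x - wO (m\<^sup>2) \<nu>\<^sub>0 x * wO' (m\<^sup>2) \<nu>\<^sub>1 x"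
  have "?W 0 \<le> ?W y"
  proof (rule nondecreasing_at[where f = ?W and f' = "\<lambda>x. (\<nu>\<^sub>1 - \<nu>\<^sub>0) * (wO (m\<^sup>2) \<nu>\<^sub>0 x * wO (m\<^sup>2) \<nu>\<^sub>1 x)"])
    fix x
    show "(?W has_real_derivative (\<nu>\<^sub>1 - \<nu>\<^sub>0) * (wO (m\<^sup>2) \<nu>\<^sub>0 x * wO (m\<^sup>2) \<nu>\<^sub>1 x)) (at x)"
      by (auto intro!: derivative_eq_intros simp: algebra_simps)
    assume "x \<in> {0<..<y}"
    then show "0 \<le> (\<nu>\<^sub>1 - \<nu>\<^sub>0) * (wO (m\<^sup>2) \<nu>\<^sub>0 x * wO (m\<^sup>2) \<nu>\<^sub>1 x)"
      using assms by (intro mult_nonneg_nonneg wO_nonneg) auto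
  qed (use assms in auto)
  then show ?thesis
    using wO_pos[of \<nu>\<^sub>0 m y] wO_pos[of \<nu>\<^sub>1 m y] assms by (simp add: field_simps)
qed

text \<open>Splits off a positive factor. In the remaining bracket the logarithmic derivative of wO
  and the squared potential can be compared separately when \<nu> varies.\<close>

lemma wN_sign:
  assumes "0 < \<nu>" "\<nu> \<le> m" "y > 0"
  shows "wN (m\<^sup>2) \<nu> y = m\<^sup>2 * y * wO (m\<^sup>2) \<nu> y *
     (wO' (m\<^sup>2) \<nu> y / wO (m\<^sup>2) \<nu> y - (m\<^sup>2 * y\<^sup>2 - \<nu>)\<^sup>2 / (m\<^sup>2 * y))"
  using wO_pos[OF assms] assms by (simp add: wN_def field_simps)

text \<open>\<open>wE_neumann_difference\<close> bounds the potential at a nearby Neumann zero by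
  functions of Z alone: from below by ql to the right of Z0, from above by qu to the left. Both
  touch q at Z0 with the same slope. Hence on each side the bracket in \<open>wN_sign\<close> is
  bounded by a function of Z that vanishes at Z0 and has there the same negative derivative.\<close>

theorem wN_transversal:
  assumes m: "0 < \<nu>\<^sub>0" "\<nu>\<^sub>0 \<le> m" and Z0: "Z\<^sub>0 > 0" "wE' (m\<^sup>2) \<nu>\<^sub>0 Z\<^sub>0 = 0" and N: "wN (m\<^sup>2) \<nu>\<^sub>0 Z\<^sub>0 = 0"
  shows "\<exists>e>0. \<forall>\<nu> Z. 0 < \<nu> \<longrightarrow> \<nu> \<le> m \<longrightarrow> 0 < Z \<longrightarrow> \<bar>Z - Z\<^sub>0\<bar> < e \<longrightarrow> wE' (m\<^sup>2) \<nu> Z = 0 \<longrightarrow>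
     (Z < Z\<^sub>0 \<longrightarrow> wN (m\<^sup>2) \<nu> Z > 0) \<and> (Z\<^sub>0 < Z \<longrightarrow> wN (m\<^sup>2) \<nu> Z < 0)"
proof -
  define q where "q = m\<^sup>2 * Z\<^sub>0\<^sup>2 - \<nu>\<^sub>0"
  define r where "r y = wO' (m\<^sup>2) \<nu>\<^sub>0 y / wO (m\<^sup>2) \<nu>\<^sub>0 y" for y
  define ql where "ql Z = m\<^sup>2 * Z\<^sup>2 - \<nu>\<^sub>0 - (Z - Z\<^sub>0) * (m\<^sup>2 * Z\<^sup>2 - \<nu>\<^sub>0) / Z\<^sub>0" for Z
  define qu where "qu Z = m\<^sup>2 * Z\<^sup>2 - \<nu>\<^sub>0 + (Z\<^sub>0 - Z) * q / Z" for Z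
  have m0: "m > 0" using m by simp
  have q: "q > 0" using wE_neumann_potential_pos[OF m, of Z\<^sub>0] Z0 by (simp add: q_def)
  have O: "wO (m\<^sup>2) \<nu>\<^sub>0 Z\<^sub>0 > 0" by (rule wO_pos[OF m Z0(1)])
  have r0: "r Z\<^sub>0 = q\<^sup>2 / (m\<^sup>2 * Z\<^sub>0)"
    using N wN_sign[OF m Z0(1)] O m0 Z0 by (simp add: r_def q_def)
  have dr: "(r has_real_derivative q - (r Z\<^sub>0)\<^sup>2) (at Z\<^sub>0)"
    using O unfolding r_def[abs_def] q_def
    by (auto intro!: derivative_eq_intros simp: field_simps power2_eq_square)
  \<comment> \<open>The expression equals 3 q (q / (m^2 Z0^2) - 1) - (r Z0)^2, and q < m^2 Z0^2
    because \<open>\<nu>\<^sub>0 > 0\<close>.\<close>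
  have slope: "q - (r Z\<^sub>0)\<^sup>2 - (2 * q * (2 * m\<^sup>2 * Z\<^sub>0 - q / Z\<^sub>0) / (m\<^sup>2 * Z\<^sub>0) - q\<^sup>2 / (m\<^sup>2 * Z\<^sub>0\<^sup>2)) < 0"
  proof -
    have "q - (2 * q * (2 * m\<^sup>2 * Z\<^sub>0 - q / Z\<^sub>0) / (m\<^sup>2 * Z\<^sub>0) - q\<^sup>2 / (m\<^sup>2 * Z\<^sub>0\<^sup>2))
      = 3 * q * (q / (m\<^sup>2 * Z\<^sub>0\<^sup>2) - 1)"
      using m0 Z0 by (simp add: field_simps power2_eq_square)
    moreover have "q / (m\<^sup>2 * Z\<^sub>0\<^sup>2) - 1 < 0" using m0 Z0 m by (simp add: q_def field_simps)
    ultimately show ?thesis using q by (smt (verit) mult_pos_neg zero_le_power2)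
  qed
  have dB: "((\<lambda>Z. r Z - (f Z)\<^sup>2 / (m\<^sup>2 * Z)) has_real_derivative
      q - (r Z\<^sub>0)\<^sup>2 - (2 * q * (2 * m\<^sup>2 * Z\<^sub>0 - q / Z\<^sub>0) / (m\<^sup>2 * Z\<^sub>0) - q\<^sup>2 / (m\<^sup>2 * Z\<^sub>0\<^sup>2))) (at Z\<^sub>0)"
    if f: "f Z\<^sub>0 = q" "(f has_real_derivative 2 * m\<^sup>2 * Z\<^sub>0 - q / Z\<^sub>0) (at Z\<^sub>0)" for f
    using m0 Z0 by (auto intro!: derivative_eq_intros dr f(2) simp: f(1)) (simp add: field_simps power2_eq_square)
  have dl: "(ql has_real_derivative 2 * m\<^sup>2 * Z\<^sub>0 - q / Z\<^sub>0) (at Z\<^sub>0)"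
    unfolding ql_def[abs_def] q_def using Z0 by (auto intro!: derivative_eq_intros simp: field_simps power2_eq_square)
  have du: "(qu has_real_derivative 2 * m\<^sup>2 * Z\<^sub>0 - q / Z\<^sub>0) (at Z\<^sub>0)"
    unfolding qu_def[abs_def] using Z0 by (auto intro!: derivative_eq_intros simp: field_simps power2_eq_square)
  have l0: "ql Z\<^sub>0 = q" "qu Z\<^sub>0 = q" by (auto simp: ql_def qu_def q_def)
  have B0: "r Z\<^sub>0 - q\<^sup>2 / (m\<^sup>2 * Z\<^sub>0) = 0" using r0 by simp
  obtain e1 where e1: "e1 > 0" "\<And>h. 0 < h \<Longrightarrow> h < e1 \<Longrightarrow> r (Z\<^sub>0 + h) - (ql (Z\<^sub>0 + h))\<^sup>2 / (m\<^sup>2 * (Z\<^sub>0 + h)) < 0"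
    using has_real_derivative_neg_dec_right[OF dB[OF l0(1) dl] slope] B0 by (auto simp: l0)
  obtain e2 where e2: "e2 > 0" "\<And>h. 0 < h \<Longrightarrow> h < e2 \<Longrightarrow> r (Z\<^sub>0 - h) - (qu (Z\<^sub>0 - h))\<^sup>2 / (m\<^sup>2 * (Z\<^sub>0 - h)) > 0"
    using has_real_derivative_neg_dec_left[OF dB[OF l0(2) du] slope] B0 by (auto simp: l0)
  \<comment> \<open>The lower bound ql has to be nonnegative before its square can be compared with
    that of the potential.\<close>
  have "isCont ql Z\<^sub>0" by (rule DERIV_isCont[OF dl])
  then obtain e3 where e3: "e3 > 0" "\<And>Z. \<bar>Z - Z\<^sub>0\<bar> < e3 \<Longrightarrow> ql Z > 0"
    using q l0 unfolding continuous_at_eps_delta by (metis abs_diff_less_iff dist_real_def diff_self less_diff_eq add_0)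
  show ?thesis
  proof (intro exI[of _ "min e1 (min e2 e3)"] conjI allI impI)
    fix \<nu> Z assume *: "0 < \<nu>" "\<nu> \<le> m" "0 < Z" "\<bar>Z - Z\<^sub>0\<bar> < min e1 (min e2 e3)" "wE' (m\<^sup>2) \<nu> Z = 0"
    have pre: "m\<^sup>2 * Z * wO (m\<^sup>2) \<nu> Z > 0" using wO_pos[OF *(1-3)] * m0 by simp
    have qZ: "\<nu> < m\<^sup>2 * Z\<^sup>2" using wE_neumann_potential_pos[OF *(1,2), of Z] * by simp
    { assume "Z\<^sub>0 < Z"
      note diff = wE_neumann_difference[OF m *(1,2) Z0(1) \<open>Z\<^sub>0 < Z\<close> Z0(2) *(5)]
      have "wO' (m\<^sup>2) \<nu> Z / wO (m\<^sup>2) \<nu> Z \<le> r Z"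
        unfolding r_def using diff m * by (intro wO_ratio_antimono) auto
      moreover have "r Z < (ql Z)\<^sup>2 / (m\<^sup>2 * Z)" using e1(2)[of "Z - Z\<^sub>0"] * \<open>Z\<^sub>0 < Z\<close> by simp
      moreover have "(ql Z)\<^sup>2 / (m\<^sup>2 * Z) \<le> (m\<^sup>2 * Z\<^sup>2 - \<nu>)\<^sup>2 / (m\<^sup>2 * Z)"
      proof (intro divide_right_mono power_mono)
        have "\<nu> - \<nu>\<^sub>0 \<le> (Z - Z\<^sub>0) * (m\<^sup>2 * Z\<^sup>2 - \<nu>) / Z\<^sub>0" using diff(2) Z0 by (simp add: pos_le_divide_eq)
        also have "\<dots> \<le> (Z - Z\<^sub>0) * (m\<^sup>2 * Z\<^sup>2 - \<nu>\<^sub>0) / Z\<^sub>0"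
          using diff(1) \<open>Z\<^sub>0 < Z\<close> Z0 by (intro divide_right_mono mult_left_mono) auto
        finally show "ql Z \<le> m\<^sup>2 * Z\<^sup>2 - \<nu>" by (simp add: ql_def)
        show "0 \<le> ql Z" using e3(2)[of Z] * by simp
      qed (use * in simp)
      ultimately have "wO' (m\<^sup>2) \<nu> Z / wO (m\<^sup>2) \<nu> Z - (m\<^sup>2 * Z\<^sup>2 - \<nu>)\<^sup>2 / (m\<^sup>2 * Z) < 0" by simp
      then show "wN (m\<^sup>2) \<nu> Z < 0" unfolding wN_sign[OF *(1-3)] using pre by (rule mult_pos_neg[rotated]) }
    { assume "Z < Z\<^sub>0"
      note diff = wE_neumann_difference[OF *(1,2) m *(3) \<open>Z < Z\<^sub>0\<close> *(5) Z0(2)]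
      have "r Z \<le> wO' (m\<^sup>2) \<nu> Z / wO (m\<^sup>2) \<nu> Z"
        unfolding r_def using diff m * by (intro wO_ratio_antimono) auto
      moreover have "(qu Z)\<^sup>2 / (m\<^sup>2 * Z) < r Z" using e2(2)[of "Z\<^sub>0 - Z"] * \<open>Z < Z\<^sub>0\<close> by simp
      moreover have "(m\<^sup>2 * Z\<^sup>2 - \<nu>)\<^sup>2 / (m\<^sup>2 * Z) \<le> (qu Z)\<^sup>2 / (m\<^sup>2 * Z)"
      proof (intro divide_right_mono power_mono)
        have "\<nu>\<^sub>0 - \<nu> \<le> (Z\<^sub>0 - Z) * q / Z" using diff(2) *(3) by (simp add: pos_le_divide_eq q_def)
        then show "m\<^sup>2 * Z\<^sup>2 - \<nu> \<le> qu Z" by (simp add: qu_def)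
        show "0 \<le> m\<^sup>2 * Z\<^sup>2 - \<nu>" using qZ by simp
      qed (use * in simp)
      ultimately have "wO' (m\<^sup>2) \<nu> Z / wO (m\<^sup>2) \<nu> Z - (m\<^sup>2 * Z\<^sup>2 - \<nu>)\<^sup>2 / (m\<^sup>2 * Z) > 0" by simp
      then show "wN (m\<^sup>2) \<nu> Z > 0" unfolding wN_sign[OF *(1-3)] using pre by simp }
  qed (use e1 e2 e3 in simp)
qed



subsection \<open>The truncated nonlinear flow\<close>

text \<open>Bounded and Lipschitz with one constant. Boundedness makes the class closed under
  products, so a polynomial in clipped coordinates is Lipschitz by composition.\<close>

definition blip :: "('a::real_normed_vector \<Rightarrow> real) \<Rightarrow> bool" where
  "blip f \<longleftrightarrow> (\<exists>C. \<forall>x y. \<bar>f x\<bar> \<le> C \<and> \<bar>f x - f y\<bar> \<le> C * norm (x - y))"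

lemma blip_const [intro]: "blip (\<lambda>x. c)"
  unfolding blip_def by (intro exI[of _ "\<bar>c\<bar>"]) auto

lemma blip_add [intro]:
  assumes "blip f" "blip g" shows "blip (\<lambda>x. f x + g x)"
proof -
  obtain C D where C: "\<And>x y. \<bar>f x\<bar> \<le> C" "\<And>x y. \<bar>f x - f y\<bar> \<le> C * norm (x - y)"
    and D: "\<And>x y. \<bar>g x\<bar> \<le> D" "\<And>x y. \<bar>g x - g y\<bar> \<le> D * norm (x - y)"
    using assms unfolding blip_def by blast
  have "\<bar>f x + g x\<bar> \<le> C + D \<and> \<bar>f x + g x - (f y + g y)\<bar> \<le> (C + D) * norm (x - y)" for x y
    using C(1)[of x] D(1)[of x] C(2)[of x y] D(2)[of x y] unfolding distrib_right by linarith
  then show ?thesis unfolding blip_def by blast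
qed

lemma blip_mult [intro]:
  assumes "blip f" "blip g" shows "blip (\<lambda>x. f x * g x)"
proof -
  obtain C D where C: "\<And>x y. \<bar>f x\<bar> \<le> C" "\<And>x y. \<bar>f x - f y\<bar> \<le> C * norm (x - y)"
    and D: "\<And>x y. \<bar>g x\<bar> \<le> D" "\<And>x y. \<bar>g x - g y\<bar> \<le> D * norm (x - y)"
    using assms unfolding blip_def by blast
  have C0: "C \<ge> 0" and D0: "D \<ge> 0" using C(1) D(1) by (meson abs_ge_zero order_trans)+
  have "\<bar>f x * g x\<bar> \<le> 2 * C * D \<and> \<bar>f x * g x - f y * g y\<bar> \<le> (2 * C * D) * norm (x - y)" for x y
  proof
    have "\<bar>f x * g x\<bar> \<le> C * D" unfolding abs_mult using C D C0 by (intro mult_mono) auto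
    then show "\<bar>f x * g x\<bar> \<le> 2 * C * D" using mult_nonneg_nonneg[OF C0 D0] by linarith
    have "f x * g x - f y * g y = f x * (g x - g y) + (f x - f y) * g y" by (simp add: algebra_simps)
    also have "\<bar>\<dots>\<bar> \<le> \<bar>f x\<bar> * \<bar>g x - g y\<bar> + \<bar>f x - f y\<bar> * \<bar>g y\<bar>"
      by (metis abs_mult abs_triangle_ineq)
    also have "\<dots> \<le> C * (D * norm (x - y)) + (C * norm (x - y)) * D"
      using C D C0 D0 by (intro add_mono mult_mono) auto
    finally show "\<bar>f x * g x - f y * g y\<bar> \<le> (2 * C * D) * norm (x - y)" by (simp add: algebra_simps)
  qed
  then show ?thesis unfolding blip_def by blast
qed

lemma blip_power2 [intro]: "blip f \<Longrightarrow> blip (\<lambda>x. (f x)\<^sup>2)"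
  unfolding power2_eq_square by (rule blip_mult)

lemma blip_diff [intro]: "blip f \<Longrightarrow> blip g \<Longrightarrow> blip (\<lambda>x. f x - g x)"
  using blip_add[OF _ blip_mult[OF blip_const, of g "-1"], of f] by simp

definition clip :: "real \<Rightarrow> real \<Rightarrow> real" where "clip M x = max (- M) (min M x)"

lemma clip_id: "\<bar>x\<bar> \<le> M \<Longrightarrow> clip M x = x"
  by (auto simp: clip_def)

lemma blip_clip:
  assumes "\<And>x y. \<bar>s x - s y\<bar> \<le> norm (x - y)"
  shows "blip (\<lambda>x. clip M (s x))"
proof -
  have "\<bar>clip M (s x)\<bar> \<le> \<bar>M\<bar> + 1 \<and> \<bar>clip M (s x) - clip M (s y)\<bar> \<le> (\<bar>M\<bar> + 1) * norm (x - y)" for x y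
  proof
    show "\<bar>clip M (s x)\<bar> \<le> \<bar>M\<bar> + 1" by (auto simp: clip_def)
    have "\<bar>clip M (s x) - clip M (s y)\<bar> \<le> \<bar>s x - s y\<bar>" by (auto simp: clip_def)
    also have "\<dots> \<le> 1 * norm (x - y)" using assms by simp
    also have "\<dots> \<le> (\<bar>M\<bar> + 1) * norm (x - y)" by (intro mult_right_mono) auto
    finally show "\<bar>clip M (s x) - clip M (s y)\<bar> \<le> (\<bar>M\<bar> + 1) * norm (x - y)" .
  qed
  then show ?thesis unfolding blip_def by blast
qed

type_synonym state = "real \<times> real \<times> real \<times> real \<times> real \<times> real \<times> real"

text \<open>The state is \<open>(\<psi>, \<psi>', a, j, h, \<epsilon>, \<nu>)\<close> with \<open>\<epsilon> = \<alpha>\<^sup>2\<close>, \<open>\<nu> = \<kappa>\<^sup>2\<close> and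
  \<open>a' = h + \<epsilon> j\<close>, \<open>j' = \<psi>\<^sup>2 a\<close>, so that the condition \<open>a'(-d) = a'(d)\<close> becomes \<open>j = 0\<close>
  at the right end, also for \<open>\<epsilon> = 0\<close>. Clipping the state makes the field globally Lipschitz.\<close>

definition field :: "real \<Rightarrow> state \<Rightarrow> state" where
  "field M x = (let
     \<psi> = clip M (fst x); p = clip M (fst (snd x)); a = clip M (fst (snd (snd x)));
     j = clip M (fst (snd (snd (snd x)))); h = clip M (fst (snd (snd (snd (snd x)))));
     \<epsilon> = clip M (fst (snd (snd (snd (snd (snd x)))))); \<nu> = clip M (snd (snd (snd (snd (snd (snd x))))))
     in (p, \<nu> * (\<epsilon> * \<psi>\<^sup>2 + a\<^sup>2 - 1) * \<psi>, h + \<epsilon> * j, \<psi>\<^sup>2 * a, 0, 0, 0))"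

lemma norm_state_components:
  fixes x y :: state
  shows "\<bar>fst x - fst y\<bar> \<le> norm (x - y)" "\<bar>fst (snd x) - fst (snd y)\<bar> \<le> norm (x - y)"
    "\<bar>fst (snd (snd x)) - fst (snd (snd y))\<bar> \<le> norm (x - y)"
    "\<bar>fst (snd (snd (snd x))) - fst (snd (snd (snd y)))\<bar> \<le> norm (x - y)"
    "\<bar>fst (snd (snd (snd (snd x)))) - fst (snd (snd (snd (snd y))))\<bar> \<le> norm (x - y)"
    "\<bar>fst (snd (snd (snd (snd (snd x))))) - fst (snd (snd (snd (snd (snd y)))))\<bar> \<le> norm (x - y)"
    "\<bar>snd (snd (snd (snd (snd (snd x))))) - snd (snd (snd (snd (snd (snd y)))))\<bar> \<le> norm (x - y)"
proof -
  have f: "norm (fst z) \<le> norm z" "norm (snd z) \<le> norm z" for z :: "'a::real_normed_vector \<times> 'b::real_normed_vector"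
    using norm_fst_le[of "fst z" "snd z"] norm_snd_le[of "snd z" "fst z"] by auto
  let ?z = "x - y"
  note s1 = f(2)[of ?z] note s2 = order_trans[OF f(2)[of "snd ?z"] s1]
  note s3 = order_trans[OF f(2)[of "snd (snd ?z)"] s2]
  note s4 = order_trans[OF f(2)[of "snd (snd (snd ?z))"] s3]
  note s5 = order_trans[OF f(2)[of "snd (snd (snd (snd ?z)))"] s4]
  note s6 = order_trans[OF f(2)[of "snd (snd (snd (snd (snd ?z))))"] s5]
  show "\<bar>fst x - fst y\<bar> \<le> norm (x - y)" using f(1)[of ?z] by simp
  show "\<bar>fst (snd x) - fst (snd y)\<bar> \<le> norm (x - y)" using order_trans[OF f(1)[of "snd ?z"] s1] by simp
  show "\<bar>fst (snd (snd x)) - fst (snd (snd y))\<bar> \<le> norm (x - y)"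
    using order_trans[OF f(1)[of "snd (snd ?z)"] s2] by simp
  show "\<bar>fst (snd (snd (snd x))) - fst (snd (snd (snd y)))\<bar> \<le> norm (x - y)"
    using order_trans[OF f(1)[of "snd (snd (snd ?z))"] s3] by simp
  show "\<bar>fst (snd (snd (snd (snd x)))) - fst (snd (snd (snd (snd y))))\<bar> \<le> norm (x - y)"
    using order_trans[OF f(1)[of "snd (snd (snd (snd ?z)))"] s4] by simp
  show "\<bar>fst (snd (snd (snd (snd (snd x))))) - fst (snd (snd (snd (snd (snd y)))))\<bar> \<le> norm (x - y)"
    using order_trans[OF f(1)[of "snd (snd (snd (snd (snd ?z))))"] s5] by simp
  show "\<bar>snd (snd (snd (snd (snd (snd x))))) - snd (snd (snd (snd (snd (snd y)))))\<bar> \<le> norm (x - y)"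
    using s6 by simp
qed

lemma norm_state_le:
  "norm (a, b, c, d, e, f, g) \<le> \<bar>a\<bar> + \<bar>b\<bar> + \<bar>c\<bar> + \<bar>d\<bar> + \<bar>e\<bar> + \<bar>f\<bar> + \<bar>g :: real\<bar>"
  for a b c d e f :: real
proof -
  note n = norm_Pair_le[of a "(b, c, d, e, f, g)"] norm_Pair_le[of b "(c, d, e, f, g)"]
    norm_Pair_le[of c "(d, e, f, g)"] norm_Pair_le[of d "(e, f, g)"] norm_Pair_le[of e "(f, g)"]
    norm_Pair_le[of f g]
  from n[unfolded real_norm_def] show ?thesis by linarith
qed

lemma field_lipschitz:
  "\<exists>L\<ge>0. \<forall>x y. norm (field M x - field M y) \<le> L * norm (x - y) \<and> norm (field M x) \<le> L"
proof -
  note [intro] = blip_clip norm_state_components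
  define f1 where "f1 x = fst (field M x)" for x
  define f2 where "f2 x = fst (snd (field M x))" for x
  define f3 where "f3 x = fst (snd (snd (field M x)))" for x
  define f4 where "f4 x = fst (snd (snd (snd (field M x))))" for x
  have b: "blip f1" "blip f2" "blip f3" "blip f4"
    unfolding f1_def[abs_def] f2_def[abs_def] f3_def[abs_def] f4_def[abs_def] field_def Let_def fst_conv snd_conv
    by (intro blip_mult blip_add blip_diff blip_power2 blip_const blip_clip norm_state_components)+
  have f: "field M x = (f1 x, f2 x, f3 x, f4 x, 0, 0, 0)" for x
    by (simp add: f1_def f2_def f3_def f4_def field_def Let_def)
  obtain C1 C2 C3 C4 where C: "\<And>x y. \<bar>f1 x\<bar> \<le> C1 \<and> \<bar>f1 x - f1 y\<bar> \<le> C1 * norm (x - y)"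
    "\<And>x y. \<bar>f2 x\<bar> \<le> C2 \<and> \<bar>f2 x - f2 y\<bar> \<le> C2 * norm (x - y)"
    "\<And>x y. \<bar>f3 x\<bar> \<le> C3 \<and> \<bar>f3 x - f3 y\<bar> \<le> C3 * norm (x - y)"
    "\<And>x y. \<bar>f4 x\<bar> \<le> C4 \<and> \<bar>f4 x - f4 y\<bar> \<le> C4 * norm (x - y)"
    using b unfolding blip_def by blast
  show ?thesis
  proof (intro exI[of _ "C1 + C2 + C3 + C4"] conjI allI)
    show "0 \<le> C1 + C2 + C3 + C4"
      using C(1)[of 0 0] C(2)[of 0 0] C(3)[of 0 0] C(4)[of 0 0] by linarith
    fix x y
    have "norm (field M x - field M y) \<le> \<bar>f1 x - f1 y\<bar> + \<bar>f2 x - f2 y\<bar> + \<bar>f3 x - f3 y\<bar> + \<bar>f4 x - f4 y\<bar>"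
      using norm_state_le[of "f1 x - f1 y" "f2 x - f2 y" "f3 x - f3 y" "f4 x - f4 y" 0 0 0]
      by (simp add: f zero_prod_def)
    also have "\<dots> \<le> C1 * norm (x - y) + C2 * norm (x - y) + C3 * norm (x - y) + C4 * norm (x - y)"
      using C by (intro add_mono) auto
    finally show "norm (field M x - field M y) \<le> (C1 + C2 + C3 + C4) * norm (x - y)"
      by (simp add: algebra_simps)
    have "norm (field M x) \<le> \<bar>f1 x\<bar> + \<bar>f2 x\<bar> + \<bar>f3 x\<bar> + \<bar>f4 x\<bar>"
      using norm_state_le[of "f1 x" "f2 x" "f3 x" "f4 x" 0 0 0] by (simp add: f zero_prod_def)
    then show "norm (field M x) \<le> C1 + C2 + C3 + C4"
      using C(1)[of x 0] C(2)[of x 0] C(3)[of x 0] C(4)[of x 0] by linarith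
  qed
qed

definition flow :: "real \<Rightarrow> state \<Rightarrow> real \<Rightarrow> state" where
  "flow M x = (SOME y. y 0 = x \<and> (\<forall>t. (y has_vector_derivative field M (y t)) (at t)))"

lemma flow: "flow M x 0 = x" "(flow M x has_vector_derivative field M (flow M x t)) (at t within S)"
proof -
  obtain L where L: "L \<ge> 0" "\<And>x y. norm (field M x - field M y) \<le> L * norm (x - y)"
    "\<And>x. norm (field M x) \<le> L" using field_lipschitz[of M] by blast
  have "L-lipschitz_on UNIV (field M)" by (rule lipschitz_onI) (use L in \<open>auto simp: dist_norm\<close>)
  then have "continuous_on UNIV (field M)" by (rule lipschitz_on_continuous_on)
  then have c: "continuous_on UNIV (\<lambda>p :: real \<times> state. field M (snd p))"
    by (rule continuous_on_compose2) (auto intro!: continuous_intros)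
  have "\<exists>y. y 0 = x \<and> (\<forall>t. (y has_vector_derivative field M (y t)) (at t))"
    by (rule picard_global[where F = "\<lambda>t. field M" and L = "\<lambda>t. L" and B = L, OF c])
      (use L in \<open>auto intro!: continuous_intros\<close>)
  from someI_ex[OF this] have *: "flow M x 0 = x \<and> (\<forall>t. (flow M x has_vector_derivative field M (flow M x t)) (at t))"
    unfolding flow_def[symmetric] .
  then show "flow M x 0 = x" by simp
  show "(flow M x has_vector_derivative field M (flow M x t)) (at t within S)"
    using * by (auto intro: has_vector_derivative_at_within)
qed

text \<open>As h, \<epsilon> and \<nu> are components of the state, this is Lipschitz dependence on
  the parameters too.\<close>

lemma flow_lipschitz: "\<exists>C\<ge>0. \<forall>x y. \<forall>t\<in>{0..T}. norm (flow M x t - flow M y t) \<le> C * norm (x - y)"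
proof -
  obtain L where L: "L \<ge> 0" "\<And>x y. norm (field M x - field M y) \<le> L * norm (x - y)"
    using field_lipschitz[of M] by blast
  define C where "C = exp ((2 * L + 1) * T) * (1 + \<bar>T\<bar>)"
  have "norm (flow M x t - flow M y t) \<le> C * norm (x - y)" if "t \<in> {0..T}" for x y t
  proof -
    have "norm (flow M x t - flow M y t) \<le> exp ((2 * L + 1) * T) * (1 + T) * (norm (flow M x 0 - flow M y 0) + 0)"
      by (rule ode_dependence[where F = "\<lambda>t. field M" and z' = "\<lambda>t. field M (flow M y t)", OF flow(2) flow(2)])
        (use L that in auto)
    moreover have "\<bar>T\<bar> = T" using that by simp
    ultimately show ?thesis by (simp add: C_def flow(1))
  qed
  moreover have "C \<ge> 0" by (simp add: C_def)
  ultimately show ?thesis by blast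
qed

lemma flow_continuous:
  "continuous_on (UNIV \<times> {0..T}) (\<lambda>(x, t). flow M x t)"
proof -
  obtain C where C: "C \<ge> 0" "\<And>x y t. t \<in> {0..T} \<Longrightarrow> norm (flow M x t - flow M y t) \<le> C * norm (x - y)"
    using flow_lipschitz[of T M] by blast
  show ?thesis unfolding continuous_on_def
  proof (safe)
    fix x0 :: state and t0 assume t0: "t0 \<in> {0..T}"
    let ?F = "at (x0, t0) within UNIV \<times> {0..T}"
    have lim: "(fst \<longlongrightarrow> x0) ?F" "(snd \<longlongrightarrow> t0) ?F" by (auto intro!: tendsto_eq_intros)
    have "isCont (flow M x0) t0"
      using flow(2)[of M x0 t0 UNIV] by (rule has_vector_derivative_continuous)
    then have 1: "((\<lambda>p. flow M x0 (snd p)) \<longlongrightarrow> flow M x0 t0) ?F"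
      by (rule isCont_tendsto_compose) (rule lim)
    have 2: "((\<lambda>p. flow M (fst p) (snd p) - flow M x0 (snd p)) \<longlongrightarrow> 0) ?F"
    proof (rule Lim_null_comparison)
      show "((\<lambda>p. C * norm (fst p - x0)) \<longlongrightarrow> 0) ?F"
        using lim(1) by (auto intro!: tendsto_eq_intros)
      show "\<forall>\<^sub>F p in ?F. norm (flow M (fst p) (snd p) - flow M x0 (snd p)) \<le> C * norm (fst p - x0)"
        by (rule eventually_at_filter[THEN iffD2]) (auto intro!: always_eventually C)
    qed
    from tendsto_add[OF 2 1] show "((\<lambda>(x, t). flow M x t) \<longlongrightarrow> flow M x0 t0) ?F"
      by (simp add: case_prod_unfold)
  qed
qed

text \<open>The unclipped system. Derivatives are relative to the interval, so that functions given
  only there, such as shifted solutions of the boundary value problem, qualify.\<close>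

definition orbit :: "real \<Rightarrow> real \<Rightarrow> real \<Rightarrow> real \<Rightarrow> (real \<Rightarrow> real) \<Rightarrow> (real \<Rightarrow> real) \<Rightarrow>
    (real \<Rightarrow> real) \<Rightarrow> (real \<Rightarrow> real) \<Rightarrow> bool" where
  "orbit \<nu> \<epsilon> h T \<psi> p a j \<longleftrightarrow> (\<forall>t\<in>{0..T}.
     (\<psi> has_real_derivative p t) (at t within {0..T}) \<and>
     (p has_real_derivative \<nu> * (\<epsilon> * (\<psi> t)\<^sup>2 + (a t)\<^sup>2 - 1) * \<psi> t) (at t within {0..T}) \<and>
     (a has_real_derivative h + \<epsilon> * j t) (at t within {0..T}) \<and>
     (j has_real_derivative (\<psi> t)\<^sup>2 * a t) (at t within {0..T}))"

lemma flow_unique: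
  assumes y: "\<And>t. t \<in> {0..T} \<Longrightarrow> (y has_vector_derivative field M (y t)) (at t within {0..T})" and "t \<in> {0..T}"
  shows "flow M (y 0) t = y t"
proof -
  obtain L where L: "L \<ge> 0" "\<And>x y. norm (field M x - field M y) \<le> L * norm (x - y)"
    using field_lipschitz[of M] by blast
  have "norm (flow M (y 0) t - y t) \<le> exp ((2 * L + 1) * T) * (1 + T) * (norm (flow M (y 0) 0 - y 0) + 0)"
    by (rule ode_dependence[where F = "\<lambda>t. field M" and z' = "\<lambda>t. field M (y t)", OF flow(2) y])
      (use L assms in auto)
  then show ?thesis by (simp add: flow(1))
qed

text \<open>Along a solution below the clipping level the truncation is inactive, so the flow sees
  every such solution, whatever its origin. Uniqueness rests on this direction, existence on the
  converse \<open>flow_orbit\<close>.\<close>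

lemma orbit_eq_flow:
  assumes orb: "orbit \<nu> \<epsilon> h T \<psi> p a j"
    and bd: "\<And>t. t \<in> {0..T} \<Longrightarrow> \<bar>\<psi> t\<bar> \<le> M \<and> \<bar>p t\<bar> \<le> M \<and> \<bar>a t\<bar> \<le> M \<and> \<bar>j t\<bar> \<le> M"
    and par: "\<bar>h\<bar> \<le> M" "\<bar>\<epsilon>\<bar> \<le> M" "\<bar>\<nu>\<bar> \<le> M" and t: "t \<in> {0..T}"
  shows "flow M (\<psi> 0, p 0, a 0, j 0, h, \<epsilon>, \<nu>) t = (\<psi> t, p t, a t, j t, h, \<epsilon>, \<nu>)"
proof (rule flow_unique[where y = "\<lambda>t. (\<psi> t, p t, a t, j t, h, \<epsilon>, \<nu>)", OF _ t])
  fix t assume t: "t \<in> {0..T}"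
  note * = orb[unfolded orbit_def, rule_format, OF t, unfolded has_real_derivative_iff_has_vector_derivative]
  have eq: "field M (\<psi> t, p t, a t, j t, h, \<epsilon>, \<nu>) =
     (p t, \<nu> * (\<epsilon> * (\<psi> t)\<^sup>2 + (a t)\<^sup>2 - 1) * \<psi> t, h + \<epsilon> * j t, (\<psi> t)\<^sup>2 * a t, 0, 0, 0)"
    using bd[OF t] par by (simp add: field_def Let_def clip_id)
  show "((\<lambda>t. (\<psi> t, p t, a t, j t, h, \<epsilon>, \<nu>)) has_vector_derivative
      field M (\<psi> t, p t, a t, j t, h, \<epsilon>, \<nu>)) (at t within {0..T})"
    unfolding eq using * by (intro has_vector_derivative_Pair has_vector_derivative_const) auto
qed

definition f\<psi> where "f\<psi> M x t = fst (flow M x t)"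
definition fp where "fp M x t = fst (snd (flow M x t))"
definition fa where "fa M x t = fst (snd (snd (flow M x t)))"
definition fj where "fj M x t = fst (snd (snd (snd (flow M x t))))"

lemmas flow_components = f\<psi>_def fp_def fa_def fj_def

lemma flow_parameters: "snd (snd (snd (snd (flow M x t)))) = snd (snd (snd (snd x)))"
proof -
  let ?g = "\<lambda>t. snd (snd (snd (snd (flow M x t))))"
  have s: "bounded_linear (\<lambda>z. snd (snd (snd (snd z))) :: real \<times> real \<times> real)"
    by (intro bounded_linear_compose[OF bounded_linear_snd] bounded_linear_snd)
  have "(?g has_vector_derivative 0) (at t within UNIV)" for t
    using bounded_linear.has_vector_derivative[OF s flow(2)[of M x t UNIV]]
    by (simp add: field_def Let_def zero_prod_def)
  then have "?g t = ?g 0"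
    using has_vector_derivative_zero_constant[of UNIV ?g] by (metis convex_UNIV UNIV_I)
  then show ?thesis by (simp add: flow(1))
qed

lemma flow_orbit:
  assumes bd: "\<And>t. t \<in> {0..T} \<Longrightarrow> \<bar>f\<psi> M x t\<bar> \<le> M \<and> \<bar>fp M x t\<bar> \<le> M \<and> \<bar>fa M x t\<bar> \<le> M \<and> \<bar>fj M x t\<bar> \<le> M"
    and par: "snd (snd (snd (snd x))) = (h, \<epsilon>, \<nu>)" "\<bar>h\<bar> \<le> M" "\<bar>\<epsilon>\<bar> \<le> M" "\<bar>\<nu>\<bar> \<le> M"
  shows "orbit \<nu> \<epsilon> h T (f\<psi> M x) (fp M x) (fa M x) (fj M x)"
  unfolding orbit_def
proof (intro ballI)
  fix t assume t: "t \<in> {0..T}"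
  have fl: "flow M x t = (f\<psi> M x t, fp M x t, fa M x t, fj M x t, h, \<epsilon>, \<nu>)"
    using flow_parameters[of M x t] par by (metis flow_components prod.collapse)
  have eq: "field M (flow M x t) = (fp M x t, \<nu> * (\<epsilon> * (f\<psi> M x t)\<^sup>2 + (fa M x t)\<^sup>2 - 1) * f\<psi> M x t,
      h + \<epsilon> * fj M x t, (f\<psi> M x t)\<^sup>2 * fa M x t, 0, 0, 0)"
    unfolding fl using bd[OF t] par by (simp add: field_def Let_def clip_id)
  note D = flow(2)[of M x t "{0..T}", unfolded eq]
  note s = bounded_linear_snd bounded_linear_compose[OF bounded_linear_snd bounded_linear_snd]
    bounded_linear_compose[OF bounded_linear_snd bounded_linear_compose[OF bounded_linear_snd bounded_linear_snd]]
  show "(f\<psi> M x has_real_derivative fp M x t) (at t within {0..T}) \<and>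
     (fp M x has_real_derivative \<nu> * (\<epsilon> * (f\<psi> M x t)\<^sup>2 + (fa M x t)\<^sup>2 - 1) * f\<psi> M x t) (at t within {0..T}) \<and>
     (fa M x has_real_derivative h + \<epsilon> * fj M x t) (at t within {0..T}) \<and>
     (fj M x has_real_derivative (f\<psi> M x t)\<^sup>2 * fa M x t) (at t within {0..T})"
    using bounded_linear.has_vector_derivative[OF bounded_linear_fst D]
      bounded_linear.has_vector_derivative[OF bounded_linear_compose[OF bounded_linear_fst s(1)] D]
      bounded_linear.has_vector_derivative[OF bounded_linear_compose[OF bounded_linear_fst s(2)] D]
      bounded_linear.has_vector_derivative[OF bounded_linear_compose[OF bounded_linear_fst s(3)] D]
    unfolding has_real_derivative_iff_has_vector_derivative
    by (simp add: f\<psi>_def[abs_def] fp_def[abs_def] fa_def[abs_def] fj_def[abs_def])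
qed

subsection \<open>Orbits and boundary value problems\<close>

lemma deriv_within_shift:
  fixes f :: "real \<Rightarrow> real"
  assumes "(f has_real_derivative D) (at (x + s) within {a + s..b + s})"
  shows "((\<lambda>x. f (x + s)) has_real_derivative D) (at x within {a..b})"
proof -
  have "((\<lambda>x. x + s) has_real_derivative 1) (at x within {a..b})" by (auto intro!: derivative_eq_intros)
  from DERIV_image_chain[OF _ this, of f D] assms show ?thesis by (simp add: o_def)
qed

lemma ideriv_eq:
  assumes "d > 0" "x \<in> {-d..d}" "(f has_real_derivative D) (at x within {-d..d})"
  shows "ideriv d f x = D"
  unfolding ideriv_def using assms
  by (intro vector_derivative_within_closed_interval)
    (auto simp: has_real_derivative_iff_has_vector_derivative)

lemma second_order_bvpI:
  assumes d: "d > 0" and f: "\<And>x. x \<in> {-d..d} \<Longrightarrow> (f has_real_derivative f' x) (at x within {-d..d})"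
    and f': "\<And>x. x \<in> {-d..d} \<Longrightarrow> (f' has_real_derivative g x) (at x within {-d..d})"
    and b: "f' (-d) = b" "f' d = b"
  shows "second_order_bvp d f g b"
proof -
  have eq: "ideriv d f x = f' x" if "x \<in> {-d..d}" for x using ideriv_eq[OF d that f[OF that]] .
  have "(ideriv d f has_real_derivative g x) (at x within {-d..d})" if "x \<in> {-d..d}" for x
    using has_field_derivative_transform_within[OF f'[OF that], of 1 "ideriv d f"] eq that by auto
  then show ?thesis using f eq d b by (simp add: second_order_bvp_def)
qed

lemma second_order_bvp_cmult:
  assumes d: "d > 0" and f: "second_order_bvp d f g b"
  shows "second_order_bvp d (\<lambda>x. c * f x) (\<lambda>x. c * g x) (c * b)"
  using f[unfolded second_order_bvp_def]
  by (intro second_order_bvpI[OF d, where f' = "\<lambda>x. c * ideriv d f x"]) (auto intro!: DERIV_cmult)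

lemma rescaled_imp_solution:
  assumes d: "d > 0" and r: "rescaled_solution \<kappa> d \<alpha> \<psi> a h"
  shows "solution \<kappa> d (\<lambda>x. \<alpha> * \<psi> x) a h"
  using r second_order_bvp_cmult[OF d, of \<psi> "\<lambda>x. \<kappa>\<^sup>2 * (\<alpha>\<^sup>2 * (\<psi> x)\<^sup>2 + (a x)\<^sup>2 - 1) * \<psi> x" 0 \<alpha>]
  by (simp add: rescaled_solution_def solution_def power_mult_distrib mult_ac)

lemma orbit_imp_rescaled:
  assumes d: "d > 0" and h: "h > 0" and orb: "orbit (\<kappa>\<^sup>2) (\<alpha>\<^sup>2) h (2 * d) \<psi> p a j"
    and "\<psi> 0 = 1" "p 0 = 0" "j 0 = 0" "p (2 * d) = 0" "j (2 * d) = 0"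
  shows "rescaled_solution \<kappa> d \<alpha> (\<lambda>x. \<psi> (x + d)) (\<lambda>x. a (x + d)) h"
proof -
  have sh: "((\<lambda>x. f (x + d)) has_real_derivative f' (x + d)) (at x within {-d..d})"
    if "\<And>t. t \<in> {0..2 * d} \<Longrightarrow> (f has_real_derivative f' t) (at t within {0..2 * d})" "x \<in> {-d..d}" for f f' x
    using deriv_within_shift[of f "f' (x + d)" x d "- d" d] that(1)[of "x + d"] that(2) by simp
  note o = orb[unfolded orbit_def]
  have a: "second_order_bvp d (\<lambda>x. a (x + d)) (\<lambda>x. \<alpha>\<^sup>2 * (\<psi> (x + d))\<^sup>2 * a (x + d)) h"
  proof (rule second_order_bvpI[OF d, where f' = "\<lambda>x. h + \<alpha>\<^sup>2 * j (x + d)"])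
    fix x assume x: "x \<in> {-d..d}"
    show "((\<lambda>x. a (x + d)) has_real_derivative h + \<alpha>\<^sup>2 * j (x + d)) (at x within {-d..d})"
      by (rule sh[of a "\<lambda>t. h + \<alpha>\<^sup>2 * j t", OF _ x]) (use o in blast)
    have "((\<lambda>x. j (x + d)) has_real_derivative (\<psi> (x + d))\<^sup>2 * a (x + d)) (at x within {-d..d})"
      by (rule sh[of j "\<lambda>t. (\<psi> t)\<^sup>2 * a t", OF _ x]) (use o in blast)
    then show "((\<lambda>x. h + \<alpha>\<^sup>2 * j (x + d)) has_real_derivative \<alpha>\<^sup>2 * (\<psi> (x + d))\<^sup>2 * a (x + d)) (at x within {-d..d})"
      by (auto intro!: derivative_eq_intros)
  qed (use assms in auto)
  have "second_order_bvp d (\<lambda>x. \<psi> (x + d)) (\<lambda>x. \<kappa>\<^sup>2 * (\<alpha>\<^sup>2 * (\<psi> (x + d))\<^sup>2 + (a (x + d))\<^sup>2 - 1) * \<psi> (x + d)) 0"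
  proof (rule second_order_bvpI[OF d, where f' = "\<lambda>x. p (x + d)"])
    fix x assume x: "x \<in> {-d..d}"
    show "((\<lambda>x. \<psi> (x + d)) has_real_derivative p (x + d)) (at x within {-d..d})"
      by (rule sh[of \<psi> p, OF _ x]) (use o in blast)
    show "((\<lambda>x. p (x + d)) has_real_derivative \<kappa>\<^sup>2 * (\<alpha>\<^sup>2 * (\<psi> (x + d))\<^sup>2 + (a (x + d))\<^sup>2 - 1) * \<psi> (x + d)) (at x within {-d..d})"
      by (rule sh[of p "\<lambda>t. \<kappa>\<^sup>2 * (\<alpha>\<^sup>2 * (\<psi> t)\<^sup>2 + (a t)\<^sup>2 - 1) * \<psi> t", OF _ x]) (use o in blast)
  qed (use assms in auto)
  with a show ?thesis using assms by (simp add: rescaled_solution_def)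
qed

lemma orbit_ideriv:
  assumes d: "d > 0" and orb: "orbit \<nu> \<epsilon> h (2 * d) \<psi> p a j" and x: "x \<in> {-d..d}"
  shows "ideriv d (\<lambda>x. c * \<psi> (x + d)) x = c * p (x + d)" "ideriv d (\<lambda>x. a (x + d)) x = h + \<epsilon> * j (x + d)"
proof -
  have "(\<psi> has_real_derivative p (x + d)) (at (x + d) within {0..2 * d})"
    "(a has_real_derivative h + \<epsilon> * j (x + d)) (at (x + d) within {0..2 * d})"
    using orb x unfolding orbit_def by auto
  then have "((\<lambda>x. \<psi> (x + d)) has_real_derivative p (x + d)) (at x within {-d..d})"
    "((\<lambda>x. a (x + d)) has_real_derivative h + \<epsilon> * j (x + d)) (at x within {-d..d})"
    using deriv_within_shift[of _ _ x d "-d" d] by auto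
  then show "ideriv d (\<lambda>x. c * \<psi> (x + d)) x = c * p (x + d)" "ideriv d (\<lambda>x. a (x + d)) x = h + \<epsilon> * j (x + d)"
    by (auto intro!: ideriv_eq[OF d x] DERIV_cmult)
qed

lemma rescaled_imp_orbit:
  assumes r: "rescaled_solution \<kappa> d \<alpha> \<psi> a h" and d: "d > 0" and \<alpha>: "\<alpha> > 0"
  defines "j \<equiv> \<lambda>x. (ideriv d a x - h) / \<alpha>\<^sup>2"
  shows "orbit (\<kappa>\<^sup>2) (\<alpha>\<^sup>2) h (2 * d) (\<lambda>t. \<psi> (t - d)) (\<lambda>t. ideriv d \<psi> (t - d)) (\<lambda>t. a (t - d)) (\<lambda>t. j (t - d))"
    "\<psi> (-d) = 1" "ideriv d \<psi> (-d) = 0" "ideriv d \<psi> d = 0" "j (-d) = 0" "j d = 0"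
proof -
  note r' = r[unfolded rescaled_solution_def second_order_bvp_def]
  show "\<psi> (-d) = 1" "ideriv d \<psi> (-d) = 0" "ideriv d \<psi> d = 0" "j (-d) = 0" "j d = 0"
    using r' by (auto simp: j_def)
  have sh: "((\<lambda>t. f (t - d)) has_real_derivative f' (t - d)) (at t within {0..2 * d})"
    if "\<And>x. x \<in> {-d..d} \<Longrightarrow> (f has_real_derivative f' x) (at x within {-d..d})" "t \<in> {0..2 * d}" for f f' t
    using deriv_within_shift[of f "f' (t - d)" t "- d" 0 "2 * d"] that(1)[of "t - d"] that(2) by simp
  have jd: "(j has_real_derivative (\<psi> x)\<^sup>2 * a x) (at x within {-d..d})" if "x \<in> {-d..d}" for x
  proof -
    have "(ideriv d a has_real_derivative \<alpha>\<^sup>2 * (\<psi> x)\<^sup>2 * a x) (at x within {-d..d})" using r' that by blast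
    then have "(j has_real_derivative (\<alpha>\<^sup>2 * (\<psi> x)\<^sup>2 * a x - 0) / \<alpha>\<^sup>2) (at x within {-d..d})"
      unfolding j_def by (intro DERIV_cdivide DERIV_diff DERIV_const)
    then show ?thesis using \<alpha> by simp
  qed
  show "orbit (\<kappa>\<^sup>2) (\<alpha>\<^sup>2) h (2 * d) (\<lambda>t. \<psi> (t - d)) (\<lambda>t. ideriv d \<psi> (t - d)) (\<lambda>t. a (t - d)) (\<lambda>t. j (t - d))"
    unfolding orbit_def
  proof (intro ballI conjI)
    fix t assume t: "t \<in> {0..2 * d}"
    show "((\<lambda>t. \<psi> (t - d)) has_real_derivative ideriv d \<psi> (t - d)) (at t within {0..2 * d})"
      by (rule sh[of \<psi> "ideriv d \<psi>", OF _ t]) (use r' in blast)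
    show "((\<lambda>t. ideriv d \<psi> (t - d)) has_real_derivative
        \<kappa>\<^sup>2 * (\<alpha>\<^sup>2 * (\<psi> (t - d))\<^sup>2 + (a (t - d))\<^sup>2 - 1) * \<psi> (t - d)) (at t within {0..2 * d})"
      by (rule sh[of "ideriv d \<psi>" "\<lambda>x. \<kappa>\<^sup>2 * (\<alpha>\<^sup>2 * (\<psi> x)\<^sup>2 + (a x)\<^sup>2 - 1) * \<psi> x", OF _ t]) (use r' in blast)
    have "((\<lambda>t. a (t - d)) has_real_derivative ideriv d a (t - d)) (at t within {0..2 * d})"
      by (rule sh[of a "ideriv d a", OF _ t]) (use r' in blast)
    then show "((\<lambda>t. a (t - d)) has_real_derivative h + \<alpha>\<^sup>2 * j (t - d)) (at t within {0..2 * d})"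
      using \<alpha> by (simp add: j_def)
    show "((\<lambda>t. j (t - d)) has_real_derivative (\<psi> (t - d))\<^sup>2 * a (t - d)) (at t within {0..2 * d})"
      by (rule sh[of j "\<lambda>x. (\<psi> x)\<^sup>2 * a x", OF jd t])
  qed
qed



subsection \<open>The linear problem\<close>

text \<open>Strict inequalities along a compact set persist with one common radius; this transfers
  sign conditions from the base parameters to nearby ones.\<close>

lemma continuous_pos_near_compact:
  fixes F :: "'a::metric_space \<Rightarrow> real"
  assumes "continuous_on UNIV F" "compact K" "\<And>p. p \<in> K \<Longrightarrow> F p > 0"
  shows "\<exists>\<delta>>0. \<forall>p\<in>K. \<forall>q. dist p q < \<delta> \<longrightarrow> F q > 0"
proof -
  have "open {q. 0 < F q}" using assms(1) by (intro open_Collect_less continuous_intros)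
  moreover have "K \<subseteq> {q. 0 < F q}" using assms(3) by auto
  ultimately obtain \<delta> where "\<delta> > 0" "(\<Union>p\<in>K. ball p \<delta>) \<subseteq> {q. 0 < F q}"
    using compact_subset_open_imp_ball_epsilon_subset[OF assms(2)] by metis
  then have "F q > 0" if "p \<in> K" "dist p q < \<delta>" for p q
    using that by (meson UN_I mem_ball mem_Collect_eq subsetD)
  with \<open>\<delta> > 0\<close> show ?thesis by blast
qed

lemma dist_Pair_leI:
  assumes "dist a c \<le> s" "dist b d \<le> t" shows "dist (a, b) (c, d) \<le> s + t"
proof -
  have "dist (a, b) (c, d) \<le> dist a c + dist b d"
    unfolding dist_Pair_Pair by (rule sqrt_sum_squares_le_sum) auto
  with assms show ?thesis by linarith
qed

text \<open>The solution with value 1 and slope 0 at -L; the coefficients come from parity and the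
  Wronskian. The linear problem on [-d, d] corresponds to y = x + c, L = d - c and right end R = d +
  c.\<close>

definition wU where "wU \<mu> \<nu> L y = wO' \<mu> \<nu> L * wE \<mu> \<nu> y + wE' \<mu> \<nu> L * wO \<mu> \<nu> y"
definition wU' where "wU' \<mu> \<nu> L y = wO' \<mu> \<nu> L * wE' \<mu> \<nu> y + wE' \<mu> \<nu> L * wO' \<mu> \<nu> y"

lemma wU_derivs:
  "(wU \<mu> \<nu> L has_real_derivative wU' \<mu> \<nu> L y) (at y within S)"
  "(wU' \<mu> \<nu> L has_real_derivative (\<mu> * y\<^sup>2 - \<nu>) * wU \<mu> \<nu> L y) (at y within S)"
  unfolding wU_def[abs_def] wU'_def[abs_def]
  by (auto intro!: derivative_eq_intros wEO_derivs simp: algebra_simps)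

lemmas wU_derivs_chain [derivative_intros] = wU_derivs[THEN DERIV_chain2]

lemma wU_left [simp]: "wU \<mu> \<nu> L (- L) = 1" "wU' \<mu> \<nu> L (- L) = 0"
  using wEO_wronskian[of \<mu> \<nu> L] by (auto simp: wU_def wU'_def wEO_parity algebra_simps)

lemma wU_continuous [continuous_intros]:
  fixes f g k l :: "'a::topological_space \<Rightarrow> real"
  assumes "continuous_on S f" "continuous_on S g" "continuous_on S k" "continuous_on S l"
  shows "continuous_on S (\<lambda>x. wU (f x) (g x) (k x) (l x))" "continuous_on S (\<lambda>x. wU' (f x) (g x) (k x) (l x))"
  unfolding wU_def wU'_def by (intro continuous_intros assms)+

text \<open>The Wronskian of \<open>wU\<close> and \<open>wO\<close> is constant; the two sides are
  its values at R and at -L.\<close>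

lemma wU_right:
  assumes "wU' \<mu> \<nu> L R = 0"
  shows "wU \<mu> \<nu> L R * wO' \<mu> \<nu> R = wO' \<mu> \<nu> L"
proof -
  have "wU \<mu> \<nu> L R * wO' \<mu> \<nu> R = wU' \<mu> \<nu> L R * wO \<mu> \<nu> R +
      wO' \<mu> \<nu> L * (wE \<mu> \<nu> R * wO' \<mu> \<nu> R - wE' \<mu> \<nu> R * wO \<mu> \<nu> R)"
    by (simp add: wU_def wU'_def algebra_simps)
  then show ?thesis using assms by (simp add: wEO_wronskian)
qed

text \<open>An explicit antiderivative of 2 \<mu> y u^2, which evaluates I(c) without
  integration.\<close>

lemma wU_energy:
  "((\<lambda>y. (\<mu> * y\<^sup>2 - \<nu>) * (wU \<mu> \<nu> L y)\<^sup>2 - (wU' \<mu> \<nu> L y)\<^sup>2) has_real_derivative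
     2 * \<mu> * (y * (wU \<mu> \<nu> L y)\<^sup>2)) (at y within S)"
  by (auto intro!: derivative_eq_intros wU_derivs simp: power2_eq_square algebra_simps)

lemma wU'_strict_mono:
  assumes "\<mu>\<^sub>1 < \<mu>\<^sub>2" and LR: "0 < L + R" and "R > 0"
    and pos: "\<And>y. y \<in> {-L..R} \<Longrightarrow> wU \<mu>\<^sub>1 \<nu> L y > 0" "\<And>y. y \<in> {-L..R} \<Longrightarrow> wU \<mu>\<^sub>2 \<nu> L y > 0"
  shows "wU \<mu>\<^sub>2 \<nu> L R * wU' \<mu>\<^sub>1 \<nu> L R < wU' \<mu>\<^sub>2 \<nu> L R * wU \<mu>\<^sub>1 \<nu> L R"
proof -
  let ?W = "\<lambda>y. wU' \<mu>\<^sub>2 \<nu> L y * wU \<mu>\<^sub>1 \<nu> L y - wU \<mu>\<^sub>2 \<nu> L y * wU' \<mu>\<^sub>1 \<nu> L y"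
  let ?W' = "\<lambda>y. (\<mu>\<^sub>2 - \<mu>\<^sub>1) * y\<^sup>2 * (wU \<mu>\<^sub>1 \<nu> L y * wU \<mu>\<^sub>2 \<nu> L y)"
  have W: "(?W has_real_derivative ?W' y) (at y)" for y
    by (auto intro!: derivative_eq_intros wU_derivs simp: algebra_simps)
  \<comment> \<open>The integrand carries the factor y^2, so strict growth of the Wronskian is
    claimed only to the right of 0; a part to the left contributes a weak inequality.\<close>
  define s where "s = max (- L) 0"
  have s: "- L \<le> s" "s < R" "0 \<le> s" using LR \<open>R > 0\<close> by (auto simp: s_def)
  have "?W (- L) \<le> ?W s"
  proof (rule nondecreasing_at[OF s(1) W])
    fix y assume "y \<in> {- L<..<s}"
    then show "0 \<le> ?W' y" using s pos[of y] assms(1) by simp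
  qed
  moreover have "?W s < ?W R"
  proof (rule increasing_at[OF s(2) W])
    fix y assume "y \<in> {s<..<R}"
    then show "0 < ?W' y" using s pos[of y] assms(1) by simp
  qed
  ultimately show ?thesis by simp
qed

lemma linear_solution_wU:
  assumes d: "d > 0" and "linear_solution \<kappa> d c h \<psi>" and x: "x \<in> {-d..d}"
  shows "\<psi> x = wU (\<kappa>\<^sup>2 * h\<^sup>2) (\<kappa>\<^sup>2) (d - c) (x + c)" "ideriv d \<psi> x = wU' (\<kappa>\<^sup>2 * h\<^sup>2) (\<kappa>\<^sup>2) (d - c) (x + c)"
proof -
  note l = assms(2)[unfolded linear_solution_def second_order_bvp_def]
  have "\<psi> x = wU (\<kappa>\<^sup>2 * h\<^sup>2) (\<kappa>\<^sup>2) (d - c) (x + c) \<and> ideriv d \<psi> x = wU' (\<kappa>\<^sup>2 * h\<^sup>2) (\<kappa>\<^sup>2) (d - c) (x + c)"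
  proof (rule linear_ode_unique[where a = "-d" and b = d and s = "-d" and t = x and u = \<psi> and u' = "ideriv d \<psi>"
        and v = "\<lambda>x. wU (\<kappa>\<^sup>2 * h\<^sup>2) (\<kappa>\<^sup>2) (d - c) (x + c)"
        and v' = "\<lambda>x. wU' (\<kappa>\<^sup>2 * h\<^sup>2) (\<kappa>\<^sup>2) (d - c) (x + c)" and Q = "\<lambda>x. \<kappa>\<^sup>2 * (h\<^sup>2 * (x + c)\<^sup>2 - 1)"])
    fix t assume t: "t \<in> {-d..d}"
    show "(\<psi> has_real_derivative ideriv d \<psi> t) (at t within {-d..d})"
      "(ideriv d \<psi> has_real_derivative \<kappa>\<^sup>2 * (h\<^sup>2 * (t + c)\<^sup>2 - 1) * \<psi> t) (at t within {-d..d})" using l t by auto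
    show "((\<lambda>x. wU (\<kappa>\<^sup>2 * h\<^sup>2) (\<kappa>\<^sup>2) (d - c) (x + c)) has_real_derivative wU' (\<kappa>\<^sup>2 * h\<^sup>2) (\<kappa>\<^sup>2) (d - c) (t + c)) (at t within {-d..d})"
      by (auto intro!: derivative_eq_intros)
    show "((\<lambda>x. wU' (\<kappa>\<^sup>2 * h\<^sup>2) (\<kappa>\<^sup>2) (d - c) (x + c)) has_real_derivative
        \<kappa>\<^sup>2 * (h\<^sup>2 * (t + c)\<^sup>2 - 1) * wU (\<kappa>\<^sup>2 * h\<^sup>2) (\<kappa>\<^sup>2) (d - c) (t + c)) (at t within {-d..d})"
      by (auto intro!: derivative_eq_intros simp: algebra_simps)
  next
    have "- d + c = - (d - c)" by simp
    then show "\<psi> (- d) = wU (\<kappa>\<^sup>2 * h\<^sup>2) (\<kappa>\<^sup>2) (d - c) (- d + c)"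
      "ideriv d \<psi> (- d) = wU' (\<kappa>\<^sup>2 * h\<^sup>2) (\<kappa>\<^sup>2) (d - c) (- d + c)"
      using l by (simp_all only: wU_left)
  qed (use d x in \<open>auto intro!: continuous_intros\<close>)
  then show "\<psi> x = wU (\<kappa>\<^sup>2 * h\<^sup>2) (\<kappa>\<^sup>2) (d - c) (x + c)" "ideriv d \<psi> x = wU' (\<kappa>\<^sup>2 * h\<^sup>2) (\<kappa>\<^sup>2) (d - c) (x + c)"
    by auto
qed

lemma wU_linear_solution:
  assumes d: "d > 0" and "wU' (\<kappa>\<^sup>2 * h\<^sup>2) (\<kappa>\<^sup>2) (d - c) (d + c) = 0"
  shows "linear_solution \<kappa> d c h (\<lambda>x. wU (\<kappa>\<^sup>2 * h\<^sup>2) (\<kappa>\<^sup>2) (d - c) (x + c))"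
proof -
  have e: "- d + c = - (d - c)" by simp
  have "second_order_bvp d (\<lambda>x. wU (\<kappa>\<^sup>2 * h\<^sup>2) (\<kappa>\<^sup>2) (d - c) (x + c))
     (\<lambda>x. \<kappa>\<^sup>2 * (h\<^sup>2 * (x + c)\<^sup>2 - 1) * wU (\<kappa>\<^sup>2 * h\<^sup>2) (\<kappa>\<^sup>2) (d - c) (x + c)) 0"
  proof (rule second_order_bvpI[OF d, where f' = "\<lambda>x. wU' (\<kappa>\<^sup>2 * h\<^sup>2) (\<kappa>\<^sup>2) (d - c) (x + c)"])
    show "wU' (\<kappa>\<^sup>2 * h\<^sup>2) (\<kappa>\<^sup>2) (d - c) (- d + c) = 0" by (simp only: e wU_left)
  qed (use assms in \<open>auto intro!: derivative_eq_intros simp: algebra_simps\<close>)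
  then show ?thesis unfolding linear_solution_def e by (simp only: wU_left)
qed

text \<open>The pair (c, h(c)) described by an equation and an inequality for \<open>wU\<close>, in
  place of the choice operators in \<open>h_crit\<close> and \<open>psi0\<close>.\<close>

definition critical :: "real \<Rightarrow> real \<Rightarrow> real \<Rightarrow> real \<Rightarrow> bool" where
  "critical \<kappa> d c h \<longleftrightarrow> h > 0 \<and> wU' (\<kappa>\<^sup>2 * h\<^sup>2) (\<kappa>\<^sup>2) (d - c) (d + c) = 0 \<and>
     (\<forall>y\<in>{-(d - c)..d + c}. wU (\<kappa>\<^sup>2 * h\<^sup>2) (\<kappa>\<^sup>2) (d - c) y > 0)"

lemma critical_unique:
  assumes "\<kappa> > 0" "d > 0" "\<bar>c\<bar> < d" "critical \<kappa> d c h\<^sub>1" "critical \<kappa> d c h\<^sub>2"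
  shows "h\<^sub>1 = h\<^sub>2"
proof -
  have False if "critical \<kappa> d c h\<^sub>1" "critical \<kappa> d c h\<^sub>2" "h\<^sub>1 < h\<^sub>2" for h\<^sub>1 h\<^sub>2
  proof -
    have "h\<^sub>1\<^sup>2 < h\<^sub>2\<^sup>2" using that by (intro power_strict_mono) (auto simp: critical_def)
    then have "\<kappa>\<^sup>2 * h\<^sub>1\<^sup>2 < \<kappa>\<^sup>2 * h\<^sub>2\<^sup>2" using assms by simp
    from wU'_strict_mono[OF this, of "d - c" "d + c" "\<kappa>\<^sup>2"] that assms show False
      by (auto simp: critical_def abs_less_iff)
  qed
  with assms show ?thesis by (meson linorder_neqE_linordered_idom)
qed

text \<open>Makes the definite description and the choice computable once some critical h is known.
  Such an h is supplied by \<open>wE_neumann_exists\<close> for c = 0 and by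
  \<open>critical_near\<close> for small c.\<close>

lemma h_crit_critical:
  assumes k: "\<kappa> > 0" "d > 0" "\<bar>c\<bar> < d" and h: "critical \<kappa> d c h"
  shows "h_crit \<kappa> d c = h" "x \<in> {-d..d} \<Longrightarrow> psi0 \<kappa> d c x = wU (\<kappa>\<^sup>2 * h\<^sup>2) (\<kappa>\<^sup>2) (d - c) (x + c)"
proof -
  have iff: "(\<exists>\<psi>. linear_solution \<kappa> d c h' \<psi> \<and> positive_on d \<psi>) \<longleftrightarrow> critical \<kappa> d c h'" if "h' > 0" for h'
  proof
    assume "critical \<kappa> d c h'"
    then show "\<exists>\<psi>. linear_solution \<kappa> d c h' \<psi> \<and> positive_on d \<psi>"
      using wU_linear_solution[OF k(2), of \<kappa> h' c]
      by (intro exI conjI) (auto simp: critical_def positive_on_def)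
  next
    assume "\<exists>\<psi>. linear_solution \<kappa> d c h' \<psi> \<and> positive_on d \<psi>"
    then obtain \<psi> where \<psi>: "linear_solution \<kappa> d c h' \<psi>" "positive_on d \<psi>" by blast
    have "wU (\<kappa>\<^sup>2 * h'\<^sup>2) (\<kappa>\<^sup>2) (d - c) y > 0" if "y \<in> {-(d - c)..d + c}" for y
    proof -
      have y: "y - c \<in> {-d..d}" using that by auto
      then have "\<psi> (y - c) > 0" using \<psi>(2) unfolding positive_on_def by blast
      with linear_solution_wU(1)[OF k(2) \<psi>(1) y] show ?thesis by simp
    qed
    moreover have "ideriv d \<psi> d = 0" using \<psi>(1) by (auto simp: linear_solution_def second_order_bvp_def)
    ultimately show "critical \<kappa> d c h'"
      using linear_solution_wU(2)[OF k(2) \<psi>(1), of d] that k by (simp add: critical_def)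
  qed
  show hc: "h_crit \<kappa> d c = h"
    unfolding h_crit_def
  proof (rule the_equality)
    show "h > 0 \<and> (\<exists>\<psi>. linear_solution \<kappa> d c h \<psi> \<and> positive_on d \<psi>)" using iff h by (auto simp: critical_def)
    fix h' assume "h' > 0 \<and> (\<exists>\<psi>. linear_solution \<kappa> d c h' \<psi> \<and> positive_on d \<psi>)"
    then show "h' = h" using iff critical_unique[OF k _ h] by blast
  qed
  assume x: "x \<in> {-d..d}"
  have "\<exists>\<psi>. linear_solution \<kappa> d c h \<psi> \<and> positive_on d \<psi>" using iff h by (auto simp: critical_def)
  then have "linear_solution \<kappa> d c h (psi0 \<kappa> d c)" unfolding psi0_def hc by (rule someI2_ex) blast
  from linear_solution_wU(1)[OF k(2) this x]
  show "psi0 \<kappa> d c x = wU (\<kappa>\<^sup>2 * h\<^sup>2) (\<kappa>\<^sup>2) (d - c) (x + c)" .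
qed

lemma critical_symmetric:
  assumes "\<kappa> < h" "\<kappa> > 0" "wE' (\<kappa>\<^sup>2 * h\<^sup>2) (\<kappa>\<^sup>2) d = 0"
  shows "critical \<kappa> d 0 h"
proof -
  have kh: "\<kappa>\<^sup>2 \<le> \<kappa> * h" using assms by (simp add: power2_eq_square)
  have pos: "wE (\<kappa>\<^sup>2 * h\<^sup>2) (\<kappa>\<^sup>2) y > 0" "wO' (\<kappa>\<^sup>2 * h\<^sup>2) (\<kappa>\<^sup>2) y > 0" for y
    using wE_pos[OF _ kh, of y] wO'_pos[OF _ kh, of y] assms by (simp_all add: power_mult_distrib)
  then show ?thesis using assms by (simp add: critical_def wU_def wU'_def)
qed

lemma h_crit_symmetric:
  assumes "\<kappa> > 0" "d > 0"
  shows "h_crit \<kappa> d 0 > \<kappa>" "wE' (\<kappa>\<^sup>2 * (h_crit \<kappa> d 0)\<^sup>2) (\<kappa>\<^sup>2) d = 0"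
proof -
  obtain m where m: "m > \<kappa>\<^sup>2" "wE' (m\<^sup>2) (\<kappa>\<^sup>2) d = 0" using wE_neumann_exists[of "\<kappa>\<^sup>2" d] assms by auto
  define h where "h = m / \<kappa>"
  have h: "\<kappa> < h" "\<kappa>\<^sup>2 * h\<^sup>2 = m\<^sup>2"
    using m assms by (auto simp: h_def power_divide field_simps power2_eq_square)
  then have "critical \<kappa> d 0 h" using m assms by (intro critical_symmetric) auto
  then have "h_crit \<kappa> d 0 = h" using h_crit_critical(1)[of \<kappa> d 0 h] assms by simp
  with h m show "h_crit \<kappa> d 0 > \<kappa>" "wE' (\<kappa>\<^sup>2 * (h_crit \<kappa> d 0)\<^sup>2) (\<kappa>\<^sup>2) d = 0" by auto
qed

lemma h_crit_eqI:
  assumes "\<kappa> > 0" "d > 0" "\<kappa> < h" "wE' (\<kappa>\<^sup>2 * h\<^sup>2) (\<kappa>\<^sup>2) d = 0"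
  shows "h_crit \<kappa> d 0 = h"
  using h_crit_critical(1)[OF assms(1,2), of 0 h] critical_symmetric[OF assms(3,1,4)] assms by simp

lemma wU_pos_near:
  assumes k: "\<kappa>\<^sub>0 > 0" "d\<^sub>0 > 0" and h: "\<kappa>\<^sub>0 < h\<^sub>0" "wE' (\<kappa>\<^sub>0\<^sup>2 * h\<^sub>0\<^sup>2) (\<kappa>\<^sub>0\<^sup>2) d\<^sub>0 = 0"
  shows "\<exists>\<delta>>0. \<delta> \<le> 1 \<and> (\<forall>\<kappa> d c h. \<bar>\<kappa> - \<kappa>\<^sub>0\<bar> < \<delta> \<longrightarrow> \<bar>d - d\<^sub>0\<bar> < \<delta> \<longrightarrow> \<bar>c\<bar> < \<delta> \<longrightarrow> \<bar>h - h\<^sub>0\<bar> < \<delta> \<longrightarrow>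
     \<kappa> > 0 \<and> \<bar>c\<bar> < d \<and> \<kappa> < h \<and> (\<forall>y\<in>{-(d - c)..d + c}. wU (\<kappa>\<^sup>2 * h\<^sup>2) (\<kappa>\<^sup>2) (d - c) y > 0))"
proof -
  let ?F = "\<lambda>(\<kappa>, d, c, h, y). wU (\<kappa>\<^sup>2 * h\<^sup>2) (\<kappa>\<^sup>2) (d - c) y"
  have kh: "\<kappa>\<^sub>0\<^sup>2 \<le> \<kappa>\<^sub>0 * h\<^sub>0" using h k by (simp add: power2_eq_square)
  have pos: "wU (\<kappa>\<^sub>0\<^sup>2 * h\<^sub>0\<^sup>2) (\<kappa>\<^sub>0\<^sup>2) d\<^sub>0 y > 0" for y
    using wE_pos[OF _ kh, of y] wO'_pos[OF _ kh, of d\<^sub>0] h k by (simp add: wU_def power_mult_distrib)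
  \<comment> \<open>The range of y is widened by 2 because d and c each move by less than 1. The
    radius is later divided by 4, for the four parameters that vary.\<close>
  have "\<exists>\<delta>>0. \<forall>p\<in>(\<lambda>y. (\<kappa>\<^sub>0, d\<^sub>0, 0, h\<^sub>0, y)) ` {-(d\<^sub>0 + 2)..d\<^sub>0 + 2}. \<forall>q. dist p q < \<delta> \<longrightarrow> ?F q > 0"
  proof (rule continuous_pos_near_compact)
    show "continuous_on UNIV ?F" unfolding case_prod_unfold by (intro continuous_intros)
    show "compact ((\<lambda>y. (\<kappa>\<^sub>0, d\<^sub>0, 0::real, h\<^sub>0, y)) ` {-(d\<^sub>0 + 2)..d\<^sub>0 + 2})"
      by (intro compact_continuous_image continuous_intros) simp
  qed (use pos in auto)
  then obtain \<delta> where \<delta>: "\<delta> > 0"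
    "\<And>y q. y \<in> {-(d\<^sub>0 + 2)..d\<^sub>0 + 2} \<Longrightarrow> dist (\<kappa>\<^sub>0, d\<^sub>0, 0, h\<^sub>0, y) q < \<delta> \<Longrightarrow> ?F q > 0" by blast
  define \<delta>' where "\<delta>' = min (\<delta> / 4) (min 1 (min (\<kappa>\<^sub>0 / 2) (min (d\<^sub>0 / 2) ((h\<^sub>0 - \<kappa>\<^sub>0) / 2))))"
  show ?thesis
  proof (intro exI[of _ \<delta>'] conjI allI impI)
    show "\<delta>' > 0" using \<delta>(1) k h by (simp add: \<delta>'_def)
    show "\<delta>' \<le> 1" by (simp add: \<delta>'_def)
    fix \<kappa> d c h assume *: "\<bar>\<kappa> - \<kappa>\<^sub>0\<bar> < \<delta>'" "\<bar>d - d\<^sub>0\<bar> < \<delta>'" "\<bar>c\<bar> < \<delta>'" "\<bar>h - h\<^sub>0\<bar> < \<delta>'"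
    have b: "\<delta>' \<le> \<delta> / 4" "\<delta>' \<le> 1" "\<delta>' \<le> \<kappa>\<^sub>0 / 2" "\<delta>' \<le> d\<^sub>0 / 2" "\<delta>' \<le> (h\<^sub>0 - \<kappa>\<^sub>0) / 2"
      by (auto simp: \<delta>'_def min_def)
    show "\<kappa> > 0" "\<bar>c\<bar> < d" "\<kappa> < h" using * b by (auto simp: abs_less_iff)
    show "\<forall>y\<in>{-(d - c)..d + c}. wU (\<kappa>\<^sup>2 * h\<^sup>2) (\<kappa>\<^sup>2) (d - c) y > 0"
    proof
      fix y assume y: "y \<in> {-(d - c)..d + c}"
      have "dist (\<kappa>\<^sub>0, d\<^sub>0, 0, h\<^sub>0, y) (\<kappa>, d, c, h, y) \<le> \<bar>\<kappa> - \<kappa>\<^sub>0\<bar> + (\<bar>d - d\<^sub>0\<bar> + (\<bar>c\<bar> + (\<bar>h - h\<^sub>0\<bar> + 0)))"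
        by (intro dist_Pair_leI) (auto simp: dist_real_def)
      also have "\<dots> < \<delta>" using * b by linarith
      finally show "wU (\<kappa>\<^sup>2 * h\<^sup>2) (\<kappa>\<^sup>2) (d - c) y > 0"
        using \<delta>(2)[of y "(\<kappa>, d, c, h, y)"] y * b by (auto simp: abs_less_iff)
    qed
  qed
qed

text \<open>Stands in for the implicit function theorem. Monotonicity in h gives the end slope
  strict opposite signs at \<open>h\<^sub>0 - s\<close> and \<open>h\<^sub>0 + s\<close>; these
  signs survive small changes of \<kappa>, d and c, and the intermediate value theorem yields a
  critical h. As r is arbitrary, \<open>h_crit\<close> is continuous at the base point.\<close>

lemma critical_near:
  assumes k: "\<kappa>\<^sub>0 > 0" "d\<^sub>0 > 0" and h: "\<kappa>\<^sub>0 < h\<^sub>0" "wE' (\<kappa>\<^sub>0\<^sup>2 * h\<^sub>0\<^sup>2) (\<kappa>\<^sub>0\<^sup>2) d\<^sub>0 = 0" and "r > 0"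
  shows "\<exists>\<delta>>0. \<forall>\<kappa> d c. \<bar>\<kappa> - \<kappa>\<^sub>0\<bar> < \<delta> \<longrightarrow> \<bar>d - d\<^sub>0\<bar> < \<delta> \<longrightarrow> \<bar>c\<bar> < \<delta> \<longrightarrow>
     \<kappa> > 0 \<and> \<bar>c\<bar> < d \<and> critical \<kappa> d c (h_crit \<kappa> d c) \<and> \<bar>h_crit \<kappa> d c - h\<^sub>0\<bar> < r \<and> \<kappa> < h_crit \<kappa> d c"
proof -
  obtain \<delta> where \<delta>: "\<delta> > 0" "\<delta> \<le> 1" "\<And>\<kappa> d c h. \<bar>\<kappa> - \<kappa>\<^sub>0\<bar> < \<delta> \<Longrightarrow> \<bar>d - d\<^sub>0\<bar> < \<delta> \<Longrightarrow> \<bar>c\<bar> < \<delta> \<Longrightarrow> \<bar>h - h\<^sub>0\<bar> < \<delta> \<Longrightarrow>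
     \<kappa> > 0 \<and> \<bar>c\<bar> < d \<and> \<kappa> < h \<and> (\<forall>y\<in>{-(d - c)..d + c}. wU (\<kappa>\<^sup>2 * h\<^sup>2) (\<kappa>\<^sup>2) (d - c) y > 0)"
    using wU_pos_near[OF k h] by blast
  define s where "s = min r \<delta> / 2"
  have s: "s > 0" "s < r" "s < \<delta>" using \<delta>(1,2) \<open>r > 0\<close> by (auto simp: s_def)
  have sign: "wU' (\<kappa>\<^sub>0\<^sup>2 * (h\<^sub>0 - s)\<^sup>2) (\<kappa>\<^sub>0\<^sup>2) d\<^sub>0 d\<^sub>0 < 0" "wU' (\<kappa>\<^sub>0\<^sup>2 * (h\<^sub>0 + s)\<^sup>2) (\<kappa>\<^sub>0\<^sup>2) d\<^sub>0 d\<^sub>0 > 0"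
  proof -
    have U0: "wU' (\<kappa>\<^sub>0\<^sup>2 * h\<^sub>0\<^sup>2) (\<kappa>\<^sub>0\<^sup>2) d\<^sub>0 d\<^sub>0 = 0" using h by (simp add: wU'_def)
    have p: "wU (\<kappa>\<^sub>0\<^sup>2 * h\<^sup>2) (\<kappa>\<^sub>0\<^sup>2) d\<^sub>0 y > 0" if "y \<in> {-d\<^sub>0..d\<^sub>0}" "\<bar>h - h\<^sub>0\<bar> < \<delta>" for h y
      using \<delta>(3)[of \<kappa>\<^sub>0 d\<^sub>0 0 h] \<delta>(1) that by auto
    have pd: "wU (\<kappa>\<^sub>0\<^sup>2 * h\<^sub>0\<^sup>2) (\<kappa>\<^sub>0\<^sup>2) d\<^sub>0 d\<^sub>0 > 0" using p[of d\<^sub>0 h\<^sub>0] \<delta>(1) k by simp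
    have hs: "h\<^sub>0 - s > 0" using \<delta>(3)[of \<kappa>\<^sub>0 d\<^sub>0 0 "h\<^sub>0 - s"] \<delta>(1) s k by auto
    have "(h\<^sub>0 - s)\<^sup>2 < h\<^sub>0\<^sup>2" "h\<^sub>0\<^sup>2 < (h\<^sub>0 + s)\<^sup>2" using hs s by (auto intro!: power_strict_mono)
    then have "\<kappa>\<^sub>0\<^sup>2 * (h\<^sub>0 - s)\<^sup>2 < \<kappa>\<^sub>0\<^sup>2 * h\<^sub>0\<^sup>2" "\<kappa>\<^sub>0\<^sup>2 * h\<^sub>0\<^sup>2 < \<kappa>\<^sub>0\<^sup>2 * (h\<^sub>0 + s)\<^sup>2" using k by auto
    note m = wU'_strict_mono[OF this(1), of d\<^sub>0 d\<^sub>0 "\<kappa>\<^sub>0\<^sup>2"] wU'_strict_mono[OF this(2), of d\<^sub>0 d\<^sub>0 "\<kappa>\<^sub>0\<^sup>2"]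
    have "0 < wU (\<kappa>\<^sub>0\<^sup>2 * h\<^sub>0\<^sup>2) (\<kappa>\<^sub>0\<^sup>2) d\<^sub>0 d\<^sub>0 * - wU' (\<kappa>\<^sub>0\<^sup>2 * (h\<^sub>0 - s)\<^sup>2) (\<kappa>\<^sub>0\<^sup>2) d\<^sub>0 d\<^sub>0"
      using m(1) U0 k p[of _ "h\<^sub>0 - s"] p[of _ h\<^sub>0] s \<delta>(1) by simp
    then show "wU' (\<kappa>\<^sub>0\<^sup>2 * (h\<^sub>0 - s)\<^sup>2) (\<kappa>\<^sub>0\<^sup>2) d\<^sub>0 d\<^sub>0 < 0" using pd by (simp add: mult_less_0_iff)
    have "0 < wU' (\<kappa>\<^sub>0\<^sup>2 * (h\<^sub>0 + s)\<^sup>2) (\<kappa>\<^sub>0\<^sup>2) d\<^sub>0 d\<^sub>0 * wU (\<kappa>\<^sub>0\<^sup>2 * h\<^sub>0\<^sup>2) (\<kappa>\<^sub>0\<^sup>2) d\<^sub>0 d\<^sub>0"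
      using m(2) U0 k p[of _ "h\<^sub>0 + s"] p[of _ h\<^sub>0] s \<delta>(1) by simp
    then show "wU' (\<kappa>\<^sub>0\<^sup>2 * (h\<^sub>0 + s)\<^sup>2) (\<kappa>\<^sub>0\<^sup>2) d\<^sub>0 d\<^sub>0 > 0" using pd by (simp add: zero_less_mult_iff)
  qed
  let ?G = "\<lambda>(\<kappa>, d, c, h). wU' (\<kappa>\<^sup>2 * h\<^sup>2) (\<kappa>\<^sup>2) (d - c) (d + c)"
  have c: "continuous_on UNIV ?G" "continuous_on UNIV (\<lambda>p. - ?G p)"
    unfolding case_prod_unfold by (intro continuous_intros)+
  obtain e1 where e1: "e1 > 0" "\<And>q. dist (\<kappa>\<^sub>0, d\<^sub>0, 0, h\<^sub>0 + s) q < e1 \<Longrightarrow> ?G q > 0"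
    using continuous_pos_near_compact[OF c(1), of "{(\<kappa>\<^sub>0, d\<^sub>0, 0, h\<^sub>0 + s)}"] sign(2) by auto
  obtain e2 where e2: "e2 > 0" "\<And>q. dist (\<kappa>\<^sub>0, d\<^sub>0, 0, h\<^sub>0 - s) q < e2 \<Longrightarrow> - ?G q > 0"
    using continuous_pos_near_compact[OF c(2), of "{(\<kappa>\<^sub>0, d\<^sub>0, 0, h\<^sub>0 - s)}"] sign(1) by auto
  show ?thesis
  proof (intro exI[of _ "min \<delta> (min (e1 / 3) (e2 / 3))"] conjI[of "0 < min \<delta> (min (e1 / 3) (e2 / 3))"] allI impI)
    show "min \<delta> (min (e1 / 3) (e2 / 3)) > 0" using \<delta>(1) e1(1) e2(1) by simp
    fix \<kappa> d c
    assume *: "\<bar>\<kappa> - \<kappa>\<^sub>0\<bar> < min \<delta> (min (e1 / 3) (e2 / 3))" "\<bar>d - d\<^sub>0\<bar> < min \<delta> (min (e1 / 3) (e2 / 3))"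
      "\<bar>c\<bar> < min \<delta> (min (e1 / 3) (e2 / 3))"
    have ds: "dist (\<kappa>\<^sub>0, d\<^sub>0, 0, h) (\<kappa>, d, c, h) < min e1 e2" for h
    proof -
      have "dist (\<kappa>\<^sub>0, d\<^sub>0, 0, h) (\<kappa>, d, c, h) \<le> \<bar>\<kappa> - \<kappa>\<^sub>0\<bar> + (\<bar>d - d\<^sub>0\<bar> + (\<bar>c\<bar> + 0))"
        by (intro dist_Pair_leI) (auto simp: dist_real_def)
      with * show ?thesis by linarith
    qed
    let ?g = "\<lambda>h. wU' (\<kappa>\<^sup>2 * h\<^sup>2) (\<kappa>\<^sup>2) (d - c) (d + c)"
    have "?g (h\<^sub>0 - s) \<le> 0" "0 \<le> ?g (h\<^sub>0 + s)"
      using e1(2)[of "(\<kappa>, d, c, h\<^sub>0 + s)"] e2(2)[of "(\<kappa>, d, c, h\<^sub>0 - s)"]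
        ds[of "h\<^sub>0 + s"] ds[of "h\<^sub>0 - s"] by auto
    moreover have "continuous_on {h\<^sub>0 - s..h\<^sub>0 + s} ?g" by (intro continuous_intros)
    ultimately obtain h where h: "h\<^sub>0 - s \<le> h" "h \<le> h\<^sub>0 + s" "?g h = 0"
      using IVT'[of ?g "h\<^sub>0 - s" 0 "h\<^sub>0 + s"] s by auto
    have hb: "\<bar>h - h\<^sub>0\<bar> \<le> s" using h by auto
    then have P: "\<kappa> > 0 \<and> \<bar>c\<bar> < d \<and> \<kappa> < h \<and> (\<forall>y\<in>{-(d - c)..d + c}. wU (\<kappa>\<^sup>2 * h\<^sup>2) (\<kappa>\<^sup>2) (d - c) y > 0)"
      using \<delta>(3)[of \<kappa> d c h] * s by simp
    then have cr: "critical \<kappa> d c h" using h by (simp add: critical_def)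
    moreover have "h_crit \<kappa> d c = h" using P cr by (intro h_crit_critical) auto
    ultimately show "\<kappa> > 0 \<and> \<bar>c\<bar> < d \<and> critical \<kappa> d c (h_crit \<kappa> d c) \<and> \<bar>h_crit \<kappa> d c - h\<^sub>0\<bar> < r \<and> \<kappa> < h_crit \<kappa> d c"
      using P hb s by simp
  qed
qed

text \<open>The energy identity between the two ends: both slopes vanish, the left value is 1 and
  the right value is given by \<open>wU_right\<close>.\<close>

lemma I_fun_critical:
  assumes k: "\<kappa> > 0" "d > 0" "\<bar>c\<bar> < d" and h: "critical \<kappa> d c h" and hk: "\<kappa> < h"
  shows "I_fun \<kappa> d c = (wO' (\<kappa>\<^sup>2 * h\<^sup>2) (\<kappa>\<^sup>2) (d - c))\<^sup>2 / (2 * (\<kappa>\<^sup>2 * h\<^sup>2)) *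
     (wPhi (\<kappa>\<^sup>2 * h\<^sup>2) (\<kappa>\<^sup>2) (d + c) - wPhi (\<kappa>\<^sup>2 * h\<^sup>2) (\<kappa>\<^sup>2) (d - c))"
proof -
  define \<mu> where "\<mu> = \<kappa>\<^sup>2 * h\<^sup>2"
  have \<mu>: "\<mu> > 0" using k hk by (simp add: \<mu>_def)
  have kh: "\<kappa>\<^sup>2 \<le> \<kappa> * h" using hk k by (simp add: power2_eq_square)
  have X: "wO' \<mu> (\<kappa>\<^sup>2) y > 0" for y
    using wO'_pos[OF _ kh, of y] k by (simp add: \<mu>_def power_mult_distrib)
  let ?u = "wU \<mu> (\<kappa>\<^sup>2) (d - c)" and ?u' = "wU' \<mu> (\<kappa>\<^sup>2) (d - c)"
  let ?G = "\<lambda>x. ((\<mu> * (x + c)\<^sup>2 - \<kappa>\<^sup>2) * (?u (x + c))\<^sup>2 - (?u' (x + c))\<^sup>2) / (2 * \<mu>)"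
  have "((\<lambda>x. (x + c) * (?u (x + c))\<^sup>2) has_integral (?G d - ?G (- d))) {-d..d}"
  proof (rule fundamental_theorem_of_calculus)
    fix x
    have "((\<lambda>x. x + c) has_real_derivative 1) (at x within {-d..d})" by (auto intro!: derivative_eq_intros)
    from DERIV_chain2[OF wU_energy[of \<mu> "\<kappa>\<^sup>2" "d - c"] this]
    have "(?G has_real_derivative (2 * \<mu> * ((x + c) * (?u (x + c))\<^sup>2) * 1) / (2 * \<mu>)) (at x within {-d..d})"
      by (rule DERIV_cdivide)
    then show "(?G has_vector_derivative (x + c) * (?u (x + c))\<^sup>2) (at x within {-d..d})"
      using \<mu> by (simp add: has_real_derivative_iff_has_vector_derivative)
  qed (use k in simp)
  then have "integral {-d..d} (\<lambda>x. (x + c) * (?u (x + c))\<^sup>2) = ?G d - ?G (- d)" by (rule integral_unique)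
  moreover have "I_fun \<kappa> d c = integral {-d..d} (\<lambda>x. (x + c) * (?u (x + c))\<^sup>2)"
    unfolding I_fun_def using h_crit_critical(2)[OF k h] by (intro integral_cong) (simp add: \<mu>_def)
  moreover have "?u' (d + c) = 0" using h by (simp add: critical_def \<mu>_def)
  moreover have "?u (d + c) = wO' \<mu> (\<kappa>\<^sup>2) (d - c) / wO' \<mu> (\<kappa>\<^sup>2) (d + c)"
    using wU_right[of \<mu> "\<kappa>\<^sup>2" "d - c" "d + c"] calculation(3) X[of "d + c"] by (simp add: field_simps)
  moreover have "- d + c = - (d - c)" by simp
  then have "?u (- d + c) = 1" "?u' (- d + c) = 0" "(- d + c)\<^sup>2 = (d - c)\<^sup>2"
    by (simp_all only: wU_left) (simp add: power2_commute)
  ultimately have "I_fun \<kappa> d c = ((\<mu> * (d + c)\<^sup>2 - \<kappa>\<^sup>2) * (wO' \<mu> (\<kappa>\<^sup>2) (d - c) / wO' \<mu> (\<kappa>\<^sup>2) (d + c))\<^sup>2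
      - (\<mu> * (d - c)\<^sup>2 - \<kappa>\<^sup>2)) / (2 * \<mu>)"
    by (simp add: diff_divide_distrib)
  also have "\<dots> = (wO' \<mu> (\<kappa>\<^sup>2) (d - c))\<^sup>2 / (2 * \<mu>) * (wPhi \<mu> (\<kappa>\<^sup>2) (d + c) - wPhi \<mu> (\<kappa>\<^sup>2) (d - c))"
    using X[of "d - c"] X[of "d + c"] \<mu> by (simp add: wPhi_def field_simps)
  finally show ?thesis by (simp add: \<mu>_def)
qed

lemma wN_continuous [continuous_intros]:
  fixes f g k :: "'a::topological_space \<Rightarrow> real"
  assumes "continuous_on S f" "continuous_on S g" "continuous_on S k"
  shows "continuous_on S (\<lambda>x. wN (f x) (g x) (k x))"
  unfolding wN_def by (intro continuous_intros assms)

text \<open>The difference of \<open>wPhi\<close> at d + c and d - c is written by the mean value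
  theorem as 2 c times its derivative at some \<xi>, with h(c) held fixed. Passing to the limit then
  takes continuity of h(c) at 0 and of the Weber functions in their parameters.\<close>

theorem I_fun_deriv:
  assumes k: "\<kappa> > 0" "d > 0"
  defines "h \<equiv> h_crit \<kappa> d 0"
  shows "(I_fun \<kappa> d has_real_derivative
     2 * wN (\<kappa>\<^sup>2 * h\<^sup>2) (\<kappa>\<^sup>2) d / (\<kappa>\<^sup>2 * h\<^sup>2 * wO' (\<kappa>\<^sup>2 * h\<^sup>2) (\<kappa>\<^sup>2) d)) (at 0)"
proof -
  note h = h_crit_symmetric[OF k, folded h_def]
  define H where "H c = h_crit \<kappa> d c" for c
  define \<mu> where "\<mu> c = \<kappa>\<^sup>2 * (H c)\<^sup>2" for c
  obtain \<delta> where \<delta>: "\<delta> > 0" "\<And>c. \<bar>c\<bar> < \<delta> \<Longrightarrow> \<bar>c\<bar> < d \<and> critical \<kappa> d c (H c) \<and> \<kappa> < H c"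
    using critical_near[OF k h zero_less_one] unfolding H_def by (metis abs_zero diff_self)
  have H: "(H \<longlongrightarrow> h) (at 0)"
  proof (rule LIM_I)
    fix r :: real assume "r > 0"
    then obtain \<delta> where "\<delta> > 0" "\<And>c. \<bar>c\<bar> < \<delta> \<Longrightarrow> \<bar>H c - h\<bar> < r"
      using critical_near[OF k h \<open>r > 0\<close>] unfolding H_def by (metis abs_zero diff_self)
    then show "\<exists>s>0. \<forall>x. x \<noteq> 0 \<and> norm (x - 0) < s \<longrightarrow> norm (H x - h) < r" by auto
  qed
  have X: "wO' (\<mu> c) (\<kappa>\<^sup>2) y > 0" if "\<bar>c\<bar> < \<delta>" for c y
  proof -
    have "\<kappa>\<^sup>2 \<le> \<kappa> * H c" using \<delta>(2)[OF that] k by (simp add: power2_eq_square)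
    from wO'_pos[OF _ this, of y] show ?thesis using k by (simp add: \<mu>_def power_mult_distrib)
  qed
  have "\<exists>\<xi>. \<bar>\<xi> - d\<bar> \<le> \<bar>c\<bar> \<and> wPhi (\<mu> c) (\<kappa>\<^sup>2) (d + c) - wPhi (\<mu> c) (\<kappa>\<^sup>2) (d - c) =
      2 * c * (2 * wN (\<mu> c) (\<kappa>\<^sup>2) \<xi> / wO' (\<mu> c) (\<kappa>\<^sup>2) \<xi> ^ 3)" if c: "\<bar>c\<bar> < \<delta>" for c
  proof -
    have D: "DERIV (wPhi (\<mu> c) (\<kappa>\<^sup>2)) y :> 2 * wN (\<mu> c) (\<kappa>\<^sup>2) y / wO' (\<mu> c) (\<kappa>\<^sup>2) y ^ 3" for y
      using X[OF c, of y] by (intro wPhi_deriv) auto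
    consider "c = 0" | "c > 0" | "c < 0" by linarith
    then show ?thesis
    proof cases
      case 1 then show ?thesis by (intro exI[of _ d]) auto
    next
      case 2
      then have "d - c < d + c" by simp
      from MVT2[OF this D] obtain \<xi> where "d - c < \<xi>" "\<xi> < d + c" "wPhi (\<mu> c) (\<kappa>\<^sup>2) (d + c) - wPhi (\<mu> c) (\<kappa>\<^sup>2) (d - c) =
         (d + c - (d - c)) * (2 * wN (\<mu> c) (\<kappa>\<^sup>2) \<xi> / wO' (\<mu> c) (\<kappa>\<^sup>2) \<xi> ^ 3)" by auto
      then show ?thesis using 2 by (intro exI[of _ \<xi>]) auto
    next
      case 3
      then have "d + c < d - c" by simp
      from MVT2[OF this D] obtain \<xi> where "d + c < \<xi>" "\<xi> < d - c" "wPhi (\<mu> c) (\<kappa>\<^sup>2) (d - c) - wPhi (\<mu> c) (\<kappa>\<^sup>2) (d + c) =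
         (d - c - (d + c)) * (2 * wN (\<mu> c) (\<kappa>\<^sup>2) \<xi> / wO' (\<mu> c) (\<kappa>\<^sup>2) \<xi> ^ 3)" by auto
      then show ?thesis using 3 by (intro exI[of _ \<xi>]) (auto simp: algebra_simps)
    qed
  qed
  then obtain \<xi> where \<xi>: "\<And>c. \<bar>c\<bar> < \<delta> \<Longrightarrow> \<bar>\<xi> c - d\<bar> \<le> \<bar>c\<bar>"
    "\<And>c. \<bar>c\<bar> < \<delta> \<Longrightarrow> wPhi (\<mu> c) (\<kappa>\<^sup>2) (d + c) - wPhi (\<mu> c) (\<kappa>\<^sup>2) (d - c) =
      2 * c * (2 * wN (\<mu> c) (\<kappa>\<^sup>2) (\<xi> c) / wO' (\<mu> c) (\<kappa>\<^sup>2) (\<xi> c) ^ 3)" by metis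
  have near: "\<forall>\<^sub>F c in at 0. \<bar>c\<bar> < \<delta>"
    using \<delta>(1) by (auto simp: eventually_at dist_real_def)
  have \<xi>lim: "(\<xi> \<longlongrightarrow> d) (at 0)"
  proof (rule LIM_zero_cancel)
    show "((\<lambda>c. \<xi> c - d) \<longlongrightarrow> 0) (at 0)"
    proof (rule Lim_null_comparison)
      show "\<forall>\<^sub>F c in at 0. norm (\<xi> c - d) \<le> \<bar>c\<bar>"
        using near by eventually_elim (simp add: \<xi>(1))
      show "((\<lambda>c. \<bar>c\<bar>) \<longlongrightarrow> 0) (at (0::real))" by (auto intro!: tendsto_eq_intros)
    qed
  qed
  have \<mu>lim: "(\<mu> \<longlongrightarrow> \<kappa>\<^sup>2 * h\<^sup>2) (at 0)" unfolding \<mu>_def by (intro tendsto_intros H)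
  have comp: "((\<lambda>c. f (\<mu> c) (g c)) \<longlongrightarrow> f (\<kappa>\<^sup>2 * h\<^sup>2) d) (at 0)"
    if f: "continuous_on UNIV (\<lambda>p. f (fst p) (snd p))" and g: "(g \<longlongrightarrow> d) (at 0)"
    for f :: "real \<Rightarrow> real \<Rightarrow> real" and g
    using continuous_on_tendsto_compose[OF f tendsto_Pair[OF \<mu>lim g]] by simp
  let ?X = "wO' (\<kappa>\<^sup>2 * h\<^sup>2) (\<kappa>\<^sup>2) d" and ?N = "wN (\<kappa>\<^sup>2 * h\<^sup>2) (\<kappa>\<^sup>2) d"
  have X0: "?X > 0" using X[of 0 d] \<delta>(1) by (simp add: \<mu>_def H_def h_def)
  let ?q = "\<lambda>c. (wO' (\<mu> c) (\<kappa>\<^sup>2) (d - c))\<^sup>2 / (2 * \<mu> c) * (2 * (2 * wN (\<mu> c) (\<kappa>\<^sup>2) (\<xi> c) / wO' (\<mu> c) (\<kappa>\<^sup>2) (\<xi> c) ^ 3))"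
  have dc: "((\<lambda>c. d - c) \<longlongrightarrow> d) (at 0)" by (auto intro!: tendsto_eq_intros)
  have m0: "\<kappa>\<^sup>2 * h\<^sup>2 > 0" using h k by simp
  have "(?q \<longlongrightarrow> ?X\<^sup>2 / (2 * (\<kappa>\<^sup>2 * h\<^sup>2)) * (2 * (2 * ?N / ?X ^ 3))) (at 0)"
    using X0 m0
    by (intro tendsto_intros \<mu>lim comp[of "\<lambda>\<mu> y. wO' \<mu> (\<kappa>\<^sup>2) y"] comp[of "\<lambda>\<mu> y. wN \<mu> (\<kappa>\<^sup>2) y"] dc \<xi>lim continuous_intros) auto
  moreover have "\<forall>\<^sub>F c in at 0. (I_fun \<kappa> d (0 + c) - I_fun \<kappa> d 0) / c = ?q c"
  proof -
    have I: "I_fun \<kappa> d c = c * ?q c" if "\<bar>c\<bar> < \<delta>" for c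
      using I_fun_critical[of \<kappa> d c "H c"] \<delta>(2)[OF that] k \<xi>(2)[OF that]
      by (simp add: \<mu>_def[symmetric])
    have "\<forall>\<^sub>F c in at (0::real). c \<noteq> 0" by (simp add: eventually_at_filter)
    with near show ?thesis
    proof eventually_elim
      case (elim c)
      show ?case using I[OF elim(1)] I[of 0] \<delta>(1) elim(2) by simp
    qed
  qed
  ultimately have "((\<lambda>c. (I_fun \<kappa> d (0 + c) - I_fun \<kappa> d 0) / c) \<longlongrightarrow>
      ?X\<^sup>2 / (2 * (\<kappa>\<^sup>2 * h\<^sup>2)) * (2 * (2 * ?N / ?X ^ 3))) (at 0)"
    by (subst tendsto_cong)
  moreover have "?X\<^sup>2 / (2 * (\<kappa>\<^sup>2 * h\<^sup>2)) * (2 * (2 * ?N / ?X ^ 3)) = 2 * ?N / (\<kappa>\<^sup>2 * h\<^sup>2 * ?X)"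
    using X0 m0 by (simp add: power2_eq_square power3_eq_cube)
  ultimately show ?thesis by (simp only: DERIV_def)
qed



section \<open>The shooting map and its value at \<epsilon> = 0\<close>

lemma flow_components_continuous:
  fixes g :: "'a::topological_space \<Rightarrow> state" and \<tau> :: "'a \<Rightarrow> real"
  assumes "continuous_on S g" "continuous_on S \<tau>" "\<And>z. z \<in> S \<Longrightarrow> \<tau> z \<in> {0..T}"
  shows "continuous_on S (\<lambda>z. f\<psi> M (g z) (\<tau> z))" "continuous_on S (\<lambda>z. fp M (g z) (\<tau> z))"
    "continuous_on S (\<lambda>z. fa M (g z) (\<tau> z))" "continuous_on S (\<lambda>z. fj M (g z) (\<tau> z))"
proof -
  have "continuous_on S (\<lambda>z. (g z, \<tau> z))" by (intro continuous_intros assms)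
  from continuous_on_compose2[OF flow_continuous[of T M] this] assms(3)
  have c: "continuous_on S (\<lambda>z. flow M (g z) (\<tau> z))" by (auto simp: image_subset_iff)
  show "continuous_on S (\<lambda>z. f\<psi> M (g z) (\<tau> z))" "continuous_on S (\<lambda>z. fp M (g z) (\<tau> z))"
    "continuous_on S (\<lambda>z. fa M (g z) (\<tau> z))" "continuous_on S (\<lambda>z. fj M (g z) (\<tau> z))"
    unfolding flow_components by (intro continuous_on_fst continuous_on_snd c)+
qed

lemma orbit_subset: "orbit \<nu> \<epsilon> h T \<psi> p a j \<Longrightarrow> T' \<le> T \<Longrightarrow> orbit \<nu> \<epsilon> h T' \<psi> p a j"
  unfolding orbit_def by (auto intro: DERIV_subset[where s = "{0..T}"])

lemma linear_orbit_exists: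
  "\<exists>j. j 0 = 0 \<and> orbit \<nu> 0 h T (\<lambda>t. wU (\<nu> * h\<^sup>2) \<nu> L (t - L)) (\<lambda>t. wU' (\<nu> * h\<^sup>2) \<nu> L (t - L)) (\<lambda>t. h * (t - L)) j"
proof -
  have "continuous_on UNIV (\<lambda>t. (wU (\<nu> * h\<^sup>2) \<nu> L (t - L))\<^sup>2 * (h * (t - L)))" by (intro continuous_intros)
  from antiderivative_real_line[OF this] obtain j where "j 0 = 0"
    "\<And>t. (j has_real_derivative (wU (\<nu> * h\<^sup>2) \<nu> L (t - L))\<^sup>2 * (h * (t - L))) (at t)"
    by (auto simp: has_real_derivative_iff_has_vector_derivative)
  moreover have "((\<lambda>t. wU' (\<nu> * h\<^sup>2) \<nu> L (t - L)) has_real_derivative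
      \<nu> * (0 * (wU (\<nu> * h\<^sup>2) \<nu> L (t - L))\<^sup>2 + (h * (t - L))\<^sup>2 - 1) * wU (\<nu> * h\<^sup>2) \<nu> L (t - L)) (at t within S)" for t S
  proof -
    have eq: "\<nu> * (0 * (wU (\<nu> * h\<^sup>2) \<nu> L (t - L))\<^sup>2 + (h * (t - L))\<^sup>2 - 1) * wU (\<nu> * h\<^sup>2) \<nu> L (t - L)
      = (\<nu> * h\<^sup>2 * (t - L)\<^sup>2 - \<nu>) * wU (\<nu> * h\<^sup>2) \<nu> L (t - L)"
      unfolding power_mult_distrib by (simp add: algebra_simps)
    show ?thesis unfolding eq by (auto intro!: derivative_eq_intros)
  qed
  moreover have "((\<lambda>t. wU (\<nu> * h\<^sup>2) \<nu> L (t - L)) has_real_derivative wU' (\<nu> * h\<^sup>2) \<nu> L (t - L)) (at t within S)"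
    "((\<lambda>t. h * (t - L)) has_real_derivative h + 0 * j t) (at t within S)" for t S and j :: "real \<Rightarrow> real"
    by (auto intro!: derivative_eq_intros)
  ultimately show ?thesis
    unfolding orbit_def by (intro exI[of _ j] conjI ballI) (blast intro: has_field_derivative_at_within)+
qed

text \<open>At \<epsilon> = 0 the equation for a decouples: a is affine with zero at t = L, and
  \<psi> solves the resulting linear equation.\<close>

lemma orbit_eps0:
  assumes orb: "orbit \<nu> 0 h T \<psi> p a j" and h: "h \<noteq> 0" and init: "\<psi> 0 = 1" "p 0 = 0" "a 0 = - h * L"
    and t: "t \<in> {0..T}"
  shows "a t = h * (t - L)" "\<psi> t = wU (\<nu> * h\<^sup>2) \<nu> L (t - L)" "p t = wU' (\<nu> * h\<^sup>2) \<nu> L (t - L)"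
proof -
  note o = orb[unfolded orbit_def, rule_format]
  have a: "a t = h * (t - L)" if t: "t \<in> {0..T}" for t
  proof -
    have "((\<lambda>t. a t - h * (t - L)) has_derivative (\<lambda>_. 0)) (at s within {0..T})" if "s \<in> {0..T}" for s
    proof -
      have "((\<lambda>t. a t - h * (t - L)) has_real_derivative (h + 0 * j s) - h * 1) (at s within {0..T})"
        using o[OF that] by (auto intro!: derivative_eq_intros)
      then show ?thesis by (simp add: has_field_derivative_def lambda_zero)
    qed
    from has_derivative_zero_unique[OF convex_real_interval(5) this _ t, of 0] t init
    show ?thesis by (auto simp: algebra_simps)
  qed
  show "a t = h * (t - L)" by (rule a[OF t])
  have "\<psi> t = wU (\<nu> * h\<^sup>2) \<nu> L (t - L) \<and> p t = wU' (\<nu> * h\<^sup>2) \<nu> L (t - L)"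
  proof (rule linear_ode_unique[where a = 0 and b = T and s = 0 and t = t and u = \<psi> and u' = p
        and v = "\<lambda>t. wU (\<nu> * h\<^sup>2) \<nu> L (t - L)" and v' = "\<lambda>t. wU' (\<nu> * h\<^sup>2) \<nu> L (t - L)"
        and Q = "\<lambda>t. \<nu> * h\<^sup>2 * (t - L)\<^sup>2 - \<nu>"])
    fix s assume s: "s \<in> {0..T}"
    show "(\<psi> has_real_derivative p s) (at s within {0..T})" using o[OF s] by blast
    have "\<nu> * (0 * (\<psi> s)\<^sup>2 + (a s)\<^sup>2 - 1) * \<psi> s = (\<nu> * h\<^sup>2 * (s - L)\<^sup>2 - \<nu>) * \<psi> s"
      unfolding a[OF s] power_mult_distrib by (simp add: algebra_simps)
    then show "(p has_real_derivative (\<nu> * h\<^sup>2 * (s - L)\<^sup>2 - \<nu>) * \<psi> s) (at s within {0..T})"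
      using o[OF s] by metis
    show "((\<lambda>t. wU (\<nu> * h\<^sup>2) \<nu> L (t - L)) has_real_derivative wU' (\<nu> * h\<^sup>2) \<nu> L (s - L)) (at s within {0..T})"
      "((\<lambda>t. wU' (\<nu> * h\<^sup>2) \<nu> L (t - L)) has_real_derivative
         (\<nu> * h\<^sup>2 * (s - L)\<^sup>2 - \<nu>) * wU (\<nu> * h\<^sup>2) \<nu> L (s - L)) (at s within {0..T})"
      by (auto intro!: derivative_eq_intros)
  qed (use init t in \<open>auto intro!: continuous_intros\<close>)
  then show "\<psi> t = wU (\<nu> * h\<^sup>2) \<nu> L (t - L)" "p t = wU' (\<nu> * h\<^sup>2) \<nu> L (t - L)" by auto
qed

text \<open>At \<epsilon> = 0 the value of j is expressed by the other components through the energy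
  identity. This is how the condition j = 0 at the right end becomes a condition on
  \<open>wPhi\<close>, or on I(c).\<close>

lemma orbit_eps0_j:
  assumes orb: "orbit \<nu> 0 h T \<psi> p a j" and t: "t \<in> {0..T}" and j0: "j 0 = 0"
  shows "2 * \<nu> * h * j t = (\<nu> * ((a t)\<^sup>2 - 1) * (\<psi> t)\<^sup>2 - (p t)\<^sup>2) - (\<nu> * ((a 0)\<^sup>2 - 1) * (\<psi> 0)\<^sup>2 - (p 0)\<^sup>2)"
proof -
  note o = orb[unfolded orbit_def, rule_format]
  let ?E = "\<lambda>t. (\<nu> * ((a t)\<^sup>2 - 1) * (\<psi> t)\<^sup>2 - (p t)\<^sup>2) - 2 * \<nu> * h * j t"
  have "(?E has_derivative (\<lambda>_. 0)) (at s within {0..T})" if s: "s \<in> {0..T}" for s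
  proof -
    have d: "(\<psi> has_real_derivative p s) (at s within {0..T})"
      "(p has_real_derivative \<nu> * ((a s)\<^sup>2 - 1) * \<psi> s) (at s within {0..T})"
      "(a has_real_derivative h) (at s within {0..T})"
      "(j has_real_derivative (\<psi> s)\<^sup>2 * a s) (at s within {0..T})"
      using o[OF s] by auto
    have "(?E has_real_derivative 0) (at s within {0..T})"
      by (auto intro!: derivative_eq_intros d simp: power2_eq_square algebra_simps)
    then show ?thesis by (simp add: has_field_derivative_def lambda_zero)
  qed
  from has_derivative_zero_unique[OF convex_real_interval(5) this _ t, of 0] t j0
  show ?thesis by auto
qed

text \<open>Controls the midpoint value of a in both existence proofs: for bounded j it differs by
  O(\<epsilon>) from that of the affine function.\<close>

lemma orbit_a_bound:
  assumes orb: "orbit \<nu> \<epsilon> h T \<psi> p a j" and j: "\<And>t. t \<in> {0..T} \<Longrightarrow> \<bar>j t\<bar> \<le> M" and t: "t \<in> {0..T}"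
  shows "\<bar>a t - (a 0 + h * t)\<bar> \<le> \<bar>\<epsilon>\<bar> * M * t"
proof -
  have d: "((\<lambda>t. a t - h * t) has_real_derivative \<epsilon> * j s) (at s within {0..T})" if "s \<in> {0..T}" for s
    using orb that unfolding orbit_def by (auto intro!: derivative_eq_intros)
  have sub: "((\<lambda>t. a t - h * t) has_real_derivative \<epsilon> * j s) (at s within {0..t})" if "s \<in> {0..t}" for s
    using DERIV_subset[OF d, of s "{0..t}"] that t by auto
  have "\<bar>(a t - h * t) - (a 0 - h * 0)\<bar> \<le> (\<bar>\<epsilon>\<bar> * M) * \<bar>t - 0\<bar>"
    using field_differentiable_bound[of "{0..t}" "\<lambda>t. a t - h * t" "\<lambda>s. \<epsilon> * j s" "\<bar>\<epsilon>\<bar> * M" 0 t] sub t j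
    by (auto simp: abs_mult mult_left_mono)
  then show ?thesis using t by (simp add: algebra_simps)
qed

definition start :: "real \<Rightarrow> real \<Rightarrow> real \<Rightarrow> real \<Rightarrow> state" where
  "start A h \<epsilon> \<nu> = (1, 0, A, 0, h, \<epsilon>, \<nu>)"

lemma flow_start:
  "f\<psi> M (start A h \<epsilon> \<nu>) 0 = 1" "fp M (start A h \<epsilon> \<nu>) 0 = 0" "fa M (start A h \<epsilon> \<nu>) 0 = A" "fj M (start A h \<epsilon> \<nu>) 0 = 0"
  by (simp_all add: flow_components flow(1) start_def)

lemma norm_start_diff:
  "norm (start A h \<epsilon> \<nu> - start A' h' \<epsilon>' \<nu>') \<le> \<bar>A - A'\<bar> + \<bar>h - h'\<bar> + \<bar>\<epsilon> - \<epsilon>'\<bar> + \<bar>\<nu> - \<nu>'\<bar>"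
  using norm_state_le[of 0 0 "A - A'" 0 "h - h'" "\<epsilon> - \<epsilon>'" "\<nu> - \<nu>'"]
  by (simp add: start_def)

lemma start_continuous [continuous_intros]:
  fixes f g k l :: "'a::topological_space \<Rightarrow> real"
  assumes "continuous_on S f" "continuous_on S g" "continuous_on S k" "continuous_on S l"
  shows "continuous_on S (\<lambda>x. start (f x) (g x) (k x) (l x))"
  unfolding start_def by (intro continuous_intros assms)

text \<open>The common bound \<open>M\<close> is the clipping level, so the truncated flow is a genuine orbit here.\<close>

lemma near_base:
  assumes k: "\<kappa>\<^sub>0 > 0" "d\<^sub>0 > 0" and h0: "\<kappa>\<^sub>0 < h\<^sub>0" "wE' (\<kappa>\<^sub>0\<^sup>2 * h\<^sub>0\<^sup>2) (\<kappa>\<^sub>0\<^sup>2) d\<^sub>0 = 0"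
  shows "\<exists>M C \<delta>. M > 0 \<and> C \<ge> 0 \<and> \<delta> > 0 \<and> \<delta> \<le> 1 \<and> \<delta> < h\<^sub>0 \<and>
    (\<forall>A h \<epsilon> \<nu>. \<bar>A + h\<^sub>0 * d\<^sub>0\<bar> < \<delta> \<longrightarrow> \<bar>h - h\<^sub>0\<bar> < \<delta> \<longrightarrow> \<bar>\<epsilon>\<bar> < \<delta> \<longrightarrow> \<bar>\<nu> - \<kappa>\<^sub>0\<^sup>2\<bar> < \<delta> \<longrightarrow>
      orbit \<nu> \<epsilon> h (2 * d\<^sub>0 + 1) (f\<psi> M (start A h \<epsilon> \<nu>)) (fp M (start A h \<epsilon> \<nu>)) (fa M (start A h \<epsilon> \<nu>)) (fj M (start A h \<epsilon> \<nu>)) \<and>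
      (\<forall>t\<in>{0..2 * d\<^sub>0 + 1}. f\<psi> M (start A h \<epsilon> \<nu>) t > 0 \<and>
        \<bar>f\<psi> M (start A h \<epsilon> \<nu>) t\<bar> \<le> M \<and> \<bar>fp M (start A h \<epsilon> \<nu>) t\<bar> \<le> M \<and>
        \<bar>fa M (start A h \<epsilon> \<nu>) t\<bar> \<le> M \<and> \<bar>fj M (start A h \<epsilon> \<nu>) t\<bar> \<le> M \<and>
        \<bar>fa M (start A h \<epsilon> \<nu>) t - h\<^sub>0 * (t - d\<^sub>0)\<bar> \<le> C * (\<bar>A + h\<^sub>0 * d\<^sub>0\<bar> + \<bar>h - h\<^sub>0\<bar> + \<bar>\<epsilon>\<bar> + \<bar>\<nu> - \<kappa>\<^sub>0\<^sup>2\<bar>)))"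
proof -
  \<comment> \<open>The time horizon exceeds 2 d by 1 so that nearby half-widths are covered by the
    same estimate.\<close>
  let ?T = "2 * d\<^sub>0 + 1"
  let ?U = "\<lambda>t. wU (\<kappa>\<^sub>0\<^sup>2 * h\<^sub>0\<^sup>2) (\<kappa>\<^sub>0\<^sup>2) d\<^sub>0 (t - d\<^sub>0)" and ?U' = "\<lambda>t. wU' (\<kappa>\<^sub>0\<^sup>2 * h\<^sub>0\<^sup>2) (\<kappa>\<^sub>0\<^sup>2) d\<^sub>0 (t - d\<^sub>0)"
  obtain j where j: "j 0 = 0" "orbit (\<kappa>\<^sub>0\<^sup>2) 0 h\<^sub>0 ?T ?U ?U' (\<lambda>t. h\<^sub>0 * (t - d\<^sub>0)) j"
    using linear_orbit_exists[of "\<kappa>\<^sub>0\<^sup>2" h\<^sub>0 ?T d\<^sub>0] by blast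
  have kh: "\<kappa>\<^sub>0\<^sup>2 \<le> \<kappa>\<^sub>0 * h\<^sub>0" using h0 k by (simp add: power2_eq_square)
  have Upos: "?U t > 0" for t
    using wE_pos[OF _ kh, of "t - d\<^sub>0"] wO'_pos[OF _ kh, of d\<^sub>0] h0 k by (simp add: wU_def power_mult_distrib)
  have bdd: "\<exists>B. \<forall>t\<in>{0..?T}. \<bar>f t\<bar> \<le> B" if "continuous_on {0..?T} f" for f :: "real \<Rightarrow> real"
  proof -
    have "bounded (f ` {0..?T})" by (intro compact_imp_bounded compact_continuous_image that) simp
    then show ?thesis by (auto simp: bounded_iff)
  qed
  have cont: "continuous_on {0..?T} ?U" "continuous_on {0..?T} ?U'" "continuous_on {0..?T} (\<lambda>t. h\<^sub>0 * (t - d\<^sub>0))"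
    "continuous_on {0..?T} j"
    using j(2) unfolding orbit_def by (auto intro!: continuous_intros intro: DERIV_continuous_on)
  obtain B1 B2 B3 B4 where B: "\<forall>t\<in>{0..?T}. \<bar>?U t\<bar> \<le> B1" "\<forall>t\<in>{0..?T}. \<bar>?U' t\<bar> \<le> B2"
    "\<forall>t\<in>{0..?T}. \<bar>h\<^sub>0 * (t - d\<^sub>0)\<bar> \<le> B3" "\<forall>t\<in>{0..?T}. \<bar>j t\<bar> \<le> B4"
    using bdd[OF cont(1)] bdd[OF cont(2)] bdd[OF cont(3)] bdd[OF cont(4)] by auto
  have T0: "(0::real) \<in> {0..?T}" using k by simp
  have Bn: "B1 \<ge> 0" "B2 \<ge> 0" "B3 \<ge> 0" "B4 \<ge> 0"
    using B T0 by (meson abs_ge_zero order_trans)+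
  \<comment> \<open>The leading 1 is a margin: data at distance at most 1 from the base orbit stay
    below the clipping level.\<close>
  define M where "M = 1 + (B1 + B2 + B3 + B4 + h\<^sub>0 + \<kappa>\<^sub>0\<^sup>2 + 1)"
  have h0p: "h\<^sub>0 > 0" using h0 k by simp
  have k20: "\<kappa>\<^sub>0\<^sup>2 \<ge> 0" by simp
  have MB: "B1 \<le> M - 1" "B2 \<le> M - 1" "B3 \<le> M - 1" "B4 \<le> M - 1" "h\<^sub>0 + 1 \<le> M" "\<kappa>\<^sub>0\<^sup>2 + 1 \<le> M" "1 \<le> M"
    using Bn h0p k20 unfolding M_def by linarith+
  let ?base = "start (- h\<^sub>0 * d\<^sub>0) h\<^sub>0 0 (\<kappa>\<^sub>0\<^sup>2)"
  have base: "flow M ?base t = (?U t, ?U' t, h\<^sub>0 * (t - d\<^sub>0), j t, h\<^sub>0, 0, \<kappa>\<^sub>0\<^sup>2)" if t: "t \<in> {0..?T}" for t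
  proof -
    have "flow M (?U 0, ?U' 0, h\<^sub>0 * (0 - d\<^sub>0), j 0, h\<^sub>0, 0, \<kappa>\<^sub>0\<^sup>2) t = (?U t, ?U' t, h\<^sub>0 * (t - d\<^sub>0), j t, h\<^sub>0, 0, \<kappa>\<^sub>0\<^sup>2)"
    proof (rule orbit_eq_flow[OF j(2) _ _ _ _ t])
      fix t assume t: "t \<in> {0..?T}"
      show "\<bar>?U t\<bar> \<le> M \<and> \<bar>?U' t\<bar> \<le> M \<and> \<bar>h\<^sub>0 * (t - d\<^sub>0)\<bar> \<le> M \<and> \<bar>j t\<bar> \<le> M"
        using B(1)[rule_format, OF t] B(2)[rule_format, OF t] B(3)[rule_format, OF t] B(4)[rule_format, OF t] MB
        by linarith
    qed (use MB h0p in auto)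
    then show ?thesis using j(1) by (simp add: start_def)
  qed
  obtain C where C: "C \<ge> 0" "\<And>x y t. t \<in> {0..?T} \<Longrightarrow> norm (flow M x t - flow M y t) \<le> C * norm (x - y)"
    using flow_lipschitz[of ?T M] by blast
  obtain t0 where t0: "t0 \<in> {0..?T}" "\<And>t. t \<in> {0..?T} \<Longrightarrow> ?U t0 \<le> ?U t"
    using continuous_attains_inf[OF _ _ cont(1)] T0 by fastforce
  define u where "u = min (?U t0) 1"
  have u: "u > 0" "u \<le> 1" "\<And>t. t \<in> {0..?T} \<Longrightarrow> u \<le> ?U t" using Upos[of t0] t0 by (auto simp: u_def intro: min.coboundedI1)
  \<comment> \<open>Four deviations below \<delta> move the flow by at most 4 C \<delta> < u <= 1.
    This keeps \<psi> positive and all components within the margin.\<close>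
  define \<delta> where "\<delta> = min (min 1 (h\<^sub>0 / 2)) (u / (8 * (C + 1)))"
  have \<delta>: "\<delta> > 0" "\<delta> \<le> 1" "\<delta> < h\<^sub>0" using u C h0p by (auto simp: \<delta>_def)
  have "\<delta> \<le> u / (8 * (C + 1))" unfolding \<delta>_def by (rule min.cobounded2)
  moreover have "0 < 8 * (C + 1)" using C(1) by simp
  ultimately have "\<delta> * (8 * (C + 1)) \<le> u" by (simp only: pos_le_divide_eq)
  then have C\<delta>: "C * (4 * \<delta>) < u" using \<delta> u C by (simp add: algebra_simps)
  have main: "orbit \<nu> \<epsilon> h ?T (f\<psi> M (start A h \<epsilon> \<nu>)) (fp M (start A h \<epsilon> \<nu>)) (fa M (start A h \<epsilon> \<nu>)) (fj M (start A h \<epsilon> \<nu>)) \<and>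
      (\<forall>t\<in>{0..?T}. f\<psi> M (start A h \<epsilon> \<nu>) t > 0 \<and>
        \<bar>f\<psi> M (start A h \<epsilon> \<nu>) t\<bar> \<le> M \<and> \<bar>fp M (start A h \<epsilon> \<nu>) t\<bar> \<le> M \<and>
        \<bar>fa M (start A h \<epsilon> \<nu>) t\<bar> \<le> M \<and> \<bar>fj M (start A h \<epsilon> \<nu>) t\<bar> \<le> M \<and>
        \<bar>fa M (start A h \<epsilon> \<nu>) t - h\<^sub>0 * (t - d\<^sub>0)\<bar> \<le> C * (\<bar>A + h\<^sub>0 * d\<^sub>0\<bar> + \<bar>h - h\<^sub>0\<bar> + \<bar>\<epsilon>\<bar> + \<bar>\<nu> - \<kappa>\<^sub>0\<^sup>2\<bar>))"
    if *: "\<bar>A + h\<^sub>0 * d\<^sub>0\<bar> < \<delta>" "\<bar>h - h\<^sub>0\<bar> < \<delta>" "\<bar>\<epsilon>\<bar> < \<delta>" "\<bar>\<nu> - \<kappa>\<^sub>0\<^sup>2\<bar> < \<delta>" for A h \<epsilon> \<nu>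
  proof -
    let ?x = "start A h \<epsilon> \<nu>"
    let ?s = "\<bar>A + h\<^sub>0 * d\<^sub>0\<bar> + \<bar>h - h\<^sub>0\<bar> + \<bar>\<epsilon>\<bar> + \<bar>\<nu> - \<kappa>\<^sub>0\<^sup>2\<bar>"
    have d: "norm (flow M ?x t - flow M ?base t) \<le> C * ?s" if t: "t \<in> {0..?T}" for t
    proof -
      have "norm (?x - ?base) \<le> ?s" using norm_start_diff[of A h \<epsilon> \<nu> "- h\<^sub>0 * d\<^sub>0" h\<^sub>0 0 "\<kappa>\<^sub>0\<^sup>2"] by simp
      then have "C * norm (?x - ?base) \<le> C * ?s" using C(1) by (rule mult_left_mono)
      with C(2)[OF t, of ?x ?base] show ?thesis by linarith
    qed
    have "C * ?s \<le> C * (4 * \<delta>)" using * C(1) by (intro mult_left_mono) auto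
    then have Cs: "C * ?s < u" using C\<delta> by linarith
    have comp: "\<bar>f\<psi> M ?x t - ?U t\<bar> \<le> C * ?s" "\<bar>fp M ?x t - ?U' t\<bar> \<le> C * ?s"
      "\<bar>fa M ?x t - h\<^sub>0 * (t - d\<^sub>0)\<bar> \<le> C * ?s" "\<bar>fj M ?x t - j t\<bar> \<le> C * ?s" if t: "t \<in> {0..?T}" for t
    proof -
      note d' = d[OF t, unfolded base[OF t]]
      note n = norm_state_components(1-4)[of "flow M ?x t" "flow M ?base t", unfolded base[OF t] fst_conv snd_conv]
      show "\<bar>f\<psi> M ?x t - ?U t\<bar> \<le> C * ?s" unfolding f\<psi>_def by (rule order_trans[OF n(1) d'])
      show "\<bar>fp M ?x t - ?U' t\<bar> \<le> C * ?s" unfolding fp_def by (rule order_trans[OF n(2) d'])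
      show "\<bar>fa M ?x t - h\<^sub>0 * (t - d\<^sub>0)\<bar> \<le> C * ?s" unfolding fa_def by (rule order_trans[OF n(3) d'])
      show "\<bar>fj M ?x t - j t\<bar> \<le> C * ?s" unfolding fj_def by (rule order_trans[OF n(4) d'])
    qed
    have gen: "\<bar>f\<bar> \<le> M" if "\<bar>f - g\<bar> \<le> C * ?s" "\<bar>g\<bar> \<le> B" "B \<le> M - 1" for f g B :: real
    proof -
      have "C * ?s \<le> 1" using Cs u(2) by linarith
      with that show ?thesis by linarith
    qed
    have bd: "\<bar>f\<psi> M ?x t\<bar> \<le> M \<and> \<bar>fp M ?x t\<bar> \<le> M \<and> \<bar>fa M ?x t\<bar> \<le> M \<and> \<bar>fj M ?x t\<bar> \<le> M" if t: "t \<in> {0..?T}" for t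
      using gen[OF comp(1)[OF t] B(1)[rule_format, OF t] MB(1)] gen[OF comp(2)[OF t] B(2)[rule_format, OF t] MB(2)]
        gen[OF comp(3)[OF t] B(3)[rule_format, OF t] MB(3)] gen[OF comp(4)[OF t] B(4)[rule_format, OF t] MB(4)] by blast
    have "orbit \<nu> \<epsilon> h ?T (f\<psi> M ?x) (fp M ?x) (fa M ?x) (fj M ?x)"
    proof (rule flow_orbit[OF bd])
      show "\<bar>h\<bar> \<le> M" "\<bar>\<epsilon>\<bar> \<le> M" "\<bar>\<nu>\<bar> \<le> M" using * \<delta> MB h0p k20 by linarith+
    qed (auto simp: start_def)
    moreover have "f\<psi> M ?x t > 0" if t: "t \<in> {0..?T}" for t using comp(1)[OF t] u(3)[OF t] Cs by linarith
    ultimately show ?thesis using bd comp(3) by blast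
  qed
  show ?thesis
  proof (rule exI[of _ M], rule exI[of _ C], rule exI[of _ \<delta>], intro conjI[of "M > 0"] conjI[of "C \<ge> 0"] conjI[of "\<delta> > 0"]
      conjI[of "\<delta> \<le> 1"] conjI[of "\<delta> < h\<^sub>0"])
    show "M > 0" using MB by simp
    show "(\<forall>A h \<epsilon> \<nu>. \<bar>A + h\<^sub>0 * d\<^sub>0\<bar> < \<delta> \<longrightarrow> \<bar>h - h\<^sub>0\<bar> < \<delta> \<longrightarrow> \<bar>\<epsilon>\<bar> < \<delta> \<longrightarrow> \<bar>\<nu> - \<kappa>\<^sub>0\<^sup>2\<bar> < \<delta> \<longrightarrow>
      orbit \<nu> \<epsilon> h ?T (f\<psi> M (start A h \<epsilon> \<nu>)) (fp M (start A h \<epsilon> \<nu>)) (fa M (start A h \<epsilon> \<nu>)) (fj M (start A h \<epsilon> \<nu>)) \<and>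
      (\<forall>t\<in>{0..?T}. f\<psi> M (start A h \<epsilon> \<nu>) t > 0 \<and>
        \<bar>f\<psi> M (start A h \<epsilon> \<nu>) t\<bar> \<le> M \<and> \<bar>fp M (start A h \<epsilon> \<nu>) t\<bar> \<le> M \<and>
        \<bar>fa M (start A h \<epsilon> \<nu>) t\<bar> \<le> M \<and> \<bar>fj M (start A h \<epsilon> \<nu>) t\<bar> \<le> M \<and>
        \<bar>fa M (start A h \<epsilon> \<nu>) t - h\<^sub>0 * (t - d\<^sub>0)\<bar> \<le> C * (\<bar>A + h\<^sub>0 * d\<^sub>0\<bar> + \<bar>h - h\<^sub>0\<bar> + \<bar>\<epsilon>\<bar> + \<bar>\<nu> - \<kappa>\<^sub>0\<^sup>2\<bar>)))"
      by (intro allI impI, rule main; assumption)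
  qed (use C \<delta> in auto)
qed

subsection \<open>Symmetric solutions\<close>

text \<open>The system is reversible: run backwards from 2d, (\<psi>, -p, -a, j) solves it again,
  and at the midpoint it coincides with the original when p = a = 0.\<close>

lemma orbit_reflect:
  assumes orb: "orbit \<nu> \<epsilon> h (2 * d) \<psi> p a j" and d: "d > 0" "p d = 0" "a d = 0"
    and bd: "\<And>t. t \<in> {0..2 * d} \<Longrightarrow> \<bar>\<psi> t\<bar> \<le> M \<and> \<bar>p t\<bar> \<le> M \<and> \<bar>a t\<bar> \<le> M \<and> \<bar>j t\<bar> \<le> M"
    and par: "\<bar>h\<bar> \<le> M" "\<bar>\<epsilon>\<bar> \<le> M" "\<bar>\<nu>\<bar> \<le> M" and t: "t \<in> {0..2 * d}"
  shows "\<psi> (2 * d - t) = \<psi> t" "p (2 * d - t) = - p t" "a (2 * d - t) = - a t" "j (2 * d - t) = j t"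
proof -
  note o = orb[unfolded orbit_def, rule_format]
  define y where "y t = (\<psi> t, p t, a t, j t, h, \<epsilon>, \<nu>)" for t
  define z where "z t = (\<psi> (2 * d - t), - p (2 * d - t), - a (2 * d - t), j (2 * d - t), h, \<epsilon>, \<nu>)" for t
  have fy: "field M (\<psi> t, p t, a t, j t, h, \<epsilon>, \<nu>) =
      (p t, \<nu> * (\<epsilon> * (\<psi> t)\<^sup>2 + (a t)\<^sup>2 - 1) * \<psi> t, h + \<epsilon> * j t, (\<psi> t)\<^sup>2 * a t, 0, 0, 0)"
    "field M (\<psi> t, - p t, - a t, j t, h, \<epsilon>, \<nu>) =
      (- p t, \<nu> * (\<epsilon> * (\<psi> t)\<^sup>2 + (a t)\<^sup>2 - 1) * \<psi> t, h + \<epsilon> * j t, - ((\<psi> t)\<^sup>2 * a t), 0, 0, 0)"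
    if "t \<in> {0..2 * d}" for t
    using bd[OF that] par by (simp_all add: field_def Let_def clip_id)
  have rev: "((\<lambda>t. f (2 * d - t)) has_real_derivative - D) (at t within {0..2 * d})"
    if "(f has_real_derivative D) (at (2 * d - t) within {0..2 * d})" for f D t
  proof -
    have "(\<lambda>t. 2 * d - t) ` {0..2 * d} = {0..2 * d}" by (simp add: image_diff_atLeastAtMost)
    moreover have "((\<lambda>t. 2 * d - t) has_real_derivative - 1) (at t within {0..2 * d})"
      by (auto intro!: derivative_eq_intros)
    ultimately show ?thesis
      using DERIV_image_chain[of f D "\<lambda>t. 2 * d - t" t "{0..2 * d}" "- 1"] that by (simp add: o_def)
  qed
  have dy: "(y has_vector_derivative field M (y t)) (at t within {0..2 * d})" if t: "t \<in> {0..2 * d}" for t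
    unfolding y_def fy[OF t] using o[OF t] unfolding has_real_derivative_iff_has_vector_derivative
    by (intro has_vector_derivative_Pair has_vector_derivative_const) auto
  have dz: "(z has_vector_derivative field M (z t)) (at t within {0..2 * d})" if t: "t \<in> {0..2 * d}" for t
  proof -
    have t': "2 * d - t \<in> {0..2 * d}" using t by auto
    have 1: "((\<lambda>t. \<psi> (2 * d - t)) has_real_derivative - p (2 * d - t)) (at t within {0..2 * d})"
      by (rule rev) (use o[OF t'] in auto)
    have "((\<lambda>t. p (2 * d - t)) has_real_derivative - (\<nu> * (\<epsilon> * (\<psi> (2 * d - t))\<^sup>2 + (a (2 * d - t))\<^sup>2 - 1) * \<psi> (2 * d - t)))
       (at t within {0..2 * d})"
      by (rule rev) (use o[OF t'] in auto)
    from DERIV_minus[OF this]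
    have 2: "((\<lambda>t. - p (2 * d - t)) has_real_derivative \<nu> * (\<epsilon> * (\<psi> (2 * d - t))\<^sup>2 + (a (2 * d - t))\<^sup>2 - 1) * \<psi> (2 * d - t))
       (at t within {0..2 * d})" by simp
    have "((\<lambda>t. a (2 * d - t)) has_real_derivative - (h + \<epsilon> * j (2 * d - t))) (at t within {0..2 * d})"
      by (rule rev) (use o[OF t'] in auto)
    from DERIV_minus[OF this]
    have 3: "((\<lambda>t. - a (2 * d - t)) has_real_derivative h + \<epsilon> * j (2 * d - t)) (at t within {0..2 * d})" by (simp only: minus_minus)
    have 4: "((\<lambda>t. j (2 * d - t)) has_real_derivative - ((\<psi> (2 * d - t))\<^sup>2 * a (2 * d - t))) (at t within {0..2 * d})"
      by (rule rev) (use o[OF t'] in auto)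
    show ?thesis
      unfolding z_def fy[OF t'] using 1 2 3 4 unfolding has_real_derivative_iff_has_vector_derivative
      by (intro has_vector_derivative_Pair has_vector_derivative_const)
  qed
  obtain L where L: "L \<ge> 0" "\<And>x y. norm (field M x - field M y) \<le> L * norm (x - y)"
    using field_lipschitz[of M] by blast
  have "y t - z t = 0"
  proof (rule zero_propagation[where y = "\<lambda>t. y t - z t" and y' = "\<lambda>t. field M (y t) - field M (z t)" and s = d and L = L])
    show "y d - z d = 0" using d by (simp add: y_def z_def zero_prod_def)
  qed (use d t L dy dz in \<open>auto intro!: has_vector_derivative_diff\<close>)
  then show "\<psi> (2 * d - t) = \<psi> t" "p (2 * d - t) = - p t" "a (2 * d - t) = - a t" "j (2 * d - t) = j t"
    by (auto simp: y_def z_def zero_prod_def)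
qed

text \<open>The unknowns are h and a shift A, the initial value of a being -h d + A. At \<epsilon> =
  0 the midpoint value of a is A, and for A = 0 the midpoint slope of \<psi> is \<open>wE'\<close>
  at d, which has the sign of \<open>h - h\<^sub>0\<close>. So each unknown controls one condition
  on its pair of faces. M is fixed before r, which later makes \<phi> = \<alpha> \<psi>
  small.\<close>

theorem symmetric_orbits_exist:
  assumes k: "\<kappa> > 0" "d > 0"
  defines "h\<^sub>0 \<equiv> h_crit \<kappa> d 0"
  shows "\<exists>M>0. \<forall>r>0. \<exists>\<alpha>\<^sub>0>0. \<forall>\<alpha>. 0 < \<alpha> \<and> \<alpha> < \<alpha>\<^sub>0 \<longrightarrow> (\<exists>\<psi> p a j h.
    orbit (\<kappa>\<^sup>2) (\<alpha>\<^sup>2) h (2 * d) \<psi> p a j \<and> \<psi> 0 = 1 \<and> p 0 = 0 \<and> j 0 = 0 \<and> p (2 * d) = 0 \<and> j (2 * d) = 0 \<and>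
    h > 0 \<and> \<bar>h - h\<^sub>0\<bar> < r \<and> (\<forall>t\<in>{0..2 * d}. \<psi> t > 0 \<and> \<bar>\<psi> t\<bar> \<le> M \<and> \<bar>p t\<bar> \<le> M \<and>
      \<bar>a t - h\<^sub>0 * (t - d)\<bar> \<le> r \<and> \<bar>h + \<alpha>\<^sup>2 * j t - h\<^sub>0\<bar> \<le> r \<and> \<psi> (2 * d - t) = \<psi> t \<and> a (2 * d - t) = - a t))"
proof -
  note h0 = h_crit_symmetric[OF k, folded h\<^sub>0_def]
  obtain M C \<delta> where M: "M > 0" and C: "C \<ge> 0" and \<delta>: "\<delta> > 0" "\<delta> \<le> 1" "\<delta> < h\<^sub>0"
    and nb: "\<And>A h \<epsilon> \<nu>. \<bar>A + h\<^sub>0 * d\<bar> < \<delta> \<Longrightarrow> \<bar>h - h\<^sub>0\<bar> < \<delta> \<Longrightarrow> \<bar>\<epsilon>\<bar> < \<delta> \<Longrightarrow> \<bar>\<nu> - \<kappa>\<^sup>2\<bar> < \<delta> \<Longrightarrow>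
      orbit \<nu> \<epsilon> h (2 * d + 1) (f\<psi> M (start A h \<epsilon> \<nu>)) (fp M (start A h \<epsilon> \<nu>)) (fa M (start A h \<epsilon> \<nu>)) (fj M (start A h \<epsilon> \<nu>)) \<and>
      (\<forall>t\<in>{0..2 * d + 1}. f\<psi> M (start A h \<epsilon> \<nu>) t > 0 \<and>
        \<bar>f\<psi> M (start A h \<epsilon> \<nu>) t\<bar> \<le> M \<and> \<bar>fp M (start A h \<epsilon> \<nu>) t\<bar> \<le> M \<and>
        \<bar>fa M (start A h \<epsilon> \<nu>) t\<bar> \<le> M \<and> \<bar>fj M (start A h \<epsilon> \<nu>) t\<bar> \<le> M \<and>
        \<bar>fa M (start A h \<epsilon> \<nu>) t - h\<^sub>0 * (t - d)\<bar> \<le> C * (\<bar>A + h\<^sub>0 * d\<bar> + \<bar>h - h\<^sub>0\<bar> + \<bar>\<epsilon>\<bar> + \<bar>\<nu> - \<kappa>\<^sup>2\<bar>))"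
    using near_base[OF k h0] by metis
  define M' where "M' = M + h\<^sub>0 + \<kappa>\<^sup>2 + 1"
  have h0p: "h\<^sub>0 > 0" using h0 k by simp
  have kh: "\<kappa>\<^sup>2 < \<kappa> * h\<^sub>0" using h0 k by (simp add: power2_eq_square)
  have E0: "wE (\<kappa>\<^sup>2 * h\<^sub>0\<^sup>2) (\<kappa>\<^sup>2) d > 0"
    using wE_pos[of "\<kappa>\<^sup>2" "\<kappa> * h\<^sub>0" d] kh k by (simp add: power_mult_distrib)
  have main: "\<exists>\<alpha>\<^sub>0>0. \<forall>\<alpha>. 0 < \<alpha> \<and> \<alpha> < \<alpha>\<^sub>0 \<longrightarrow> (\<exists>\<psi> p a j h.
    orbit (\<kappa>\<^sup>2) (\<alpha>\<^sup>2) h (2 * d) \<psi> p a j \<and> \<psi> 0 = 1 \<and> p 0 = 0 \<and> j 0 = 0 \<and> p (2 * d) = 0 \<and> j (2 * d) = 0 \<and>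
    h > 0 \<and> \<bar>h - h\<^sub>0\<bar> < r \<and> (\<forall>t\<in>{0..2 * d}. \<psi> t > 0 \<and> \<bar>\<psi> t\<bar> \<le> M \<and> \<bar>p t\<bar> \<le> M \<and>
      \<bar>a t - h\<^sub>0 * (t - d)\<bar> \<le> r \<and> \<bar>h + \<alpha>\<^sup>2 * j t - h\<^sub>0\<bar> \<le> r \<and> \<psi> (2 * d - t) = \<psi> t \<and> a (2 * d - t) = - a t))"
    if r: "r > 0" for r
  proof -
    \<comment> \<open>D >= 4 C and D >= 4, so D \<rho> <= r bounds both the deviation 4 C \<rho> of
      a and the deviation 2 \<rho> of its derivative by r.\<close>
    define D where "D = 4 * (C + 1) * (M + 1)"
    have D: "D \<ge> 4" using C M mult_mono[of 1 "C + 1" 1 "M + 1"] unfolding D_def by linarith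
    define \<rho> where "\<rho> = min \<delta> (r / D)"
    have \<rho>: "\<rho> > 0" "\<rho> \<le> \<delta>" "D * \<rho> \<le> r" using \<delta> r D by (auto simp: \<rho>_def min_def field_simps)
    define s where "s = min (\<rho> / (4 * (d + 1))) (min (\<rho> / 4) ((h\<^sub>0 - \<kappa>) / 2))"
    have s: "s > 0" "s \<le> \<rho> / (4 * (d + 1))" "s \<le> \<rho> / 4" "s \<le> (h\<^sub>0 - \<kappa>) / 2"
    proof -
      show "s > 0" using \<rho> k h0 by (simp add: s_def)
      show "s \<le> \<rho> / (4 * (d + 1))" "s \<le> \<rho> / 4" "s \<le> (h\<^sub>0 - \<kappa>) / 2"
        unfolding s_def by (rule min.cobounded1 min.coboundedI2[OF min.cobounded1] min.coboundedI2[OF min.cobounded2])+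
    qed
    have sd: "s * d \<le> \<rho> / 4"
    proof -
      have "s * (4 * (d + 1)) \<le> \<rho>" using s(2) k by (simp add: field_simps)
      then show ?thesis using s(1) by (simp add: algebra_simps)
    qed
    have hs: "\<kappa> < h\<^sub>0 - s" using s h0 by (auto simp: field_simps)
    have sq: "(\<kappa> * h)\<^sup>2 = \<kappa>\<^sup>2 * h\<^sup>2" for h by (rule power_mult_distrib)
    have khs: "\<kappa>\<^sup>2 \<le> \<kappa> * (h\<^sub>0 - s)" using hs k by (simp add: power2_eq_square)
    have lo: "wE' (\<kappa>\<^sup>2 * (h\<^sub>0 - s)\<^sup>2) (\<kappa>\<^sup>2) d < 0"
    proof -
      have "wE (\<kappa>\<^sup>2 * h\<^sub>0\<^sup>2) (\<kappa>\<^sup>2) d * wE' (\<kappa>\<^sup>2 * (h\<^sub>0 - s)\<^sup>2) (\<kappa>\<^sup>2) d < 0"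
        using wE_strict_mono[of "\<kappa>\<^sup>2" "\<kappa> * (h\<^sub>0 - s)" "\<kappa> * h\<^sub>0" d] khs k s h0 unfolding sq by simp
      then show ?thesis using E0 by (simp add: mult_less_0_iff)
    qed
    have hi: "wE' (\<kappa>\<^sup>2 * (h\<^sub>0 + s)\<^sup>2) (\<kappa>\<^sup>2) d > 0"
    proof -
      have "0 < wE' (\<kappa>\<^sup>2 * (h\<^sub>0 + s)\<^sup>2) (\<kappa>\<^sup>2) d * wE (\<kappa>\<^sup>2 * h\<^sub>0\<^sup>2) (\<kappa>\<^sup>2) d"
        using wE_strict_mono[of "\<kappa>\<^sup>2" "\<kappa> * h\<^sub>0" "\<kappa> * (h\<^sub>0 + s)" d] kh k s h0 unfolding sq by simp
      then show ?thesis using E0 by (simp add: zero_less_mult_iff)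
    qed
    let ?x = "\<lambda>A h \<epsilon>. start (- h * d + A) h \<epsilon> (\<kappa>\<^sup>2)"
    have close: "\<bar>- h * d + A + h\<^sub>0 * d\<bar> < \<rho>" "\<bar>h - h\<^sub>0\<bar> < \<rho>" if "\<bar>A\<bar> \<le> s" "\<bar>h - h\<^sub>0\<bar> \<le> s" for A h
    proof -
      have "\<bar>- h * d + A + h\<^sub>0 * d\<bar> = \<bar>A - (h - h\<^sub>0) * d\<bar>" by (simp add: algebra_simps)
      also have "\<dots> \<le> \<bar>A\<bar> + \<bar>h - h\<^sub>0\<bar> * d" using abs_triangle_ineq4[of A "(h - h\<^sub>0) * d"] k by (simp add: abs_mult)
      also have "\<dots> \<le> s + s * d" using that k by (intro add_mono mult_right_mono) auto
      also have "\<dots> < \<rho>" using sd s \<rho> by linarith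
      finally show "\<bar>- h * d + A + h\<^sub>0 * d\<bar> < \<rho>" .
      show "\<bar>h - h\<^sub>0\<bar> < \<rho>" using that s \<rho> by linarith
    qed
    note close' = close[THEN less_le_trans, OF _ _ \<rho>(2)]
    have nb': "orbit (\<kappa>\<^sup>2) \<epsilon> h (2 * d + 1) (f\<psi> M (?x A h \<epsilon>)) (fp M (?x A h \<epsilon>)) (fa M (?x A h \<epsilon>)) (fj M (?x A h \<epsilon>)) \<and>
      (\<forall>t\<in>{0..2 * d + 1}. f\<psi> M (?x A h \<epsilon>) t > 0 \<and> \<bar>f\<psi> M (?x A h \<epsilon>) t\<bar> \<le> M \<and> \<bar>fp M (?x A h \<epsilon>) t\<bar> \<le> M \<and>
        \<bar>fa M (?x A h \<epsilon>) t\<bar> \<le> M \<and> \<bar>fj M (?x A h \<epsilon>) t\<bar> \<le> M \<and>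
        \<bar>fa M (?x A h \<epsilon>) t - h\<^sub>0 * (t - d)\<bar> \<le> C * (\<bar>- h * d + A + h\<^sub>0 * d\<bar> + \<bar>h - h\<^sub>0\<bar> + \<bar>\<epsilon>\<bar> + 0))"
      if "\<bar>A\<bar> \<le> s" "\<bar>h - h\<^sub>0\<bar> \<le> s" "\<bar>\<epsilon>\<bar> < \<delta>" for A h \<epsilon>
      using nb[OF close'(1)[OF that(1,2)] close'(2)[OF that(1,2)] that(3), of "\<kappa>\<^sup>2"] \<delta>(1) by simp
    have p0: "fp M (?x 0 h 0) d = wE' (\<kappa>\<^sup>2 * h\<^sup>2) (\<kappa>\<^sup>2) d" if "\<bar>h - h\<^sub>0\<bar> \<le> s" for h
    proof -
      have "h \<noteq> 0" using that hs k by auto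
      from orbit_eps0(3)[OF conjunct1[OF nb'[of 0 h 0]] this, of d d] that s \<delta> k
      show ?thesis by (simp add: flow_start wU'_def)
    qed
    have cfp: "continuous_on UNIV (\<lambda>(A, h, \<epsilon>). fp M (?x A h \<epsilon>) d)" "continuous_on UNIV (\<lambda>(A, h, \<epsilon>). - fp M (?x A h \<epsilon>) d)"
      unfolding case_prod_unfold using k
      by (auto intro!: continuous_intros flow_components_continuous(2)[where T = d])
    have "(\<lambda>(A, h, \<epsilon>). fp M (?x A h \<epsilon>) d) (0, h\<^sub>0 + s, 0) > 0"
      unfolding prod.case using hi s(1) by (subst p0) auto
    then obtain e1 where e1: "e1 > 0" "\<And>q. dist (0, h\<^sub>0 + s, 0) q < e1 \<Longrightarrow> (\<lambda>(A, h, \<epsilon>). fp M (?x A h \<epsilon>) d) q > 0"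
      using continuous_pos_near_compact[OF cfp(1) compact_sing] by blast
    have "(\<lambda>(A, h, \<epsilon>). - fp M (?x A h \<epsilon>) d) (0, h\<^sub>0 - s, 0) > 0"
      unfolding prod.case using lo s(1) by (subst p0) auto
    then obtain e2 where e2: "e2 > 0" "\<And>q. dist (0, h\<^sub>0 - s, 0) q < e2 \<Longrightarrow> (\<lambda>(A, h, \<epsilon>). - fp M (?x A h \<epsilon>) d) q > 0"
      using continuous_pos_near_compact[OF cfp(2) compact_sing] by blast
    \<comment> \<open>Chosen after s: the slope signs known at A = 0 must persist for all shifts up
      to \<sigma> on the faces \<open>h = h\<^sub>0 - s\<close> and
      \<open>h = h\<^sub>0 + s\<close>.\<close>
    define \<sigma> where "\<sigma> = min s (min (e1 / 3) (e2 / 3))"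
    have \<sigma>: "\<sigma> > 0" "\<sigma> \<le> s" "\<sigma> \<le> e1 / 3" "\<sigma> \<le> e2 / 3" using s(1) e1(1) e2(1) by (auto simp: \<sigma>_def)
    \<comment> \<open>The last entry gives \<epsilon> M d <= \<sigma>, so that on the faces where A
      is -\<sigma> or \<sigma> the midpoint value of a keeps the sign of A, at least weakly.\<close>
    define \<epsilon>\<^sub>0 where "\<epsilon>\<^sub>0 = min (min (\<rho> / 4) (\<rho> / (4 * (M + 1)))) (min (min (e1 / 3) (e2 / 3)) (\<sigma> / (M * d)))"
    have \<epsilon>0: "\<epsilon>\<^sub>0 > 0" "\<epsilon>\<^sub>0 \<le> \<rho> / 4" "\<epsilon>\<^sub>0 \<le> \<rho> / (4 * (M + 1))" "\<epsilon>\<^sub>0 \<le> e1 / 3" "\<epsilon>\<^sub>0 \<le> e2 / 3" "\<epsilon>\<^sub>0 \<le> \<sigma> / (M * d)"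
    proof -
      show "\<epsilon>\<^sub>0 > 0" using \<rho>(1) e1(1) e2(1) \<sigma>(1) M k by (simp add: \<epsilon>\<^sub>0_def)
      show "\<epsilon>\<^sub>0 \<le> \<rho> / 4" "\<epsilon>\<^sub>0 \<le> \<rho> / (4 * (M + 1))" "\<epsilon>\<^sub>0 \<le> e1 / 3" "\<epsilon>\<^sub>0 \<le> e2 / 3" "\<epsilon>\<^sub>0 \<le> \<sigma> / (M * d)"
        unfolding \<epsilon>\<^sub>0_def by linarith+
    qed
    have sol: "\<exists>\<psi> p a j h.
      orbit (\<kappa>\<^sup>2) (\<alpha>\<^sup>2) h (2 * d) \<psi> p a j \<and> \<psi> 0 = 1 \<and> p 0 = 0 \<and> j 0 = 0 \<and> p (2 * d) = 0 \<and> j (2 * d) = 0 \<and>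
      h > 0 \<and> \<bar>h - h\<^sub>0\<bar> < r \<and> (\<forall>t\<in>{0..2 * d}. \<psi> t > 0 \<and> \<bar>\<psi> t\<bar> \<le> M \<and> \<bar>p t\<bar> \<le> M \<and>
      \<bar>a t - h\<^sub>0 * (t - d)\<bar> \<le> r \<and> \<bar>h + \<alpha>\<^sup>2 * j t - h\<^sub>0\<bar> \<le> r \<and> \<psi> (2 * d - t) = \<psi> t \<and> a (2 * d - t) = - a t)"
      if \<alpha>: "\<alpha> > 0" "\<alpha>\<^sup>2 < \<epsilon>\<^sub>0" for \<alpha>
    proof -
      let ?e = "\<alpha>\<^sup>2"
      have e: "0 < ?e" "\<bar>?e\<bar> < \<delta>" using \<alpha> \<epsilon>0 \<rho> by auto
      have eMd: "?e * M * d \<le> \<sigma>"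
      proof -
        have "?e * (M * d) \<le> \<epsilon>\<^sub>0 * (M * d)" using \<alpha> M k by (intro mult_right_mono) auto
        also have "\<dots> \<le> \<sigma>" using \<epsilon>0(6) M k by (simp add: field_simps)
        finally show ?thesis by (simp add: mult.assoc)
      qed
      obtain A h where Ah: "A \<in> {-\<sigma>..\<sigma>}" "h \<in> {h\<^sub>0 - s..h\<^sub>0 + s}" "fa M (?x A h ?e) d = 0" "fp M (?x A h ?e) d = 0"
      proof (rule poincare_miranda_2d[where f = "\<lambda>A h. fa M (?x A h ?e) d" and g = "\<lambda>A h. fp M (?x A h ?e) d"
            and a = "-\<sigma>" and b = \<sigma> and c = "h\<^sub>0 - s" and d = "h\<^sub>0 + s"])
        show "continuous_on ({-\<sigma>..\<sigma>} \<times> {h\<^sub>0 - s..h\<^sub>0 + s}) (\<lambda>p. fa M (?x (fst p) (snd p) ?e) d)"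
          "continuous_on ({-\<sigma>..\<sigma>} \<times> {h\<^sub>0 - s..h\<^sub>0 + s}) (\<lambda>p. fp M (?x (fst p) (snd p) ?e) d)"
          using k by (auto intro!: continuous_intros flow_components_continuous(2,3)[where T = d])
      next
        have a: "\<bar>fa M (?x A h ?e) d - A\<bar> \<le> \<sigma>" if "\<bar>A\<bar> \<le> \<sigma>" "\<bar>h - h\<^sub>0\<bar> \<le> s" for A h
        proof -
          note n = nb'[of A h ?e]
          have "\<bar>fa M (?x A h ?e) d - (fa M (?x A h ?e) 0 + h * d)\<bar> \<le> \<bar>?e\<bar> * M * d"
            by (rule orbit_a_bound[OF conjunct1[OF n]]) (use n that \<sigma> e k in auto)
          then show ?thesis using eMd by (simp add: flow_start)
        qed
        show "fa M (?x (-\<sigma>) h ?e) d \<le> 0" if "h \<in> {h\<^sub>0 - s..h\<^sub>0 + s}" for h using a[of "-\<sigma>" h] that \<sigma> by (auto simp: abs_le_iff)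
        show "fa M (?x \<sigma> h ?e) d \<ge> 0" if "h \<in> {h\<^sub>0 - s..h\<^sub>0 + s}" for h using a[of \<sigma> h] that \<sigma> by (auto simp: abs_le_iff)
      next
        fix A assume A: "A \<in> {-\<sigma>..\<sigma>}"
        have ds: "dist (0, h, 0) (A, h, ?e) < min e1 e2" for h
        proof -
          have "dist (0, h, 0) (A, h, ?e) \<le> \<bar>A\<bar> + (0 + ?e)" by (intro dist_Pair_leI) (auto simp: dist_real_def)
          also have "\<dots> < min e1 e2" using A \<sigma> \<alpha> \<epsilon>0 e1(1) e2(1) by auto
          finally show ?thesis .
        qed
        have ds': "dist (0, h, 0) (A, h, ?e) < e1" "dist (0, h, 0) (A, h, ?e) < e2" for h
          using ds[of h] by auto
        show "fp M (?x A (h\<^sub>0 - s) ?e) d \<le> 0" using e2(2)[OF ds'(2), unfolded prod.case] by linarith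
        show "fp M (?x A (h\<^sub>0 + s) ?e) d \<ge> 0" using e1(2)[OF ds'(1), unfolded prod.case] by linarith
      qed (use \<sigma> s in auto)
      let ?y = "?x A h ?e"
      have Ahs: "\<bar>A\<bar> \<le> s" "\<bar>h - h\<^sub>0\<bar> \<le> s" using Ah \<sigma> by auto
      note n = nb'[OF Ahs e(2)]
      have orb: "orbit (\<kappa>\<^sup>2) ?e h (2 * d) (f\<psi> M ?y) (fp M ?y) (fa M ?y) (fj M ?y)"
        using orbit_subset[OF conjunct1[OF n], of "2 * d"] by simp
      have bdM: "\<bar>f\<psi> M ?y t\<bar> \<le> M \<and> \<bar>fp M ?y t\<bar> \<le> M \<and> \<bar>fa M ?y t\<bar> \<le> M \<and> \<bar>fj M ?y t\<bar> \<le> M" if "t \<in> {0..2 * d}" for t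
        using n that by auto
      have MM: "M \<le> M'" "\<bar>h\<bar> \<le> M'" "\<bar>?e\<bar> \<le> M'" "\<bar>\<kappa>\<^sup>2\<bar> \<le> M'"
        unfolding M'_def using M h0p e \<delta> Ahs s(3) \<rho>(2) zero_le_power2[of \<kappa>] by linarith+
      have bdM': "\<bar>f\<psi> M ?y t\<bar> \<le> M' \<and> \<bar>fp M ?y t\<bar> \<le> M' \<and> \<bar>fa M ?y t\<bar> \<le> M' \<and> \<bar>fj M ?y t\<bar> \<le> M'" if "t \<in> {0..2 * d}" for t
        using bdM[OF that] MM by linarith
      have refl: "f\<psi> M ?y (2 * d - t) = f\<psi> M ?y t" "fp M ?y (2 * d - t) = - fp M ?y t"
        "fa M ?y (2 * d - t) = - fa M ?y t" "fj M ?y (2 * d - t) = fj M ?y t" if "t \<in> {0..2 * d}" for t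
        by (rule orbit_reflect[OF orb k(2) Ah(4,3) bdM' MM(2-4) that]; assumption)+
      have fin: "fp M ?y (2 * d) = 0" "fj M ?y (2 * d) = 0"
        using refl(2)[of 0] refl(4)[of 0] k by (simp_all add: flow_start)
      have Ah\<rho>: "\<bar>- h * d + A + h\<^sub>0 * d\<bar> < \<rho>" "\<bar>h - h\<^sub>0\<bar> < \<rho>" using close[OF Ahs] by auto
      have \<rho>r: "C * (4 * \<rho>) \<le> r" "2 * \<rho> \<le> r"
      proof -
        have "C * (4 * \<rho>) \<le> D * \<rho>"
        proof -
          have "4 * C \<le> D" using C M unfolding D_def by (simp add: algebra_simps)
          then show ?thesis using \<rho>(1) by simp
        qed
        then show "C * (4 * \<rho>) \<le> r" using \<rho>(3) by linarith
        show "2 * \<rho> \<le> r" using mult_right_mono[OF D, of \<rho>] \<rho> by linarith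
      qed
      have cl: "\<bar>fa M ?y t - h\<^sub>0 * (t - d)\<bar> \<le> r \<and> \<bar>h + ?e * fj M ?y t - h\<^sub>0\<bar> \<le> r" if t: "t \<in> {0..2 * d}" for t
      proof
        have "\<bar>fa M ?y t - h\<^sub>0 * (t - d)\<bar> \<le> C * (\<bar>- h * d + A + h\<^sub>0 * d\<bar> + \<bar>h - h\<^sub>0\<bar> + \<bar>?e\<bar> + 0)" using n t by auto
        also have "\<dots> \<le> C * (4 * \<rho>)" using Ah\<rho> \<alpha> \<epsilon>0 \<rho> C by (intro mult_left_mono) auto
        finally show "\<bar>fa M ?y t - h\<^sub>0 * (t - d)\<bar> \<le> r" using \<rho>r by linarith
        have "?e * (M + 1) \<le> \<epsilon>\<^sub>0 * (M + 1)" using \<alpha> M by (intro mult_right_mono) auto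
        also have "\<dots> \<le> \<rho>" using \<epsilon>0(3) M \<rho> by (simp add: field_simps)
        finally have "?e * M + ?e \<le> \<rho>" by (simp add: distrib_left)
        then have "?e * M \<le> \<rho>" using zero_le_power2[of \<alpha>] by linarith
        moreover have "\<bar>?e * fj M ?y t\<bar> \<le> ?e * M" using bdM[OF t] by (simp add: abs_mult mult_left_mono)
        ultimately show "\<bar>h + ?e * fj M ?y t - h\<^sub>0\<bar> \<le> r" using Ah\<rho> \<rho>r by linarith
      qed
      have hr: "h > 0" "\<bar>h - h\<^sub>0\<bar> < r" using Ahs hs k Ah\<rho> \<rho>r \<rho>(1) by auto
      have "\<forall>t\<in>{0..2 * d}. f\<psi> M ?y t > 0 \<and> \<bar>f\<psi> M ?y t\<bar> \<le> M \<and> \<bar>fp M ?y t\<bar> \<le> M \<and>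
        \<bar>fa M ?y t - h\<^sub>0 * (t - d)\<bar> \<le> r \<and> \<bar>h + ?e * fj M ?y t - h\<^sub>0\<bar> \<le> r \<and>
        f\<psi> M ?y (2 * d - t) = f\<psi> M ?y t \<and> fa M ?y (2 * d - t) = - fa M ?y t"
      proof
        fix t assume t: "t \<in> {0..2 * d}"
        then have "f\<psi> M ?y t > 0" using n by simp
        with bdM[OF t] cl[OF t] refl(1,3)[OF t] show "f\<psi> M ?y t > 0 \<and> \<bar>f\<psi> M ?y t\<bar> \<le> M \<and> \<bar>fp M ?y t\<bar> \<le> M \<and>
          \<bar>fa M ?y t - h\<^sub>0 * (t - d)\<bar> \<le> r \<and> \<bar>h + ?e * fj M ?y t - h\<^sub>0\<bar> \<le> r \<and>
          f\<psi> M ?y (2 * d - t) = f\<psi> M ?y t \<and> fa M ?y (2 * d - t) = - fa M ?y t" by blast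
      qed
      note all = this
      show ?thesis
        by (rule exI[of _ "f\<psi> M ?y"], rule exI[of _ "fp M ?y"], rule exI[of _ "fa M ?y"], rule exI[of _ "fj M ?y"],
            rule exI[of _ h]) (intro conjI orb fin hr all flow_start)
    qed
    show ?thesis
    proof (intro exI[of _ "min 1 \<epsilon>\<^sub>0"] conjI allI impI)
      show "min 1 \<epsilon>\<^sub>0 > 0" using \<epsilon>0(1) by simp
      fix \<alpha> assume \<alpha>: "0 < \<alpha> \<and> \<alpha> < min 1 \<epsilon>\<^sub>0"
      then have "\<alpha>\<^sup>2 \<le> \<alpha>" by (simp add: power2_eq_square mult_le_cancel_left1)
      then have "\<alpha>\<^sup>2 < \<epsilon>\<^sub>0" using \<alpha> by auto
      with sol[of \<alpha>] \<alpha> show "\<exists>\<psi> p a j h.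
      orbit (\<kappa>\<^sup>2) (\<alpha>\<^sup>2) h (2 * d) \<psi> p a j \<and> \<psi> 0 = 1 \<and> p 0 = 0 \<and> j 0 = 0 \<and> p (2 * d) = 0 \<and> j (2 * d) = 0 \<and>
      h > 0 \<and> \<bar>h - h\<^sub>0\<bar> < r \<and> (\<forall>t\<in>{0..2 * d}. \<psi> t > 0 \<and> \<bar>\<psi> t\<bar> \<le> M \<and> \<bar>p t\<bar> \<le> M \<and>
      \<bar>a t - h\<^sub>0 * (t - d)\<bar> \<le> r \<and> \<bar>h + \<alpha>\<^sup>2 * j t - h\<^sub>0\<bar> \<le> r \<and> \<psi> (2 * d - t) = \<psi> t \<and> a (2 * d - t) = - a t)"
        by blast
    qed
  qed
  with M show ?thesis by blast
qed



subsection \<open>A priori bounds\<close>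

text \<open>Closeness to the normal state is not part of the assumptions: uniqueness in (ii)
  restricts only h, so the bounds have to cover every positive solution.\<close>

locale rescaled_orbit =
  fixes \<nu> \<epsilon> h T :: real and \<psi> p a j :: "real \<Rightarrow> real"
  assumes orb: "orbit \<nu> \<epsilon> h T \<psi> p a j" and T: "T > 0" and \<nu>: "\<nu> > 0" and \<epsilon>: "0 < \<epsilon>" "\<epsilon> \<le> 1" and h: "h > 0"
    and pos: "\<And>t. t \<in> {0..T} \<Longrightarrow> \<psi> t > 0"
    and init: "\<psi> 0 = 1" "p 0 = 0" "j 0 = 0" and final: "p T = 0" "j T = 0"
begin

lemma derivs:
  assumes "t \<in> {0..T}"
  shows "(\<psi> has_real_derivative p t) (at t within {0..T})"
    "(p has_real_derivative \<nu> * (\<epsilon> * (\<psi> t)\<^sup>2 + (a t)\<^sup>2 - 1) * \<psi> t) (at t within {0..T})"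
    "(a has_real_derivative h + \<epsilon> * j t) (at t within {0..T})"
    "(j has_real_derivative (\<psi> t)\<^sup>2 * a t) (at t within {0..T})"
  using orb assms unfolding orbit_def by auto

lemma cont: "continuous_on {0..T} \<psi>" "continuous_on {0..T} p" "continuous_on {0..T} a" "continuous_on {0..T} j"
  by (rule DERIV_continuous_on, erule derivs)+

text \<open>At a maximum of \<open>\<psi>\<close> one has \<open>\<psi>' = 0\<close> also at the end points, so \<open>\<psi>'' \<le> 0\<close> there.\<close>

lemma psi_max:
  assumes t: "t \<in> {0..T}"
  shows "\<epsilon> * (\<psi> t)\<^sup>2 \<le> 1"
proof -
  obtain s where s: "s \<in> {0..T}" "\<And>t. t \<in> {0..T} \<Longrightarrow> \<psi> t \<le> \<psi> s"
    using continuous_attains_sup[OF _ _ cont(1)] T by fastforce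
  have "\<epsilon> * (\<psi> s)\<^sup>2 \<le> 1"
  proof (rule ccontr)
    assume neg: "\<not> \<epsilon> * (\<psi> s)\<^sup>2 \<le> 1"
    let ?Q = "\<lambda>t. \<nu> * (\<epsilon> * (\<psi> t)\<^sup>2 + (a t)\<^sup>2 - 1) * \<psi> t"
    have "\<epsilon> * (\<psi> s)\<^sup>2 + (a s)\<^sup>2 - 1 > 0" using neg zero_le_power2[of "a s"] by linarith
    then have Qs: "?Q s > 0" using \<nu> pos[OF s(1)] by simp
    have "continuous_on {0..T} ?Q" by (intro continuous_intros cont)
    then have "\<exists>e>0. \<forall>t\<in>{0..T}. dist t s < e \<longrightarrow> dist (?Q t) (?Q s) < ?Q s"
      using s(1) Qs unfolding continuous_on_iff by blast
    then obtain e where e: "e > 0" "\<And>t. t \<in> {0..T} \<Longrightarrow> dist t s < e \<Longrightarrow> dist (?Q t) (?Q s) < ?Q s" by blast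
    have Qpos: "?Q t > 0" if "t \<in> {0..T}" "\<bar>t - s\<bar> < e" for t
      using e(2)[OF that(1)] that(2) by (auto simp: dist_real_def abs_less_iff)
    have ps: "p s = 0"
    proof (cases "s = 0 \<or> s = T")
      case False
      then have "s \<in> interior {0..T}" using s by auto
      then have at: "at s within {0..T} = at s" by (rule at_within_interior)
      define m where "m = min s (T - s)"
      have "m > 0" using False s by (auto simp: m_def)
      have "DERIV \<psi> s :> p s" using derivs(1)[OF s(1)] unfolding at .
      then show "p s = 0"
        by (rule DERIV_local_max[OF _ \<open>m > 0\<close>]) (use s in \<open>auto simp: m_def abs_less_iff\<close>)
    qed (use init final in auto)
    have inc: "\<psi> x < \<psi> y" if "x \<in> {0..T}" "y \<in> {0..T}" "x < y" "\<And>t. t \<in> {x<..<y} \<Longrightarrow> p t > 0" for x y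
      using that by (intro increasing_within[where f = \<psi> and f' = p]) (auto intro: DERIV_subset[OF derivs(1)])
    have pinc: "p x < p y" if "x \<in> {0..T}" "y \<in> {0..T}" "x < y" "\<bar>x - s\<bar> < e" "\<bar>y - s\<bar> < e" for x y
      using that by (intro increasing_within[where f = p and f' = ?Q] Qpos) (auto intro: DERIV_subset[OF derivs(2)])
    \<comment> \<open>With p = 0 at s and p increasing near s, \<psi> grows to the right of s, or to
      the left when s is the right end. Either contradicts maximality.\<close>
    show False
    proof (cases "s < T")
      case True
      define y where "y = min T (s + e / 2)"
      have y: "s < y" "y \<le> T" "y - s < e" using True e(1) by (auto simp: y_def)
      have "\<psi> s < \<psi> y"
      proof (rule inc)
        fix t assume "t \<in> {s<..<y}"
        then show "p t > 0" using pinc[of s t] ps s y e(1) by auto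
      qed (use s y in auto)
      then show False using s(2)[of y] s(1) y by auto
    next
      case False
      then have sT: "s = T" using s by auto
      define x where "x = max 0 (T - e / 2)"
      have x: "0 \<le> x" "x < T" "T - x < e" using T e(1) by (auto simp: x_def)
      have "- \<psi> x < - \<psi> T"
      proof (rule increasing_within[where f = "\<lambda>t. - \<psi> t" and f' = "\<lambda>t. - p t", OF x(2)])
        fix t assume "t \<in> {x..T}"
        then show "((\<lambda>t. - \<psi> t) has_real_derivative - p t) (at t within {x..T})"
          using x by (intro DERIV_minus DERIV_subset[OF derivs(1)]) auto
      next
        fix t assume "t \<in> {x<..<T}"
        then show "- p t > 0" using pinc[of t T] ps sT x e(1) T by auto
      qed
      then show False using s(2)[of x] x sT by auto
    qed
  qed
  moreover have "(\<psi> t)\<^sup>2 \<le> (\<psi> s)\<^sup>2" using s(2)[OF t] pos[OF t] by (intro power_mono) auto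
  then have "\<epsilon> * (\<psi> t)\<^sup>2 \<le> \<epsilon> * (\<psi> s)\<^sup>2" using \<epsilon> by (intro mult_left_mono) auto
  ultimately show ?thesis by linarith
qed

text \<open>\<open>a a'\<close> is nondecreasing, and \<open>a\<close> must change sign because of \<open>j(T) = 0\<close>.\<close>

lemma a_ends: "a 0 \<le> 0" "0 \<le> a T"
proof -
  let ?G = "\<lambda>t. a t * (h + \<epsilon> * j t)"
  have G: "(?G has_real_derivative (h + \<epsilon> * j t)\<^sup>2 + \<epsilon> * (\<psi> t * a t)\<^sup>2) (at t within {0..T})" if "t \<in> {0..T}" for t
    using derivs[OF that] by (auto intro!: derivative_eq_intros simp: power2_eq_square algebra_simps)
  have Gmono: "?G x \<le> ?G y" if "0 \<le> x" "x \<le> y" "y \<le> T" for x y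
    using that \<epsilon> by (intro nondecreasing_within[where f = ?G and f' = "\<lambda>t. (h + \<epsilon> * j t)\<^sup>2 + \<epsilon> * (\<psi> t * a t)\<^sup>2"])
      (auto intro!: DERIV_subset[OF G])
  show "a 0 \<le> 0"
  proof (rule ccontr)
    assume a0: "\<not> a 0 \<le> 0"
    have nz: "a t \<noteq> 0" if "t \<in> {0..T}" for t
    proof -
      have "a 0 * h > 0" using a0 h by simp
      then show ?thesis using Gmono[of 0 t] that init by auto
    qed
    have apos: "a t > 0" if t: "t \<in> {0..T}" for t
    proof (rule ccontr)
      assume "\<not> a t > 0"
      moreover have "continuous_on {0..t} a" using cont(3) by (rule continuous_on_subset) (use t in auto)
      ultimately obtain x where "0 \<le> x" "x \<le> t" "a x = 0" using IVT2'[of a t 0 0] a0 t by auto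
      then show False using nz[of x] t by auto
    qed
    have "j 0 < j T"
    proof (rule increasing_within[OF T derivs(4)])
      fix t assume "t \<in> {0<..<T}"
      then show "(\<psi> t)\<^sup>2 * a t > 0" using apos[of t] pos[of t] by simp
    qed
    then show False using init final by simp
  qed
  show "0 \<le> a T"
  proof (rule ccontr)
    assume aT: "\<not> 0 \<le> a T"
    have nz: "a t \<noteq> 0" if "t \<in> {0..T}" for t
    proof -
      have "a T * h < 0" using aT h by (simp add: mult_less_0_iff)
      then show ?thesis using Gmono[of t T] that final by auto
    qed
    have aneg: "a t < 0" if t: "t \<in> {0..T}" for t
    proof (rule ccontr)
      assume "\<not> a t < 0"
      moreover have "continuous_on {t..T} a" using cont(3) by (rule continuous_on_subset) (use t in auto)
      ultimately obtain x where "t \<le> x" "x \<le> T" "a x = 0" using IVT2'[of a T 0 t] aT t by auto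
      then show False using nz[of x] t by auto
    qed
    have "- j 0 < - j T"
    proof (rule increasing_within[where f = "\<lambda>t. - j t" and f' = "\<lambda>t. - ((\<psi> t)\<^sup>2 * a t)", OF T])
      fix t assume "t \<in> {0<..<T}"
      then show "- ((\<psi> t)\<^sup>2 * a t) > 0" using aneg[of t] pos[of t] by (simp add: mult_pos_neg)
    qed (auto intro!: DERIV_minus derivs)
    then show False using init final by simp
  qed
qed

text \<open>Up to the first point where a >= 0 one has a < 0, hence j <= 0 and a' <= h. So a climbs
  from its initial value to 0 with slope at most h within time T.\<close>

lemma a_lower: "- h * T \<le> a 0"
proof (rule ccontr)
  assume neg: "\<not> - h * T \<le> a 0"
  define S where "S = {t \<in> {0..T}. 0 \<le> a t}"
  have "closed S" unfolding S_def
    by (intro continuous_on_closed_Collect_le cont continuous_intros closed_atLeastAtMost)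
  moreover have "S \<noteq> {}" using a_ends(2) T by (auto simp: S_def)
  moreover have bdd: "bdd_below S" by (auto simp: S_def)
  ultimately have s: "Inf S \<in> S" by (intro closed_contains_Inf)
  define s where "s = Inf S"
  have sT: "s \<in> {0..T}" "0 \<le> a s" using s by (auto simp: s_def S_def)
  have before: "a x < 0" if "0 \<le> x" "x < s" for x
  proof (rule ccontr)
    assume "\<not> a x < 0"
    then have "x \<in> S" using that sT by (auto simp: S_def)
    then have "s \<le> x" unfolding s_def by (rule cInf_lower[OF _ bdd])
    with that show False by simp
  qed
  have jneg: "j x \<le> 0" if x: "0 \<le> x" "x \<le> s" for x
  proof -
    have "- j 0 \<le> - j x"
    proof (rule nondecreasing_within[where f = "\<lambda>t. - j t" and f' = "\<lambda>t. - ((\<psi> t)\<^sup>2 * a t)", OF x(1)])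
      fix t assume "t \<in> {0..x}"
      then show "((\<lambda>t. - j t) has_real_derivative - ((\<psi> t)\<^sup>2 * a t)) (at t within {0..x})"
        using x sT by (intro DERIV_minus DERIV_subset[OF derivs(4)]) auto
    next
      fix t assume "t \<in> {0<..<x}"
      then show "- ((\<psi> t)\<^sup>2 * a t) \<ge> 0" using before[of t] x by (simp add: mult_nonneg_nonpos)
    qed
    then show ?thesis using init by simp
  qed
  have "h * 0 - a 0 \<le> h * s - a s"
  proof (rule nondecreasing_within[where f = "\<lambda>t. h * t - a t" and f' = "\<lambda>t. h - (h + \<epsilon> * j t)"])
    fix t assume "t \<in> {0..s}"
    then have "(a has_real_derivative h + \<epsilon> * j t) (at t within {0..s})"
      using sT by (intro DERIV_subset[OF derivs(3)]) auto
    then show "((\<lambda>t. h * t - a t) has_real_derivative h - (h + \<epsilon> * j t)) (at t within {0..s})"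
      by (auto intro!: derivative_eq_intros)
  next
    fix t assume "t \<in> {0<..<s}"
    then show "h - (h + \<epsilon> * j t) \<ge> 0" using jneg[of t] \<epsilon> by (simp add: mult_nonneg_nonpos)
  qed (use sT in auto)
  moreover have "h * s \<le> h * T" using sT h by (intro mult_left_mono) auto
  ultimately show False using neg sT by simp
qed

end

lemma norm_pair_bounds: "\<bar>x\<bar> \<le> norm (x, y)" "\<bar>y\<bar> \<le> norm (x, y)" "norm (x, y) \<le> \<bar>x\<bar> + \<bar>y\<bar>" for x y :: real
  using norm_fst_le[of x y] norm_snd_le[of y x] norm_Pair_le[of x y] by auto

text \<open>The order is essential. \<open>psi_max\<close> gives \<epsilon> \<psi>^2 <= 1, which
  bounds the pair (a, \<epsilon> j) before anything is known about \<psi>. Then \<psi> solves a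
  linear equation with bounded coefficient, and j follows by integration. None of the constants
  depends on \<epsilon>.\<close>

lemma a_priori_bound:
  fixes \<nu> T H :: real
  assumes "H > 0" "\<nu> > 0" "T > 0"
  shows "\<exists>B. \<forall>\<epsilon> h \<psi> p a j. rescaled_orbit \<nu> \<epsilon> h T \<psi> p a j \<longrightarrow> h \<le> H \<longrightarrow>
    (\<forall>t\<in>{0..T}. \<bar>\<psi> t\<bar> \<le> B \<and> \<bar>p t\<bar> \<le> B \<and> \<bar>a t\<bar> \<le> B \<and> \<bar>j t\<bar> \<le> B)"
proof -
  define Ba where "Ba = exp ((2 * 2 + 1) * T) * (1 + T) * (H * T + H)"
  define L where "L = 1 + \<nu> * (2 + Ba\<^sup>2)"
  define Bp where "Bp = exp ((2 * L + 1) * T) * (1 + T) * (1 + 0)"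
  define Bj where "Bj = Bp\<^sup>2 * Ba * T"
  have L0: "L \<ge> 0" using assms by (simp add: L_def)
  have B0: "Ba \<ge> 0" "Bp \<ge> 0" using assms by (auto simp: Ba_def Bp_def)
  have main: "\<bar>\<psi> t\<bar> \<le> Bp \<and> \<bar>p t\<bar> \<le> Bp \<and> \<bar>a t\<bar> \<le> Ba \<and> \<bar>j t\<bar> \<le> Bj"
    if "rescaled_orbit \<nu> \<epsilon> h T \<psi> p a j" and hH: "h \<le> H" and t: "t \<in> {0..T}" for \<epsilon> h \<psi> p a j t
  proof -
    interpret rescaled_orbit \<nu> \<epsilon> h T \<psi> p a j by fact
    have a0: "\<bar>a 0\<bar> \<le> H * T"
    proof -
      have "h * T \<le> H * T" using hH T by (intro mult_right_mono) auto
      then show ?thesis using a_ends(1) a_lower by auto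
    qed
    have a: "\<bar>a t\<bar> \<le> Ba" if t: "t \<in> {0..T}" for t
    proof -
      have "norm (a t, \<epsilon> * j t) \<le> exp ((2 * 2 + 1) * T) * (1 + T) * (norm (a 0, \<epsilon> * j 0) + H)"
      proof (rule gronwall_norm_linear[where y = "\<lambda>t. (a t, \<epsilon> * j t)" and y' = "\<lambda>t. (h + \<epsilon> * j t, \<epsilon> * ((\<psi> t)\<^sup>2 * a t))"])
        fix t assume t: "t \<in> {0..T}"
        show "((\<lambda>t. (a t, \<epsilon> * j t)) has_vector_derivative (h + \<epsilon> * j t, \<epsilon> * ((\<psi> t)\<^sup>2 * a t))) (at t within {0..T})"
          using derivs[OF t] by (intro has_vector_derivative_real_Pair DERIV_cmult)
        have "\<bar>\<epsilon> * (\<psi> t)\<^sup>2\<bar> \<le> 1" using psi_max[OF t] \<epsilon> by simp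
        then have "\<bar>\<epsilon> * (\<psi> t)\<^sup>2\<bar> * \<bar>a t\<bar> \<le> 1 * \<bar>a t\<bar>" by (intro mult_right_mono) auto
        then have "\<bar>\<epsilon> * ((\<psi> t)\<^sup>2 * a t)\<bar> \<le> \<bar>a t\<bar>" by (simp add: abs_mult mult.assoc)
        moreover have "\<bar>h + \<epsilon> * j t\<bar> \<le> H + \<bar>\<epsilon> * j t\<bar>" using h hH by linarith
        ultimately show "norm (h + \<epsilon> * j t, \<epsilon> * ((\<psi> t)\<^sup>2 * a t)) \<le> 2 * norm (a t, \<epsilon> * j t) + H"
          using norm_pair_bounds(1,2)[where x = "a t" and y = "\<epsilon> * j t"]
            norm_pair_bounds(3)[where x = "h + \<epsilon> * j t" and y = "\<epsilon> * ((\<psi> t)\<^sup>2 * a t)"] by linarith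
      qed (use assms t in auto)
      also have "\<dots> \<le> Ba"
        unfolding Ba_def using a0 init T by (intro mult_left_mono add_mono) auto
      finally show ?thesis using norm_pair_bounds(1)[where x = "a t" and y = "\<epsilon> * j t"] by linarith
    qed
    have \<psi>p: "\<bar>\<psi> t\<bar> \<le> Bp \<and> \<bar>p t\<bar> \<le> Bp" if t: "t \<in> {0..T}" for t
    proof -
      have "norm (\<psi> t, p t) \<le> exp ((2 * L + 1) * T) * (1 + T) * (norm (\<psi> 0, p 0) + 0)"
      proof (rule gronwall_norm_linear[where y = "\<lambda>t. (\<psi> t, p t)" and y' = "\<lambda>t. (p t, \<nu> * (\<epsilon> * (\<psi> t)\<^sup>2 + (a t)\<^sup>2 - 1) * \<psi> t)"])
        fix t assume t: "t \<in> {0..T}"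
        show "((\<lambda>t. (\<psi> t, p t)) has_vector_derivative (p t, \<nu> * (\<epsilon> * (\<psi> t)\<^sup>2 + (a t)\<^sup>2 - 1) * \<psi> t)) (at t within {0..T})"
          using derivs[OF t] by (intro has_vector_derivative_real_Pair)
        have "(a t)\<^sup>2 \<le> Ba\<^sup>2" using a[OF t] B0 by (simp add: abs_le_square_iff[symmetric])
        moreover have "0 \<le> \<epsilon> * (\<psi> t)\<^sup>2" using \<epsilon> by simp
        ultimately have "\<bar>\<epsilon> * (\<psi> t)\<^sup>2 + (a t)\<^sup>2 - 1\<bar> \<le> 2 + Ba\<^sup>2"
          using psi_max[OF t] zero_le_power2[of "a t"] by linarith
        then have "\<nu> * \<bar>\<epsilon> * (\<psi> t)\<^sup>2 + (a t)\<^sup>2 - 1\<bar> * \<bar>\<psi> t\<bar> \<le> \<nu> * (2 + Ba\<^sup>2) * norm (\<psi> t, p t)"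
          using \<nu> norm_pair_bounds(1)[where x = "\<psi> t" and y = "p t"] by (intro mult_mono) auto
        then have "\<bar>\<nu> * (\<epsilon> * (\<psi> t)\<^sup>2 + (a t)\<^sup>2 - 1) * \<psi> t\<bar> \<le> \<nu> * (2 + Ba\<^sup>2) * norm (\<psi> t, p t)"
          using \<nu> by (simp add: abs_mult)
        moreover have "L * norm (\<psi> t, p t) = norm (\<psi> t, p t) + \<nu> * (2 + Ba\<^sup>2) * norm (\<psi> t, p t)"
          by (simp add: L_def algebra_simps)
        ultimately show "norm (p t, \<nu> * (\<epsilon> * (\<psi> t)\<^sup>2 + (a t)\<^sup>2 - 1) * \<psi> t) \<le> L * norm (\<psi> t, p t) + 0"
          using norm_pair_bounds(2)[where x = "\<psi> t" and y = "p t"]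
            norm_pair_bounds(3)[where x = "p t" and y = "\<nu> * (\<epsilon> * (\<psi> t)\<^sup>2 + (a t)\<^sup>2 - 1) * \<psi> t"] by linarith
      qed (use L0 t in auto)
      then have "norm (\<psi> t, p t) \<le> Bp" using init by (simp add: Bp_def norm_Pair)
      then show ?thesis using norm_pair_bounds(1,2)[where x = "\<psi> t" and y = "p t"] by auto
    qed
    have "\<bar>j t - j 0\<bar> \<le> (Bp\<^sup>2 * Ba) * \<bar>t - 0\<bar>"
    proof (rule field_differentiable_bound[of "{0..T}" j "\<lambda>t. (\<psi> t)\<^sup>2 * a t", unfolded real_norm_def])
      fix s assume s: "s \<in> {0..T}"
      have "(\<psi> s)\<^sup>2 \<le> Bp\<^sup>2" using \<psi>p[OF s] B0 by (simp add: abs_le_square_iff[symmetric])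
      then show "\<bar>(\<psi> s)\<^sup>2 * a s\<bar> \<le> Bp\<^sup>2 * Ba" unfolding abs_mult using a[OF s] by (intro mult_mono) auto
    qed (use t T in \<open>auto intro: derivs\<close>)
    also have "\<dots> \<le> Bj" unfolding Bj_def using t B0 by (intro mult_left_mono) auto
    finally show ?thesis using a[OF t] \<psi>p[OF t] init by simp
  qed
  show ?thesis
  proof (intro exI[of _ "max Bp (max Ba Bj)"] allI impI ballI)
    fix \<epsilon> h \<psi> p a j t assume "rescaled_orbit \<nu> \<epsilon> h T \<psi> p a j" "h \<le> H" "t \<in> {0..T}"
    from main[OF this] show "\<bar>\<psi> t\<bar> \<le> max Bp (max Ba Bj) \<and> \<bar>p t\<bar> \<le> max Bp (max Ba Bj) \<and>
        \<bar>a t\<bar> \<le> max Bp (max Ba Bj) \<and> \<bar>j t\<bar> \<le> max Bp (max Ba Bj)" by auto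
  qed
qed

subsection \<open>The linearization at the symmetric normal state\<close>

text \<open>The system has a conserved quantity that also contains -p^2 / \<nu> - 2 h j - \<epsilon>
  j^2. These terms vanish where p = j = 0, so the two ends can be compared directly.\<close>

lemma orbit_energy:
  assumes orb: "orbit \<nu> \<epsilon> h T \<psi> p a j" and \<nu>: "\<nu> \<noteq> 0" and t: "t \<in> {0..T}" "j 0 = 0" "p 0 = 0" "j t = 0" "p t = 0"
  shows "((a t)\<^sup>2 - 1) * (\<psi> t)\<^sup>2 + \<epsilon> * (\<psi> t) ^ 4 / 2 = ((a 0)\<^sup>2 - 1) * (\<psi> 0)\<^sup>2 + \<epsilon> * (\<psi> 0) ^ 4 / 2"
proof -
  let ?E = "\<lambda>t. ((a t)\<^sup>2 - 1) * (\<psi> t)\<^sup>2 + \<epsilon> * (\<psi> t) ^ 4 / 2 - (p t)\<^sup>2 / \<nu> - 2 * h * j t - \<epsilon> * (j t)\<^sup>2"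
  have "(?E has_derivative (\<lambda>_. 0)) (at s within {0..T})" if s: "s \<in> {0..T}" for s
  proof -
    have d: "(\<psi> has_real_derivative p s) (at s within {0..T})"
      "(p has_real_derivative \<nu> * (\<epsilon> * (\<psi> s)\<^sup>2 + (a s)\<^sup>2 - 1) * \<psi> s) (at s within {0..T})"
      "(a has_real_derivative h + \<epsilon> * j s) (at s within {0..T})"
      "(j has_real_derivative (\<psi> s)\<^sup>2 * a s) (at s within {0..T})"
      using orb s unfolding orbit_def by auto
    have "(?E has_real_derivative 0) (at s within {0..T})"
      using \<nu> by (auto intro!: derivative_eq_intros d simp: field_simps power2_eq_square power3_eq_cube)
    then show ?thesis by (simp add: has_field_derivative_def lambda_zero)
  qed
  from has_derivative_zero_unique[OF convex_real_interval(5) this _ t(1), of 0] t show ?thesis by auto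
qed

lemma bounded_convergence:
  fixes f :: "nat \<Rightarrow> real \<Rightarrow> real"
  assumes "\<And>n. (f n has_integral I n) {a..b}" "\<And>n t. t \<in> {a..b} \<Longrightarrow> \<bar>f n t\<bar> \<le> K"
    and "\<And>t. t \<in> {a..b} \<Longrightarrow> (\<lambda>n. f n t) \<longlonglongrightarrow> g t" and "I \<longlonglongrightarrow> l"
  shows "(g has_integral l) {a..b}"
proof -
  have i: "f n integrable_on {a..b}" "integral {a..b} (f n) = I n" for n
    using assms(1) by (auto simp: has_integral_integrable integral_unique)
  have K: "(\<lambda>_. K) integrable_on {a..b}" by (rule integrable_const_ivl)
  have le: "norm (f n t) \<le> K" if "t \<in> {a..b}" for n t using assms(2)[OF that] by simp
  note dc = dominated_convergence[where f = f and S = "{a..b}", OF i(1) K le assms(3)]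
  have "g integrable_on {a..b}" "(\<lambda>n. integral {a..b} (f n)) \<longlonglongrightarrow> integral {a..b} g"
    using dc by blast+
  moreover have "integral {a..b} g = l"
    using LIMSEQ_unique[OF calculation(2)[unfolded i(2)] assms(4)] .
  ultimately show ?thesis by (metis integrable_integral)
qed

text \<open>\<open>A\<close>, \<open>\<gamma>\<close> and \<open>w\<close> are the initial value of the linearized \<open>a\<close>, the linearized \<open>h\<close> and the end value
  of the linearized \<open>\<psi>\<close>. The Wronskian of the two solutions yields \<open>\<gamma> = 0\<close>; the energy identity and the
  Wronskian with the odd Weber function are two relations between \<open>w\<close> and \<open>A\<close> with determinant \<open>wN\<close>.\<close>

lemma difference_limit:
  fixes \<psi>1 p1 a1 j1 \<psi>2 p2 a2 j2 :: "nat \<Rightarrow> real \<Rightarrow> real" and h1 h2 \<epsilon> D :: "nat \<Rightarrow> real"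
  assumes orb1: "\<And>n. orbit \<nu> (\<epsilon> n) (h1 n) (2 * d) (\<psi>1 n) (p1 n) (a1 n) (j1 n)"
    and orb2: "\<And>n. orbit \<nu> (\<epsilon> n) (h2 n) (2 * d) (\<psi>2 n) (p2 n) (a2 n) (j2 n)"
    and bd1: "\<And>n t. t \<in> {0..2 * d} \<Longrightarrow> \<bar>\<psi>1 n t\<bar> \<le> M \<and> \<bar>p1 n t\<bar> \<le> M \<and> \<bar>a1 n t\<bar> \<le> M \<and> \<bar>j1 n t\<bar> \<le> M"
    and bd2: "\<And>n t. t \<in> {0..2 * d} \<Longrightarrow> \<bar>\<psi>2 n t\<bar> \<le> M \<and> \<bar>p2 n t\<bar> \<le> M \<and> \<bar>a2 n t\<bar> \<le> M \<and> \<bar>j2 n t\<bar> \<le> M"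
    and diff: "\<And>n t. t \<in> {0..2 * d} \<Longrightarrow> \<bar>\<psi>1 n t - \<psi>2 n t\<bar> \<le> C * D n \<and> \<bar>p1 n t - p2 n t\<bar> \<le> C * D n \<and>
      \<bar>a1 n t - a2 n t\<bar> \<le> C * D n \<and> \<bar>j1 n t - j2 n t\<bar> \<le> C * D n"
    and D: "\<And>n. D n > 0" and \<nu>: "\<nu> > 0" and d: "d > 0" and \<epsilon>: "\<epsilon> \<longlonglongrightarrow> 0" "\<And>n. \<bar>\<epsilon> n\<bar> \<le> 1"
    and init1: "\<And>n. \<psi>1 n 0 = 1" "\<And>n. p1 n 0 = 0" "\<And>n. j1 n 0 = 0" "\<And>n. p1 n (2 * d) = 0" "\<And>n. j1 n (2 * d) = 0"
    and init2: "\<And>n. \<psi>2 n 0 = 1" "\<And>n. p2 n 0 = 0" "\<And>n. j2 n 0 = 0" "\<And>n. p2 n (2 * d) = 0" "\<And>n. j2 n (2 * d) = 0"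
    and lim1: "\<And>t. t \<in> {0..2 * d} \<Longrightarrow> (\<lambda>n. \<psi>1 n t) \<longlonglongrightarrow> wU (\<nu> * h\<^sub>0\<^sup>2) \<nu> d (t - d)"
      "\<And>t. t \<in> {0..2 * d} \<Longrightarrow> (\<lambda>n. a1 n t) \<longlonglongrightarrow> h\<^sub>0 * (t - d)"
    and lim2: "\<And>t. t \<in> {0..2 * d} \<Longrightarrow> (\<lambda>n. \<psi>2 n t) \<longlonglongrightarrow> wU (\<nu> * h\<^sub>0\<^sup>2) \<nu> d (t - d)"
      "\<And>t. t \<in> {0..2 * d} \<Longrightarrow> (\<lambda>n. a2 n t) \<longlonglongrightarrow> h\<^sub>0 * (t - d)"
    and limA: "(\<lambda>n. (a1 n 0 - a2 n 0) / D n) \<longlonglongrightarrow> A" and limh: "(\<lambda>n. (h1 n - h2 n) / D n) \<longlonglongrightarrow> \<gamma>"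
    and limw: "(\<lambda>n. (\<psi>1 n (2 * d) - \<psi>2 n (2 * d)) / D n) \<longlonglongrightarrow> w"
    and h0: "h\<^sub>0 > 0" and E: "wE' (\<nu> * h\<^sub>0\<^sup>2) \<nu> d = 0" and N: "wN (\<nu> * h\<^sub>0\<^sup>2) \<nu> d \<noteq> 0" and X: "wO' (\<nu> * h\<^sub>0\<^sup>2) \<nu> d > 0"
  shows "A = 0 \<and> \<gamma> = 0"
proof -
  let ?T = "2 * d"
  define \<mu> where "\<mu> = \<nu> * h\<^sub>0\<^sup>2"
  have \<mu>: "\<mu> > 0" using \<nu> h0 by (simp add: \<mu>_def)
  define \<Psi> where "\<Psi> t = wU \<mu> \<nu> d (t - d)" for t
  define \<Psi>' where "\<Psi>' t = wU' \<mu> \<nu> d (t - d)" for t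
  define Y where "Y t = wO \<mu> \<nu> (t - d)" for t
  define Y' where "Y' t = wO' \<mu> \<nu> (t - d)" for t
  have dY: "(\<Psi> has_real_derivative \<Psi>' t) (at t within S)" "(\<Psi>' has_real_derivative (\<mu> * (t - d)\<^sup>2 - \<nu>) * \<Psi> t) (at t within S)"
    "(Y has_real_derivative Y' t) (at t within S)" "(Y' has_real_derivative (\<mu> * (t - d)\<^sup>2 - \<nu>) * Y t) (at t within S)" for t S
    unfolding \<Psi>_def[abs_def] \<Psi>'_def[abs_def] Y_def[abs_def] Y'_def[abs_def] by (auto intro!: derivative_eq_intros)
  have U0: "wU' \<mu> \<nu> d d = 0" using E by (simp add: wU'_def \<mu>_def)
  have ends: "\<Psi> 0 = 1" "\<Psi>' 0 = 0" "\<Psi> ?T = 1" "\<Psi>' ?T = 0" "Y 0 = - wO \<mu> \<nu> d" "Y ?T = wO \<mu> \<nu> d" "Y' ?T = wO' \<mu> \<nu> d"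
    using wU_left[of \<mu> \<nu> d] U0 wU_right[OF U0] X
    by (simp_all add: \<Psi>_def \<Psi>'_def Y_def Y'_def wEO_parity \<mu>_def)
  have C0: "C \<ge> 0"
  proof -
    have "0 \<le> C * D 0" using diff[of 0 0] d abs_ge_zero[of "\<psi>1 0 0 - \<psi>2 0 0"] by auto
    then show ?thesis using D[of 0] by (simp add: zero_le_mult_iff)
  qed
  have M0: "M \<ge> 0" using bd1[of 0 0] d abs_ge_zero[of "\<psi>1 0 0"] by auto
  define w\<psi> where "w\<psi> n t = (\<psi>1 n t - \<psi>2 n t) / D n" for n t
  define wp where "wp n t = (p1 n t - p2 n t) / D n" for n t
  define wa where "wa n t = (a1 n t - a2 n t) / D n" for n t
  have wb: "\<bar>w\<psi> n t\<bar> \<le> C" "\<bar>wa n t\<bar> \<le> C" if "t \<in> {0..?T}" for n t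
    using diff[OF that, of n] D[of n] by (auto simp: w\<psi>_def wa_def pos_divide_le_eq)
  have D0: "D n \<noteq> 0" for n using D[of n] by simp
  have wD: "\<psi>1 n t - \<psi>2 n t = w\<psi> n t * D n" "a1 n t - a2 n t = wa n t * D n" for n t
    using D0[of n] by (simp_all add: w\<psi>_def wa_def)
  note o1 = orb1[unfolded orbit_def, rule_format] and o2 = orb2[unfolded orbit_def, rule_format]
  \<comment> \<open>The difference of the two a-equations has the right-hand side (h1 - h2) +
    \<epsilon> (j1 - j2), so the rescaled difference becomes affine in the limit.\<close>
  have walim: "(\<lambda>n. wa n t) \<longlonglongrightarrow> A + \<gamma> * t" if t: "t \<in> {0..?T}" for t
  proof (rule LIM_zero_cancel, rule Lim_null_comparison)
    have bound: "\<bar>(a1 n t - a2 n t) - ((a1 n 0 - a2 n 0) + (h1 n - h2 n) * t)\<bar> \<le> \<bar>\<epsilon> n\<bar> * (C * D n) * t" for n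
    proof -
      have dd: "((\<lambda>t. (a1 n t - a2 n t) - (h1 n - h2 n) * t) has_real_derivative \<epsilon> n * (j1 n s - j2 n s)) (at s within {0..?T})"
        if "s \<in> {0..?T}" for s
        using o1[OF that, of n] o2[OF that, of n] by (auto intro!: derivative_eq_intros simp: algebra_simps)
      have "\<bar>((a1 n t - a2 n t) - (h1 n - h2 n) * t) - ((a1 n 0 - a2 n 0) - (h1 n - h2 n) * 0)\<bar> \<le> (\<bar>\<epsilon> n\<bar> * (C * D n)) * \<bar>t - 0\<bar>"
        using field_differentiable_bound[of "{0..?T}" "\<lambda>t. (a1 n t - a2 n t) - (h1 n - h2 n) * t" "\<lambda>s. \<epsilon> n * (j1 n s - j2 n s)"
            "\<bar>\<epsilon> n\<bar> * (C * D n)" 0 t] dd t d diff[of _ n]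
        by (auto simp: abs_mult mult_left_mono)
      then show ?thesis using t by (simp add: algebra_simps)
    qed
    show "\<forall>\<^sub>F n in sequentially. norm (wa n t - (A + \<gamma> * t)) \<le>
        \<bar>\<epsilon> n\<bar> * C * t + \<bar>(a1 n 0 - a2 n 0) / D n - A\<bar> + \<bar>(h1 n - h2 n) / D n - \<gamma>\<bar> * t"
    proof (rule always_eventually, rule allI)
      fix n
      have "wa n t - ((a1 n 0 - a2 n 0) / D n + (h1 n - h2 n) / D n * t) =
          ((a1 n t - a2 n t) - ((a1 n 0 - a2 n 0) + (h1 n - h2 n) * t)) / D n"
        using D[of n] by (simp add: wa_def field_simps)
      then have "\<bar>wa n t - ((a1 n 0 - a2 n 0) / D n + (h1 n - h2 n) / D n * t)\<bar> =
          \<bar>(a1 n t - a2 n t) - ((a1 n 0 - a2 n 0) + (h1 n - h2 n) * t)\<bar> / D n"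
        using D[of n] by (simp only: abs_divide abs_of_pos)
      also have "\<dots> \<le> (\<bar>\<epsilon> n\<bar> * (C * D n) * t) / D n" using bound[of n] D[of n] by (intro divide_right_mono) auto
      also have "\<dots> = \<bar>\<epsilon> n\<bar> * C * t" using D[of n] by simp
      finally have 1: "\<bar>wa n t - ((a1 n 0 - a2 n 0) / D n + (h1 n - h2 n) / D n * t)\<bar> \<le> \<bar>\<epsilon> n\<bar> * C * t" .
      have 2: "\<bar>((h1 n - h2 n) / D n - \<gamma>) * t\<bar> = \<bar>(h1 n - h2 n) / D n - \<gamma>\<bar> * t" using t by (simp add: abs_mult)
      have 3: "wa n t - (A + \<gamma> * t) = (wa n t - ((a1 n 0 - a2 n 0) / D n + (h1 n - h2 n) / D n * t)) +
          ((a1 n 0 - a2 n 0) / D n - A) + ((h1 n - h2 n) / D n - \<gamma>) * t" by (simp add: algebra_simps)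
      show "norm (wa n t - (A + \<gamma> * t)) \<le>
        \<bar>\<epsilon> n\<bar> * C * t + \<bar>(a1 n 0 - a2 n 0) / D n - A\<bar> + \<bar>(h1 n - h2 n) / D n - \<gamma>\<bar> * t"
        unfolding 3 real_norm_def using 1 2 by linarith
    qed
    have "(\<lambda>n. \<bar>\<epsilon> n\<bar> * C * t + \<bar>(a1 n 0 - a2 n 0) / D n - A\<bar> + \<bar>(h1 n - h2 n) / D n - \<gamma>\<bar> * t) \<longlonglongrightarrow>
        \<bar>0\<bar> * C * t + \<bar>A - A\<bar> + \<bar>\<gamma> - \<gamma>\<bar> * t"
      by (intro tendsto_intros \<epsilon>(1) limA limh)
    then show "(\<lambda>n. \<bar>\<epsilon> n\<bar> * C * t + \<bar>(a1 n 0 - a2 n 0) / D n - A\<bar> + \<bar>(h1 n - h2 n) / D n - \<gamma>\<bar> * t) \<longlonglongrightarrow> 0"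
      by simp
  qed
  \<comment> \<open>Between the ends only a bound on \<open>w\<psi>\<close> is available, so it is
    always paired with a factor that tends to 0: here \<epsilon>, later the difference of a1^2 and
    its limit.\<close>
  have ew: "(\<lambda>n. \<epsilon> n * w\<psi> n t) \<longlonglongrightarrow> 0" if t: "t \<in> {0..?T}" for t
  proof (rule Lim_null_comparison)
    show "\<forall>\<^sub>F n in sequentially. norm (\<epsilon> n * w\<psi> n t) \<le> \<bar>\<epsilon> n\<bar> * C"
      using wb(1)[OF t] by (intro always_eventually allI) (simp add: abs_mult mult_left_mono)
    have "(\<lambda>n. \<bar>\<epsilon> n\<bar> * C) \<longlonglongrightarrow> \<bar>0\<bar> * C" by (intro tendsto_intros \<epsilon>(1))
    then show "(\<lambda>n. \<bar>\<epsilon> n\<bar> * C) \<longlonglongrightarrow> 0" by simp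
  qed
  note L1 = lim1[folded \<mu>_def, folded \<Psi>_def] and L2 = lim2[folded \<mu>_def, folded \<Psi>_def]
  \<comment> \<open>The Wronskian of \<psi>1 and \<psi>2 divided by D vanishes at both ends; its
    derivative is the integrand before the limit.\<close>
  have I1: "((\<lambda>t. \<nu> * (0 * (\<Psi> t + \<Psi> t) + (h\<^sub>0 * (t - d) + h\<^sub>0 * (t - d)) * (A + \<gamma> * t)) * \<Psi> t * \<Psi> t) has_integral 0) {0..?T}"
  proof (rule bounded_convergence[where I = "\<lambda>_. 0"
        and f = "\<lambda>n t. \<nu> * ((\<epsilon> n * w\<psi> n t) * (\<psi>1 n t + \<psi>2 n t) + (a1 n t + a2 n t) * wa n t) * \<psi>1 n t * \<psi>2 n t"
        and K = "\<nu> * ((1 * C) * (M + M) + (M + M) * C) * M * M"])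
    fix n
    let ?W = "\<lambda>t. (p1 n t * \<psi>2 n t - \<psi>1 n t * p2 n t) / D n"
    have "((\<lambda>t. \<nu> * ((\<epsilon> n * w\<psi> n t) * (\<psi>1 n t + \<psi>2 n t) + (a1 n t + a2 n t) * wa n t) * \<psi>1 n t * \<psi>2 n t) has_integral (?W ?T - ?W 0)) {0..?T}"
    proof (rule fundamental_theorem_of_calculus)
      fix t assume t: "t \<in> {0..?T}"
      have dp: "(\<psi>1 n has_real_derivative p1 n t) (at t within {0..?T})"
        "(p1 n has_real_derivative \<nu> * (\<epsilon> n * (\<psi>1 n t)\<^sup>2 + (a1 n t)\<^sup>2 - 1) * \<psi>1 n t) (at t within {0..?T})"
        "(\<psi>2 n has_real_derivative p2 n t) (at t within {0..?T})"
        "(p2 n has_real_derivative \<nu> * (\<epsilon> n * (\<psi>2 n t)\<^sup>2 + (a2 n t)\<^sup>2 - 1) * \<psi>2 n t) (at t within {0..?T})"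
        using o1[OF t, of n] o2[OF t, of n] by auto
      have "(?W has_real_derivative ((\<nu> * (\<epsilon> n * (\<psi>1 n t)\<^sup>2 + (a1 n t)\<^sup>2 - 1) * \<psi>1 n t * \<psi>2 n t + p2 n t * p1 n t)
          - (p1 n t * p2 n t + \<nu> * (\<epsilon> n * (\<psi>2 n t)\<^sup>2 + (a2 n t)\<^sup>2 - 1) * \<psi>2 n t * \<psi>1 n t)) / D n) (at t within {0..?T})"
        by (intro DERIV_cdivide DERIV_diff DERIV_mult dp)
      moreover have "((\<nu> * (\<epsilon> n * (\<psi>1 n t)\<^sup>2 + (a1 n t)\<^sup>2 - 1) * \<psi>1 n t * \<psi>2 n t + p2 n t * p1 n t)
          - (p1 n t * p2 n t + \<nu> * (\<epsilon> n * (\<psi>2 n t)\<^sup>2 + (a2 n t)\<^sup>2 - 1) * \<psi>2 n t * \<psi>1 n t))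
         = (\<nu> * ((\<epsilon> n * w\<psi> n t) * (\<psi>1 n t + \<psi>2 n t) + (a1 n t + a2 n t) * wa n t) * \<psi>1 n t * \<psi>2 n t) * D n"
      proof -
        have alg: "(\<nu> * (e * u1\<^sup>2 + x1\<^sup>2 - 1) * u1 * u2 + q2 * q1) - (q1 * q2 + \<nu> * (e * u2\<^sup>2 + x2\<^sup>2 - 1) * u2 * u1)
          = \<nu> * (e * (u1 - u2) * (u1 + u2) + (x1 + x2) * (x1 - x2)) * u1 * u2" for u1 u2 x1 x2 q1 q2 e :: real
          by (simp add: power2_eq_square algebra_simps)
        show ?thesis unfolding alg wD by (simp add: algebra_simps)
      qed
      ultimately have "(?W has_real_derivative \<nu> * ((\<epsilon> n * w\<psi> n t) * (\<psi>1 n t + \<psi>2 n t) + (a1 n t + a2 n t) * wa n t) * \<psi>1 n t * \<psi>2 n t) (at t within {0..?T})"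
        by (simp only: nonzero_mult_div_cancel_right[OF D0])
      then show "(?W has_vector_derivative \<nu> * ((\<epsilon> n * w\<psi> n t) * (\<psi>1 n t + \<psi>2 n t) + (a1 n t + a2 n t) * wa n t) * \<psi>1 n t * \<psi>2 n t) (at t within {0..?T})"
        by (simp add: has_real_derivative_iff_has_vector_derivative)
    qed (use d in simp)
    then show "((\<lambda>t. \<nu> * ((\<epsilon> n * w\<psi> n t) * (\<psi>1 n t + \<psi>2 n t) + (a1 n t + a2 n t) * wa n t) * \<psi>1 n t * \<psi>2 n t) has_integral 0) {0..?T}"
      by (simp add: init1 init2)
    fix t assume t: "t \<in> {0..?T}"
    have "\<bar>(\<epsilon> n * w\<psi> n t) * (\<psi>1 n t + \<psi>2 n t)\<bar> \<le> (1 * C) * (M + M)"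
      unfolding abs_mult using \<epsilon>(2)[of n] wb[OF t, of n] bd1[OF t, of n] bd2[OF t, of n] C0
      by (intro mult_mono order_trans[OF abs_triangle_ineq] add_mono) auto
    moreover have "\<bar>(a1 n t + a2 n t) * wa n t\<bar> \<le> (M + M) * C"
      unfolding abs_mult using wb[OF t, of n] bd1[OF t, of n] bd2[OF t, of n] M0
      by (intro mult_mono order_trans[OF abs_triangle_ineq] add_mono) auto
    ultimately have "\<bar>(\<epsilon> n * w\<psi> n t) * (\<psi>1 n t + \<psi>2 n t) + (a1 n t + a2 n t) * wa n t\<bar> \<le> (1 * C) * (M + M) + (M + M) * C"
      by linarith
    then show "\<bar>\<nu> * ((\<epsilon> n * w\<psi> n t) * (\<psi>1 n t + \<psi>2 n t) + (a1 n t + a2 n t) * wa n t) * \<psi>1 n t * \<psi>2 n t\<bar>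
        \<le> \<nu> * ((1 * C) * (M + M) + (M + M) * C) * M * M"
      unfolding abs_mult[of _ "\<psi>2 n t"] abs_mult[of _ "\<psi>1 n t"] abs_mult[of \<nu>]
      using bd1[OF t, of n] bd2[OF t, of n] \<nu> C0 M0 by (intro mult_mono) auto
    show "(\<lambda>n. \<nu> * ((\<epsilon> n * w\<psi> n t) * (\<psi>1 n t + \<psi>2 n t) + (a1 n t + a2 n t) * wa n t) * \<psi>1 n t * \<psi>2 n t) \<longlonglongrightarrow>
        \<nu> * (0 * (\<Psi> t + \<Psi> t) + (h\<^sub>0 * (t - d) + h\<^sub>0 * (t - d)) * (A + \<gamma> * t)) * \<Psi> t * \<Psi> t"
      by (intro tendsto_intros ew t walim L1 L2)
  qed simp
  have I0: "((\<lambda>t. 2 * \<mu> * ((t - d) * (\<Psi> t)\<^sup>2)) has_integral 0) {0..?T}"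
  proof -
    let ?G = "\<lambda>t. (\<mu> * (t - d)\<^sup>2 - \<nu>) * (\<Psi> t)\<^sup>2 - (\<Psi>' t)\<^sup>2"
    have "((\<lambda>t. 2 * \<mu> * ((t - d) * (\<Psi> t)\<^sup>2)) has_integral (?G ?T - ?G 0)) {0..?T}"
    proof (rule fundamental_theorem_of_calculus)
      fix t assume "t \<in> {0..?T}"
      have "(?G has_real_derivative 2 * \<mu> * ((t - d) * (\<Psi> t)\<^sup>2)) (at t within {0..?T})"
        by (auto intro!: derivative_eq_intros dY simp: power2_eq_square algebra_simps)
      then show "(?G has_vector_derivative 2 * \<mu> * ((t - d) * (\<Psi> t)\<^sup>2)) (at t within {0..?T})"
        by (simp add: has_real_derivative_iff_has_vector_derivative)
    qed (use d in simp)
    then show ?thesis by (simp add: ends)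
  qed
  \<comment> \<open>Write A + \<gamma> t = (A + \<gamma> d) + \<gamma> (t - d). By I0 the constant
    part drops out of I1, and \<gamma> times the integral of a nonzero square is left.\<close>
  have \<gamma>0: "\<gamma> = 0"
  proof -
    have "((\<lambda>t. (h\<^sub>0 / (2 * \<nu>)) * (\<nu> * (0 * (\<Psi> t + \<Psi> t) + (h\<^sub>0 * (t - d) + h\<^sub>0 * (t - d)) * (A + \<gamma> * t)) * \<Psi> t * \<Psi> t)
        - ((A + \<gamma> * d) / (2 * \<nu>)) * (2 * \<mu> * ((t - d) * (\<Psi> t)\<^sup>2))) has_integral (h\<^sub>0 / (2 * \<nu>)) * 0 - ((A + \<gamma> * d) / (2 * \<nu>)) * 0) {0..?T}"
      using I1 I0 by (intro has_integral_diff has_integral_mult_right)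
    moreover have "(h\<^sub>0 / (2 * \<nu>)) * (\<nu> * (0 * (\<Psi> t + \<Psi> t) + (h\<^sub>0 * (t - d) + h\<^sub>0 * (t - d)) * (A + \<gamma> * t)) * \<Psi> t * \<Psi> t)
        - ((A + \<gamma> * d) / (2 * \<nu>)) * (2 * \<mu> * ((t - d) * (\<Psi> t)\<^sup>2)) = \<gamma> * (h\<^sub>0 * (t - d) * \<Psi> t)\<^sup>2" for t
      using \<nu> by (simp add: \<mu>_def field_simps power2_eq_square)
    ultimately have I: "((\<lambda>t. \<gamma> * (h\<^sub>0 * (t - d) * \<Psi> t)\<^sup>2) has_integral 0) {0..?T}" by simp
    show ?thesis
    proof (rule ccontr)
      assume "\<gamma> \<noteq> 0"
      from has_integral_mult_right[OF I, of "1 / \<gamma>"] this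
      have "((\<lambda>t. (h\<^sub>0 * (t - d) * \<Psi> t)\<^sup>2) has_integral 0) {0..?T}" by simp
      moreover have "continuous_on {0..?T} (\<lambda>t. (h\<^sub>0 * (t - d) * \<Psi> t)\<^sup>2)"
        using dY(1) by (intro continuous_intros) (auto intro: DERIV_continuous_on)
      ultimately have "(h\<^sub>0 * (0 - d) * \<Psi> 0)\<^sup>2 = 0"
        using has_integral_0_cbox_imp_0[of 0 ?T "\<lambda>t. (h\<^sub>0 * (t - d) * \<Psi> t)\<^sup>2" 0] d by auto
      then show False using h0 d ends by simp
    qed
  qed
  \<comment> \<open>\<open>orbit_energy\<close> for both orbits, subtracted, divided by D and passed
    to the limit. The terms with \<epsilon> disappear and the end value w enters.\<close>
  have Id2: "(2 * h\<^sub>0 * d) * A + (h\<^sub>0\<^sup>2 * d\<^sup>2 - 1) * 2 * w = - 2 * h\<^sub>0 * d * A"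
  proof -
    have T: "?T \<in> {0..?T}" "0 \<in> {0..?T}" using d by auto
    have e: "(a1 n ?T + a2 n ?T) * wa n ?T * (\<psi>1 n ?T)\<^sup>2 + ((a2 n ?T)\<^sup>2 - 1) * (\<psi>1 n ?T + \<psi>2 n ?T) * w\<psi> n ?T
        + (\<epsilon> n * w\<psi> n ?T) / 2 * ((\<psi>1 n ?T)\<^sup>2 + (\<psi>2 n ?T)\<^sup>2) * (\<psi>1 n ?T + \<psi>2 n ?T) = (a1 n 0 + a2 n 0) * ((a1 n 0 - a2 n 0) / D n)" for n
    proof -
      have e1: "((a1 n ?T)\<^sup>2 - 1) * (\<psi>1 n ?T)\<^sup>2 + \<epsilon> n * (\<psi>1 n ?T) ^ 4 / 2 = (a1 n 0)\<^sup>2 - 1 + \<epsilon> n / 2"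
        using orbit_energy[OF orb1 _ T(1), of n] \<nu> by (simp add: init1)
      have e2: "((a2 n ?T)\<^sup>2 - 1) * (\<psi>2 n ?T)\<^sup>2 + \<epsilon> n * (\<psi>2 n ?T) ^ 4 / 2 = (a2 n 0)\<^sup>2 - 1 + \<epsilon> n / 2"
        using orbit_energy[OF orb2 _ T(1), of n] \<nu> by (simp add: init2)
      have alg: "(x1 + x2) * (x1 - x2) * u1\<^sup>2 + (x2\<^sup>2 - 1) * (u1 + u2) * (u1 - u2) + (c / 2) * (u1 - u2) * (u1\<^sup>2 + u2\<^sup>2) * (u1 + u2)
          = ((x1\<^sup>2 - 1) * u1\<^sup>2 + c * u1 ^ 4 / 2) - ((x2\<^sup>2 - 1) * u2\<^sup>2 + c * u2 ^ 4 / 2)" for x1 x2 u1 u2 c :: real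
      proof -
        have "k * (u1 - u2) * (u1\<^sup>2 + u2\<^sup>2) * (u1 + u2) = k * u1 ^ 4 - k * u2 ^ 4" for k
          by (simp add: power2_eq_square power4_eq_xxxx algebra_simps)
        from this[of "c / 2"] show ?thesis by (simp add: power2_eq_square algebra_simps)
      qed
      have "(a1 n ?T + a2 n ?T) * (a1 n ?T - a2 n ?T) * (\<psi>1 n ?T)\<^sup>2 + ((a2 n ?T)\<^sup>2 - 1) * (\<psi>1 n ?T + \<psi>2 n ?T) * (\<psi>1 n ?T - \<psi>2 n ?T)
        + (\<epsilon> n / 2) * (\<psi>1 n ?T - \<psi>2 n ?T) * ((\<psi>1 n ?T)\<^sup>2 + (\<psi>2 n ?T)\<^sup>2) * (\<psi>1 n ?T + \<psi>2 n ?T) = (a1 n 0 + a2 n 0) * (a1 n 0 - a2 n 0)"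
        unfolding alg e1 e2 by (simp add: power2_eq_square algebra_simps)
      then have "((a1 n ?T + a2 n ?T) * wa n ?T * (\<psi>1 n ?T)\<^sup>2 + ((a2 n ?T)\<^sup>2 - 1) * (\<psi>1 n ?T + \<psi>2 n ?T) * w\<psi> n ?T
        + (\<epsilon> n * w\<psi> n ?T) / 2 * ((\<psi>1 n ?T)\<^sup>2 + (\<psi>2 n ?T)\<^sup>2) * (\<psi>1 n ?T + \<psi>2 n ?T)) * D n = ((a1 n 0 + a2 n 0) * wa n 0) * D n"
        unfolding wD by (simp add: algebra_simps)
      then show ?thesis unfolding mult_right_cancel[OF D0] wa_def[of n 0] .
    qed
    have "(\<lambda>n. (a1 n ?T + a2 n ?T) * wa n ?T * (\<psi>1 n ?T)\<^sup>2 + ((a2 n ?T)\<^sup>2 - 1) * (\<psi>1 n ?T + \<psi>2 n ?T) * w\<psi> n ?T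
        + (\<epsilon> n * w\<psi> n ?T) / 2 * ((\<psi>1 n ?T)\<^sup>2 + (\<psi>2 n ?T)\<^sup>2) * (\<psi>1 n ?T + \<psi>2 n ?T)) \<longlonglongrightarrow>
       (h\<^sub>0 * (?T - d) + h\<^sub>0 * (?T - d)) * (A + \<gamma> * ?T) * (\<Psi> ?T)\<^sup>2 + ((h\<^sub>0 * (?T - d))\<^sup>2 - 1) * (\<Psi> ?T + \<Psi> ?T) * w
        + 0 / 2 * ((\<Psi> ?T)\<^sup>2 + (\<Psi> ?T)\<^sup>2) * (\<Psi> ?T + \<Psi> ?T)"
      using limw by (intro tendsto_intros ew walim L1 L2 T(1)) (simp_all add: w\<psi>_def)
    moreover have "(\<lambda>n. (a1 n 0 + a2 n 0) * ((a1 n 0 - a2 n 0) / D n)) \<longlonglongrightarrow> (h\<^sub>0 * (0 - d) + h\<^sub>0 * (0 - d)) * A"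
      by (intro tendsto_intros limA L1(2) L2(2) T(2))
    ultimately have "(h\<^sub>0 * (?T - d) + h\<^sub>0 * (?T - d)) * (A + \<gamma> * ?T) * (\<Psi> ?T)\<^sup>2 + ((h\<^sub>0 * (?T - d))\<^sup>2 - 1) * (\<Psi> ?T + \<Psi> ?T) * w
        + 0 / 2 * ((\<Psi> ?T)\<^sup>2 + (\<Psi> ?T)\<^sup>2) * (\<Psi> ?T + \<Psi> ?T) = (h\<^sub>0 * (0 - d) + h\<^sub>0 * (0 - d)) * A"
      unfolding e by (rule LIMSEQ_unique)
    then show ?thesis using \<gamma>0 ends(3)[unfolded mult.commute[of 2 d]] by (simp add: ends power_mult_distrib algebra_simps)
  qed
  \<comment> \<open>Wronskian of \<open>w\<psi>\<close> with the odd solution Y of the limit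
    equation. Unlike \<Psi>, Y has a nonzero slope at the right end, so w survives in the boundary
    term.\<close>
  have I3: "((\<lambda>t. Y t * (\<nu> * ((0 * ((\<Psi> t)\<^sup>2 + \<Psi> t * \<Psi> t + (\<Psi> t)\<^sup>2)) + 0 + \<Psi> t * (h\<^sub>0 * (t - d) + h\<^sub>0 * (t - d)) * (A + \<gamma> * t)))) has_integral (- w * wO' \<mu> \<nu> d)) {0..?T}"
  proof -
    have "continuous_on {0..?T} Y" using dY(3) by (auto intro: DERIV_continuous_on)
    then have "bounded (Y ` {0..?T})" by (intro compact_imp_bounded compact_continuous_image) auto
    then obtain BY where BY: "\<forall>t\<in>{0..?T}. \<bar>Y t\<bar> \<le> BY" by (auto simp: bounded_iff)
    have BY0: "BY \<ge> 0" using BY[rule_format, of 0] d by auto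
    show ?thesis
    proof (rule bounded_convergence[where I = "\<lambda>n. - w\<psi> n ?T * wO' \<mu> \<nu> d"
        and f = "\<lambda>n t. Y t * (\<nu> * ((\<epsilon> n * w\<psi> n t) * ((\<psi>1 n t)\<^sup>2 + \<psi>1 n t * \<psi>2 n t + (\<psi>2 n t)\<^sup>2) + (((a1 n t)\<^sup>2 - (h\<^sub>0 * (t - d))\<^sup>2) * w\<psi> n t) + \<psi>2 n t * (a1 n t + a2 n t) * wa n t))"
        and K = "BY * (\<nu> * ((1 * C) * (M\<^sup>2 + M * M + M\<^sup>2) + ((M\<^sup>2 + (h\<^sub>0 * d)\<^sup>2) * C) + M * (M + M) * C))"])
      fix n
      let ?W = "\<lambda>t. wp n t * Y t - w\<psi> n t * Y' t"
      have "((\<lambda>t. Y t * (\<nu> * ((\<epsilon> n * w\<psi> n t) * ((\<psi>1 n t)\<^sup>2 + \<psi>1 n t * \<psi>2 n t + (\<psi>2 n t)\<^sup>2) + (((a1 n t)\<^sup>2 - (h\<^sub>0 * (t - d))\<^sup>2) * w\<psi> n t) + \<psi>2 n t * (a1 n t + a2 n t) * wa n t))) has_integral (?W ?T - ?W 0)) {0..?T}"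
      proof (rule fundamental_theorem_of_calculus)
        fix t assume t: "t \<in> {0..?T}"
        have dp: "(\<psi>1 n has_real_derivative p1 n t) (at t within {0..?T})"
          "(p1 n has_real_derivative \<nu> * (\<epsilon> n * (\<psi>1 n t)\<^sup>2 + (a1 n t)\<^sup>2 - 1) * \<psi>1 n t) (at t within {0..?T})"
          "(\<psi>2 n has_real_derivative p2 n t) (at t within {0..?T})"
          "(p2 n has_real_derivative \<nu> * (\<epsilon> n * (\<psi>2 n t)\<^sup>2 + (a2 n t)\<^sup>2 - 1) * \<psi>2 n t) (at t within {0..?T})"
          using o1[OF t, of n] o2[OF t, of n] by auto
        have dw: "(w\<psi> n has_real_derivative wp n t) (at t within {0..?T})"
          "(wp n has_real_derivative (\<nu> * (\<epsilon> n * (\<psi>1 n t)\<^sup>2 + (a1 n t)\<^sup>2 - 1) * \<psi>1 n t - \<nu> * (\<epsilon> n * (\<psi>2 n t)\<^sup>2 + (a2 n t)\<^sup>2 - 1) * \<psi>2 n t) / D n) (at t within {0..?T})"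
          unfolding w\<psi>_def[abs_def] wp_def[abs_def] by (intro DERIV_cdivide DERIV_diff dp)+
        have num: "\<nu> * (\<epsilon> n * (\<psi>1 n t)\<^sup>2 + (a1 n t)\<^sup>2 - 1) * \<psi>1 n t - \<nu> * (\<epsilon> n * (\<psi>2 n t)\<^sup>2 + (a2 n t)\<^sup>2 - 1) * \<psi>2 n t
          = (\<nu> * ((\<epsilon> n * w\<psi> n t) * ((\<psi>1 n t)\<^sup>2 + \<psi>1 n t * \<psi>2 n t + (\<psi>2 n t)\<^sup>2) + ((a1 n t)\<^sup>2 - 1) * w\<psi> n t + \<psi>2 n t * (a1 n t + a2 n t) * wa n t)) * D n"
        proof -
          have alg: "\<nu> * (e * u1\<^sup>2 + x1\<^sup>2 - 1) * u1 - \<nu> * (e * u2\<^sup>2 + x2\<^sup>2 - 1) * u2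
            = \<nu> * (e * (u1 - u2) * (u1\<^sup>2 + u1 * u2 + u2\<^sup>2) + (x1\<^sup>2 - 1) * (u1 - u2) + u2 * (x1 + x2) * (x1 - x2))" for u1 u2 x1 x2 e :: real
            by (simp add: power2_eq_square algebra_simps)
          show ?thesis unfolding alg wD by (simp add: algebra_simps)
        qed
        have "(\<nu> * (\<epsilon> n * (\<psi>1 n t)\<^sup>2 + (a1 n t)\<^sup>2 - 1) * \<psi>1 n t - \<nu> * (\<epsilon> n * (\<psi>2 n t)\<^sup>2 + (a2 n t)\<^sup>2 - 1) * \<psi>2 n t) / D n * Y t + wp n t * Y' t
            - (wp n t * Y' t + w\<psi> n t * ((\<mu> * (t - d)\<^sup>2 - \<nu>) * Y t)) =
            Y t * (\<nu> * ((\<epsilon> n * w\<psi> n t) * ((\<psi>1 n t)\<^sup>2 + \<psi>1 n t * \<psi>2 n t + (\<psi>2 n t)\<^sup>2) + (((a1 n t)\<^sup>2 - (h\<^sub>0 * (t - d))\<^sup>2) * w\<psi> n t) + \<psi>2 n t * (a1 n t + a2 n t) * wa n t))"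
          unfolding num nonzero_mult_div_cancel_right[OF D0] \<mu>_def power_mult_distrib by (simp add: algebra_simps)
        moreover have "(?W has_real_derivative (\<nu> * (\<epsilon> n * (\<psi>1 n t)\<^sup>2 + (a1 n t)\<^sup>2 - 1) * \<psi>1 n t - \<nu> * (\<epsilon> n * (\<psi>2 n t)\<^sup>2 + (a2 n t)\<^sup>2 - 1) * \<psi>2 n t) / D n * Y t + wp n t * Y' t
            - (wp n t * Y' t + w\<psi> n t * ((\<mu> * (t - d)\<^sup>2 - \<nu>) * Y t))) (at t within {0..?T})"
        proof (rule DERIV_diff)
          show "((\<lambda>t. wp n t * Y t) has_real_derivative (\<nu> * (\<epsilon> n * (\<psi>1 n t)\<^sup>2 + (a1 n t)\<^sup>2 - 1) * \<psi>1 n t - \<nu> * (\<epsilon> n * (\<psi>2 n t)\<^sup>2 + (a2 n t)\<^sup>2 - 1) * \<psi>2 n t) / D n * Y t + wp n t * Y' t) (at t within {0..?T})"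
            by (rule DERIV_cong[OF DERIV_mult[OF dw(2) dY(3)]]) (simp only: mult.commute)
          show "((\<lambda>t. w\<psi> n t * Y' t) has_real_derivative wp n t * Y' t + w\<psi> n t * ((\<mu> * (t - d)\<^sup>2 - \<nu>) * Y t)) (at t within {0..?T})"
            by (rule DERIV_cong[OF DERIV_mult[OF dw(1) dY(4)]]) (simp only: mult.commute)
        qed
        ultimately show "(?W has_vector_derivative Y t * (\<nu> * ((\<epsilon> n * w\<psi> n t) * ((\<psi>1 n t)\<^sup>2 + \<psi>1 n t * \<psi>2 n t + (\<psi>2 n t)\<^sup>2) + (((a1 n t)\<^sup>2 - (h\<^sub>0 * (t - d))\<^sup>2) * w\<psi> n t) + \<psi>2 n t * (a1 n t + a2 n t) * wa n t))) (at t within {0..?T})"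
          by (simp only: has_real_derivative_iff_has_vector_derivative)
      qed (use d in simp)
      then show "((\<lambda>t. Y t * (\<nu> * ((\<epsilon> n * w\<psi> n t) * ((\<psi>1 n t)\<^sup>2 + \<psi>1 n t * \<psi>2 n t + (\<psi>2 n t)\<^sup>2) + (((a1 n t)\<^sup>2 - (h\<^sub>0 * (t - d))\<^sup>2) * w\<psi> n t) + \<psi>2 n t * (a1 n t + a2 n t) * wa n t))) has_integral (- w\<psi> n ?T * wO' \<mu> \<nu> d)) {0..?T}"
        by (simp add: wp_def w\<psi>_def init1 init2 ends)
      fix t assume t: "t \<in> {0..?T}"
      have sq: "(\<psi>1 n t)\<^sup>2 \<le> M\<^sup>2" "(\<psi>2 n t)\<^sup>2 \<le> M\<^sup>2" "(a1 n t)\<^sup>2 \<le> M\<^sup>2" "(h\<^sub>0 * (t - d))\<^sup>2 \<le> (h\<^sub>0 * d)\<^sup>2"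
        using bd1[OF t, of n] bd2[OF t, of n] M0 t h0 d by (auto simp: abs_le_square_iff[symmetric] abs_mult)
      have "\<bar>\<psi>1 n t * \<psi>2 n t\<bar> \<le> M * M" unfolding abs_mult using bd1[OF t, of n] bd2[OF t, of n] M0 by (intro mult_mono) auto
      then have "\<bar>(\<psi>1 n t)\<^sup>2 + \<psi>1 n t * \<psi>2 n t + (\<psi>2 n t)\<^sup>2\<bar> \<le> M\<^sup>2 + M * M + M\<^sup>2"
        using sq zero_le_power2[of "\<psi>1 n t"] zero_le_power2[of "\<psi>2 n t"] by linarith
      then have b1: "\<bar>(\<epsilon> n * w\<psi> n t) * ((\<psi>1 n t)\<^sup>2 + \<psi>1 n t * \<psi>2 n t + (\<psi>2 n t)\<^sup>2)\<bar> \<le> (1 * C) * (M\<^sup>2 + M * M + M\<^sup>2)"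
        unfolding abs_mult[of "\<epsilon> n * w\<psi> n t"] abs_mult[of "\<epsilon> n"] using \<epsilon>(2)[of n] wb[OF t, of n] C0
        by (intro mult_mono) auto
      have "\<bar>(a1 n t)\<^sup>2 - (h\<^sub>0 * (t - d))\<^sup>2\<bar> \<le> M\<^sup>2 + (h\<^sub>0 * d)\<^sup>2"
        using sq zero_le_power2[of "a1 n t"] zero_le_power2[of "h\<^sub>0 * (t - d)"] by linarith
      then have b2: "\<bar>((a1 n t)\<^sup>2 - (h\<^sub>0 * (t - d))\<^sup>2) * w\<psi> n t\<bar> \<le> (M\<^sup>2 + (h\<^sub>0 * d)\<^sup>2) * C"
        unfolding abs_mult[of _ "w\<psi> n t"] using wb[OF t, of n] by (intro mult_mono) auto
      have b3: "\<bar>\<psi>2 n t * (a1 n t + a2 n t) * wa n t\<bar> \<le> M * (M + M) * C"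
        unfolding abs_mult using wb[OF t, of n] bd1[OF t, of n] bd2[OF t, of n] M0
        by (intro mult_mono order_trans[OF abs_triangle_ineq] add_mono) auto
      have "\<bar>(\<epsilon> n * w\<psi> n t) * ((\<psi>1 n t)\<^sup>2 + \<psi>1 n t * \<psi>2 n t + (\<psi>2 n t)\<^sup>2) + (((a1 n t)\<^sup>2 - (h\<^sub>0 * (t - d))\<^sup>2) * w\<psi> n t) + \<psi>2 n t * (a1 n t + a2 n t) * wa n t\<bar>
          \<le> (1 * C) * (M\<^sup>2 + M * M + M\<^sup>2) + ((M\<^sup>2 + (h\<^sub>0 * d)\<^sup>2) * C) + M * (M + M) * C"
        using b1 b2 b3 by linarith
      then show "\<bar>Y t * (\<nu> * ((\<epsilon> n * w\<psi> n t) * ((\<psi>1 n t)\<^sup>2 + \<psi>1 n t * \<psi>2 n t + (\<psi>2 n t)\<^sup>2) + (((a1 n t)\<^sup>2 - (h\<^sub>0 * (t - d))\<^sup>2) * w\<psi> n t) + \<psi>2 n t * (a1 n t + a2 n t) * wa n t))\<bar>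
          \<le> BY * (\<nu> * ((1 * C) * (M\<^sup>2 + M * M + M\<^sup>2) + ((M\<^sup>2 + (h\<^sub>0 * d)\<^sup>2) * C) + M * (M + M) * C))"
        unfolding abs_mult[of "Y t"] abs_mult[of \<nu>] using BY[rule_format, OF t] BY0 \<nu> by (intro mult_mono) auto
      have "(\<lambda>n. ((a1 n t)\<^sup>2 - (h\<^sub>0 * (t - d))\<^sup>2) * w\<psi> n t) \<longlonglongrightarrow> 0"
      proof (rule Lim_null_comparison)
        show "\<forall>\<^sub>F n in sequentially. norm (((a1 n t)\<^sup>2 - (h\<^sub>0 * (t - d))\<^sup>2) * w\<psi> n t) \<le> \<bar>(a1 n t)\<^sup>2 - (h\<^sub>0 * (t - d))\<^sup>2\<bar> * C"
          using wb(1)[OF t] by (intro always_eventually allI) (simp add: abs_mult mult_left_mono)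
        have "(\<lambda>n. \<bar>(a1 n t)\<^sup>2 - (h\<^sub>0 * (t - d))\<^sup>2\<bar> * C) \<longlonglongrightarrow> \<bar>(h\<^sub>0 * (t - d))\<^sup>2 - (h\<^sub>0 * (t - d))\<^sup>2\<bar> * C"
          by (intro tendsto_intros L1(2) t)
        then show "(\<lambda>n. \<bar>(a1 n t)\<^sup>2 - (h\<^sub>0 * (t - d))\<^sup>2\<bar> * C) \<longlonglongrightarrow> 0" by simp
      qed
      then show "(\<lambda>n. Y t * (\<nu> * ((\<epsilon> n * w\<psi> n t) * ((\<psi>1 n t)\<^sup>2 + \<psi>1 n t * \<psi>2 n t + (\<psi>2 n t)\<^sup>2) + (((a1 n t)\<^sup>2 - (h\<^sub>0 * (t - d))\<^sup>2) * w\<psi> n t) + \<psi>2 n t * (a1 n t + a2 n t) * wa n t))) \<longlonglongrightarrow>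
          Y t * (\<nu> * ((0 * ((\<Psi> t)\<^sup>2 + \<Psi> t * \<Psi> t + (\<Psi> t)\<^sup>2)) + 0 + \<Psi> t * (h\<^sub>0 * (t - d) + h\<^sub>0 * (t - d)) * (A + \<gamma> * t)))"
        by (intro tendsto_mult tendsto_add tendsto_const tendsto_power ew t walim L1 L2)
    next
      show "(\<lambda>n. - w\<psi> n ?T * wO' \<mu> \<nu> d) \<longlonglongrightarrow> - w * wO' \<mu> \<nu> d"
        using limw by (intro tendsto_intros) (simp add: w\<psi>_def)
    qed
  qed
  \<comment> \<open>The energy identity in polarized form, for the two solutions \<Psi> and
    Y.\<close>
  have I4: "((\<lambda>t. 2 * \<mu> * (t - d) * \<Psi> t * Y t) has_integral 2 * ((\<mu> * d\<^sup>2 - \<nu>) * wO \<mu> \<nu> d)) {0..?T}"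
  proof -
    let ?G = "\<lambda>t. (\<mu> * (t - d)\<^sup>2 - \<nu>) * \<Psi> t * Y t - \<Psi>' t * Y' t"
    have "((\<lambda>t. 2 * \<mu> * (t - d) * \<Psi> t * Y t) has_integral (?G ?T - ?G 0)) {0..?T}"
    proof (rule fundamental_theorem_of_calculus)
      fix t assume "t \<in> {0..?T}"
      have "(?G has_real_derivative 2 * \<mu> * (t - d) * \<Psi> t * Y t) (at t within {0..?T})"
        by (auto intro!: derivative_eq_intros dY simp: power2_eq_square algebra_simps)
      then show "(?G has_vector_derivative 2 * \<mu> * (t - d) * \<Psi> t * Y t) (at t within {0..?T})"
        by (simp add: has_real_derivative_iff_has_vector_derivative)
    qed (use d in simp)
    then show ?thesis by (simp add: ends mult.commute[of "wO \<mu> \<nu> d"])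
  qed
  have "- w * wO' \<mu> \<nu> d * h\<^sub>0 = A * (2 * ((\<mu> * d\<^sup>2 - \<nu>) * wO \<mu> \<nu> d))"
  proof (rule has_integral_unique)
    show "((\<lambda>t. A * (2 * \<mu> * (t - d) * \<Psi> t * Y t)) has_integral A * (2 * ((\<mu> * d\<^sup>2 - \<nu>) * wO \<mu> \<nu> d))) {0..?T}"
      by (rule has_integral_mult_right[OF I4])
    have eq: "A * (2 * \<mu> * (t - d) * \<Psi> t * Y t) = Y t * (\<nu> * ((0 * ((\<Psi> t)\<^sup>2 + \<Psi> t * \<Psi> t + (\<Psi> t)\<^sup>2)) + 0 + \<Psi> t * (h\<^sub>0 * (t - d) + h\<^sub>0 * (t - d)) * (A + \<gamma> * t))) * h\<^sub>0" for t
      using \<gamma>0 by (simp add: \<mu>_def power2_eq_square algebra_simps)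
    show "((\<lambda>t. A * (2 * \<mu> * (t - d) * \<Psi> t * Y t)) has_integral - w * wO' \<mu> \<nu> d * h\<^sub>0) {0..?T}"
      unfolding eq by (rule has_integral_mult_left[OF I3])
  qed
  then have w1: "w * wO' \<mu> \<nu> d * h\<^sub>0 = - 2 * A * ((\<mu> * d\<^sup>2 - \<nu>) * wO \<mu> \<nu> d)" by simp
  have w2: "\<nu> * (h\<^sub>0\<^sup>2 * d\<^sup>2 - 1) * w = - 2 * \<nu> * h\<^sub>0 * d * A"
  proof -
    have "(h\<^sub>0\<^sup>2 * d\<^sup>2 - 1) * w = - 2 * h\<^sub>0 * d * A" using Id2 by (simp add: algebra_simps)
    then have "\<nu> * ((h\<^sub>0\<^sup>2 * d\<^sup>2 - 1) * w) = \<nu> * (- 2 * h\<^sub>0 * d * A)" by (rule arg_cong)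
    then show ?thesis by (simp add: algebra_simps)
  qed
  have "(\<mu> * d\<^sup>2 - \<nu>) * (w * wO' \<mu> \<nu> d * h\<^sub>0) = (\<nu> * (h\<^sub>0\<^sup>2 * d\<^sup>2 - 1) * w) * (wO' \<mu> \<nu> d * h\<^sub>0)"
    by (simp add: \<mu>_def algebra_simps)
  then have "(\<mu> * d\<^sup>2 - \<nu>) * (- 2 * A * ((\<mu> * d\<^sup>2 - \<nu>) * wO \<mu> \<nu> d)) = (- 2 * \<nu> * h\<^sub>0 * d * A) * (wO' \<mu> \<nu> d * h\<^sub>0)"
    unfolding w1 w2 .
  then have "A * wN \<mu> \<nu> d = 0" by (simp add: wN_def \<mu>_def power2_eq_square algebra_simps)
  with N \<gamma>0 show ?thesis by (simp add: \<mu>_def)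
qed



subsection \<open>Uniqueness of the bifurcating solutions\<close>

lemma h_crit_square:
  assumes "\<kappa> > 0" "d > 0"
  shows "\<kappa>\<^sup>2 * (h_crit \<kappa> d 0)\<^sup>2 = (\<kappa> * h_crit \<kappa> d 0)\<^sup>2" "0 < \<kappa>\<^sup>2" "\<kappa>\<^sup>2 \<le> \<kappa> * h_crit \<kappa> d 0"
  using h_crit_symmetric(1)[OF assms] assms by (auto simp: power2_eq_square)

text \<open>The equality \<open>e\<close> is what j = 0 at the right end becomes for \<epsilon> = 0.
  Through \<open>wU_right\<close> it is equality of \<open>wPhi\<close> at L and R, and the
  vanishing slope is the condition on \<open>wRho\<close>.\<close>

lemma neumann_pair_unique:
  assumes k: "\<kappa> > 0" "d > 0" and reg: "\<kappa> * d \<le> 1 / 100 \<or> 4 \<le> \<kappa> * d"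
  defines "\<mu> \<equiv> \<kappa>\<^sup>2 * (h_crit \<kappa> d 0)\<^sup>2"
  assumes LR: "0 \<le> L" "0 \<le> R" "L + R = 2 * d" and U: "wU' \<mu> (\<kappa>\<^sup>2) L R = 0"
    and e: "(\<mu> * R\<^sup>2 - \<kappa>\<^sup>2) * (wU \<mu> (\<kappa>\<^sup>2) L R)\<^sup>2 = \<mu> * L\<^sup>2 - \<kappa>\<^sup>2"
  shows "L = d"
proof -
  define m where "m = \<kappa> * h_crit \<kappa> d 0"
  have \<mu>: "\<mu> = m\<^sup>2" and \<nu>: "0 < \<kappa>\<^sup>2" "\<kappa>\<^sup>2 \<le> m" using h_crit_square[OF k] by (simp_all add: \<mu>_def m_def)
  have E: "wE' (m\<^sup>2) (\<kappa>\<^sup>2) d = 0" using h_crit_symmetric(2)[OF k] by (simp add: \<mu>[symmetric] \<mu>_def)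
  have X: "wO' (m\<^sup>2) (\<kappa>\<^sup>2) y > 0" for y by (rule wO'_pos[OF \<nu>])
  have pair: "L' = R'" if "0 \<le> L'" "L' \<le> R'" "L' + R' = 2 * d" "wRho (m\<^sup>2) (\<kappa>\<^sup>2) L' + wRho (m\<^sup>2) (\<kappa>\<^sup>2) R' = 0"
      "wPhi (m\<^sup>2) (\<kappa>\<^sup>2) L' = wPhi (m\<^sup>2) (\<kappa>\<^sup>2) R'" for L' R'
    using reg
  proof
    assume "\<kappa> * d \<le> 1 / 100"
    from neumann_pair_small[OF k(1) \<nu>(2) k(2) this E that(1,2,3,5)] show ?thesis .
  next
    assume "4 \<le> \<kappa> * d"
    from neumann_pair_large[OF k(1) \<nu>(2) this E that] show ?thesis .
  qed
  have rho: "wRho (m\<^sup>2) (\<kappa>\<^sup>2) L + wRho (m\<^sup>2) (\<kappa>\<^sup>2) R = 0"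
    using U X[of L] X[of R] by (simp add: wU'_def wRho_def \<mu> field_simps)
  have *: "wU (m\<^sup>2) (\<kappa>\<^sup>2) L R = wO' (m\<^sup>2) (\<kappa>\<^sup>2) L / wO' (m\<^sup>2) (\<kappa>\<^sup>2) R"
    using wU_right[OF U] X[of R] by (simp add: \<mu> field_simps)
  have phi: "wPhi (m\<^sup>2) (\<kappa>\<^sup>2) L = wPhi (m\<^sup>2) (\<kappa>\<^sup>2) R"
  proof -
    have "m\<^sup>2 * L\<^sup>2 - \<kappa>\<^sup>2 = (m\<^sup>2 * R\<^sup>2 - \<kappa>\<^sup>2) * (wO' (m\<^sup>2) (\<kappa>\<^sup>2) L / wO' (m\<^sup>2) (\<kappa>\<^sup>2) R)\<^sup>2"
      using e unfolding \<mu> * by simp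
    then show ?thesis using X[of L] unfolding wPhi_def by (simp add: power_divide)
  qed
  have "L = R"
  proof (cases "L \<le> R")
    case True
    then show ?thesis by (rule pair[OF LR(1) _ LR(3) rho phi])
  next
    case False
    then show ?thesis using pair[of R L] LR rho phi by simp
  qed
  with LR show ?thesis by simp
qed

text \<open>The limit is an orbit with \<epsilon> = 0 whose a vanishes at L = -A' / h(0), and the
  bounds on \<open>A n\<close>, which for solutions are \<open>a_ends\<close> and
  \<open>a_lower\<close>, place L in [0, 2d]. Then \<open>neumann_pair_unique\<close> forces L = d,
  whichever limit A' a subsequence has produced.\<close>

lemma limit_base:
  fixes A h e :: "nat \<Rightarrow> real"
  assumes k: "\<kappa> > 0" "d > 0" and reg: "\<kappa> * d \<le> 1 / 100 \<or> 4 \<le> \<kappa> * d"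
  defines "h\<^sub>0 \<equiv> h_crit \<kappa> d 0"
  defines "x \<equiv> \<lambda>n. start (A n) (h n) (e n) (\<kappa>\<^sup>2)"
  assumes lim: "A \<longlonglongrightarrow> A'" "h \<longlonglongrightarrow> h\<^sub>0" "e \<longlonglongrightarrow> 0" and par: "h\<^sub>0 \<le> M" "\<kappa>\<^sup>2 \<le> M"
    and bd: "\<And>n t. t \<in> {0..2 * d} \<Longrightarrow> \<bar>f\<psi> M (x n) t\<bar> \<le> M \<and> \<bar>fp M (x n) t\<bar> \<le> M \<and> \<bar>fa M (x n) t\<bar> \<le> M \<and> \<bar>fj M (x n) t\<bar> \<le> M"
    and A: "\<And>n. - h n * (2 * d) \<le> A n" "\<And>n. A n \<le> 0"
    and final: "\<And>n. fp M (x n) (2 * d) = 0" "\<And>n. fj M (x n) (2 * d) = 0"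
    and t: "t \<in> {0..2 * d}"
  shows "(\<lambda>n. f\<psi> M (x n) t) \<longlonglongrightarrow> wU (\<kappa>\<^sup>2 * h\<^sub>0\<^sup>2) (\<kappa>\<^sup>2) d (t - d)" "(\<lambda>n. fa M (x n) t) \<longlonglongrightarrow> h\<^sub>0 * (t - d)"
proof -
  let ?y = "start A' h\<^sub>0 0 (\<kappa>\<^sup>2)"
  have h0: "h\<^sub>0 > 0" using h_crit_symmetric(1)[OF k] k by (simp add: h\<^sub>0_def)
  have g: "(\<lambda>n. f (x n)) \<longlonglongrightarrow> f ?y" if "continuous_on UNIV (\<lambda>z. f (start (fst z) (fst (snd z)) (snd (snd z)) (\<kappa>\<^sup>2)))" for f :: "state \<Rightarrow> real"
    using continuous_on_tendsto_compose[OF that tendsto_Pair[OF lim(1) tendsto_Pair[OF lim(2,3)]]] by (simp add: x_def)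
  have c: "continuous_on UNIV (\<lambda>z. f\<psi> M (start (fst z) (fst (snd z)) (snd (snd z)) (\<kappa>\<^sup>2)) s)"
    "continuous_on UNIV (\<lambda>z. fp M (start (fst z) (fst (snd z)) (snd (snd z)) (\<kappa>\<^sup>2)) s)"
    "continuous_on UNIV (\<lambda>z. fa M (start (fst z) (fst (snd z)) (snd (snd z)) (\<kappa>\<^sup>2)) s)"
    "continuous_on UNIV (\<lambda>z. fj M (start (fst z) (fst (snd z)) (snd (snd z)) (\<kappa>\<^sup>2)) s)" if "s \<in> {0..2 * d}" for s
    using that by (intro continuous_intros flow_components_continuous[where T = "2 * d"]; simp)+
  note l = g[OF c(1)] g[OF c(2)] g[OF c(3)] g[OF c(4)]
  have absle: "\<bar>z\<bar> \<le> M" if "f \<longlonglongrightarrow> z" "\<And>n. \<bar>f n\<bar> \<le> M" for f :: "nat \<Rightarrow> real" and z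
    by (rule LIMSEQ_le_const2[OF tendsto_rabs[OF that(1)]]) (use that(2) in blast)
  have orb: "orbit (\<kappa>\<^sup>2) 0 h\<^sub>0 (2 * d) (f\<psi> M ?y) (fp M ?y) (fa M ?y) (fj M ?y)"
  proof (rule flow_orbit)
    fix s assume s: "s \<in> {0..2 * d}"
    show "\<bar>f\<psi> M ?y s\<bar> \<le> M \<and> \<bar>fp M ?y s\<bar> \<le> M \<and> \<bar>fa M ?y s\<bar> \<le> M \<and> \<bar>fj M ?y s\<bar> \<le> M"
      using absle[OF l(1)[OF s]] absle[OF l(2)[OF s]] absle[OF l(3)[OF s]] absle[OF l(4)[OF s]] bd[OF s] by blast
  qed (use par h0 in \<open>auto simp: start_def\<close>)
  define L where "L = - A' / h\<^sub>0"
  have AL: "A' = - h\<^sub>0 * L" using h0 by (simp add: L_def)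
  have "A' \<le> 0" by (rule LIMSEQ_le_const2[OF lim(1)]) (use A(2) in blast)
  then have L0: "0 \<le> L" using h0 by (simp add: L_def divide_le_0_iff)
  have "- h\<^sub>0 * (2 * d) \<le> A'"
    by (rule LIMSEQ_le[OF tendsto_mult[OF tendsto_minus[OF lim(2)] tendsto_const] lim(1)]) (use A(1) in blast)
  then have L1: "L \<le> 2 * d" using h0 by (simp add: AL)
  note eps = orbit_eps0[OF orb _ flow_start(1) flow_start(2), of L, unfolded flow_start]
  have T: "2 * d \<in> {0..2 * d}" using k by simp
  have p0: "fp M ?y (2 * d) = 0" using LIMSEQ_unique[OF l(2)[OF T]] final(1) by (simp add: LIMSEQ_const_iff)
  have j0: "fj M ?y (2 * d) = 0" using LIMSEQ_unique[OF l(4)[OF T]] final(2) by (simp add: LIMSEQ_const_iff)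
  have "L = d"
  proof (rule neumann_pair_unique[OF k reg, folded h\<^sub>0_def])
    show "wU' (\<kappa>\<^sup>2 * h\<^sub>0\<^sup>2) (\<kappa>\<^sup>2) L (2 * d - L) = 0" using eps(3)[OF _ AL T] h0 p0 by simp
    have "0 = \<kappa>\<^sup>2 * ((h\<^sub>0 * (2 * d - L))\<^sup>2 - 1) * (wU (\<kappa>\<^sup>2 * h\<^sub>0\<^sup>2) (\<kappa>\<^sup>2) L (2 * d - L))\<^sup>2 - \<kappa>\<^sup>2 * ((h\<^sub>0 * L)\<^sup>2 - 1)"
      using orbit_eps0_j[OF orb T flow_start(4)] eps(1)[OF _ AL T] eps(2)[OF _ AL T] h0 p0 j0
      by (simp add: flow_start AL)
    then show "(\<kappa>\<^sup>2 * h\<^sub>0\<^sup>2 * (2 * d - L)\<^sup>2 - \<kappa>\<^sup>2) * (wU (\<kappa>\<^sup>2 * h\<^sub>0\<^sup>2) (\<kappa>\<^sup>2) L (2 * d - L))\<^sup>2 = \<kappa>\<^sup>2 * h\<^sub>0\<^sup>2 * L\<^sup>2 - \<kappa>\<^sup>2"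
      unfolding power_mult_distrib by (simp add: right_diff_distrib mult.assoc)
  qed (use L0 L1 in auto)
  then show "(\<lambda>n. f\<psi> M (x n) t) \<longlonglongrightarrow> wU (\<kappa>\<^sup>2 * h\<^sub>0\<^sup>2) (\<kappa>\<^sup>2) d (t - d)" "(\<lambda>n. fa M (x n) t) \<longlonglongrightarrow> h\<^sub>0 * (t - d)"
    using l(1)[OF t] l(3)[OF t] eps(1,2)[OF _ AL t] h0 by auto
qed

lemma flow_difference_bound:
  "\<exists>C. \<forall>A h A' h' \<epsilon> \<nu>. \<forall>t\<in>{0..T}.
     \<bar>f\<psi> M (start A h \<epsilon> \<nu>) t - f\<psi> M (start A' h' \<epsilon> \<nu>) t\<bar> \<le> C * (\<bar>A - A'\<bar> + \<bar>h - h'\<bar>) \<and>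
     \<bar>fp M (start A h \<epsilon> \<nu>) t - fp M (start A' h' \<epsilon> \<nu>) t\<bar> \<le> C * (\<bar>A - A'\<bar> + \<bar>h - h'\<bar>) \<and>
     \<bar>fa M (start A h \<epsilon> \<nu>) t - fa M (start A' h' \<epsilon> \<nu>) t\<bar> \<le> C * (\<bar>A - A'\<bar> + \<bar>h - h'\<bar>) \<and>
     \<bar>fj M (start A h \<epsilon> \<nu>) t - fj M (start A' h' \<epsilon> \<nu>) t\<bar> \<le> C * (\<bar>A - A'\<bar> + \<bar>h - h'\<bar>)"
proof -
  obtain C where C: "C \<ge> 0" "\<And>x y t. t \<in> {0..T} \<Longrightarrow> norm (flow M x t - flow M y t) \<le> C * norm (x - y)"
    using flow_lipschitz by blast
  have n: "norm (flow M (start A h \<epsilon> \<nu>) t - flow M (start A' h' \<epsilon> \<nu>) t) \<le> C * (\<bar>A - A'\<bar> + \<bar>h - h'\<bar>)"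
    if "t \<in> {0..T}" for A h A' h' \<epsilon> \<nu> t
    using order_trans[OF C(2)[OF that] mult_left_mono[OF norm_start_diff[of A h \<epsilon> \<nu> A' h' \<epsilon> \<nu>] C(1)]] by simp
  show ?thesis unfolding f\<psi>_def fp_def fa_def fj_def
    by (intro exI[of _ C] allI ballI conjI norm_state_components(1-4)[THEN order_trans, OF n])
qed

lemma wN_nonzero:
  assumes k: "\<kappa> > 0" "d > 0" and reg: "\<kappa> * d \<le> 1 / 100 \<or> 4 \<le> \<kappa> * d"
  shows "wN (\<kappa>\<^sup>2 * (h_crit \<kappa> d 0)\<^sup>2) (\<kappa>\<^sup>2) d \<noteq> 0"
  using reg
proof
  assume "\<kappa> * d \<le> 1 / 100"
  with wN_small_pos[OF k(1) h_crit_square(3)[OF k] k(2) _ _ k(2)] h_crit_symmetric(2)[OF k] k show ?thesis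
    by (simp add: h_crit_square)
next
  assume "4 \<le> \<kappa> * d"
  with wN_large_neg[OF k(1) h_crit_square(3)[OF k], of d] show ?thesis by (simp add: h_crit_square[OF k])
qed

lemma shooting_unique:
  fixes M :: real
  assumes k: "\<kappa> > 0" "d > 0" and reg: "\<kappa> * d \<le> 1 / 100 \<or> 4 \<le> \<kappa> * d"
  defines "h\<^sub>0 \<equiv> h_crit \<kappa> d 0"
  defines "good \<equiv> \<lambda>\<epsilon> A h. - h * (2 * d) \<le> A \<and> A \<le> 0 \<and> fp M (start A h \<epsilon> (\<kappa>\<^sup>2)) (2 * d) = 0 \<and> fj M (start A h \<epsilon> (\<kappa>\<^sup>2)) (2 * d) = 0 \<and>
    (\<forall>t\<in>{0..2 * d}. \<bar>f\<psi> M (start A h \<epsilon> (\<kappa>\<^sup>2)) t\<bar> \<le> M \<and> \<bar>fp M (start A h \<epsilon> (\<kappa>\<^sup>2)) t\<bar> \<le> M \<and>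
       \<bar>fa M (start A h \<epsilon> (\<kappa>\<^sup>2)) t\<bar> \<le> M \<and> \<bar>fj M (start A h \<epsilon> (\<kappa>\<^sup>2)) t\<bar> \<le> M)"
  assumes par: "h\<^sub>0 + 1 \<le> M" "\<kappa>\<^sup>2 \<le> M"
  shows "\<exists>\<delta>>0. \<delta> \<le> 1 \<and> (\<forall>\<epsilon> A h A' h'. 0 < \<epsilon> \<longrightarrow> \<epsilon> < \<delta> \<longrightarrow> \<bar>h - h\<^sub>0\<bar> < \<delta> \<longrightarrow> \<bar>h' - h\<^sub>0\<bar> < \<delta> \<longrightarrow>
    good \<epsilon> A h \<longrightarrow> good \<epsilon> A' h' \<longrightarrow> A = A' \<and> h = h')"
proof (rule ccontr)
  assume neg: "\<not> ?thesis"
  have h0: "h\<^sub>0 > 0" using h_crit_symmetric(1)[OF k] k by (simp add: h\<^sub>0_def)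
  have "\<exists>\<epsilon> A h A' h'. 0 < \<epsilon> \<and> \<epsilon> < inverse (real (Suc n)) \<and> \<bar>h - h\<^sub>0\<bar> < inverse (real (Suc n)) \<and>
      \<bar>h' - h\<^sub>0\<bar> < inverse (real (Suc n)) \<and> good \<epsilon> A h \<and> good \<epsilon> A' h' \<and> \<not> (A = A' \<and> h = h')" for n
  proof -
    have "inverse (real (Suc n)) > 0" "inverse (real (Suc n)) \<le> 1" by (auto simp: field_simps)
    with neg show ?thesis by blast
  qed
  then obtain e A h A' h' where s: "\<And>n. 0 < e n" "\<And>n. e n < inverse (real (Suc n))"
    "\<And>n. \<bar>h n - h\<^sub>0\<bar> < inverse (real (Suc n))" "\<And>n. \<bar>h' n - h\<^sub>0\<bar> < inverse (real (Suc n))"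
    "\<And>n. good (e n) (A n) (h n)" "\<And>n. good (e n) (A' n) (h' n)" "\<And>n. \<not> (A n = A' n \<and> h n = h' n)"
    by metis
  obtain C where C: "\<And>A h A' h' \<epsilon> \<nu> t. t \<in> {0..2 * d} \<Longrightarrow>
     \<bar>f\<psi> M (start A h \<epsilon> \<nu>) t - f\<psi> M (start A' h' \<epsilon> \<nu>) t\<bar> \<le> C * (\<bar>A - A'\<bar> + \<bar>h - h'\<bar>) \<and>
     \<bar>fp M (start A h \<epsilon> \<nu>) t - fp M (start A' h' \<epsilon> \<nu>) t\<bar> \<le> C * (\<bar>A - A'\<bar> + \<bar>h - h'\<bar>) \<and>
     \<bar>fa M (start A h \<epsilon> \<nu>) t - fa M (start A' h' \<epsilon> \<nu>) t\<bar> \<le> C * (\<bar>A - A'\<bar> + \<bar>h - h'\<bar>) \<and>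
     \<bar>fj M (start A h \<epsilon> \<nu>) t - fj M (start A' h' \<epsilon> \<nu>) t\<bar> \<le> C * (\<bar>A - A'\<bar> + \<bar>h - h'\<bar>)"
    using flow_difference_bound[of "2 * d" M] by blast
  have T: "2 * d \<in> {0..2 * d}" "0 \<in> {0..2 * d}" using k by auto
  \<comment> \<open>The initial differences are a sufficient norm: by Lipschitz dependence they
    dominate the differences of all components.\<close>
  define D where "D n = \<bar>A n - A' n\<bar> + \<bar>h n - h' n\<bar>" for n
  have D: "D n > 0" for n using s(7)[of n] by (auto simp: D_def)
  define x where "x n = start (A n) (h n) (e n) (\<kappa>\<^sup>2)" for n
  define x' where "x' n = start (A' n) (h' n) (e n) (\<kappa>\<^sup>2)" for n
  \<comment> \<open>The end difference of \<psi> is included because \<open>difference_limit\<close>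
    needs its limit w to exist.\<close>
  define q where "q n = ((A n - A' n) / D n, (h n - h' n) / D n, (f\<psi> M (x n) (2 * d) - f\<psi> M (x' n) (2 * d)) / D n)" for n
  have A: "\<bar>A n\<bar> \<le> M" "\<bar>A' n\<bar> \<le> M" for n
    using s(5)[of n] s(6)[of n] T(2) unfolding good_def by (metis flow_start(3))+
  have qb: "\<bar>(A n - A' n) / D n\<bar> \<le> 1" "\<bar>(h n - h' n) / D n\<bar> \<le> 1" "\<bar>(f\<psi> M (x n) (2 * d) - f\<psi> M (x' n) (2 * d)) / D n\<bar> \<le> C" for n
    using C[OF T(1), of "A n" "h n" "e n" "\<kappa>\<^sup>2" "A' n" "h' n"] D[of n]
    by (auto simp: abs_divide pos_divide_le_eq D_def x_def x'_def)
  let ?K = "{-M..M} \<times> {-M..M} \<times> {-1..1::real} \<times> {-1..1::real} \<times> {-C..C}"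
  have "bounded (range (\<lambda>n. (A n, A' n, q n)))"
  proof (rule bounded_subset)
    show "bounded ?K" by (intro bounded_Times) auto
    show "range (\<lambda>n. (A n, A' n, q n)) \<subseteq> ?K"
    proof (rule image_subsetI)
      fix n
      have mem: "z \<in> {- c..c}" if "\<bar>z\<bar> \<le> c" for z c :: real using that by auto
      show "(A n, A' n, q n) \<in> ?K" unfolding q_def by (intro SigmaI mem A qb)
    qed
  qed
  from bounded_imp_convergent_subsequence[OF this] obtain l r where r: "strict_mono (r :: nat \<Rightarrow> nat)"
    and l: "((\<lambda>n. (A n, A' n, q n)) \<circ> r) \<longlonglongrightarrow> l" by blast
  obtain B B' \<xi> \<gamma> w where leq: "l = (B, B', \<xi>, \<gamma>, w)" by (metis prod.exhaust)
  have lims: "(\<lambda>n. A (r n)) \<longlonglongrightarrow> B" "(\<lambda>n. A' (r n)) \<longlonglongrightarrow> B'" "(\<lambda>n. (A (r n) - A' (r n)) / D (r n)) \<longlonglongrightarrow> \<xi>"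
    "(\<lambda>n. (h (r n) - h' (r n)) / D (r n)) \<longlonglongrightarrow> \<gamma>"
    "(\<lambda>n. (f\<psi> M (x (r n)) (2 * d) - f\<psi> M (x' (r n)) (2 * d)) / D (r n)) \<longlonglongrightarrow> w"
    using tendsto_fst[OF l] tendsto_fst[OF tendsto_snd[OF l]] tendsto_fst[OF tendsto_snd[OF tendsto_snd[OF l]]]
      tendsto_fst[OF tendsto_snd[OF tendsto_snd[OF tendsto_snd[OF l]]]] tendsto_snd[OF tendsto_snd[OF tendsto_snd[OF tendsto_snd[OF l]]]]
    by (simp_all add: leq q_def o_def)
  have inv: "(\<lambda>n. inverse (real (Suc n))) \<longlonglongrightarrow> 0" by (rule LIMSEQ_inverse_real_of_nat)
  have h: "h \<longlonglongrightarrow> h\<^sub>0" "h' \<longlonglongrightarrow> h\<^sub>0" and e: "e \<longlonglongrightarrow> 0"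
  proof -
    show "h \<longlonglongrightarrow> h\<^sub>0" by (rule LIM_zero_cancel, rule Lim_null_comparison[OF _ inv]) (use s(3) in \<open>auto intro!: always_eventually less_imp_le\<close>)
    show "h' \<longlonglongrightarrow> h\<^sub>0" by (rule LIM_zero_cancel, rule Lim_null_comparison[OF _ inv]) (use s(4) in \<open>auto intro!: always_eventually less_imp_le\<close>)
    show "e \<longlonglongrightarrow> 0" by (rule Lim_null_comparison[OF _ inv]) (use s(1,2) in \<open>auto intro!: always_eventually less_imp_le simp: abs_of_pos\<close>)
  qed
  note sub = LIMSEQ_subseq_LIMSEQ[OF _ r, unfolded o_def]
  have g: "- h n * (2 * d) \<le> A n \<and> A n \<le> 0 \<and> fp M (x n) (2 * d) = 0 \<and> fj M (x n) (2 * d) = 0" 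
    "- h' n * (2 * d) \<le> A' n \<and> A' n \<le> 0 \<and> fp M (x' n) (2 * d) = 0 \<and> fj M (x' n) (2 * d) = 0" for n
    using s(5)[of n] s(6)[of n] by (auto simp: good_def x_def x'_def)
  have gb: "\<bar>f\<psi> M (x n) t\<bar> \<le> M \<and> \<bar>fp M (x n) t\<bar> \<le> M \<and> \<bar>fa M (x n) t\<bar> \<le> M \<and> \<bar>fj M (x n) t\<bar> \<le> M"
    "\<bar>f\<psi> M (x' n) t\<bar> \<le> M \<and> \<bar>fp M (x' n) t\<bar> \<le> M \<and> \<bar>fa M (x' n) t\<bar> \<le> M \<and> \<bar>fj M (x' n) t\<bar> \<le> M" if "t \<in> {0..2 * d}" for n t
    using s(5)[of n] s(6)[of n] that by (simp_all add: good_def x_def x'_def)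
  have pars: "\<bar>h n\<bar> \<le> M \<and> \<bar>e n\<bar> \<le> M \<and> \<bar>h' n\<bar> \<le> M \<and> \<bar>\<kappa>\<^sup>2\<bar> \<le> M \<and> \<bar>e n\<bar> \<le> 1" for n
  proof -
    have "inverse (real (Suc n)) \<le> 1" by (simp add: field_simps)
    then show ?thesis using s(1,2,3,4)[of n] par h0 by auto
  qed
  have orb: "orbit (\<kappa>\<^sup>2) (e n) (h n) (2 * d) (f\<psi> M (x n)) (fp M (x n)) (fa M (x n)) (fj M (x n))"
    "orbit (\<kappa>\<^sup>2) (e n) (h' n) (2 * d) (f\<psi> M (x' n)) (fp M (x' n)) (fa M (x' n)) (fj M (x' n))" for n
  proof -
    have p: "snd (snd (snd (snd (x n)))) = (h n, e n, \<kappa>\<^sup>2)" "snd (snd (snd (snd (x' n)))) = (h' n, e n, \<kappa>\<^sup>2)"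
      by (simp_all add: x_def x'_def start_def)
    show "orbit (\<kappa>\<^sup>2) (e n) (h n) (2 * d) (f\<psi> M (x n)) (fp M (x n)) (fa M (x n)) (fj M (x n))"
      by (rule flow_orbit[OF gb(1) p(1)]) (use pars[of n] in auto)
    show "orbit (\<kappa>\<^sup>2) (e n) (h' n) (2 * d) (f\<psi> M (x' n)) (fp M (x' n)) (fa M (x' n)) (fj M (x' n))"
      by (rule flow_orbit[OF gb(2) p(2)]) (use pars[of n] in auto)
  qed
  have M: "h\<^sub>0 \<le> M" using par by simp
  note LB = limit_base[OF k reg, folded h\<^sub>0_def, OF lims(1) sub[OF h(1)] sub[OF e] M par(2), folded x_def, OF gb(1)]
    limit_base[OF k reg, folded h\<^sub>0_def, OF lims(2) sub[OF h(2)] sub[OF e] M par(2), folded x'_def, OF gb(2)]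
  have "\<xi> = 0 \<and> \<gamma> = 0"
  proof (rule difference_limit[where \<epsilon> = "\<lambda>n. e (r n)" and ?h1.0 = "\<lambda>n. h (r n)" and ?h2.0 = "\<lambda>n. h' (r n)" and D = "\<lambda>n. D (r n)" and C = C
        and ?\<psi>1.0 = "\<lambda>n. f\<psi> M (x (r n))" and ?p1.0 = "\<lambda>n. fp M (x (r n))" and ?a1.0 = "\<lambda>n. fa M (x (r n))" and ?j1.0 = "\<lambda>n. fj M (x (r n))"
        and ?\<psi>2.0 = "\<lambda>n. f\<psi> M (x' (r n))" and ?p2.0 = "\<lambda>n. fp M (x' (r n))" and ?a2.0 = "\<lambda>n. fa M (x' (r n))" and ?j2.0 = "\<lambda>n. fj M (x' (r n))"
        and \<nu> = "\<kappa>\<^sup>2" and d = d and M = M and w = w and h\<^sub>0 = h\<^sub>0])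
    fix t assume t: "t \<in> {0..2 * d}"
    show "(\<lambda>n. f\<psi> M (x (r n)) t) \<longlonglongrightarrow> wU (\<kappa>\<^sup>2 * h\<^sub>0\<^sup>2) (\<kappa>\<^sup>2) d (t - d)" "(\<lambda>n. fa M (x (r n)) t) \<longlonglongrightarrow> h\<^sub>0 * (t - d)"
      "(\<lambda>n. f\<psi> M (x' (r n)) t) \<longlonglongrightarrow> wU (\<kappa>\<^sup>2 * h\<^sub>0\<^sup>2) (\<kappa>\<^sup>2) d (t - d)" "(\<lambda>n. fa M (x' (r n)) t) \<longlonglongrightarrow> h\<^sub>0 * (t - d)"
      using LB g t by blast+
  next
    show "wN (\<kappa>\<^sup>2 * h\<^sub>0\<^sup>2) (\<kappa>\<^sup>2) d \<noteq> 0" unfolding h\<^sub>0_def by (rule wN_nonzero[OF k reg])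
    show "wE' (\<kappa>\<^sup>2 * h\<^sub>0\<^sup>2) (\<kappa>\<^sup>2) d = 0" unfolding h\<^sub>0_def by (rule h_crit_symmetric(2)[OF k])
    show "wO' (\<kappa>\<^sup>2 * h\<^sub>0\<^sup>2) (\<kappa>\<^sup>2) d > 0"
      using wO'_pos[OF h_crit_square(2,3)[OF k], of d] by (simp add: h\<^sub>0_def h_crit_square(1)[OF k])
  next
    fix n t assume t: "t \<in> {0..2 * d}"
    show "\<bar>f\<psi> M (x (r n)) t - f\<psi> M (x' (r n)) t\<bar> \<le> C * D (r n) \<and> \<bar>fp M (x (r n)) t - fp M (x' (r n)) t\<bar> \<le> C * D (r n) \<and>
      \<bar>fa M (x (r n)) t - fa M (x' (r n)) t\<bar> \<le> C * D (r n) \<and> \<bar>fj M (x (r n)) t - fj M (x' (r n)) t\<bar> \<le> C * D (r n)"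
      unfolding x_def x'_def D_def by (rule C[OF t])
  next
    show "(\<lambda>n. (fa M (x (r n)) 0 - fa M (x' (r n)) 0) / D (r n)) \<longlonglongrightarrow> \<xi>" using lims(3) by (simp add: x_def x'_def flow_start)
    show "\<bar>e (r n)\<bar> \<le> 1" for n using pars by blast
    show "f\<psi> M (x (r n)) 0 = 1" "fp M (x (r n)) 0 = 0" "fj M (x (r n)) 0 = 0"
      "f\<psi> M (x' (r n)) 0 = 1" "fp M (x' (r n)) 0 = 0" "fj M (x' (r n)) 0 = 0" for n
      by (simp_all add: x_def x'_def flow_start)
  qed (use orb gb g D k h0 lims sub[OF e] in auto)
  moreover have "(\<lambda>n. \<bar>(A (r n) - A' (r n)) / D (r n)\<bar> + \<bar>(h (r n) - h' (r n)) / D (r n)\<bar>) \<longlonglongrightarrow> \<bar>\<xi>\<bar> + \<bar>\<gamma>\<bar>"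
    by (intro tendsto_intros lims)
  \<comment> \<open>The normalized initial data have 1-norm equal to 1, which excludes the limit
    0.\<close>
  moreover have "\<bar>(A n - A' n) / D n\<bar> + \<bar>(h n - h' n) / D n\<bar> = 1" for n
    using D[of n] by (simp add: abs_divide add_divide_distrib[symmetric] D_def)
  ultimately show False by (simp add: LIMSEQ_const_iff)
qed

text \<open>The clipping level M lies above the a priori bound, so every positive solution with h
  close to h(0) is an orbit of the truncated flow and falls under \<open>shooting_unique\<close>.
  Equal initial data then give equal solutions.\<close>

theorem rescaled_orbit_unique:
  assumes k: "\<kappa> > 0" "d > 0" and reg: "\<kappa> * d \<le> 1 / 100 \<or> 4 \<le> \<kappa> * d"
  defines "h\<^sub>0 \<equiv> h_crit \<kappa> d 0"
  shows "\<exists>\<delta>>0. \<delta> \<le> 1 \<and> (\<forall>\<epsilon> \<psi> p a j h \<psi>' p' a' j' h'. \<epsilon> < \<delta> \<longrightarrow> \<bar>h - h\<^sub>0\<bar> < \<delta> \<longrightarrow> \<bar>h' - h\<^sub>0\<bar> < \<delta> \<longrightarrow>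
    rescaled_orbit (\<kappa>\<^sup>2) \<epsilon> h (2 * d) \<psi> p a j \<longrightarrow> rescaled_orbit (\<kappa>\<^sup>2) \<epsilon> h' (2 * d) \<psi>' p' a' j' \<longrightarrow>
    h' = h \<and> (\<forall>t\<in>{0..2 * d}. \<psi>' t = \<psi> t \<and> a' t = a t))"
proof -
  have h0: "h\<^sub>0 > 0" using h_crit_symmetric(1)[OF k] k by (simp add: h\<^sub>0_def)
  have "h\<^sub>0 + 1 > 0" "\<kappa>\<^sup>2 > 0" "2 * d > 0" using h0 k by auto
  from a_priori_bound[OF this] obtain B where B: "\<And>\<epsilon> h \<psi> p a j t. rescaled_orbit (\<kappa>\<^sup>2) \<epsilon> h (2 * d) \<psi> p a j \<Longrightarrow> h \<le> h\<^sub>0 + 1 \<Longrightarrow>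
    t \<in> {0..2 * d} \<Longrightarrow> \<bar>\<psi> t\<bar> \<le> B \<and> \<bar>p t\<bar> \<le> B \<and> \<bar>a t\<bar> \<le> B \<and> \<bar>j t\<bar> \<le> B" by blast
  define M where "M = max B (h\<^sub>0 + 1 + \<kappa>\<^sup>2)"
  have M: "B \<le> M" "h\<^sub>0 + 1 \<le> M" "\<kappa>\<^sup>2 \<le> M" "1 \<le> M" using h0 by (auto simp: M_def intro: max.coboundedI2)
  have fl: "flow M (start (a 0) h \<epsilon> (\<kappa>\<^sup>2)) t = (\<psi> t, p t, a t, j t, h, \<epsilon>, \<kappa>\<^sup>2)"
    and bd: "\<bar>\<psi> t\<bar> \<le> M \<and> \<bar>p t\<bar> \<le> M \<and> \<bar>a t\<bar> \<le> M \<and> \<bar>j t\<bar> \<le> M"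
    if o: "rescaled_orbit (\<kappa>\<^sup>2) \<epsilon> h (2 * d) \<psi> p a j" and near: "\<bar>h - h\<^sub>0\<bar> < 1" and t: "t \<in> {0..2 * d}" for \<epsilon> h \<psi> p a j t
  proof -
    interpret rescaled_orbit "\<kappa>\<^sup>2" \<epsilon> h "2 * d" \<psi> p a j by (rule o)
    have b: "\<bar>\<psi> t\<bar> \<le> M \<and> \<bar>p t\<bar> \<le> M \<and> \<bar>a t\<bar> \<le> M \<and> \<bar>j t\<bar> \<le> M" if "t \<in> {0..2 * d}" for t
      using B[OF o _ that] near M(1) by force
    then show "\<bar>\<psi> t\<bar> \<le> M \<and> \<bar>p t\<bar> \<le> M \<and> \<bar>a t\<bar> \<le> M \<and> \<bar>j t\<bar> \<le> M" using t .
    show "flow M (start (a 0) h \<epsilon> (\<kappa>\<^sup>2)) t = (\<psi> t, p t, a t, j t, h, \<epsilon>, \<kappa>\<^sup>2)"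
      using orbit_eq_flow[OF orb b, OF _ _ _ _ t] init near h M \<epsilon> by (simp add: start_def)
  qed
  obtain \<delta> where \<delta>: "\<delta> > 0" "\<delta> \<le> 1" and un: "\<And>\<epsilon> A h A' h'. 0 < \<epsilon> \<Longrightarrow> \<epsilon> < \<delta> \<Longrightarrow> \<bar>h - h\<^sub>0\<bar> < \<delta> \<Longrightarrow> \<bar>h' - h\<^sub>0\<bar> < \<delta> \<Longrightarrow>
     - h * (2 * d) \<le> A \<and> A \<le> 0 \<and> fp M (start A h \<epsilon> (\<kappa>\<^sup>2)) (2 * d) = 0 \<and> fj M (start A h \<epsilon> (\<kappa>\<^sup>2)) (2 * d) = 0 \<and>
       (\<forall>t\<in>{0..2 * d}. \<bar>f\<psi> M (start A h \<epsilon> (\<kappa>\<^sup>2)) t\<bar> \<le> M \<and> \<bar>fp M (start A h \<epsilon> (\<kappa>\<^sup>2)) t\<bar> \<le> M \<and>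
       \<bar>fa M (start A h \<epsilon> (\<kappa>\<^sup>2)) t\<bar> \<le> M \<and> \<bar>fj M (start A h \<epsilon> (\<kappa>\<^sup>2)) t\<bar> \<le> M) \<Longrightarrow>
     - h' * (2 * d) \<le> A' \<and> A' \<le> 0 \<and> fp M (start A' h' \<epsilon> (\<kappa>\<^sup>2)) (2 * d) = 0 \<and> fj M (start A' h' \<epsilon> (\<kappa>\<^sup>2)) (2 * d) = 0 \<and>
       (\<forall>t\<in>{0..2 * d}. \<bar>f\<psi> M (start A' h' \<epsilon> (\<kappa>\<^sup>2)) t\<bar> \<le> M \<and> \<bar>fp M (start A' h' \<epsilon> (\<kappa>\<^sup>2)) t\<bar> \<le> M \<and>
       \<bar>fa M (start A' h' \<epsilon> (\<kappa>\<^sup>2)) t\<bar> \<le> M \<and> \<bar>fj M (start A' h' \<epsilon> (\<kappa>\<^sup>2)) t\<bar> \<le> M) \<Longrightarrow> A = A' \<and> h = h'"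
    using shooting_unique[OF k reg, folded h\<^sub>0_def, OF M(2,3)] by blast
  have good: "- h * (2 * d) \<le> a 0 \<and> a 0 \<le> 0 \<and> fp M (start (a 0) h \<epsilon> (\<kappa>\<^sup>2)) (2 * d) = 0 \<and> fj M (start (a 0) h \<epsilon> (\<kappa>\<^sup>2)) (2 * d) = 0 \<and>
       (\<forall>t\<in>{0..2 * d}. \<bar>f\<psi> M (start (a 0) h \<epsilon> (\<kappa>\<^sup>2)) t\<bar> \<le> M \<and> \<bar>fp M (start (a 0) h \<epsilon> (\<kappa>\<^sup>2)) t\<bar> \<le> M \<and>
       \<bar>fa M (start (a 0) h \<epsilon> (\<kappa>\<^sup>2)) t\<bar> \<le> M \<and> \<bar>fj M (start (a 0) h \<epsilon> (\<kappa>\<^sup>2)) t\<bar> \<le> M)"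
    if o: "rescaled_orbit (\<kappa>\<^sup>2) \<epsilon> h (2 * d) \<psi> p a j" and near: "\<bar>h - h\<^sub>0\<bar> < 1" for \<epsilon> h \<psi> p a j
  proof -
    interpret rescaled_orbit "\<kappa>\<^sup>2" \<epsilon> h "2 * d" \<psi> p a j by (rule o)
    have T: "2 * d \<in> {0..2 * d}" using k by simp
    have c: "f\<psi> M (start (a 0) h \<epsilon> (\<kappa>\<^sup>2)) t = \<psi> t \<and> fp M (start (a 0) h \<epsilon> (\<kappa>\<^sup>2)) t = p t \<and>
      fa M (start (a 0) h \<epsilon> (\<kappa>\<^sup>2)) t = a t \<and> fj M (start (a 0) h \<epsilon> (\<kappa>\<^sup>2)) t = j t" if "t \<in> {0..2 * d}" for t
      unfolding f\<psi>_def fp_def fa_def fj_def fl[OF o near that] by simp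
    have l: "- h * (2 * d) \<le> a 0" using a_lower by simp
    show ?thesis
      by (intro conjI ballI l a_ends(1)) (simp_all add: c[OF T] final c bd[OF o near])
  qed
  show ?thesis
  proof (intro exI[of _ \<delta>] conjI[of "\<delta> > 0"] conjI[of "\<delta> \<le> 1"] allI impI \<delta>)
    fix \<epsilon> \<psi> p a j h \<psi>' p' a' j' h'
    assume *: "\<epsilon> < \<delta>" "\<bar>h - h\<^sub>0\<bar> < \<delta>" "\<bar>h' - h\<^sub>0\<bar> < \<delta>" and o: "rescaled_orbit (\<kappa>\<^sup>2) \<epsilon> h (2 * d) \<psi> p a j"
      and o': "rescaled_orbit (\<kappa>\<^sup>2) \<epsilon> h' (2 * d) \<psi>' p' a' j'"
    have 1: "\<bar>h - h\<^sub>0\<bar> < 1" "\<bar>h' - h\<^sub>0\<bar> < 1" using * \<delta>(2) by linarith+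
    have e: "0 < \<epsilon>" by (rule rescaled_orbit.\<epsilon>[OF o])
    have eq: "a 0 = a' 0 \<and> h = h'" by (rule un[OF e * good[OF o 1(1)] good[OF o' 1(2)]])
    have "\<psi>' t = \<psi> t \<and> a' t = a t" if t: "t \<in> {0..2 * d}" for t
    proof -
      have "(\<psi>' t, p' t, a' t, j' t, h', \<epsilon>, \<kappa>\<^sup>2) = (\<psi> t, p t, a t, j t, h, \<epsilon>, \<kappa>\<^sup>2)"
        unfolding fl[OF o 1(1) t, symmetric] fl[OF o' 1(2) t, symmetric] using eq by (simp only:)
      then show ?thesis by (simp only: prod.inject)
    qed
    with eq show "h' = h \<and> (\<forall>t\<in>{0..2 * d}. \<psi>' t = \<psi> t \<and> a' t = a t)" by blast
  qed
qed

section \<open>The symmetric branch: convergence to the normal state and uniqueness\<close>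

theorem symmetric_bifurcation:
  assumes k: "\<kappa> > 0" "d > 0"
  shows "\<exists>(\<phi> :: nat \<Rightarrow> real \<Rightarrow> real) (a :: nat \<Rightarrow> real \<Rightarrow> real) (h :: nat \<Rightarrow> real).
         (\<forall>n. solution \<kappa> d (\<phi> n) (a n) (h n) \<and> symmetric d (\<phi> n) (a n) \<and> positive_on d (\<phi> n)) \<and>
         h \<longlonglongrightarrow> h_crit \<kappa> d 0 \<and>
         C1_limit d \<phi> (\<lambda>x. 0) \<and> C1_limit d a (\<lambda>x. h_crit \<kappa> d 0 * x)"
proof -
  define h\<^sub>0 where "h\<^sub>0 = h_crit \<kappa> d 0"
  obtain M where M: "M > 0" and ex: "\<And>r. r > 0 \<Longrightarrow> \<exists>\<alpha>\<^sub>0>0. \<forall>\<alpha>. 0 < \<alpha> \<and> \<alpha> < \<alpha>\<^sub>0 \<longrightarrow> (\<exists>\<psi> p a j h.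
    orbit (\<kappa>\<^sup>2) (\<alpha>\<^sup>2) h (2 * d) \<psi> p a j \<and> \<psi> 0 = 1 \<and> p 0 = 0 \<and> j 0 = 0 \<and> p (2 * d) = 0 \<and> j (2 * d) = 0 \<and>
    h > 0 \<and> \<bar>h - h\<^sub>0\<bar> < r \<and> (\<forall>t\<in>{0..2 * d}. \<psi> t > 0 \<and> \<bar>\<psi> t\<bar> \<le> M \<and> \<bar>p t\<bar> \<le> M \<and>
      \<bar>a t - h\<^sub>0 * (t - d)\<bar> \<le> r \<and> \<bar>h + \<alpha>\<^sup>2 * j t - h\<^sub>0\<bar> \<le> r \<and> \<psi> (2 * d - t) = \<psi> t \<and> a (2 * d - t) = - a t))"
    using symmetric_orbits_exist[OF k, folded h\<^sub>0_def] by blast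
  let ?r = "\<lambda>n. inverse (real (Suc n))"
  have one: "\<exists>\<phi> a h. solution \<kappa> d \<phi> a h \<and> symmetric d \<phi> a \<and> positive_on d \<phi> \<and> \<bar>h - h\<^sub>0\<bar> \<le> r \<and>
     (\<forall>x\<in>{-d..d}. \<bar>\<phi> x\<bar> \<le> r * M \<and> \<bar>ideriv d \<phi> x\<bar> \<le> r * M \<and> \<bar>a x - h\<^sub>0 * x\<bar> \<le> r \<and> \<bar>ideriv d a x - h\<^sub>0\<bar> \<le> r)"
    if r: "r > 0" for r
  proof -
    obtain \<alpha>\<^sub>0 where a0: "\<alpha>\<^sub>0 > 0" and *: "\<And>\<alpha>. 0 < \<alpha> \<and> \<alpha> < \<alpha>\<^sub>0 \<Longrightarrow> (\<exists>\<psi> p a j h.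
      orbit (\<kappa>\<^sup>2) (\<alpha>\<^sup>2) h (2 * d) \<psi> p a j \<and> \<psi> 0 = 1 \<and> p 0 = 0 \<and> j 0 = 0 \<and> p (2 * d) = 0 \<and> j (2 * d) = 0 \<and>
      h > 0 \<and> \<bar>h - h\<^sub>0\<bar> < r \<and> (\<forall>t\<in>{0..2 * d}. \<psi> t > 0 \<and> \<bar>\<psi> t\<bar> \<le> M \<and> \<bar>p t\<bar> \<le> M \<and>
      \<bar>a t - h\<^sub>0 * (t - d)\<bar> \<le> r \<and> \<bar>h + \<alpha>\<^sup>2 * j t - h\<^sub>0\<bar> \<le> r \<and> \<psi> (2 * d - t) = \<psi> t \<and> a (2 * d - t) = - a t))"
      using ex[OF r] by blast
    \<comment> \<open>\<alpha> <= r bounds \<phi> = \<alpha> \<psi> and its derivative by r M, with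
      M independent of r.\<close>
    define \<alpha> where "\<alpha> = min \<alpha>\<^sub>0 r / 2"
    have al: "0 < \<alpha> \<and> \<alpha> < \<alpha>\<^sub>0" "\<alpha> \<le> r" using a0 r by (auto simp: \<alpha>_def)
    obtain \<psi> p a j h where o: "orbit (\<kappa>\<^sup>2) (\<alpha>\<^sup>2) h (2 * d) \<psi> p a j" "\<psi> 0 = 1" "p 0 = 0" "j 0 = 0" "p (2 * d) = 0" "j (2 * d) = 0"
      "h > 0" "\<bar>h - h\<^sub>0\<bar> < r" and b: "\<And>t. t \<in> {0..2 * d} \<Longrightarrow> \<psi> t > 0 \<and> \<bar>\<psi> t\<bar> \<le> M \<and> \<bar>p t\<bar> \<le> M \<and>
      \<bar>a t - h\<^sub>0 * (t - d)\<bar> \<le> r \<and> \<bar>h + \<alpha>\<^sup>2 * j t - h\<^sub>0\<bar> \<le> r \<and> \<psi> (2 * d - t) = \<psi> t \<and> a (2 * d - t) = - a t"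
      using *[OF al(1)] by blast
    have sol: "solution \<kappa> d (\<lambda>x. \<alpha> * \<psi> (x + d)) (\<lambda>x. a (x + d)) h"
      by (rule rescaled_imp_solution[OF k(2) orbit_imp_rescaled[OF k(2) o(7,1-6)]])
    have refl: "2 * d - (x + d) = - x + d" for x by simp
    show ?thesis
    proof (rule exI[of _ "\<lambda>x. \<alpha> * \<psi> (x + d)"], rule exI[of _ "\<lambda>x. a (x + d)"], rule exI[of _ h], intro conjI ballI sol)
      show "symmetric d (\<lambda>x. \<alpha> * \<psi> (x + d)) (\<lambda>x. a (x + d))"
        unfolding symmetric_def
      proof
        fix x assume "x \<in> {-d..d}"
        then show "\<alpha> * \<psi> (- x + d) = \<alpha> * \<psi> (x + d) \<and> a (- x + d) = - a (x + d)" using b[of "x + d"] unfolding refl by auto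
      qed
      show "positive_on d (\<lambda>x. \<alpha> * \<psi> (x + d))" using b al by (auto simp: positive_on_def)
      show "\<bar>h - h\<^sub>0\<bar> \<le> r" using o(8) by simp
      fix x assume x: "x \<in> {-d..d}"
      then have t: "x + d \<in> {0..2 * d}" by auto
      show "\<bar>\<alpha> * \<psi> (x + d)\<bar> \<le> r * M" unfolding abs_mult using al b[OF t] r by (intro mult_mono) auto
      show "\<bar>ideriv d (\<lambda>x. \<alpha> * \<psi> (x + d)) x\<bar> \<le> r * M"
        unfolding orbit_ideriv(1)[OF k(2) o(1) x] abs_mult using al b[OF t] r by (intro mult_mono) auto
      show "\<bar>a (x + d) - h\<^sub>0 * x\<bar> \<le> r" using b[OF t] by simp
      show "\<bar>ideriv d (\<lambda>x. a (x + d)) x - h\<^sub>0\<bar> \<le> r"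
        unfolding orbit_ideriv(2)[OF k(2) o(1) x] using b[OF t] by simp
    qed
  qed
  have "\<exists>\<phi> a h. solution \<kappa> d \<phi> a h \<and> symmetric d \<phi> a \<and> positive_on d \<phi> \<and> \<bar>h - h\<^sub>0\<bar> \<le> ?r n \<and>
     (\<forall>x\<in>{-d..d}. \<bar>\<phi> x\<bar> \<le> ?r n * M \<and> \<bar>ideriv d \<phi> x\<bar> \<le> ?r n * M \<and> \<bar>a x - h\<^sub>0 * x\<bar> \<le> ?r n \<and> \<bar>ideriv d a x - h\<^sub>0\<bar> \<le> ?r n)" for n
    by (rule one) simp
  then obtain \<phi> a h where s: "\<And>n. solution \<kappa> d (\<phi> n) (a n) (h n) \<and> symmetric d (\<phi> n) (a n) \<and> positive_on d (\<phi> n)"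
    "\<And>n. \<bar>h n - h\<^sub>0\<bar> \<le> ?r n" "\<And>n x. x \<in> {-d..d} \<Longrightarrow> \<bar>\<phi> n x\<bar> \<le> ?r n * M \<and> \<bar>ideriv d (\<phi> n) x\<bar> \<le> ?r n * M \<and>
      \<bar>a n x - h\<^sub>0 * x\<bar> \<le> ?r n \<and> \<bar>ideriv d (a n) x - h\<^sub>0\<bar> \<le> ?r n"
    by metis
  have inv: "?r \<longlonglongrightarrow> 0" by (rule LIMSEQ_inverse_real_of_nat)
  have inv2: "(\<lambda>n. ?r n * M) \<longlonglongrightarrow> 0" using tendsto_mult[OF inv tendsto_const[of M]] by simp
  have ul: "uniform_limit {-d..d} f g sequentially"
    if "\<And>n x. x \<in> {-d..d} \<Longrightarrow> \<bar>f n x - g x\<bar> \<le> e n" "e \<longlonglongrightarrow> 0" for f :: "nat \<Rightarrow> real \<Rightarrow> real" and g e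
  proof (rule uniform_limitI)
    fix \<epsilon> :: real assume "\<epsilon> > 0"
    then have "\<forall>\<^sub>F n in sequentially. e n < \<epsilon>" using order_tendstoD(2)[OF that(2)] by blast
    then show "\<forall>\<^sub>F n in sequentially. \<forall>x\<in>{-d..d}. dist (f n x) (g x) < \<epsilon>"
      by eventually_elim (auto simp: dist_real_def intro: le_less_trans[OF that(1)])
  qed
  have i0: "ideriv d (\<lambda>x. 0) x = 0" "ideriv d (\<lambda>x. h\<^sub>0 * x) x = h\<^sub>0" if "x \<in> {-d..d}" for x
    by (rule ideriv_eq[OF k(2) that], auto intro!: derivative_eq_intros)+
  have "h \<longlonglongrightarrow> h\<^sub>0" by (rule LIM_zero_cancel, rule Lim_null_comparison[OF _ inv]) (use s(2) in auto)
  moreover have "C1_limit d \<phi> (\<lambda>x. 0)" unfolding C1_limit_def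
    by (intro conjI ul[OF _ inv2]) (use s(3) i0 in auto)
  moreover have "C1_limit d a (\<lambda>x. h\<^sub>0 * x)" unfolding C1_limit_def
    by (intro conjI ul[OF _ inv]) (use s(3) i0 in auto)
  ultimately show ?thesis using s(1) unfolding h\<^sub>0_def by blast
qed

theorem unique_symmetric_curve:
  assumes k: "\<kappa> > 0" "d > 0" and reg: "\<kappa> * d \<le> 1 / 100 \<or> 4 \<le> \<kappa> * d"
  shows "\<exists>\<delta>>0. \<exists>\<alpha>\<^sub>0>0. \<forall>\<alpha>. 0 < \<alpha> \<and> \<alpha> < \<alpha>\<^sub>0 \<longrightarrow>
            (\<exists>\<psi> a h. rescaled_solution \<kappa> d \<alpha> \<psi> a h \<and> positive_on d \<psi> \<and>
               \<bar>h - h_crit \<kappa> d 0\<bar> < \<delta> \<and> symmetric d \<psi> a \<and>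
               (\<forall>\<psi>' a' h'. rescaled_solution \<kappa> d \<alpha> \<psi>' a' h' \<and> positive_on d \<psi>' \<and>
                  \<bar>h' - h_crit \<kappa> d 0\<bar> < \<delta> \<longrightarrow>
                  h' = h \<and> (\<forall>x\<in>{-d..d}. \<psi>' x = \<psi> x \<and> a' x = a x)))"
proof -
  define h\<^sub>0 where "h\<^sub>0 = h_crit \<kappa> d 0"
  obtain \<delta> where \<delta>: "\<delta> > 0" "\<delta> \<le> 1" and un: "\<And>\<epsilon> \<psi> p a j h \<psi>' p' a' j' h'. \<epsilon> < \<delta> \<Longrightarrow> \<bar>h - h\<^sub>0\<bar> < \<delta> \<Longrightarrow> \<bar>h' - h\<^sub>0\<bar> < \<delta> \<Longrightarrow>
    rescaled_orbit (\<kappa>\<^sup>2) \<epsilon> h (2 * d) \<psi> p a j \<Longrightarrow> rescaled_orbit (\<kappa>\<^sup>2) \<epsilon> h' (2 * d) \<psi>' p' a' j' \<Longrightarrow>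
    h' = h \<and> (\<forall>t\<in>{0..2 * d}. \<psi>' t = \<psi> t \<and> a' t = a t)"
    using rescaled_orbit_unique[OF k reg, folded h\<^sub>0_def] by blast
  \<comment> \<open>The radius \<delta> is fixed by uniqueness first; existence then provides an
    amplitude range for this same radius.\<close>
  obtain \<alpha>\<^sub>0 M where a0: "\<alpha>\<^sub>0 > 0" and ex: "\<And>\<alpha>. 0 < \<alpha> \<and> \<alpha> < \<alpha>\<^sub>0 \<Longrightarrow> (\<exists>\<psi> p a j h.
      orbit (\<kappa>\<^sup>2) (\<alpha>\<^sup>2) h (2 * d) \<psi> p a j \<and> \<psi> 0 = 1 \<and> p 0 = 0 \<and> j 0 = 0 \<and> p (2 * d) = 0 \<and> j (2 * d) = 0 \<and>
      h > 0 \<and> \<bar>h - h\<^sub>0\<bar> < \<delta> \<and> (\<forall>t\<in>{0..2 * d}. \<psi> t > 0 \<and> \<bar>\<psi> t\<bar> \<le> M \<and> \<bar>p t\<bar> \<le> M \<and>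
      \<bar>a t - h\<^sub>0 * (t - d)\<bar> \<le> \<delta> \<and> \<bar>h + \<alpha>\<^sup>2 * j t - h\<^sub>0\<bar> \<le> \<delta> \<and> \<psi> (2 * d - t) = \<psi> t \<and> a (2 * d - t) = - a t))"
    using symmetric_orbits_exist[OF k, folded h\<^sub>0_def] \<delta>(1) by metis
  have main: "\<exists>\<psi> a h. rescaled_solution \<kappa> d \<alpha> \<psi> a h \<and> positive_on d \<psi> \<and> \<bar>h - h\<^sub>0\<bar> < \<delta> \<and> symmetric d \<psi> a \<and>
               (\<forall>\<psi>' a' h'. rescaled_solution \<kappa> d \<alpha> \<psi>' a' h' \<and> positive_on d \<psi>' \<and>
                  \<bar>h' - h\<^sub>0\<bar> < \<delta> \<longrightarrow> h' = h \<and> (\<forall>x\<in>{-d..d}. \<psi>' x = \<psi> x \<and> a' x = a x))"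
    if "0 < \<alpha>" "\<alpha> < min \<alpha>\<^sub>0 \<delta>" for \<alpha>
  proof -
    have al: "0 < \<alpha> \<and> \<alpha> < \<alpha>\<^sub>0" and a1: "\<alpha>\<^sup>2 < \<delta>" "0 < \<alpha>\<^sup>2" "\<alpha>\<^sup>2 \<le> 1"
    proof -
      show "0 < \<alpha> \<and> \<alpha> < \<alpha>\<^sub>0" "0 < \<alpha>\<^sup>2" using that by auto
      have "\<alpha> * \<alpha> \<le> \<alpha> * 1" using that \<delta> by (intro mult_left_mono) auto
      moreover have "\<alpha> < \<delta>" using that by simp
      ultimately show "\<alpha>\<^sup>2 < \<delta>" "\<alpha>\<^sup>2 \<le> 1" using \<delta> unfolding power2_eq_square by linarith+
    qed
    obtain \<psi> p a j h where o: "orbit (\<kappa>\<^sup>2) (\<alpha>\<^sup>2) h (2 * d) \<psi> p a j" "\<psi> 0 = 1" "p 0 = 0" "j 0 = 0" "p (2 * d) = 0" "j (2 * d) = 0"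
      "h > 0" "\<bar>h - h\<^sub>0\<bar> < \<delta>" and b: "\<And>t. t \<in> {0..2 * d} \<Longrightarrow> \<psi> t > 0 \<and> \<psi> (2 * d - t) = \<psi> t \<and> a (2 * d - t) = - a t"
      using ex[OF al] by blast
    have ro: "rescaled_orbit (\<kappa>\<^sup>2) (\<alpha>\<^sup>2) h (2 * d) \<psi> p a j"
      by (unfold_locales) (use o b k a1 in auto)
    have refl: "2 * d - (x + d) = - x + d" for x by simp
    show ?thesis
    proof (rule exI[of _ "\<lambda>x. \<psi> (x + d)"], rule exI[of _ "\<lambda>x. a (x + d)"], rule exI[of _ h], intro conjI[of "rescaled_solution _ _ _ _ _ _"]
        conjI[of "positive_on _ _"] conjI[of "_ < _"] conjI[of "symmetric _ _ _"] allI impI)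
      show "rescaled_solution \<kappa> d \<alpha> (\<lambda>x. \<psi> (x + d)) (\<lambda>x. a (x + d)) h" by (rule orbit_imp_rescaled[OF k(2) o(7,1-6)])
      show "symmetric d (\<lambda>x. \<psi> (x + d)) (\<lambda>x. a (x + d))"
        unfolding symmetric_def
      proof
        fix x assume "x \<in> {-d..d}"
        then show "\<psi> (- x + d) = \<psi> (x + d) \<and> a (- x + d) = - a (x + d)" using b[of "x + d"] unfolding refl by auto
      qed
      show "positive_on d (\<lambda>x. \<psi> (x + d))" using b by (auto simp: positive_on_def)
      show "\<bar>h - h\<^sub>0\<bar> < \<delta>" by (rule o(8))
      fix \<psi>' a' h' assume s: "rescaled_solution \<kappa> d \<alpha> \<psi>' a' h' \<and> positive_on d \<psi>' \<and> \<bar>h' - h\<^sub>0\<bar> < \<delta>"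
      note r = rescaled_imp_orbit[OF conjunct1[OF s] k(2) conjunct1[OF al]]
      have ro': "rescaled_orbit (\<kappa>\<^sup>2) (\<alpha>\<^sup>2) h' (2 * d) (\<lambda>t. \<psi>' (t - d)) (\<lambda>t. ideriv d \<psi>' (t - d)) (\<lambda>t. a' (t - d))
          (\<lambda>t. (ideriv d a' (t - d) - h') / \<alpha>\<^sup>2)"
        by (unfold_locales) (use r s k a1 in \<open>auto simp: positive_on_def rescaled_solution_def\<close>)
      have "h' = h \<and> (\<forall>t\<in>{0..2 * d}. \<psi>' (t - d) = \<psi> t \<and> a' (t - d) = a t)"
        using un[OF a1(1) o(8) _ ro ro'] s by blast
      then have eq: "h' = h" "\<And>t. t \<in> {0..2 * d} \<Longrightarrow> \<psi>' (t - d) = \<psi> t \<and> a' (t - d) = a t" by blast+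
      have "\<psi>' x = \<psi> (x + d) \<and> a' x = a (x + d)" if "x \<in> {-d..d}" for x
        using eq(2)[of "x + d"] that by auto
      with eq(1) show "h' = h \<and> (\<forall>x\<in>{-d..d}. \<psi>' x = \<psi> (x + d) \<and> a' x = a (x + d))" by blast
    qed
  qed
  show ?thesis
    by (rule exI[of _ \<delta>], rule conjI[OF \<delta>(1)], rule exI[of _ "min \<alpha>\<^sub>0 \<delta>"], rule conjI)
      (use a0 \<delta>(1) main in \<open>auto simp: h\<^sub>0_def\<close>)
qed



subsection \<open>Asymmetric solutions\<close>

text \<open>Convergence at one further point \<open>s\<^sub>0\<close> of the interval puts t in the
  interior of the domain of convergence, so the sum is continuous at t, also at an end point. At the
  right end \<open>s\<^sub>0\<close> has to be taken to the left.\<close>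

lemma analytic_pair_continuous:
  fixes K D :: "real \<Rightarrow> real"
  assumes an: "real_analytic_on (\<lambda>t. (K t, D t)) {a..b}" and ab: "a < b"
  shows "continuous_on {a..b} K" "continuous_on {a..b} D"
proof -
  have powser: "continuous (at t within {a..b}) f"
    if t: "t \<in> {a..b}" and r: "r > 0" and s: "\<And>s. s \<in> {a..b} \<Longrightarrow> \<bar>s - t\<bar> < r \<Longrightarrow> (\<lambda>n. (s - t) ^ n * c n) sums f s"
    for f :: "real \<Rightarrow> real" and c :: "nat \<Rightarrow> real" and t r
  proof -
    obtain s\<^sub>0 where s0: "s\<^sub>0 \<in> {a..b}" "s\<^sub>0 \<noteq> t" "\<bar>s\<^sub>0 - t\<bar> < r"
    proof (cases "t < b")
      case True
      show ?thesis by (rule that[of "min b (t + r / 2)"]) (use True t r in auto)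
    next
      case False
      show ?thesis by (rule that[of "max a (t - r / 2)"]) (use False t r ab in auto)
    qed
    have "summable (\<lambda>n. c n * (s\<^sub>0 - t) ^ n)" using s[OF s0(1,3)] by (auto simp: sums_iff mult.commute)
    then have "isCont (\<lambda>z. \<Sum>n. c n * z ^ n) (t - t)" by (rule isCont_powser) (use s0 in auto)
    then have "isCont (\<lambda>s. \<Sum>n. c n * (s - t) ^ n) t" by (rule continuous_within_compose3) (intro continuous_intros)
    then have "((\<lambda>s. \<Sum>n. c n * (s - t) ^ n) \<longlongrightarrow> (\<Sum>n. c n * (t - t) ^ n)) (at t within {a..b})"
      using continuous_at_imp_continuous_at_within continuous_within by blast
    moreover have eq: "(\<Sum>n. c n * (s - t) ^ n) = f s" if "s \<in> {a..b}" "\<bar>s - t\<bar> < r" for s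
      using s[OF that] by (simp add: sums_iff mult.commute)
    ultimately have lim: "((\<lambda>s. \<Sum>n. c n * (s - t) ^ n) \<longlongrightarrow> f t) (at t within {a..b})"
      using eq[OF t] r by (simp only: diff_self abs_zero)
    show ?thesis unfolding continuous_within
    proof (rule Lim_transform_eventually[OF lim])
      show "\<forall>\<^sub>F s in at t within {a..b}. (\<Sum>n. c n * (s - t) ^ n) = f s"
        unfolding eventually_at using r by (intro exI[of _ r]) (simp add: dist_real_def eq)
    qed
  qed
  have "continuous (at t within {a..b}) K \<and> continuous (at t within {a..b}) D" if t: "t \<in> {a..b}" for t
  proof -
    obtain r c where r: "r > 0" and c: "\<And>s. s \<in> {a..b} \<Longrightarrow> \<bar>s - t\<bar> < r \<Longrightarrow> (\<lambda>n. (s - t) ^ n *\<^sub>R c n) sums (K s, D s)"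
      using an t unfolding real_analytic_on_def by blast
    show ?thesis
      using powser[OF t r, of "\<lambda>n. fst (c n)" K] powser[OF t r, of "\<lambda>n. snd (c n)" D]
        bounded_linear.sums[OF bounded_linear_fst c] bounded_linear.sums[OF bounded_linear_snd c] by simp
  qed
  then show "continuous_on {a..b} K" "continuous_on {a..b} D" by (auto simp: continuous_on_eq_continuous_within)
qed

text \<open>I'(0) is a positive multiple of N and I(0) = 0, so the sign of N is also that of I(c)
  for small c > 0.\<close>

lemma I_fun_sign:
  assumes k: "\<kappa> > 0" "d > 0"
  defines "N \<equiv> wN (\<kappa>\<^sup>2 * (h_crit \<kappa> d 0)\<^sup>2) (\<kappa>\<^sup>2) d"
  shows "deriv (I_fun \<kappa> d) 0 < 0 \<longleftrightarrow> N < 0" "deriv (I_fun \<kappa> d) 0 > 0 \<longleftrightarrow> N > 0"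
    and "N < 0 \<Longrightarrow> \<exists>e>0. \<forall>c. 0 < c \<longrightarrow> c < e \<longrightarrow> I_fun \<kappa> d c < 0"
    and "N > 0 \<Longrightarrow> \<exists>e>0. \<forall>c. 0 < c \<longrightarrow> c < e \<longrightarrow> I_fun \<kappa> d c > 0"
proof -
  define h where "h = h_crit \<kappa> d 0"
  note D = I_fun_deriv[OF k, folded N_def] and h = h_crit_symmetric[OF k]
  have X: "wO' (\<kappa>\<^sup>2 * h\<^sup>2) (\<kappa>\<^sup>2) d > 0"
    using wO'_pos[OF h_crit_square(2,3)[OF k], of d] by (simp add: h_def h_crit_square(1)[OF k])
  have p: "\<kappa>\<^sup>2 * h\<^sup>2 * wO' (\<kappa>\<^sup>2 * h\<^sup>2) (\<kappa>\<^sup>2) d > 0" using X h k by (simp add: h_def)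
  note D' = D[folded h_def]
  have d: "deriv (I_fun \<kappa> d) 0 = 2 * N / (\<kappa>\<^sup>2 * h\<^sup>2 * wO' (\<kappa>\<^sup>2 * h\<^sup>2) (\<kappa>\<^sup>2) d)" by (rule DERIV_imp_deriv[OF D'])
  show "deriv (I_fun \<kappa> d) 0 < 0 \<longleftrightarrow> N < 0" "deriv (I_fun \<kappa> d) 0 > 0 \<longleftrightarrow> N > 0"
    unfolding d using p by (simp_all add: divide_less_0_iff zero_less_divide_iff)
  have "critical \<kappa> d 0 h" using critical_symmetric[OF h(1) k(1) h(2)] by (simp add: h_def)
  then have I0: "I_fun \<kappa> d 0 = 0" using I_fun_critical[of \<kappa> d 0 h] k h by (simp add: h_def)
  show "\<exists>e>0. \<forall>c. 0 < c \<longrightarrow> c < e \<longrightarrow> I_fun \<kappa> d c < 0" if "N < 0"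
    using DERIV_neg_dec_right[OF D'] that p I0 by (simp add: divide_less_0_iff)
  show "\<exists>e>0. \<forall>c. 0 < c \<longrightarrow> c < e \<longrightarrow> I_fun \<kappa> d c > 0" if "N > 0"
    using DERIV_pos_inc_right[OF D'] that p I0 by (simp add: zero_less_divide_iff)
qed

text \<open>The end value of j at \<epsilon> = 0, in the form of \<open>orbit_eps0_j\<close>,
  expressed by I(c).\<close>

lemma critical_energy:
  assumes k: "\<kappa> > 0" "d > 0" "\<bar>c\<bar> < d" and h: "critical \<kappa> d c h" and hk: "\<kappa> < h"
  defines "\<mu> \<equiv> \<kappa>\<^sup>2 * h\<^sup>2"
  shows "(\<mu> * (d + c)\<^sup>2 - \<kappa>\<^sup>2) * (wU \<mu> (\<kappa>\<^sup>2) (d - c) (d + c))\<^sup>2 - (\<mu> * (d - c)\<^sup>2 - \<kappa>\<^sup>2) = 2 * \<mu> * I_fun \<kappa> d c"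
proof -
  have m: "\<mu> = (\<kappa> * h)\<^sup>2" "0 < \<kappa>\<^sup>2" "\<kappa>\<^sup>2 \<le> \<kappa> * h" "\<mu> > 0"
    using k hk by (auto simp: \<mu>_def power_mult_distrib power2_eq_square)
  have X: "wO' \<mu> (\<kappa>\<^sup>2) y > 0" for y unfolding m(1) by (rule wO'_pos[OF m(2,3)])
  have "wU' \<mu> (\<kappa>\<^sup>2) (d - c) (d + c) = 0" using h by (simp add: critical_def \<mu>_def)
  from wU_right[OF this] have U: "wU \<mu> (\<kappa>\<^sup>2) (d - c) (d + c) = wO' \<mu> (\<kappa>\<^sup>2) (d - c) / wO' \<mu> (\<kappa>\<^sup>2) (d + c)"
    using X[of "d + c"] by (simp add: field_simps)
  have alg: "A * (p / q)\<^sup>2 - B = 2 * z * (p\<^sup>2 / (2 * z) * (A / q\<^sup>2 - B / p\<^sup>2))" if "p > 0" "q > 0" "z > 0" for A B p q z :: real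
    using that by (simp add: field_simps)
  show ?thesis
    unfolding I_fun_critical[OF k h hk, folded \<mu>_def] U wPhi_def
    by (rule alg[OF X X m(4)])
qed

text \<open>Raising \<nu> at fixed m lowers the logarithmic derivative of wE. This tells in which
  direction the Neumann zero moves in \<open>wN_sign_change\<close>.\<close>

lemma wE'_strict_antimono:
  assumes "0 < \<nu>\<^sub>1" "\<nu>\<^sub>1 < \<nu>\<^sub>2" "\<nu>\<^sub>2 \<le> m" "y > 0"
  shows "wE' (m\<^sup>2) \<nu>\<^sub>2 y * wE (m\<^sup>2) \<nu>\<^sub>1 y < wE (m\<^sup>2) \<nu>\<^sub>2 y * wE' (m\<^sup>2) \<nu>\<^sub>1 y"
proof -
  let ?f = "\<lambda>y. wE (m\<^sup>2) \<nu>\<^sub>2 y * wE' (m\<^sup>2) \<nu>\<^sub>1 y - wE' (m\<^sup>2) \<nu>\<^sub>2 y * wE (m\<^sup>2) \<nu>\<^sub>1 y"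
  have "?f 0 < ?f y"
  proof (rule increasing_at[where f = ?f and f' = "\<lambda>y. (\<nu>\<^sub>2 - \<nu>\<^sub>1) * (wE (m\<^sup>2) \<nu>\<^sub>1 y * wE (m\<^sup>2) \<nu>\<^sub>2 y)"])
    fix x
    show "(?f has_real_derivative (\<nu>\<^sub>2 - \<nu>\<^sub>1) * (wE (m\<^sup>2) \<nu>\<^sub>1 x * wE (m\<^sup>2) \<nu>\<^sub>2 x)) (at x)"
      by (auto intro!: derivative_eq_intros simp: algebra_simps)
    show "(\<nu>\<^sub>2 - \<nu>\<^sub>1) * (wE (m\<^sup>2) \<nu>\<^sub>1 x * wE (m\<^sup>2) \<nu>\<^sub>2 x) > 0"
      using wE_pos[of \<nu>\<^sub>1 m x] wE_pos[of \<nu>\<^sub>2 m x] assms by simp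
  qed (use assms in auto)
  then show ?thesis by (simp add: wEO_0)
qed

text \<open>Moving \<open>\<nu> = \<kappa>\<^sup>2\<close> with \<open>m = \<kappa> h\<close> fixed makes \<open>wN_transversal\<close> applicable.\<close>

lemma wN_sign_change:
  assumes k: "\<kappa>\<^sub>0 > 0" "d\<^sub>0 > 0" and N0: "wN (\<kappa>\<^sub>0\<^sup>2 * (h_crit \<kappa>\<^sub>0 d\<^sub>0 0)\<^sup>2) (\<kappa>\<^sub>0\<^sup>2) d\<^sub>0 = 0" and "\<rho> > 0" and s: "s = 1 \<or> s = - 1"
  shows "\<exists>\<kappa> d. \<kappa> > 0 \<and> d > 0 \<and> \<bar>\<kappa> - \<kappa>\<^sub>0\<bar> < \<rho> \<and> \<bar>d - d\<^sub>0\<bar> < \<rho> \<and>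
    s * wN (\<kappa>\<^sup>2 * (h_crit \<kappa> d 0)\<^sup>2) (\<kappa>\<^sup>2) d < 0"
proof -
  define m where "m = \<kappa>\<^sub>0 * h_crit \<kappa>\<^sub>0 d\<^sub>0 0"
  define \<nu>\<^sub>0 where "\<nu>\<^sub>0 = \<kappa>\<^sub>0\<^sup>2"
  note h = h_crit_symmetric[OF k]
  have \<nu>0: "0 < \<nu>\<^sub>0" "\<nu>\<^sub>0 < m" using k h by (auto simp: \<nu>\<^sub>0_def m_def power2_eq_square)
  have E0: "wE' (m\<^sup>2) \<nu>\<^sub>0 d\<^sub>0 = 0" and N: "wN (m\<^sup>2) \<nu>\<^sub>0 d\<^sub>0 = 0"
    using h N0 by (simp_all add: m_def \<nu>\<^sub>0_def power_mult_distrib)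
  obtain e where e: "e > 0" "\<And>\<nu> Z. 0 < \<nu> \<Longrightarrow> \<nu> \<le> m \<Longrightarrow> 0 < Z \<Longrightarrow> \<bar>Z - d\<^sub>0\<bar> < e \<Longrightarrow> wE' (m\<^sup>2) \<nu> Z = 0 \<Longrightarrow>
     (Z < d\<^sub>0 \<longrightarrow> wN (m\<^sup>2) \<nu> Z > 0) \<and> (d\<^sub>0 < Z \<longrightarrow> wN (m\<^sup>2) \<nu> Z < 0)"
    using wN_transversal[OF \<nu>0(1) less_imp_le[OF \<nu>0(2)] k(2) E0 N] by blast
  have pot: "m\<^sup>2 * d\<^sub>0\<^sup>2 > \<nu>\<^sub>0" using wE_neumann_potential_pos[OF \<nu>0(1) less_imp_le[OF \<nu>0(2)], of d\<^sub>0] E0 k by simp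
  have "continuous_on UNIV (\<lambda>y. m\<^sup>2 * y\<^sup>2 - \<nu>\<^sub>0)" by (intro continuous_intros)
  from continuous_pos_near_compact[OF this compact_sing, of d\<^sub>0] pot obtain e1 where e1: "e1 > 0"
    "\<And>y. \<bar>y - d\<^sub>0\<bar> < e1 \<Longrightarrow> m\<^sup>2 * y\<^sup>2 - \<nu>\<^sub>0 > 0" by (auto simp: dist_real_def abs_minus_commute)
  \<comment> \<open>r limits the displacement of the Neumann zero; within it the slope of wE for the
    old \<nu> is strictly increasing.\<close>
  define r where "r = min (min e \<rho>) (min e1 d\<^sub>0) / 2"
  have r: "r > 0" "r < e" "r < \<rho>" "r < e1" "r < d\<^sub>0" using e(1) e1(1) k \<open>\<rho> > 0\<close> by (auto simp: r_def)
  have inc: "wE' (m\<^sup>2) \<nu>\<^sub>0 a < wE' (m\<^sup>2) \<nu>\<^sub>0 b" if "d\<^sub>0 - r \<le> a" "a < b" "b \<le> d\<^sub>0 + r" for a b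
  proof (rule increasing_at[where f = "wE' (m\<^sup>2) \<nu>\<^sub>0" and f' = "\<lambda>y. (m\<^sup>2 * y\<^sup>2 - \<nu>\<^sub>0) * wE (m\<^sup>2) \<nu>\<^sub>0 y"])
    fix x assume "x \<in> {a<..<b}"
    then have "\<bar>x - d\<^sub>0\<bar> < e1" using that r by auto
    then show "(m\<^sup>2 * x\<^sup>2 - \<nu>\<^sub>0) * wE (m\<^sup>2) \<nu>\<^sub>0 x > 0" using e1(2) wE_pos[OF \<nu>0(1) less_imp_le[OF \<nu>0(2)]] by simp
  qed (use that in \<open>auto intro: wEO_derivs\<close>)
  have sr: "s * wE' (m\<^sup>2) \<nu>\<^sub>0 (d\<^sub>0 + s * r) > 0"
    using s inc[of d\<^sub>0 "d\<^sub>0 + r"] inc[of "d\<^sub>0 - r" d\<^sub>0] r E0 by auto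
  let ?F = "\<lambda>\<kappa>. s * wE' (m\<^sup>2) (\<kappa>\<^sup>2) (d\<^sub>0 + s * r)"
  have "continuous_on UNIV ?F" by (intro continuous_intros)
  from continuous_pos_near_compact[OF this compact_sing, of \<kappa>\<^sub>0] sr obtain e2 where e2: "e2 > 0"
    "\<And>\<kappa>. \<bar>\<kappa> - \<kappa>\<^sub>0\<bar> < e2 \<Longrightarrow> ?F \<kappa> > 0" by (auto simp: dist_real_def abs_minus_commute \<nu>\<^sub>0_def)
  have "continuous_on UNIV (\<lambda>\<kappa>. m - \<kappa>\<^sup>2)" by (intro continuous_intros)
  from continuous_pos_near_compact[OF this compact_sing, of \<kappa>\<^sub>0] \<nu>0 obtain e3 where e3: "e3 > 0"
    "\<And>\<kappa>. \<bar>\<kappa> - \<kappa>\<^sub>0\<bar> < e3 \<Longrightarrow> m - \<kappa>\<^sup>2 > 0" by (auto simp: dist_real_def abs_minus_commute \<nu>\<^sub>0_def)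
  \<comment> \<open>Chosen after r: changing \<kappa> by u must not alter the sign of the slope at
    \<open>d\<^sub>0 + s * r\<close>.\<close>
  define u where "u = min (min e2 e3) (min \<rho> \<kappa>\<^sub>0) / 2"
  have u: "u > 0" "u < e2" "u < e3" "u < \<rho>" "u < \<kappa>\<^sub>0" using e2(1) e3(1) k \<open>\<rho> > 0\<close> by (auto simp: u_def)
  define \<kappa> where "\<kappa> = \<kappa>\<^sub>0 + s * u"
  have \<kappa>: "\<kappa> > 0" "\<bar>\<kappa> - \<kappa>\<^sub>0\<bar> < e2" "\<bar>\<kappa> - \<kappa>\<^sub>0\<bar> < e3" "\<bar>\<kappa> - \<kappa>\<^sub>0\<bar> < \<rho>" using s u by (auto simp: \<kappa>_def)
  have \<nu>m: "0 < \<kappa>\<^sup>2" "\<kappa>\<^sup>2 < m" using \<kappa> e3(2)[OF \<kappa>(3)] by auto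
  \<comment> \<open>At \<open>d\<^sub>0\<close> the old slope is 0, so the change of \<nu> alone
    decides the sign. The new Neumann zero therefore lies off \<open>d\<^sub>0\<close>, in the
    direction s.\<close>
  have left: "s * wE' (m\<^sup>2) (\<kappa>\<^sup>2) d\<^sub>0 < 0"
  proof -
    have p: "wE (m\<^sup>2) \<nu>\<^sub>0 d\<^sub>0 > 0" by (rule wE_pos[OF \<nu>0(1) less_imp_le[OF \<nu>0(2)]])
    show ?thesis using s
    proof
      assume s1: "s = 1"
      then have "\<nu>\<^sub>0 < \<kappa>\<^sup>2" using k u unfolding \<nu>\<^sub>0_def \<kappa>_def by (intro power_strict_mono) auto
      from wE'_strict_antimono[OF \<nu>0(1) this less_imp_le[OF \<nu>m(2)] k(2)] show ?thesis
        using p E0 s1 by (simp add: mult_less_0_iff)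
    next
      assume s1: "s = - 1"
      then have "\<kappa>\<^sup>2 < \<nu>\<^sub>0" using k u \<kappa>(1) unfolding \<nu>\<^sub>0_def \<kappa>_def by (intro power_strict_mono) auto
      from wE'_strict_antimono[OF \<nu>m(1) this less_imp_le[OF \<nu>0(2)] k(2)] show ?thesis
        using p E0 s1 by (simp add: zero_less_mult_iff)
    qed
  qed
  have right: "s * wE' (m\<^sup>2) (\<kappa>\<^sup>2) (d\<^sub>0 + s * r) > 0" by (rule e2(2)[OF \<kappa>(2)])
  have cont: "continuous_on {0..r} (\<lambda>z. s * wE' (m\<^sup>2) (\<kappa>\<^sup>2) (d\<^sub>0 + s * z))" by (intro continuous_intros)
  obtain z where z: "0 \<le> z" "z \<le> r" "s * wE' (m\<^sup>2) (\<kappa>\<^sup>2) (d\<^sub>0 + s * z) = 0"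
    using IVT'[OF _ _ _ cont, of 0] left right r by auto
  define Z where "Z = d\<^sub>0 + s * z"
  have EZ: "wE' (m\<^sup>2) (\<kappa>\<^sup>2) Z = 0" using z(3) s by (auto simp: Z_def)
  have "z \<noteq> 0" using left z(3) by auto
  with z(1) have "z > 0" by simp
  then have Z: "Z > 0" "\<bar>Z - d\<^sub>0\<bar> < e" "\<bar>Z - d\<^sub>0\<bar> < \<rho>" "s = 1 \<Longrightarrow> d\<^sub>0 < Z" "s = - 1 \<Longrightarrow> Z < d\<^sub>0"
    using s z r by (auto simp: Z_def)
  have hc: "h_crit \<kappa> Z 0 = m / \<kappa>"
    by (rule h_crit_eqI) (use \<kappa> Z \<nu>m EZ in \<open>auto simp: field_simps power2_eq_square\<close>)
  have "\<kappa>\<^sup>2 * (h_crit \<kappa> Z 0)\<^sup>2 = m\<^sup>2" using \<kappa> by (simp add: hc power_divide)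
  then have "s * wN (\<kappa>\<^sup>2 * (h_crit \<kappa> Z 0)\<^sup>2) (\<kappa>\<^sup>2) Z < 0"
    using e(2)[OF \<nu>m(1) less_imp_le[OF \<nu>m(2)] Z(1,2) EZ] Z(4,5) s by auto
  then show ?thesis using \<kappa> Z by blast
qed

lemma neumann_zero_on_path:
  fixes K D :: "real \<Rightarrow> real"
  assumes c: "continuous_on {a..b} K" "continuous_on {a..b} D" and pos: "\<And>t. t \<in> {a..b} \<Longrightarrow> K t > 0 \<and> D t > 0" and ab: "a < b"
  defines "N \<equiv> \<lambda>t. wN ((K t)\<^sup>2 * (h_crit (K t) (D t) 0)\<^sup>2) ((K t)\<^sup>2) (D t)"
  assumes sign: "N a < 0" "0 < N b"
  shows "\<exists>t\<in>{a<..<b}. N t = 0"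
proof -
  \<comment> \<open>\<open>critical_near\<close> with c = 0 at each point of the path is continuity
    of \<open>h_crit\<close> there.\<close>
  have ch: "continuous_on {a..b} (\<lambda>t. h_crit (K t) (D t) 0)"
    unfolding continuous_on_eq_continuous_within continuous_within_eps_delta
  proof (intro ballI allI impI)
    fix t e :: real assume t: "t \<in> {a..b}" and "e > 0"
    note p = pos[OF t, THEN conjunct1] pos[OF t, THEN conjunct2]
    obtain \<delta> where \<delta>: "\<delta> > 0" "\<And>\<kappa> d. \<bar>\<kappa> - K t\<bar> < \<delta> \<Longrightarrow> \<bar>d - D t\<bar> < \<delta> \<Longrightarrow> \<bar>h_crit \<kappa> d 0 - h_crit (K t) (D t) 0\<bar> < e"
      using critical_near[OF p h_crit_symmetric[OF p] \<open>e > 0\<close>] by (metis abs_zero)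
    obtain r1 where r1: "r1 > 0" "\<And>s. s \<in> {a..b} \<Longrightarrow> dist s t < r1 \<Longrightarrow> dist (K s) (K t) < \<delta>"
      using c(1) t \<delta>(1) unfolding continuous_on_iff by blast
    obtain r2 where r2: "r2 > 0" "\<And>s. s \<in> {a..b} \<Longrightarrow> dist s t < r2 \<Longrightarrow> dist (D s) (D t) < \<delta>"
      using c(2) t \<delta>(1) unfolding continuous_on_iff by blast
    show "\<exists>r>0. \<forall>s\<in>{a..b}. dist s t < r \<longrightarrow> dist (h_crit (K s) (D s) 0) (h_crit (K t) (D t) 0) < e"
      using r1 r2 \<delta>(2) by (intro exI[of _ "min r1 r2"]) (auto simp: dist_real_def)
  qed
  have "continuous_on {a..b} N" unfolding N_def by (intro continuous_intros c ch)
  then obtain t where t: "a \<le> t" "t \<le> b" "N t = 0" using IVT'[of N a 0 b] sign ab by auto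
  moreover have "t \<noteq> a" "t \<noteq> b" using t sign by auto
  ultimately show ?thesis by (intro bexI[of _ t]) auto
qed

lemma compact_pos_lower_bound:
  fixes F :: "'a::topological_space \<Rightarrow> real"
  assumes "compact K" "continuous_on K F" "\<And>x. x \<in> K \<Longrightarrow> F x > 0"
  shows "\<exists>b>0. \<forall>x\<in>K. b \<le> F x"
proof (cases "K = {}")
  case False
  then obtain x where "x \<in> K" "\<forall>y\<in>K. F x \<le> F y" using continuous_attains_inf[OF assms(1) _ assms(2)] by blast
  with assms(3) show ?thesis by blast
qed (auto intro: exI[of _ 1])

text \<open>By compactness the maximum of |F| and -G has a positive lower bound b. Where |F| >= b a
  large multiple of |F| outweighs G; elsewhere G <= -b already.\<close>

lemma penalty:
  fixes F G :: "'a::topological_space \<Rightarrow> real"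
  assumes K: "compact K" "continuous_on K F" "continuous_on K G" and neg: "\<And>x. x \<in> K \<Longrightarrow> F x = 0 \<Longrightarrow> G x < 0"
  shows "\<exists>\<Lambda>\<^sub>0 b. \<Lambda>\<^sub>0 \<ge> 0 \<and> b > 0 \<and> (\<forall>\<Lambda>\<ge>\<Lambda>\<^sub>0. \<forall>x\<in>K. G x - \<Lambda> * \<bar>F x\<bar> \<le> - b)"
proof -
  have "continuous_on K (\<lambda>x. max \<bar>F x\<bar> (- G x))" by (intro continuous_intros K)
  then obtain b where b: "b > 0" "\<And>x. x \<in> K \<Longrightarrow> b \<le> max \<bar>F x\<bar> (- G x)"
    using compact_pos_lower_bound[OF K(1), of "\<lambda>x. max \<bar>F x\<bar> (- G x)"] neg by (fastforce simp: less_max_iff_disj)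
  have "bounded (G ` K)" by (intro compact_imp_bounded compact_continuous_image K)
  then obtain B where B: "B > 0" "\<And>x. x \<in> K \<Longrightarrow> \<bar>G x\<bar> \<le> B" by (auto simp: bounded_pos)
  show ?thesis
  proof (rule exI[of _ "(B + b) / b"], rule exI[of _ b], intro conjI allI impI ballI)
    fix \<Lambda> x assume \<Lambda>: "\<Lambda> \<ge> (B + b) / b" and x: "x \<in> K"
    then have Lb: "B + b \<le> \<Lambda> * b" "\<Lambda> \<ge> 0" using b(1) B(1) by (auto simp: field_simps intro: order_trans[of 0 "(B + b) / b"])
    show "G x - \<Lambda> * \<bar>F x\<bar> \<le> - b"
    proof (cases "b \<le> \<bar>F x\<bar>")
      case True
      then have "\<Lambda> * b \<le> \<Lambda> * \<bar>F x\<bar>" using Lb by (intro mult_left_mono)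
      then show ?thesis using Lb(1) B(2)[OF x] by linarith
    next
      case False
      then have "G x \<le> - b" using b(2)[OF x] by (auto simp: le_max_iff_disj)
      moreover have "0 \<le> \<Lambda> * \<bar>F x\<bar>" using Lb by simp
      ultimately show ?thesis by linarith
    qed
  qed (use b B in auto)
qed



text \<open>
  The two end conditions are solved for \<open>h\<close> and the position on a segment that joins a point with
  \<open>wN < 0\<close> to one with \<open>wN > 0\<close>; the centre of the linear state is shifted by a small fixed \<open>c\<close>, so that
  the solutions are not symmetric. At the ends of the segment the sign of the second condition is
  known only where the first one holds, hence the penalty term.
\<close>

theorem asymmetric_near:
  assumes k: "\<kappa>\<^sub>0 > 0" "d\<^sub>0 > 0" and N0: "wN (\<kappa>\<^sub>0\<^sup>2 * (h_crit \<kappa>\<^sub>0 d\<^sub>0 0)\<^sup>2) (\<kappa>\<^sub>0\<^sup>2) d\<^sub>0 = 0" and \<eta>: "\<eta> > 0"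
  defines "h\<^sub>0 \<equiv> h_crit \<kappa>\<^sub>0 d\<^sub>0 0"
  shows "\<exists>\<kappa> d h \<phi> a. \<kappa> > 0 \<and> d > 0 \<and> h > 0 \<and> \<bar>\<kappa> - \<kappa>\<^sub>0\<bar> < \<eta> \<and> \<bar>d - d\<^sub>0\<bar> < \<eta> \<and> \<bar>h - h\<^sub>0\<bar> < \<eta> \<and>
     solution \<kappa> d \<phi> a h \<and> \<not> symmetric d \<phi> a \<and> positive_on d \<phi> \<and>
     (SUP x\<in>{-d..d}. \<bar>\<phi> x\<bar> + \<bar>ideriv d \<phi> x\<bar> + \<bar>a x - h\<^sub>0 * x\<bar> + \<bar>ideriv d a x - h\<^sub>0\<bar>) < \<eta>"
proof -
  note hc = h_crit_symmetric[OF k, folded h\<^sub>0_def]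
  have h0: "h\<^sub>0 > 0" using hc k by simp
  let ?T = "2 * d\<^sub>0 + 1"
  obtain M C \<delta> where M: "M > 0" and C: "C \<ge> 0" and \<delta>: "\<delta> > 0" "\<delta> \<le> 1" "\<delta> < h\<^sub>0"
    and nb: "\<And>A h \<epsilon> \<nu>. \<bar>A + h\<^sub>0 * d\<^sub>0\<bar> < \<delta> \<Longrightarrow> \<bar>h - h\<^sub>0\<bar> < \<delta> \<Longrightarrow> \<bar>\<epsilon>\<bar> < \<delta> \<Longrightarrow> \<bar>\<nu> - \<kappa>\<^sub>0\<^sup>2\<bar> < \<delta> \<Longrightarrow>
      orbit \<nu> \<epsilon> h ?T (f\<psi> M (start A h \<epsilon> \<nu>)) (fp M (start A h \<epsilon> \<nu>)) (fa M (start A h \<epsilon> \<nu>)) (fj M (start A h \<epsilon> \<nu>)) \<and>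
      (\<forall>t\<in>{0..?T}. f\<psi> M (start A h \<epsilon> \<nu>) t > 0 \<and>
        \<bar>f\<psi> M (start A h \<epsilon> \<nu>) t\<bar> \<le> M \<and> \<bar>fp M (start A h \<epsilon> \<nu>) t\<bar> \<le> M \<and>
        \<bar>fa M (start A h \<epsilon> \<nu>) t\<bar> \<le> M \<and> \<bar>fj M (start A h \<epsilon> \<nu>) t\<bar> \<le> M \<and>
        \<bar>fa M (start A h \<epsilon> \<nu>) t - h\<^sub>0 * (t - d\<^sub>0)\<bar> \<le> C * (\<bar>A + h\<^sub>0 * d\<^sub>0\<bar> + \<bar>h - h\<^sub>0\<bar> + \<bar>\<epsilon>\<bar> + \<bar>\<nu> - \<kappa>\<^sub>0\<^sup>2\<bar>))"
    using near_base[OF k hc] by metis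
  obtain \<delta>' where \<delta>': "\<delta>' > 0" and pos: "\<And>\<kappa> d c h. \<bar>\<kappa> - \<kappa>\<^sub>0\<bar> < \<delta>' \<Longrightarrow> \<bar>d - d\<^sub>0\<bar> < \<delta>' \<Longrightarrow> \<bar>c\<bar> < \<delta>' \<Longrightarrow> \<bar>h - h\<^sub>0\<bar> < \<delta>' \<Longrightarrow>
     \<kappa> > 0 \<and> \<bar>c\<bar> < d \<and> \<kappa> < h \<and> (\<forall>y\<in>{-(d - c)..d + c}. wU (\<kappa>\<^sup>2 * h\<^sup>2) (\<kappa>\<^sup>2) (d - c) y > 0)"
    using wU_pos_near[OF k hc] by blast
  \<comment> \<open>W collects the factors with which a deviation \<sigma> of h, d, c, \<kappa> and
    \<epsilon> enters the shooting data, Z those with which it enters the final norm. The choice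
    \<sigma> Z = m / 2 then keeps that norm within \<eta> / 2.\<close>
  define W where "W = d\<^sub>0 + 2 * h\<^sub>0 + 2 * \<kappa>\<^sub>0 + 4"
  define Z where "Z = (C + 1) * W + h\<^sub>0 + 3 * M + 2"
  have W: "W \<ge> 4" using k h0 by (simp add: W_def)
  have Z: "Z \<ge> 1" "W \<le> Z" using C W h0 M by (simp_all add: Z_def algebra_simps)
  define m where "m = min (min \<eta> \<delta>) (min (min \<delta>' 1) (min d\<^sub>0 h\<^sub>0))"
  have m: "m > 0" "m \<le> \<eta>" "m \<le> \<delta>" "m \<le> \<delta>'" "m \<le> 1" "m \<le> d\<^sub>0" "m \<le> h\<^sub>0"
  proof -
    show "m > 0" using \<eta> \<delta>(1) \<delta>' k h0 by (simp add: m_def)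
    show "m \<le> \<eta>" "m \<le> \<delta>" "m \<le> \<delta>'" "m \<le> 1" "m \<le> d\<^sub>0" "m \<le> h\<^sub>0" unfolding m_def by linarith+
  qed
  define \<sigma> where "\<sigma> = m / (2 * Z)"
  have \<sigma>: "\<sigma> > 0" "\<sigma> * Z = m / 2" using m(1) Z(1) by (simp_all add: \<sigma>_def)
  have \<sigma>Z: "\<sigma> \<le> \<sigma> * Z" "\<sigma> * W \<le> \<sigma> * Z" using mult_left_mono[OF Z(1), of \<sigma>] mult_left_mono[OF Z(2), of \<sigma>] \<sigma>(1) by simp_all
  have \<sigma>m: "\<sigma> \<le> m / 2" "\<sigma> * W \<le> m / 2" using \<sigma>Z \<sigma>(2) by simp_all
  obtain e1 where e1: "e1 > 0" and crit: "\<And>\<kappa> d c. \<bar>\<kappa> - \<kappa>\<^sub>0\<bar> < e1 \<Longrightarrow> \<bar>d - d\<^sub>0\<bar> < e1 \<Longrightarrow> \<bar>c\<bar> < e1 \<Longrightarrow>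
     \<kappa> > 0 \<and> \<bar>c\<bar> < d \<and> critical \<kappa> d c (h_crit \<kappa> d c) \<and> \<bar>h_crit \<kappa> d c - h\<^sub>0\<bar> < \<sigma> \<and> \<kappa> < h_crit \<kappa> d c"
    using critical_near[OF k hc \<sigma>(1)] by blast
  define \<rho> where "\<rho> = min \<sigma> e1"
  have \<rho>: "\<rho> > 0" "\<rho> \<le> \<sigma>" "\<rho> \<le> e1" using \<sigma>(1) e1 by (auto simp: \<rho>_def)
  obtain \<kappa>\<^sub>1 d\<^sub>1 where p1: "\<kappa>\<^sub>1 > 0" "d\<^sub>1 > 0" "\<bar>\<kappa>\<^sub>1 - \<kappa>\<^sub>0\<bar> < \<rho>" "\<bar>d\<^sub>1 - d\<^sub>0\<bar> < \<rho>" "wN (\<kappa>\<^sub>1\<^sup>2 * (h_crit \<kappa>\<^sub>1 d\<^sub>1 0)\<^sup>2) (\<kappa>\<^sub>1\<^sup>2) d\<^sub>1 < 0"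
    using wN_sign_change[OF k N0 \<rho>(1), of 1] by auto
  obtain \<kappa>\<^sub>2 d\<^sub>2 where p2: "\<kappa>\<^sub>2 > 0" "d\<^sub>2 > 0" "\<bar>\<kappa>\<^sub>2 - \<kappa>\<^sub>0\<bar> < \<rho>" "\<bar>d\<^sub>2 - d\<^sub>0\<bar> < \<rho>" "wN (\<kappa>\<^sub>2\<^sup>2 * (h_crit \<kappa>\<^sub>2 d\<^sub>2 0)\<^sup>2) (\<kappa>\<^sub>2\<^sup>2) d\<^sub>2 > 0"
    using wN_sign_change[OF k N0 \<rho>(1), of "- 1"] by auto
  obtain e2 where e2: "e2 > 0" "\<And>c. 0 < c \<Longrightarrow> c < e2 \<Longrightarrow> I_fun \<kappa>\<^sub>1 d\<^sub>1 c < 0" using I_fun_sign(3)[OF p1(1,2,5)] by blast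
  obtain e3 where e3: "e3 > 0" "\<And>c. 0 < c \<Longrightarrow> c < e3 \<Longrightarrow> I_fun \<kappa>\<^sub>2 d\<^sub>2 c > 0" using I_fun_sign(4)[OF p2(1,2,5)] by blast
  \<comment> \<open>Fixed before \<epsilon>, and small enough for I(c) to have its definite sign at
    both ends of the segment.\<close>
  define c where "c = min (min e2 e3) \<rho> / 2"
  have c: "c > 0" "c < e2" "c < e3" "c < \<rho>" using e2(1) e3(1) \<rho>(1) by (auto simp: c_def)
  define K where "K \<tau> = (1 - \<tau>) * \<kappa>\<^sub>1 + \<tau> * \<kappa>\<^sub>2" for \<tau>
  define D where "D \<tau> = (1 - \<tau>) * d\<^sub>1 + \<tau> * d\<^sub>2" for \<tau>
  have path: "\<bar>K \<tau> - \<kappa>\<^sub>0\<bar> < \<rho>" "\<bar>D \<tau> - d\<^sub>0\<bar> < \<rho>" if "\<tau> \<in> {0..1}" for \<tau>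
  proof -
    have conv: "\<bar>((1 - \<tau>) * x + \<tau> * y) - z\<bar> < \<rho>" if "\<bar>x - z\<bar> < \<rho>" "\<bar>y - z\<bar> < \<rho>" for x y z :: real
    proof -
      have 1: "(1 - \<tau>) * x + \<tau> * y < z + \<rho>" using that \<open>\<tau> \<in> {0..1}\<close> by (intro convex_bound_lt) auto
      have "(1 - \<tau>) * (- x) + \<tau> * (- y) < \<rho> - z" using that \<open>\<tau> \<in> {0..1}\<close> by (intro convex_bound_lt) auto
      then have "- ((1 - \<tau>) * x + \<tau> * y) < \<rho> - z" by simp
      with 1 show ?thesis by linarith
    qed
    show "\<bar>K \<tau> - \<kappa>\<^sub>0\<bar> < \<rho>" "\<bar>D \<tau> - d\<^sub>0\<bar> < \<rho>" unfolding K_def D_def using p1 p2 by (auto intro: conv)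
  qed
  have ends: "K 0 = \<kappa>\<^sub>1" "D 0 = d\<^sub>1" "K 1 = \<kappa>\<^sub>2" "D 1 = d\<^sub>2" by (simp_all add: K_def D_def)
  have KD: "continuous_on S K" "continuous_on S D" for S unfolding K_def D_def by (intro continuous_intros)+
  have KDb: "K \<tau> > 0" "c < D \<tau>" "D \<tau> \<le> d\<^sub>0 + 1 / 2" "K \<tau> \<le> \<kappa>\<^sub>0 + 1" "2 * D \<tau> \<in> {0..?T}" if "\<tau> \<in> {0..1}" for \<tau>
  proof -
    show K: "K \<tau> > 0" "c < D \<tau>" using crit[of "K \<tau>" "D \<tau>" c] path[OF that] \<rho> c by auto
    show D: "D \<tau> \<le> d\<^sub>0 + 1 / 2" "K \<tau> \<le> \<kappa>\<^sub>0 + 1" using path[OF that] \<rho>(2) \<sigma>m(1) m(5) by linarith+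
    show "2 * D \<tau> \<in> {0..?T}" using K D c(1) by simp
  qed
  have posU: "K \<tau> < h \<and> (\<forall>y\<in>{-(D \<tau> - c)..D \<tau> + c}. wU ((K \<tau>)\<^sup>2 * h\<^sup>2) ((K \<tau>)\<^sup>2) (D \<tau> - c) y > 0)"
    if "\<tau> \<in> {0..1}" "\<bar>h - h\<^sub>0\<bar> \<le> \<sigma>" for \<tau> h
  proof -
    have "\<sigma> < \<delta>'" using \<sigma>m(1) m(1,4) by linarith
    then show ?thesis using pos[of "K \<tau>" "D \<tau>" c h] path[OF that(1)] that(2) c(1,4) \<rho>(2) by auto
  qed
  let ?x = "\<lambda>h \<tau> \<epsilon>. start (- h * (D \<tau> - c)) h \<epsilon> ((K \<tau>)\<^sup>2)"
  have close: "\<bar>- h * (D \<tau> - c) + h\<^sub>0 * d\<^sub>0\<bar> + \<bar>h - h\<^sub>0\<bar> + \<bar>\<epsilon>\<bar> + \<bar>(K \<tau>)\<^sup>2 - \<kappa>\<^sub>0\<^sup>2\<bar> \<le> \<sigma> * W"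
    if t: "\<tau> \<in> {0..1}" and h: "\<bar>h - h\<^sub>0\<bar> \<le> \<sigma>" and e: "0 \<le> \<epsilon>" "\<epsilon> \<le> \<sigma>" for \<tau> h \<epsilon>
  proof -
    have 1: "\<bar>(h - h\<^sub>0) * (D \<tau> - c)\<bar> \<le> \<sigma> * (d\<^sub>0 + 1)"
      unfolding abs_mult using h KDb[OF t] c(1) \<sigma>(1) by (intro mult_mono) auto
    have 2: "\<bar>h\<^sub>0 * (D \<tau> - d\<^sub>0)\<bar> \<le> h\<^sub>0 * \<sigma>" "\<bar>h\<^sub>0 * c\<bar> \<le> h\<^sub>0 * \<sigma>"
      unfolding abs_mult using path[OF t] \<rho>(2) c(1,4) h0 by (intro mult_mono; simp)+
    have "(K \<tau>)\<^sup>2 - \<kappa>\<^sub>0\<^sup>2 = (K \<tau> - \<kappa>\<^sub>0) * (K \<tau> + \<kappa>\<^sub>0)" by (simp add: power2_eq_square algebra_simps)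
    then have 3: "\<bar>(K \<tau>)\<^sup>2 - \<kappa>\<^sub>0\<^sup>2\<bar> \<le> \<sigma> * (2 * \<kappa>\<^sub>0 + 1)"
      using path[OF t] KDb[OF t] \<rho>(2) k \<sigma>(1) by (simp only: abs_mult) (intro mult_mono, auto)
    have "- h * (D \<tau> - c) + h\<^sub>0 * d\<^sub>0 = - ((h - h\<^sub>0) * (D \<tau> - c)) - h\<^sub>0 * (D \<tau> - d\<^sub>0) + h\<^sub>0 * c" by (simp add: algebra_simps)
    then have "\<bar>- h * (D \<tau> - c) + h\<^sub>0 * d\<^sub>0\<bar> \<le> \<sigma> * (d\<^sub>0 + 1) + h\<^sub>0 * \<sigma> + h\<^sub>0 * \<sigma>" using 1 2 by linarith
    then have "\<bar>- h * (D \<tau> - c) + h\<^sub>0 * d\<^sub>0\<bar> + \<bar>h - h\<^sub>0\<bar> + \<bar>\<epsilon>\<bar> + \<bar>(K \<tau>)\<^sup>2 - \<kappa>\<^sub>0\<^sup>2\<bar> \<le>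
        (\<sigma> * (d\<^sub>0 + 1) + h\<^sub>0 * \<sigma> + h\<^sub>0 * \<sigma>) + \<sigma> + \<sigma> + \<sigma> * (2 * \<kappa>\<^sub>0 + 1)"
      using h e 3 by linarith
    also have "\<dots> = \<sigma> * W" by (simp add: W_def algebra_simps)
    finally show ?thesis .
  qed
  have nbx: "orbit ((K \<tau>)\<^sup>2) \<epsilon> h ?T (f\<psi> M (?x h \<tau> \<epsilon>)) (fp M (?x h \<tau> \<epsilon>)) (fa M (?x h \<tau> \<epsilon>)) (fj M (?x h \<tau> \<epsilon>))"
    "\<And>t. t \<in> {0..?T} \<Longrightarrow> f\<psi> M (?x h \<tau> \<epsilon>) t > 0 \<and> \<bar>f\<psi> M (?x h \<tau> \<epsilon>) t\<bar> \<le> M \<and> \<bar>fp M (?x h \<tau> \<epsilon>) t\<bar> \<le> M \<and>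
      \<bar>fj M (?x h \<tau> \<epsilon>) t\<bar> \<le> M \<and> \<bar>fa M (?x h \<tau> \<epsilon>) t - h\<^sub>0 * (t - d\<^sub>0)\<bar> \<le> C * (\<sigma> * W)"
    if t: "\<tau> \<in> {0..1}" and h: "\<bar>h - h\<^sub>0\<bar> \<le> \<sigma>" and e: "0 \<le> \<epsilon>" "\<epsilon> \<le> \<sigma>" for \<tau> h \<epsilon>
  proof -
    note cl = close[OF that]
    have s: "\<sigma> * W < \<delta>" using \<sigma>m(2) m(1,3) by linarith
    have b: "\<bar>- h * (D \<tau> - c) + h\<^sub>0 * d\<^sub>0\<bar> < \<delta>" "\<bar>h - h\<^sub>0\<bar> < \<delta>" "\<bar>\<epsilon>\<bar> < \<delta>" "\<bar>(K \<tau>)\<^sup>2 - \<kappa>\<^sub>0\<^sup>2\<bar> < \<delta>" using cl s by linarith+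
    note n = nb[OF b]
    show "orbit ((K \<tau>)\<^sup>2) \<epsilon> h ?T (f\<psi> M (?x h \<tau> \<epsilon>)) (fp M (?x h \<tau> \<epsilon>)) (fa M (?x h \<tau> \<epsilon>)) (fj M (?x h \<tau> \<epsilon>))" using n by (rule conjunct1)
    fix t assume "t \<in> {0..?T}"
    then show "f\<psi> M (?x h \<tau> \<epsilon>) t > 0 \<and> \<bar>f\<psi> M (?x h \<tau> \<epsilon>) t\<bar> \<le> M \<and> \<bar>fp M (?x h \<tau> \<epsilon>) t\<bar> \<le> M \<and>
      \<bar>fj M (?x h \<tau> \<epsilon>) t\<bar> \<le> M \<and> \<bar>fa M (?x h \<tau> \<epsilon>) t - h\<^sub>0 * (t - d\<^sub>0)\<bar> \<le> C * (\<sigma> * W)"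
      using n mult_left_mono[OF cl C] by (meson order_trans)
  qed
  define f where "f \<epsilon> h \<tau> = fp M (?x h \<tau> \<epsilon>) (2 * D \<tau>)" for \<epsilon> h \<tau>
  define g where "g \<epsilon> h \<tau> = fj M (?x h \<tau> \<epsilon>) (2 * D \<tau>)" for \<epsilon> h \<tau>
  have hpos: "h > 0" if "\<bar>h - h\<^sub>0\<bar> \<le> \<sigma>" for h using that \<sigma>m(1) m(1,7) by linarith
  let ?U = "\<lambda>h \<tau>. wU ((K \<tau>)\<^sup>2 * h\<^sup>2) ((K \<tau>)\<^sup>2) (D \<tau> - c) (D \<tau> + c)"
  let ?U' = "\<lambda>h \<tau>. wU' ((K \<tau>)\<^sup>2 * h\<^sup>2) ((K \<tau>)\<^sup>2) (D \<tau> - c) (D \<tau> + c)"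
  have f0: "f 0 h \<tau> = ?U' h \<tau>"
    and g0: "2 * (K \<tau>)\<^sup>2 * h * g 0 h \<tau> = ((K \<tau>)\<^sup>2 * ((h * (D \<tau> + c))\<^sup>2 - 1) * (?U h \<tau>)\<^sup>2 - (?U' h \<tau>)\<^sup>2) - (K \<tau>)\<^sup>2 * ((h * (D \<tau> - c))\<^sup>2 - 1)"
    if t: "\<tau> \<in> {0..1}" and h: "\<bar>h - h\<^sub>0\<bar> \<le> \<sigma>" for h \<tau>
  proof -
    note orb = nbx(1)[OF t h order_refl less_imp_le[OF \<sigma>(1)]]
    have "h \<noteq> 0" using hpos[OF h] by simp
    note eps = orbit_eps0[OF orb this flow_start(1) flow_start(2) flow_start(3) KDb(5)[OF t]]
    have e: "2 * D \<tau> - (D \<tau> - c) = D \<tau> + c" by simp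
    show "f 0 h \<tau> = ?U' h \<tau>" using eps(3) unfolding f_def e .
    show "2 * (K \<tau>)\<^sup>2 * h * g 0 h \<tau> = ((K \<tau>)\<^sup>2 * ((h * (D \<tau> + c))\<^sup>2 - 1) * (?U h \<tau>)\<^sup>2 - (?U' h \<tau>)\<^sup>2) - (K \<tau>)\<^sup>2 * ((h * (D \<tau> - c))\<^sup>2 - 1)"
      unfolding g_def orbit_eps0_j[OF orb KDb(5)[OF t] flow_start(4)] eps e flow_start by simp
  qed
  \<comment> \<open>The critical h for (\<kappa>, d, c) lies strictly within \<sigma> of
    \<open>h\<^sub>0\<close>, and the end slope changes sign there by monotonicity in h.\<close>
  have sides: "?U' (h\<^sub>0 - \<sigma>) \<tau> < 0" "?U' (h\<^sub>0 + \<sigma>) \<tau> > 0" if t: "\<tau> \<in> {0..1}" for \<tau>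
  proof -
    let ?h = "h_crit (K \<tau>) (D \<tau>) c"
    have cr: "critical (K \<tau>) (D \<tau>) c ?h" "\<bar>?h - h\<^sub>0\<bar> < \<sigma>" using crit[of "K \<tau>" "D \<tau>" c] path[OF t] \<rho>(3) c(1,4) by auto
    have U0: "?U' ?h \<tau> = 0" using cr(1) by (simp add: critical_def)
    have b: "\<bar>(h\<^sub>0 - \<sigma>) - h\<^sub>0\<bar> \<le> \<sigma>" "\<bar>(h\<^sub>0 + \<sigma>) - h\<^sub>0\<bar> \<le> \<sigma>" "\<bar>?h - h\<^sub>0\<bar> \<le> \<sigma>" using \<sigma>(1) cr(2) by auto
    have sq: "(K \<tau>)\<^sup>2 * u\<^sup>2 < (K \<tau>)\<^sup>2 * v\<^sup>2" if "0 < u" "u < v" for u v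
      using that KDb(1)[OF t] by (intro mult_strict_left_mono power_strict_mono) auto
    have dc: "0 < (D \<tau> - c) + (D \<tau> + c)" "D \<tau> + c > 0" using KDb(2)[OF t] c(1) by auto
    have Up: "?U h \<tau> > 0" if "\<bar>h - h\<^sub>0\<bar> \<le> \<sigma>" for h using posU[OF t that] KDb(2)[OF t] c(1) by auto
    have "?U ?h \<tau> * ?U' (h\<^sub>0 - \<sigma>) \<tau> < ?U' ?h \<tau> * ?U (h\<^sub>0 - \<sigma>) \<tau>"
      by (rule wU'_strict_mono[OF sq dc]) (use hpos[OF b(1)] cr(2) posU[OF t b(1)] posU[OF t b(3)] in auto)
    then show "?U' (h\<^sub>0 - \<sigma>) \<tau> < 0" using U0 Up[OF b(3)] by (simp add: mult_less_0_iff)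
    have "?U (h\<^sub>0 + \<sigma>) \<tau> * ?U' ?h \<tau> < ?U' (h\<^sub>0 + \<sigma>) \<tau> * ?U ?h \<tau>"
      by (rule wU'_strict_mono[OF sq dc]) (use hpos[OF b(3)] cr(2) posU[OF t b(2)] posU[OF t b(3)] in auto)
    then show "?U' (h\<^sub>0 + \<sigma>) \<tau> > 0" using U0 Up[OF b(3)] by (simp add: zero_less_mult_iff)
  qed
  have gsign: "2 * (K \<tau>)\<^sup>2 * h * g 0 h \<tau> = 2 * ((K \<tau>)\<^sup>2 * h\<^sup>2) * I_fun (K \<tau>) (D \<tau>) c"
    if t: "\<tau> \<in> {0..1}" and h: "\<bar>h - h\<^sub>0\<bar> \<le> \<sigma>" and z: "f 0 h \<tau> = 0" for \<tau> h
  proof -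
    have U0: "?U' h \<tau> = 0" using z f0[OF t h] by simp
    have cr: "critical (K \<tau>) (D \<tau>) c h" using U0 hpos[OF h] posU[OF t h] by (simp add: critical_def)
    have cD: "\<bar>c\<bar> < D \<tau>" "D \<tau> > 0" using KDb(2)[OF t] c(1) by auto
    have alg: "q * ((h * y)\<^sup>2 - 1) * u\<^sup>2 - 0\<^sup>2 - q * ((h * z)\<^sup>2 - 1) = (q * h\<^sup>2 * y\<^sup>2 - q) * u\<^sup>2 - (q * h\<^sup>2 * z\<^sup>2 - q)" for q y z u :: real
      by (simp add: power_mult_distrib algebra_simps)
    from critical_energy[OF KDb(1)[OF t] cD(2,1) cr conjunct1[OF posU[OF t h]]] show ?thesis
      unfolding g0[OF t h] U0 alg .
  qed
  let ?H = "{h\<^sub>0 - \<sigma>..h\<^sub>0 + \<sigma>}"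
  have Hb: "\<bar>h - h\<^sub>0\<bar> \<le> \<sigma>" if "h \<in> ?H" for h using that by auto
  have fg: "continuous_on (?H \<times> {0..1}) (\<lambda>p. f \<epsilon> (fst p) (snd p))" "continuous_on (?H \<times> {0..1}) (\<lambda>p. g \<epsilon> (fst p) (snd p))" for \<epsilon>
    unfolding f_def g_def
    by (intro flow_components_continuous[where T = ?T] continuous_intros continuous_on_compose2[OF KD(1)[of UNIV]]
        continuous_on_compose2[OF KD(2)[of UNIV]]; use KDb(5) in auto)+
  have fgh: "continuous_on ?H (\<lambda>h. f \<epsilon> h \<tau>)" "continuous_on ?H (\<lambda>h. g \<epsilon> h \<tau>)" if "\<tau> \<in> {0..1}" for \<epsilon> \<tau>
    by (rule continuous_on_compose2[OF fg(1), of ?H "\<lambda>h. (h, \<tau>)", unfolded fst_conv snd_conv]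
        continuous_on_compose2[OF fg(2), of ?H "\<lambda>h. (h, \<tau>)", unfolded fst_conv snd_conv],
        intro continuous_intros, use that in auto)+
  have cU: "continuous_on {0..1} (\<lambda>\<tau>. ?U' h \<tau>)" for h by (intro continuous_intros KD)
  obtain b1 where b1: "b1 > 0" "\<And>\<tau>. \<tau> \<in> {0..1} \<Longrightarrow> b1 \<le> - ?U' (h\<^sub>0 - \<sigma>) \<tau>"
    using compact_pos_lower_bound[OF compact_Icc continuous_on_minus[OF cU[of "h\<^sub>0 - \<sigma>"]]] sides(1) by fastforce
  obtain b2 where b2: "b2 > 0" "\<And>\<tau>. \<tau> \<in> {0..1} \<Longrightarrow> b2 \<le> ?U' (h\<^sub>0 + \<sigma>) \<tau>"
    using compact_pos_lower_bound[OF compact_Icc cU[of "h\<^sub>0 + \<sigma>"]] sides(2) by fastforce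
  have z01: "0 \<in> {0..1::real}" "1 \<in> {0..1::real}" by auto
  have n0: "g 0 h 0 < 0" if "h \<in> ?H" "f 0 h 0 = 0" for h
  proof -
    have "2 * ((K 0)\<^sup>2 * h\<^sup>2) * I_fun (K 0) (D 0) c < 0"
      using hpos[OF Hb[OF that(1)]] KDb(1)[OF z01(1)] e2(2)[OF c(1,2)] by (simp add: ends mult_pos_neg)
    then have "2 * (K 0)\<^sup>2 * h * g 0 h 0 < 0" unfolding gsign[OF z01(1) Hb[OF that(1)] that(2)] .
    moreover have "0 < 2 * (K 0)\<^sup>2 * h" using hpos[OF Hb[OF that(1)]] KDb(1)[OF z01(1)] by simp
    ultimately show ?thesis using mult_less_0_iff[of "2 * (K 0)\<^sup>2 * h" "g 0 h 0"] by linarith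
  qed
  have n1: "- g 0 h 1 < 0" if "h \<in> ?H" "f 0 h 1 = 0" for h
  proof -
    have "2 * ((K 1)\<^sup>2 * h\<^sup>2) * I_fun (K 1) (D 1) c > 0"
      using hpos[OF Hb[OF that(1)]] KDb(1)[OF z01(2)] e3(2)[OF c(1,3)] by (simp add: ends)
    then have "2 * (K 1)\<^sup>2 * h * g 0 h 1 > 0" unfolding gsign[OF z01(2) Hb[OF that(1)] that(2)] .
    moreover have "0 < 2 * (K 1)\<^sup>2 * h" using hpos[OF Hb[OF that(1)]] KDb(1)[OF z01(2)] by simp
    ultimately show ?thesis using zero_less_mult_iff[of "2 * (K 1)\<^sup>2 * h" "g 0 h 1"] by linarith
  qed
  obtain \<Lambda>\<^sub>1 b3 where L1: "\<Lambda>\<^sub>1 \<ge> 0" "b3 > 0" "\<And>\<Lambda> h. \<Lambda> \<ge> \<Lambda>\<^sub>1 \<Longrightarrow> h \<in> ?H \<Longrightarrow> g 0 h 0 - \<Lambda> * \<bar>f 0 h 0\<bar> \<le> - b3"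
    using penalty[OF _ fgh[OF z01(1)], OF compact_Icc n0] by blast
  obtain \<Lambda>\<^sub>2 b4 where L2: "\<Lambda>\<^sub>2 \<ge> 0" "b4 > 0" "\<And>\<Lambda> h. \<Lambda> \<ge> \<Lambda>\<^sub>2 \<Longrightarrow> h \<in> ?H \<Longrightarrow> - g 0 h 1 - \<Lambda> * \<bar>f 0 h 1\<bar> \<le> - b4"
    using penalty[OF _ fgh(1)[OF z01(2)] continuous_on_minus[OF fgh(2)[OF z01(2)]], OF compact_Icc n1] by blast
  define \<Lambda> where "\<Lambda> = max \<Lambda>\<^sub>1 \<Lambda>\<^sub>2"
  have \<Lambda>: "\<Lambda> \<ge> 0" "\<Lambda> \<ge> \<Lambda>\<^sub>1" "\<Lambda> \<ge> \<Lambda>\<^sub>2" using L1(1) by (auto simp: \<Lambda>_def)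
  obtain C1 where C1: "C1 \<ge> 0" "\<And>x y t. t \<in> {0..?T} \<Longrightarrow> norm (flow M x t - flow M y t) \<le> C1 * norm (x - y)"
    using flow_lipschitz by blast
  have lip: "\<bar>f \<epsilon> h \<tau> - f 0 h \<tau>\<bar> \<le> C1 * \<epsilon>" "\<bar>g \<epsilon> h \<tau> - g 0 h \<tau>\<bar> \<le> C1 * \<epsilon>" if t: "\<tau> \<in> {0..1}" and e: "\<epsilon> \<ge> 0" for \<epsilon> h \<tau>
  proof -
    have "norm (flow M (?x h \<tau> \<epsilon>) (2 * D \<tau>) - flow M (?x h \<tau> 0) (2 * D \<tau>)) \<le> C1 * \<epsilon>"
      using order_trans[OF C1(2)[OF KDb(5)[OF t]] mult_left_mono[OF norm_start_diff[of "- h * (D \<tau> - c)" h \<epsilon> "(K \<tau>)\<^sup>2" "- h * (D \<tau> - c)" h 0 "(K \<tau>)\<^sup>2"] C1(1)]] e by simp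
    then show "\<bar>f \<epsilon> h \<tau> - f 0 h \<tau>\<bar> \<le> C1 * \<epsilon>" "\<bar>g \<epsilon> h \<tau> - g 0 h \<tau>\<bar> \<le> C1 * \<epsilon>" unfolding f_def g_def fp_def fj_def
      by (rule norm_state_components[THEN order_trans])+
  qed
  \<comment> \<open>The smallest margin among the strict inequalities at \<epsilon> = 0: slopes on
    the sides, penalized values at the ends of the segment, and the midpoint value of a, which is at
    least \<open>(h\<^sub>0 - \<sigma>) * c\<close>.\<close>
  define b where "b = min (min b1 b2) (min (min b3 b4) ((h\<^sub>0 - \<sigma>) * c))"
  have b: "b > 0" "b \<le> b1" "b \<le> b2" "b \<le> b3" "b \<le> b4" "b \<le> (h\<^sub>0 - \<sigma>) * c"
  proof -
    have "h\<^sub>0 - \<sigma> > 0" using \<sigma>m(1) m(1,7) by linarith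
    then show "b > 0" using b1(1) b2(1) L1(2) L2(2) c(1) by (simp add: b_def)
    show "b \<le> b1" "b \<le> b2" "b \<le> b3" "b \<le> b4" "b \<le> (h\<^sub>0 - \<sigma>) * c" unfolding b_def by linarith+
  qed
  \<comment> \<open>V dominates every coefficient of \<epsilon> in the perturbation estimates below,
    so \<alpha> <= b / V keeps all of them within the margin b.\<close>
  define V where "V = (1 + \<Lambda>) * C1 + M * (d\<^sub>0 + 1) + 1"
  have V: "V \<ge> 1" "(1 + \<Lambda>) * C1 \<le> V" "C1 \<le> V" "M * (d\<^sub>0 + 1) < V"
  proof -
    have p: "0 \<le> \<Lambda> * C1" "0 \<le> M * (d\<^sub>0 + 1)" using \<Lambda>(1) C1(1) M k by auto
    then show "V \<ge> 1" "(1 + \<Lambda>) * C1 \<le> V" "C1 \<le> V" "M * (d\<^sub>0 + 1) < V"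
      using C1(1) unfolding V_def by (auto simp: distrib_right)
  qed
  define \<alpha> where "\<alpha> = min \<sigma> (b / V)"
  have \<alpha>: "\<alpha> > 0" "\<alpha> \<le> \<sigma>" "V * \<alpha> \<le> b"
  proof -
    show "\<alpha> > 0" "\<alpha> \<le> \<sigma>" using \<sigma>(1) b(1) V(1) by (auto simp: \<alpha>_def)
    have "\<alpha> \<le> b / V" by (simp add: \<alpha>_def)
    then show "V * \<alpha> \<le> b" using V(1) by (simp add: field_simps)
  qed
  let ?e = "\<alpha>\<^sup>2"
  have e: "0 < ?e" "?e \<le> \<alpha>" "?e \<le> \<sigma>"
  proof -
    have "\<alpha> \<le> 1" using \<alpha>(2) \<sigma>m(1) m(5) by linarith
    then have "\<alpha> * \<alpha> \<le> \<alpha> * 1" using \<alpha>(1) by (intro mult_left_mono) auto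
    then show "?e \<le> \<alpha>" "?e \<le> \<sigma>" using \<alpha>(2) unfolding power2_eq_square by linarith+
    show "0 < ?e" using \<alpha>(1) by simp
  qed
  have Ve: "y * ?e \<le> b" if "y \<le> V" "0 \<le> y" for y
  proof -
    have "y * ?e \<le> V * \<alpha>" using that e V(1) by (intro mult_mono) auto
    with \<alpha>(3) show ?thesis by simp
  qed
  have pen: "\<bar>(G - \<Lambda> * \<bar>F\<bar>) - (G' - \<Lambda> * \<bar>F'\<bar>)\<bar> \<le> b" if "\<bar>F - F'\<bar> \<le> C1 * ?e" "\<bar>G - G'\<bar> \<le> C1 * ?e" for F G F' G'
  proof -
    have "\<bar>\<bar>F\<bar> - \<bar>F'\<bar>\<bar> \<le> C1 * ?e" using that(1) by linarith
    then have "\<Lambda> * \<bar>\<bar>F\<bar> - \<bar>F'\<bar>\<bar> \<le> \<Lambda> * (C1 * ?e)" using \<Lambda>(1) by (rule mult_left_mono)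
    then have "\<bar>\<Lambda> * \<bar>F\<bar> - \<Lambda> * \<bar>F'\<bar>\<bar> \<le> \<Lambda> * (C1 * ?e)" using \<Lambda>(1) by (simp add: right_diff_distrib[symmetric] abs_mult)
    moreover have "C1 * ?e + \<Lambda> * (C1 * ?e) = ((1 + \<Lambda>) * C1) * ?e" by (simp add: algebra_simps)
    moreover have "((1 + \<Lambda>) * C1) * ?e \<le> b" using V(2) \<Lambda>(1) C1(1) by (intro Ve) auto
    ultimately show ?thesis using that(2) by linarith
  qed
  \<comment> \<open>The weight 2 \<tau> - 1 gives the penalty the sign required at each end of the
    segment. Where f vanishes the penalty vanishes too, and g = 0 remains.\<close>
  obtain h \<tau> where ht: "h \<in> ?H" "\<tau> \<in> {0..1}" "f ?e h \<tau> = 0" "g ?e h \<tau> + \<Lambda> * (2 * \<tau> - 1) * \<bar>f ?e h \<tau>\<bar> = 0"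
  proof (rule poincare_miranda_2d[where f = "f ?e" and g = "\<lambda>h \<tau>. g ?e h \<tau> + \<Lambda> * (2 * \<tau> - 1) * \<bar>f ?e h \<tau>\<bar>"
        and a = "h\<^sub>0 - \<sigma>" and b = "h\<^sub>0 + \<sigma>" and c = 0 and d = 1])
    show "continuous_on (?H \<times> {0..1}) (\<lambda>p. f ?e (fst p) (snd p))" by (rule fg(1))
    show "continuous_on (?H \<times> {0..1}) (\<lambda>p. g ?e (fst p) (snd p) + \<Lambda> * (2 * snd p - 1) * \<bar>f ?e (fst p) (snd p)\<bar>)"
      by (intro continuous_intros fg)
    show "h\<^sub>0 - \<sigma> < h\<^sub>0 + \<sigma>" "(0::real) < 1" using \<sigma>(1) by auto
    have C1e: "C1 * ?e \<le> b" by (rule Ve[OF V(3) C1(1)])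
    have sb: "\<bar>(h\<^sub>0 - \<sigma>) - h\<^sub>0\<bar> \<le> \<sigma>" "\<bar>(h\<^sub>0 + \<sigma>) - h\<^sub>0\<bar> \<le> \<sigma>" using \<sigma>(1) by auto
    fix \<tau> :: real assume t: "\<tau> \<in> {0..1}"
    show "f ?e (h\<^sub>0 - \<sigma>) \<tau> \<le> 0"
      using lip(1)[OF t less_imp_le[OF e(1)], of "h\<^sub>0 - \<sigma>"] f0[OF t sb(1)] b1(2)[OF t] b(2) C1e by linarith
    show "f ?e (h\<^sub>0 + \<sigma>) \<tau> \<ge> 0"
      using lip(1)[OF t less_imp_le[OF e(1)], of "h\<^sub>0 + \<sigma>"] f0[OF t sb(2)] b2(2)[OF t] b(3) C1e by linarith
  next
    fix h assume h: "h \<in> ?H"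
    have "\<bar>(g ?e h 0 - \<Lambda> * \<bar>f ?e h 0\<bar>) - (g 0 h 0 - \<Lambda> * \<bar>f 0 h 0\<bar>)\<bar> \<le> b"
      by (rule pen) (use lip[OF z01(1) less_imp_le[OF e(1)]] in auto)
    then have "g ?e h 0 - \<Lambda> * \<bar>f ?e h 0\<bar> \<le> 0" using L1(3)[OF \<Lambda>(2) h] b(4) by linarith
    then show "g ?e h 0 + \<Lambda> * (2 * 0 - 1) * \<bar>f ?e h 0\<bar> \<le> 0" by simp
    have "\<bar>(- g ?e h 1 - \<Lambda> * \<bar>f ?e h 1\<bar>) - (- g 0 h 1 - \<Lambda> * \<bar>f 0 h 1\<bar>)\<bar> \<le> b"
      by (rule pen) (use lip[OF z01(2) less_imp_le[OF e(1)], of h] in auto)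
    then have "- g ?e h 1 - \<Lambda> * \<bar>f ?e h 1\<bar> \<le> 0" using L2(3)[OF \<Lambda>(3) h] b(5) by linarith
    then show "g ?e h 1 + \<Lambda> * (2 * 1 - 1) * \<bar>f ?e h 1\<bar> \<ge> 0" by simp
  qed
  have hb: "\<bar>h - h\<^sub>0\<bar> \<le> \<sigma>" using Hb[OF ht(1)] .
  define d where "d = D \<tau>"
  have d: "d > 0" "c < d" "d \<le> d\<^sub>0 + 1" "2 * d \<le> ?T" using KDb[OF ht(2)] c(1) by (auto simp: d_def)
  let ?y = "?x h \<tau> ?e"
  note N = nbx[OF ht(2) hb less_imp_le[OF e(1)] e(3)]
  have orb: "orbit ((K \<tau>)\<^sup>2) ?e h (2 * d) (f\<psi> M ?y) (fp M ?y) (fa M ?y) (fj M ?y)"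
    by (rule orbit_subset[OF N(1) d(4)])
  have fin: "fp M ?y (2 * d) = 0" "fj M ?y (2 * d) = 0" using ht(3,4) by (simp_all add: f_def g_def d_def)
  have sol: "solution (K \<tau>) d (\<lambda>x. \<alpha> * f\<psi> M ?y (x + d)) (\<lambda>x. fa M ?y (x + d)) h"
    by (rule rescaled_imp_solution[OF d(1) orbit_imp_rescaled[OF d(1) hpos[OF hb] orb flow_start(1,2,4) fin]])
  \<comment> \<open>An odd a would vanish at the midpoint; here a differs there from h c > 0 by less
    than h c.\<close>
  have mid: "fa M ?y d > 0"
  proof -
    have "\<bar>fa M ?y d - (fa M ?y 0 + h * d)\<bar> \<le> \<bar>?e\<bar> * M * d"
      by (rule orbit_a_bound[OF orb]) (use N(2) d in auto)
    then have 1: "\<bar>fa M ?y d - h * c\<bar> \<le> ?e * M * d" by (simp add: flow_start d_def algebra_simps)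
    have "?e * M * d \<le> ?e * M * (d\<^sub>0 + 1)" using d(3) e(1) M by (intro mult_left_mono) auto
    also have "\<dots> \<le> \<alpha> * (M * (d\<^sub>0 + 1))" using e(2) M k unfolding mult.assoc by (intro mult_right_mono) auto
    also have "\<dots> < \<alpha> * V" by (rule mult_strict_left_mono[OF V(4) \<alpha>(1)])
    also have "\<dots> \<le> (h\<^sub>0 - \<sigma>) * c" using \<alpha>(3) b(6) by (simp add: mult.commute)
    also have "\<dots> \<le> h * c" using ht(1) c(1) by (intro mult_right_mono) auto
    finally show ?thesis using 1 by linarith
  qed
  have asym: "\<not> symmetric d (\<lambda>x. \<alpha> * f\<psi> M ?y (x + d)) (\<lambda>x. fa M ?y (x + d))"
  proof
    assume "symmetric d (\<lambda>x. \<alpha> * f\<psi> M ?y (x + d)) (\<lambda>x. fa M ?y (x + d))"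
    then have "fa M ?y (- 0 + d) = - fa M ?y (0 + d)" unfolding symmetric_def using d(1) by (metis (no_types, lifting) atLeastAtMost_iff less_eq_real_def neg_le_0_iff_le)
    then show False using mid by simp
  qed
  have bound: "\<bar>\<alpha> * f\<psi> M ?y (x + d)\<bar> + \<bar>ideriv d (\<lambda>x. \<alpha> * f\<psi> M ?y (x + d)) x\<bar> + \<bar>fa M ?y (x + d) - h\<^sub>0 * x\<bar> +
      \<bar>ideriv d (\<lambda>x. fa M ?y (x + d)) x - h\<^sub>0\<bar> \<le> \<eta> / 2" if x: "x \<in> {-d..d}" for x
  proof -
    have t: "x + d \<in> {0..?T}" using x d(4) by auto
    note n = N(2)[OF t]
    have prod: "\<bar>u * v\<bar> \<le> \<sigma> * M" if "0 \<le> u" "u \<le> \<sigma>" "\<bar>v\<bar> \<le> M" for u v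
      unfolding abs_mult using that \<sigma>(1) by (intro mult_mono) auto
    have 1: "\<bar>\<alpha> * f\<psi> M ?y (x + d)\<bar> \<le> \<sigma> * M" "\<bar>\<alpha> * fp M ?y (x + d)\<bar> \<le> \<sigma> * M" "\<bar>?e * fj M ?y (x + d)\<bar> \<le> \<sigma> * M"
      using prod[OF less_imp_le[OF \<alpha>(1)] \<alpha>(2)] prod[OF less_imp_le[OF e(1)] e(3)] n by blast+
    have "\<bar>h\<^sub>0 * (d - d\<^sub>0)\<bar> \<le> h\<^sub>0 * \<sigma>"
      unfolding abs_mult using path(2)[OF ht(2)] \<rho>(2) h0 by (intro mult_mono) (auto simp: d_def)
    moreover have "fa M ?y (x + d) - h\<^sub>0 * x = (fa M ?y (x + d) - h\<^sub>0 * (x + d - d\<^sub>0)) + h\<^sub>0 * (d - d\<^sub>0)" by (simp add: algebra_simps)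
    ultimately have 2: "\<bar>fa M ?y (x + d) - h\<^sub>0 * x\<bar> \<le> C * (\<sigma> * W) + h\<^sub>0 * \<sigma>" using n by linarith
    have 3: "\<bar>h + ?e * fj M ?y (x + d) - h\<^sub>0\<bar> \<le> \<sigma> + \<sigma> * M" using 1(3) hb by linarith
    have "\<sigma> * M + \<sigma> * M + (C * (\<sigma> * W) + h\<^sub>0 * \<sigma>) + (\<sigma> + \<sigma> * M) \<le> \<sigma> * Z"
    proof -
      have "\<sigma> * Z = \<sigma> * M + \<sigma> * M + (C * (\<sigma> * W) + h\<^sub>0 * \<sigma>) + (\<sigma> + \<sigma> * M) + \<sigma> * W + \<sigma>" by (simp add: Z_def algebra_simps)
      then show ?thesis using \<sigma>(1) W by simp
    qed
    also have "\<dots> \<le> \<eta> / 2" using \<sigma>(2) m(2) by simp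
    finally show ?thesis
      unfolding orbit_ideriv(1)[OF d(1) orb x] orbit_ideriv(2)[OF d(1) orb x] using 1(1,2) 2 3 by linarith
  qed
  have sup: "(SUP x\<in>{-d..d}. \<bar>\<alpha> * f\<psi> M ?y (x + d)\<bar> + \<bar>ideriv d (\<lambda>x. \<alpha> * f\<psi> M ?y (x + d)) x\<bar> + \<bar>fa M ?y (x + d) - h\<^sub>0 * x\<bar> +
      \<bar>ideriv d (\<lambda>x. fa M ?y (x + d)) x - h\<^sub>0\<bar>) \<le> \<eta> / 2"
    by (rule cSUP_least[OF _ bound]) (use d(1) in auto)
  have \<sigma>\<eta>: "\<sigma> < \<eta>" using \<sigma>m(1) m(1,2) by linarith
  show ?thesis
  proof (rule exI[of _ "K \<tau>"], rule exI[of _ d], rule exI[of _ h], rule exI[of _ "\<lambda>x. \<alpha> * f\<psi> M ?y (x + d)"],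
      rule exI[of _ "\<lambda>x. fa M ?y (x + d)"], intro conjI sol asym)
    show "K \<tau> > 0" "d > 0" "h > 0" using KDb(1)[OF ht(2)] d(1) hpos[OF hb] by auto
    show "\<bar>K \<tau> - \<kappa>\<^sub>0\<bar> < \<eta>" "\<bar>d - d\<^sub>0\<bar> < \<eta>" "\<bar>h - h\<^sub>0\<bar> < \<eta>"
      using path[OF ht(2)] \<rho>(2) hb \<sigma>\<eta> unfolding d_def by linarith+
    show "positive_on d (\<lambda>x. \<alpha> * f\<psi> M ?y (x + d))"
      unfolding positive_on_def using N(2) \<alpha>(1) d(4) by auto
  qed (use sup \<eta> in linarith)
qed

theorem asymmetric_bifurcation:
  fixes K D :: "real \<Rightarrow> real"
  assumes "deriv (I_fun (K 0) (D 0)) 0 < 0" "deriv (I_fun (K 1) (D 1)) 0 > 0"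
    and an: "real_analytic_on (\<lambda>t. (K t, D t)) {0..1}" and pos: "\<forall>t\<in>{0..1}. K t > 0 \<and> D t > 0"
  shows "\<exists>t\<^sub>0\<in>{0<..<1}. let h\<^sub>0 = h_crit (K t\<^sub>0) (D t\<^sub>0) 0 in
         \<forall>\<epsilon>>0. \<exists>\<kappa> d h \<phi> a. \<kappa> > 0 \<and> d > 0 \<and> h > 0 \<and>
           \<bar>\<kappa> - K t\<^sub>0\<bar> < \<epsilon> \<and> \<bar>d - D t\<^sub>0\<bar> < \<epsilon> \<and> \<bar>h - h\<^sub>0\<bar> < \<epsilon> \<and>
           solution \<kappa> d \<phi> a h \<and> \<not> symmetric d \<phi> a \<and> positive_on d \<phi> \<and>
           (SUP x\<in>{-d..d}. \<bar>\<phi> x\<bar> + \<bar>ideriv d \<phi> x\<bar> + \<bar>a x - h\<^sub>0 * x\<bar> + \<bar>ideriv d a x - h\<^sub>0\<bar>) < \<epsilon>"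
proof -
  have p: "K t > 0" "D t > 0" if "t \<in> {0..1}" for t using pos that by auto
  have N: "wN ((K 0)\<^sup>2 * (h_crit (K 0) (D 0) 0)\<^sup>2) ((K 0)\<^sup>2) (D 0) < 0" "wN ((K 1)\<^sup>2 * (h_crit (K 1) (D 1) 0)\<^sup>2) ((K 1)\<^sup>2) (D 1) > 0"
    using I_fun_sign(1)[of "K 0" "D 0"] I_fun_sign(2)[of "K 1" "D 1"] assms(1,2) p by auto
  obtain t where t: "t \<in> {0<..<1}" "wN ((K t)\<^sup>2 * (h_crit (K t) (D t) 0)\<^sup>2) ((K t)\<^sup>2) (D t) = 0"
    using neumann_zero_on_path[OF analytic_pair_continuous[OF an] _ _ N] pos by auto
  have pt: "K t > 0" "D t > 0" using p t(1) by auto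
  show ?thesis unfolding Let_def
    by (rule bexI[OF _ t(1)]) (intro allI impI asymmetric_near[OF pt t(2)])
qed


theorem theorem3:
  "(\<forall>\<kappa> d :: real. \<kappa> > 0 \<longrightarrow> d > 0 \<longrightarrow>
      (\<exists>(\<phi> :: nat \<Rightarrow> real \<Rightarrow> real) (a :: nat \<Rightarrow> real \<Rightarrow> real) (h :: nat \<Rightarrow> real).
         (\<forall>n. solution \<kappa> d (\<phi> n) (a n) (h n) \<and> symmetric d (\<phi> n) (a n) \<and> positive_on d (\<phi> n)) \<and>
         h \<longlonglongrightarrow> h_crit \<kappa> d 0 \<and>
         C1_limit d \<phi> (\<lambda>x. 0) \<and> C1_limit d a (\<lambda>x. h_crit \<kappa> d 0 * x)))
   \<and>
   (\<exists>k K :: real. 0 < k \<and> k < K \<and>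
      (\<forall>\<kappa> d :: real. \<kappa> > 0 \<longrightarrow> d > 0 \<longrightarrow> \<kappa> * d < k \<or> \<kappa> * d > K \<longrightarrow>
         (\<exists>\<delta>>0. \<exists>\<alpha>\<^sub>0>0. \<forall>\<alpha>. 0 < \<alpha> \<and> \<alpha> < \<alpha>\<^sub>0 \<longrightarrow>
            (\<exists>\<psi> a h. rescaled_solution \<kappa> d \<alpha> \<psi> a h \<and> positive_on d \<psi> \<and>
               \<bar>h - h_crit \<kappa> d 0\<bar> < \<delta> \<and> symmetric d \<psi> a \<and>
               (\<forall>\<psi>' a' h'. rescaled_solution \<kappa> d \<alpha> \<psi>' a' h' \<and> positive_on d \<psi>' \<and>
                  \<bar>h' - h_crit \<kappa> d 0\<bar> < \<delta> \<longrightarrow>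
                  h' = h \<and> (\<forall>x\<in>{-d..d}. \<psi>' x = \<psi> x \<and> a' x = a x))))))
   \<and>
   (\<forall>(\<kappa>\<^sub>1 :: real) (d\<^sub>1 :: real) (\<kappa>\<^sub>2 :: real) (d\<^sub>2 :: real) (K :: real \<Rightarrow> real) (D :: real \<Rightarrow> real).
      \<kappa>\<^sub>1 > 0 \<longrightarrow> d\<^sub>1 > 0 \<longrightarrow> \<kappa>\<^sub>2 > 0 \<longrightarrow> d\<^sub>2 > 0 \<longrightarrow>
      deriv (I_fun \<kappa>\<^sub>1 d\<^sub>1) 0 < 0 \<longrightarrow> deriv (I_fun \<kappa>\<^sub>2 d\<^sub>2) 0 > 0 \<longrightarrow>
      real_analytic_on (\<lambda>t. (K t, D t)) {0..1} \<longrightarrow>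
      (\<forall>t\<in>{0..1}. K t > 0 \<and> D t > 0) \<longrightarrow>
      K 0 = \<kappa>\<^sub>1 \<longrightarrow> D 0 = d\<^sub>1 \<longrightarrow> K 1 = \<kappa>\<^sub>2 \<longrightarrow> D 1 = d\<^sub>2 \<longrightarrow>
      (\<exists>t\<^sub>0\<in>{0<..<1}. let h\<^sub>0 = h_crit (K t\<^sub>0) (D t\<^sub>0) 0 in
         \<forall>\<epsilon>>0. \<exists>\<kappa> d h \<phi> a. \<kappa> > 0 \<and> d > 0 \<and> h > 0 \<and>
           \<bar>\<kappa> - K t\<^sub>0\<bar> < \<epsilon> \<and> \<bar>d - D t\<^sub>0\<bar> < \<epsilon> \<and> \<bar>h - h\<^sub>0\<bar> < \<epsilon> \<and>
           solution \<kappa> d \<phi> a h \<and> \<not> symmetric d \<phi> a \<and> positive_on d \<phi> \<and>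
           (SUP x\<in>{-d..d}. \<bar>\<phi> x\<bar> + \<bar>ideriv d \<phi> x\<bar> + \<bar>a x - h\<^sub>0 * x\<bar> + \<bar>ideriv d a x - h\<^sub>0\<bar>) < \<epsilon>))"
proof (intro conjI)
  show "\<forall>\<kappa> d :: real. \<kappa> > 0 \<longrightarrow> d > 0 \<longrightarrow>
      (\<exists>(\<phi> :: nat \<Rightarrow> real \<Rightarrow> real) (a :: nat \<Rightarrow> real \<Rightarrow> real) (h :: nat \<Rightarrow> real).
         (\<forall>n. solution \<kappa> d (\<phi> n) (a n) (h n) \<and> symmetric d (\<phi> n) (a n) \<and> positive_on d (\<phi> n)) \<and>
         h \<longlonglongrightarrow> h_crit \<kappa> d 0 \<and>
         C1_limit d \<phi> (\<lambda>x. 0) \<and> C1_limit d a (\<lambda>x. h_crit \<kappa> d 0 * x))"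
    by (intro allI impI symmetric_bifurcation)
qed ((rule exI[of _ "1 / 100"], rule exI[of _ 4], (intro conjI allI impI; (rule unique_symmetric_curve)?; force)),
    (intro allI impI, hypsubst, rule asymmetric_bifurcation))

end
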